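(* Let $W\subsetneq\mathcal U_a$ be a $D$-invariant subspace with residual interval $I_W$ of length $d$, and let $\Lambda$ be the sequence of exponents (with multiplicities) of $\mathrm{Exp}(W)$. Assume that the annihilator submodule $\mathcal J=\mathcal F(W^0)$ is stable, and that one of the following conditions holds: (a) $2\pi D_{BM}(\Lambda)<d$; or (b) there exists a nonzero $\varphi_0\in\mathcal J$ generating a weakly localisable principal submodule $\mathcal J_{\varphi_0}$. Then $W$ admits weak spectral synthesis.
   Context: Weight. $\omega:[0,\infty)\to[0,\infty)$ is a non-decreasing continuous function such that: $\varphi_\omega(t):=\omega(e^t)$ is convex on $[0,\infty)$; $\omega(x)=o(x)$ and $\ln x=o(\omega(x))$ as $x\to\infty$; for every $\sigma>1$ there is $C>0$ with $\omega(x+y)\le\sigma(\omega(x)+\omega(y))+C$ for all $x,y\ge0$; $\int_1^\infty \omega(x)x^{-2}\,dx<\infty$. Fix $0<a\le+\infty$ and sequences $0<c_k\nearrow a$ with $c_k<a$, and $0<r_k\nearrow1$ with $r_k<1$. Ultradifferentiable functions. Put $\varphi_\omega^*(s)=\sup_{t\ge0}(st-\varphi_\omega(t))$ and, for $f\in C^\infty(-a,a)$, $q\in(0,1)$, $k\in\mathbb N$, $\|f\|_{\omega,q,k}=\sup_{j\in\mathbb N_0}\sup_{|x|\le c_k}|f^{(j)}(x)|e^{-q\varphi_\omega^*(j/q)}$. $\mathcal U_a$ is the space of all $f\in C^\infty(-a,a)$ with $\|f\|_{\omega,q,k}<\infty$ for all $q\in(0,1)$, $k\in\mathbb N$, with the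 locally convex topology given by these semi-norms; $\mathcal U_a'$ is its strong dual. $D=d/dx$. A $D$-invariant subspace is a closed linear subspace $W\subset\mathcal U_a$ with $D(W)\subset W$. $W^0=\{S\in\mathcal U_a': S(f)=0\ \forall f\in W\}$. $\mathrm{Exp}(W)$ is the set of all exponential monomials $t^je^{-\mathrm i\lambda t}$ contained in $W$; its sequence of exponents is the collection $\{(\lambda_k;m_k)\}$ of points with multiplicities such that $\mathrm{Exp}(W)=\{t^je^{-\mathrm i\lambda_kt}:0\le j\le m_k-1\}_k$. Weak spectral synthesis. An interval $I\subset(-a,a)$ (possibly a single point) is relatively closed if it is closed in $(-a,a)$. For such $I$ put $W_I=\{f\in\mathcal U_a: f^{(j)}=0\text{ on }I\ \forall j\ge0\}$ (for $I$ of positive length this is $\{f: f=0\text{ on }I\}$). The residual interval $I_W$ of a $D$-invariant subspace $W\ne\mathcal U_a$ is the relatively closed interval with $W_{I_W}\subset W$ and $W_I\setminus W\ne\emptyset$ for every relatively closed interval $I\subsetneq I_W$ (it exists). $W$ admits weak spectral synthesis if $W=\overline{\mathrm{span}(\mathrm{Exp}(W))+W_{I_W}}$ (closure in $\mathcal U_a$). Module. $P_k$ is the Banach space of entire functions $\varphi$ with $\|\varphi\|_k=\sup_{z\in\mathbb C}|\varphi(z)|e^{-r_k\omega(|z|)-c_k|\mathrm{Im}\,z|}<\infty$, and $\mathcal P_a$ is the locally convex inductive limit of the $P_k$. The Fourier-Laplace transform $\mathcal F(S)(z)=S(e^{-\mathrm itz})$ is a linear topological isomorphism of $\mathcal U_a'$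 onto $\mathcal P_a$. $\mathcal P_a$ is a topological module over $\mathbb C[z]$; "submodule" means closed $\mathbb C[z]$-submodule. The principal submodule $\mathcal J_\varphi$ is the closure of $\{p\varphi:p\in\mathbb C[z]\}$ in $\mathcal P_a$. For a submodule $\mathcal J\ne\{0\}$ and $\lambda\in\mathbb C$ let $n_\lambda\ge0$ be the minimal multiplicity of vanishing at $\lambda$ of functions in $\mathcal J$. $\mathcal Z_{\mathcal J}$ is the set of points $\lambda$ with $n_\lambda\ge1$, counted with multiplicity $n_\lambda$. $\mathcal J$ is stable if for every $\lambda\in\mathbb C$, $\varphi/(z-\lambda)\in\mathcal J$ whenever $\varphi\in\mathcal J$ vanishes at $\lambda$ with multiplicity greater than $n_\lambda$. For nonzero $\varphi\in\mathcal P_a$ let $h_\varphi(\theta)=\limsup_{r\to\infty}r^{-1}\ln|\varphi(re^{\mathrm i\theta})|$, $c_\varphi=-h_\varphi(-\pi/2)$, $d_\varphi=h_\varphi(\pi/2)$. The indicator segment of $\mathcal J\ne\{0\}$ is $[c_{\mathcal J};d_{\mathcal J}]\subset\overline{\mathbb R}$, $c_{\mathcal J}=\inf c_\varphi$, $d_{\mathcal J}=\sup d_\varphi$ over nonzero $\varphi\in\mathcal J$. A submodule $\mathcal J\ne\{0\}$ is weakly localisable if it is maximal among all submodules with the same zero set and the same indicator segment; equivalently, $\mathcal J$ contains every nonzero $\psi\in\mathcal P_a$ with $[c_\psi;d_\psi]\subset[c_{\mathcal J};d_{\mathcal J}]$ that vanishes on $\mathcal Z_{\mathcal J}$ (with multiplicities).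 Density. For a collection $\Lambda=\{(\lambda_j;m_j)\}$ of points with multiplicities, the completeness radius $r(\Lambda)\in[0,+\infty]$ is the infimum of all $r>0$ such that the system $\{t^ke^{-\mathrm i\lambda_jt}:0\le k\le m_j-1\}_j$ is incomplete in $C^\infty(-r,r)$ (equivalently in $C(-r,r)$). $D_{BM}(\Lambda)$ is the Beurling-Malliavin density; by the Beurling-Malliavin theorem $r(\Lambda)=\pi D_{BM}(\Lambda)$, which may be taken as its definition here. *)

theory Defs
  imports
    "HOL-Complex_Analysis.Complex_Analysis"
    "HOL-Library.Function_Algebras"
    "HOL-Library.Landau_Symbols"
begin

section \<open>Function spaces and topologies given by semi-norms\<close>

definition cscale :: "complex \<Rightarrow> ('x \<Rightarrow> complex) \<Rightarrow> 'x \<Rightarrow> complex" where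
  "cscale c f = (\<lambda>x. c * f x)"

interpretation cfun: vector_space cscale
  by unfold_locales (auto simp: cscale_def fun_eq_iff algebra_simps)

text \<open>Semi-norms are extended-real valued, so that a supremum defining one of them makes
  sense before it is known to be finite.\<close>

definition seminorm_topology :: "('f::minus) set \<Rightarrow> ('f \<Rightarrow> ereal) set \<Rightarrow> 'f topology" where
  "seminorm_topology X P =
     topology_generated_by {{g \<in> X. p (g - f) < ereal \<epsilon>} |f p \<epsilon>. f \<in> X \<and> p \<in> P \<and> 0 < \<epsilon>}"

lemma topspace_seminorm_topology:
  fixes X :: "('f::group_add) set"
  assumes "p \<in> P" "p 0 = 0"
  shows "topspace (seminorm_topology X P) = X"
proof -
  let ?S = "{{g \<in> X. p (g - f) < ereal \<epsilon>} |f p \<epsilon>. f \<in> X \<and> p \<in> P \<and> 0 < \<epsilon>}"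
  have "h \<in> \<Union> ?S" if "h \<in> X" for h
  proof
    show "{g \<in> X. p (g - h) < ereal 1} \<in> ?S"
      using that assms(1) zero_less_one by blast
    show "h \<in> {g \<in> X. p (g - h) < ereal 1}"
      using that assms(2) by simp
  qed
  moreover have "\<Union> ?S \<subseteq> X"
    by (rule Union_least) auto
  ultimately show ?thesis
    unfolding seminorm_topology_def topology_generated_by_topspace by (meson subsetI subset_antisym)
qed


section \<open>Weights\<close>

definition weight :: "(real \<Rightarrow> real) \<Rightarrow> bool" where
  "weight \<omega> \<longleftrightarrow>
     (\<forall>x\<ge>0. 0 \<le> \<omega> x) \<and> mono_on {0..} \<omega> \<and> continuous_on {0..} \<omega> \<and>
     convex_on {0..} (\<lambda>t. \<omega> (exp t)) \<and>
     \<omega> \<in> o[at_top](\<lambda>x. x) \<and> ln \<in> o[at_top](\<omega>) \<and>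
     (\<forall>\<sigma>>1. \<exists>C>0. \<forall>x\<ge>0. \<forall>y\<ge>0. \<omega> (x + y) \<le> \<sigma> * (\<omega> x + \<omega> y) + C) \<and>
     set_integrable lborel {1..} (\<lambda>x. \<omega> x / x\<^sup>2)"

text \<open>For a weight, \<open>t = o(\<omega>(exp t))\<close>, so the supremum is over a set bounded above.\<close>

definition young_conj :: "(real \<Rightarrow> real) \<Rightarrow> real \<Rightarrow> real" where
  "young_conj \<omega> s = (SUP t\<in>{0..}. s * t - \<omega> (exp t))"


section \<open>Smooth and ultradifferentiable functions on a symmetric interval\<close>

text \<open>A function on \<open>(-a, a)\<close>, \<open>0 < a \<le> \<infinity>\<close>, is represented by its extension by \<open>0\<close> to the whole
  real line; this is only a choice of representative, and nothing is required of the extension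
  at \<open>\<plusminus>a\<close>.\<close>

definition sym_ival :: "ereal \<Rightarrow> real set" where
  "sym_ival a = {x. ereal \<bar>x\<bar> < a}"

definition Diff :: "ereal \<Rightarrow> (real \<Rightarrow> complex) \<Rightarrow> real \<Rightarrow> complex" where
  "Diff a f = (\<lambda>x. if x \<in> sym_ival a then vector_derivative f (at x) else 0)"

definition Cinf :: "ereal \<Rightarrow> (real \<Rightarrow> complex) set" where
  "Cinf a = {f. (\<forall>x. x \<notin> sym_ival a \<longrightarrow> f x = 0) \<and>
                (\<forall>j. \<forall>x\<in>sym_ival a. ((Diff a ^^ j) f) differentiable (at x))}"

definition Cinf_seminorm :: "ereal \<Rightarrow> nat \<Rightarrow> real \<Rightarrow> (real \<Rightarrow> complex) \<Rightarrow> ereal" where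
  "Cinf_seminorm a n s f = (SUP j\<in>{..n}. SUP x\<in>{-s..s}. ereal (cmod ((Diff a ^^ j) f x)))"

definition Cinf_topology :: "ereal \<Rightarrow> (real \<Rightarrow> complex) topology" where
  "Cinf_topology a =
     seminorm_topology (Cinf a) {Cinf_seminorm a n s |n s. 0 < s \<and> ereal s < a}"

definition Ua_seminorm ::
  "(real \<Rightarrow> real) \<Rightarrow> ereal \<Rightarrow> (nat \<Rightarrow> real) \<Rightarrow> real \<Rightarrow> nat \<Rightarrow> (real \<Rightarrow> complex) \<Rightarrow> ereal" where
  "Ua_seminorm \<omega> a c q k f =
     (SUP j. SUP x\<in>{- c k..c k}.
        ereal (cmod ((Diff a ^^ j) f x) * exp (- q * young_conj \<omega> (real j / q))))"

definition Ua :: "(real \<Rightarrow> real) \<Rightarrow> ereal \<Rightarrow> (nat \<Rightarrow> real) \<Rightarrow> (real \<Rightarrow> complex) set" where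
  "Ua \<omega> a c = {f \<in> Cinf a. \<forall>q k. 0 < q \<and> q < 1 \<longrightarrow> Ua_seminorm \<omega> a c q k f < \<infinity>}"

definition Ua_topology ::
  "(real \<Rightarrow> real) \<Rightarrow> ereal \<Rightarrow> (nat \<Rightarrow> real) \<Rightarrow> (real \<Rightarrow> complex) topology" where
  "Ua_topology \<omega> a c =
     seminorm_topology (Ua \<omega> a c) {Ua_seminorm \<omega> a c q k |q k. 0 < q \<and> q < 1}"

lemma topspace_Ua_topology:
  assumes "\<And>k. 0 < c k"
  shows "topspace (Ua_topology \<omega> a c) = Ua \<omega> a c"
proof -
  have "Diff a 0 = 0"
    by (simp add: Diff_def fun_eq_iff zero_fun_def)
  then have "(Diff a ^^ j) 0 = 0" for j
    by (induction j) auto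
  moreover have "{- c 0..c 0} \<noteq> {}"
    using assms[of 0] by simp
  ultimately have "Ua_seminorm \<omega> a c (1/2) 0 0 = 0"
    unfolding Ua_seminorm_def by (simp flip: zero_ereal_def)
  then show ?thesis
    unfolding Ua_topology_def
    by (intro topspace_seminorm_topology[of "Ua_seminorm \<omega> a c (1/2) 0"])
       (auto intro: exI[of _ "1/2"])
qed

text \<open>Only the values of a functional on \<^term>\<open>Ua \<omega> a c\<close> matter.\<close>

definition Ua_dual ::
  "(real \<Rightarrow> real) \<Rightarrow> ereal \<Rightarrow> (nat \<Rightarrow> real) \<Rightarrow> ((real \<Rightarrow> complex) \<Rightarrow> complex) set" where
  "Ua_dual \<omega> a c =
     {S. (\<forall>f\<in>Ua \<omega> a c. \<forall>g\<in>Ua \<omega> a c. S (f + g) = S f + S g) \<and>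
         (\<forall>s. \<forall>f\<in>Ua \<omega> a c. S (cscale s f) = s * S f) \<and>
         continuous_map (Ua_topology \<omega> a c) euclidean S}"


section \<open>Invariant subspaces and weak spectral synthesis\<close>

definition D_invariant_subspace ::
  "(real \<Rightarrow> real) \<Rightarrow> ereal \<Rightarrow> (nat \<Rightarrow> real) \<Rightarrow> (real \<Rightarrow> complex) set \<Rightarrow> bool" where
  "D_invariant_subspace \<omega> a c W \<longleftrightarrow>
     W \<subseteq> Ua \<omega> a c \<and> cfun.subspace W \<and> closedin (Ua_topology \<omega> a c) W \<and> Diff a ` W \<subseteq> W"

definition exp_monomial :: "ereal \<Rightarrow> nat \<Rightarrow> complex \<Rightarrow> real \<Rightarrow> complex" where
  "exp_monomial a j \<mu> =
     (\<lambda>t. if t \<in> sym_ival a then of_real t ^ j * exp (- \<i> * \<mu> * of_real t) else 0)"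

definition Exp_set :: "ereal \<Rightarrow> (real \<Rightarrow> complex) set \<Rightarrow> (real \<Rightarrow> complex) set" where
  "Exp_set a W = {exp_monomial a j \<mu> |j \<mu>. exp_monomial a j \<mu> \<in> W}"

text \<open>A collection of points with multiplicities is a function \<open>\<Lambda>\<close> assigning to each point its
  multiplicity, with \<open>\<Lambda> \<mu> = 0\<close> for the points not in the collection.\<close>

definition exp_system :: "ereal \<Rightarrow> (complex \<Rightarrow> nat) \<Rightarrow> (real \<Rightarrow> complex) set" where
  "exp_system a \<Lambda> = {exp_monomial a j \<mu> |j \<mu>. j < \<Lambda> \<mu>}"

definition exponents :: "ereal \<Rightarrow> (real \<Rightarrow> complex) set \<Rightarrow> (complex \<Rightarrow> nat) \<Rightarrow> bool" where
  "exponents a W \<Lambda> \<longleftrightarrow> Exp_set a W = exp_system a \<Lambda>"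

definition rel_closed_interval :: "ereal \<Rightarrow> real set \<Rightarrow> bool" where
  "rel_closed_interval a I \<longleftrightarrow>
     I \<noteq> {} \<and> is_interval I \<and> closedin (top_of_set (sym_ival a)) I"

definition flat_on ::
  "(real \<Rightarrow> real) \<Rightarrow> ereal \<Rightarrow> (nat \<Rightarrow> real) \<Rightarrow> real set \<Rightarrow> (real \<Rightarrow> complex) set" where
  "flat_on \<omega> a c I = {f \<in> Ua \<omega> a c. \<forall>j. \<forall>x\<in>I. (Diff a ^^ j) f x = 0}"

definition residual_interval ::
  "(real \<Rightarrow> real) \<Rightarrow> ereal \<Rightarrow> (nat \<Rightarrow> real) \<Rightarrow> (real \<Rightarrow> complex) set \<Rightarrow> real set \<Rightarrow> bool" where
  "residual_interval \<omega> a c W I \<longleftrightarrow>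
     rel_closed_interval a I \<and> flat_on \<omega> a c I \<subseteq> W \<and>
     (\<forall>I'. rel_closed_interval a I' \<and> I' \<subset> I \<longrightarrow> flat_on \<omega> a c I' - W \<noteq> {})"

definition interval_length :: "real set \<Rightarrow> ereal" where
  "interval_length I = (SUP x\<in>I. ereal x) - (INF x\<in>I. ereal x)"

definition admits_weak_spectral_synthesis ::
  "(real \<Rightarrow> real) \<Rightarrow> ereal \<Rightarrow> (nat \<Rightarrow> real) \<Rightarrow> (real \<Rightarrow> complex) set \<Rightarrow> bool" where
  "admits_weak_spectral_synthesis \<omega> a c W \<longleftrightarrow>
     (\<exists>I. residual_interval \<omega> a c W I \<and>
          W = Ua_topology \<omega> a c closure_of
                {f + g |f g. f \<in> cfun.span (Exp_set a W) \<and> g \<in> flat_on \<omega> a c I})"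


section \<open>The module of entire functions\<close>

definition Pk_norm ::
  "(real \<Rightarrow> real) \<Rightarrow> (nat \<Rightarrow> real) \<Rightarrow> (nat \<Rightarrow> real) \<Rightarrow> nat \<Rightarrow> (complex \<Rightarrow> complex) \<Rightarrow> ereal" where
  "Pk_norm \<omega> c r k \<phi> =
     (SUP z. ereal (cmod (\<phi> z) * exp (- r k * \<omega> (cmod z) - c k * \<bar>Im z\<bar>)))"

definition Pk ::
  "(real \<Rightarrow> real) \<Rightarrow> (nat \<Rightarrow> real) \<Rightarrow> (nat \<Rightarrow> real) \<Rightarrow> nat \<Rightarrow> (complex \<Rightarrow> complex) set" where
  "Pk \<omega> c r k = {\<phi>. \<phi> holomorphic_on UNIV \<and> Pk_norm \<omega> c r k \<phi> < \<infinity>}"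

definition Pa ::
  "(real \<Rightarrow> real) \<Rightarrow> (nat \<Rightarrow> real) \<Rightarrow> (nat \<Rightarrow> real) \<Rightarrow> (complex \<Rightarrow> complex) set" where
  "Pa \<omega> c r = (\<Union>k. Pk \<omega> c r k)"

text \<open>The locally convex inductive limit topology: the absolutely convex sets whose trace on each
  \<open>P\<^sub>k\<close> is a neighbourhood of \<open>0\<close> in \<open>P\<^sub>k\<close> form a base of neighbourhoods of \<open>0\<close>.\<close>

definition Pa_zero_nhd ::
  "(real \<Rightarrow> real) \<Rightarrow> (nat \<Rightarrow> real) \<Rightarrow> (nat \<Rightarrow> real) \<Rightarrow> (complex \<Rightarrow> complex) set \<Rightarrow> bool" where
  "Pa_zero_nhd \<omega> c r V \<longleftrightarrow>
     V \<subseteq> Pa \<omega> c r \<and>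
     (\<forall>f\<in>V. \<forall>g\<in>V. \<forall>s t. cmod s + cmod t \<le> 1 \<longrightarrow> cscale s f + cscale t g \<in> V) \<and>
     (\<forall>k. \<exists>\<delta>>0. {\<phi> \<in> Pk \<omega> c r k. Pk_norm \<omega> c r k \<phi> < ereal \<delta>} \<subseteq> V)"

definition Pa_topology ::
  "(real \<Rightarrow> real) \<Rightarrow> (nat \<Rightarrow> real) \<Rightarrow> (nat \<Rightarrow> real) \<Rightarrow> (complex \<Rightarrow> complex) topology" where
  "Pa_topology \<omega> c r =
     topology (\<lambda>G. G \<subseteq> Pa \<omega> c r \<and> (\<forall>f\<in>G. \<exists>V. Pa_zero_nhd \<omega> c r V \<and> (\<forall>v\<in>V. f + v \<in> G)))"

lemma Pa_zero_nhd_Int: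
  assumes V: "Pa_zero_nhd \<omega> c r V" and V': "Pa_zero_nhd \<omega> c r V'"
  shows "Pa_zero_nhd \<omega> c r (V \<inter> V')"
  unfolding Pa_zero_nhd_def
proof (intro conjI allI ballI impI)
  show "V \<inter> V' \<subseteq> Pa \<omega> c r"
    using V unfolding Pa_zero_nhd_def by blast
next
  fix f g s t
  assume "f \<in> V \<inter> V'" "g \<in> V \<inter> V'" "cmod s + cmod t \<le> 1"
  then show "cscale s f + cscale t g \<in> V \<inter> V'"
    using V V' unfolding Pa_zero_nhd_def by (simp only: Int_iff)
next
  fix k
  obtain d where d: "d > 0" "{\<phi> \<in> Pk \<omega> c r k. Pk_norm \<omega> c r k \<phi> < ereal d} \<subseteq> V"
    using V unfolding Pa_zero_nhd_def by meson
  obtain d' where d': "d' > 0" "{\<phi> \<in> Pk \<omega> c r k. Pk_norm \<omega> c r k \<phi> < ereal d'} \<subseteq> V'"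
    using V' unfolding Pa_zero_nhd_def by meson
  have "x < ereal d \<and> x < ereal d'" if "x < ereal (min d d')" for x
    using order.strict_trans2[OF that, of "ereal d"] order.strict_trans2[OF that, of "ereal d'"]
    by simp
  then have "{\<phi> \<in> Pk \<omega> c r k. Pk_norm \<omega> c r k \<phi> < ereal (min d d')} \<subseteq> V \<inter> V'"
    using d(2) d'(2) by (intro subsetI) (simp add: subset_iff)
  moreover have "0 < min d d'" using d(1) d'(1) by simp
  ultimately show "\<exists>\<delta>>0. {\<phi> \<in> Pk \<omega> c r k. Pk_norm \<omega> c r k \<phi> < ereal \<delta>} \<subseteq> V \<inter> V'"
    by (intro exI[of _ "min d d'"] conjI)
qed

lemma openin_Pa_topology:
  "openin (Pa_topology \<omega> c r) G \<longleftrightarrow>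
     G \<subseteq> Pa \<omega> c r \<and> (\<forall>f\<in>G. \<exists>V. Pa_zero_nhd \<omega> c r V \<and> (\<forall>v\<in>V. f + v \<in> G))"
proof -
  define nb where "nb f G \<longleftrightarrow> (\<exists>V. Pa_zero_nhd \<omega> c r V \<and> (\<forall>v\<in>V. f + v \<in> G))" for f G
  have nb_mono: "nb f T" if "nb f S" "S \<subseteq> T" for f S T
    using that unfolding nb_def by (meson subsetD)
  have nb_Int: "nb f (S \<inter> T)" if S: "nb f S" and T: "nb f T" for f S T
  proof -
    obtain V where V: "Pa_zero_nhd \<omega> c r V" "\<forall>v\<in>V. f + v \<in> S"
      using S unfolding nb_def by meson
    obtain V' where V': "Pa_zero_nhd \<omega> c r V'" "\<forall>v\<in>V'. f + v \<in> T"
      using T unfolding nb_def by meson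
    have "Pa_zero_nhd \<omega> c r (V \<inter> V')" using V(1) V'(1) by (rule Pa_zero_nhd_Int)
    moreover have "\<forall>v\<in>V \<inter> V'. f + v \<in> S \<inter> T" using V(2) V'(2) by simp
    ultimately show ?thesis unfolding nb_def by (intro exI conjI)
  qed
  have "istopology (\<lambda>G. G \<subseteq> Pa \<omega> c r \<and> (\<forall>f\<in>G. nb f G))"
    unfolding istopology_def
  proof (intro conjI allI impI ballI)
    show "S \<inter> T \<subseteq> Pa \<omega> c r"
      if "S \<subseteq> Pa \<omega> c r \<and> (\<forall>f\<in>S. nb f S)" for S T
      using that by (simp add: le_infI1)
    show "nb f (S \<inter> T)"
      if "S \<subseteq> Pa \<omega> c r \<and> (\<forall>f\<in>S. nb f S)" "T \<subseteq> Pa \<omega> c r \<and> (\<forall>f\<in>T. nb f T)"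
        "f \<in> S \<inter> T" for S T f
      using that by (simp add: nb_Int)
    show "\<Union> K \<subseteq> Pa \<omega> c r"
      if "\<forall>S\<in>K. S \<subseteq> Pa \<omega> c r \<and> (\<forall>f\<in>S. nb f S)" for K
      using that by (simp add: Sup_le_iff)
    show "nb f (\<Union> K)"
      if "\<forall>S\<in>K. S \<subseteq> Pa \<omega> c r \<and> (\<forall>f\<in>S. nb f S)" "f \<in> \<Union> K" for K f
      using that by (meson UnionE Union_upper nb_mono)
  qed
  then show ?thesis
    unfolding Pa_topology_def nb_def by (simp only: topology_inverse')
qed

lemma Pk_iff:
  "\<phi> \<in> Pk \<omega> c r k \<longleftrightarrow>
     \<phi> holomorphic_on UNIV \<and> (\<exists>C. \<forall>z. cmod (\<phi> z) \<le> C * exp (r k * \<omega> (cmod z) + c k * \<bar>Im z\<bar>))"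
proof -
  have eq: "cmod (\<phi> z) * exp (- r k * \<omega> (cmod z) - c k * \<bar>Im z\<bar>) \<le> C \<longleftrightarrow>
        cmod (\<phi> z) \<le> C * exp (r k * \<omega> (cmod z) + c k * \<bar>Im z\<bar>)" for z C
  proof -
    have "exp (- r k * \<omega> (cmod z) - c k * \<bar>Im z\<bar>)
          = inverse (exp (r k * \<omega> (cmod z) + c k * \<bar>Im z\<bar>))"
      by (simp flip: exp_minus)
    then show ?thesis by (simp only: divide_inverse[symmetric] pos_divide_le_eq exp_gt_zero)
  qed
  have "Pk_norm \<omega> c r k \<phi> < \<infinity> \<longleftrightarrow>
      (\<exists>C. \<forall>z. cmod (\<phi> z) * exp (- r k * \<omega> (cmod z) - c k * \<bar>Im z\<bar>) \<le> C)"
  proof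
    assume "Pk_norm \<omega> c r k \<phi> < \<infinity>"
    then obtain C where "Pk_norm \<omega> c r k \<phi> \<le> ereal C"
      by (cases "Pk_norm \<omega> c r k \<phi>") auto
    then show "\<exists>C. \<forall>z. cmod (\<phi> z) * exp (- r k * \<omega> (cmod z) - c k * \<bar>Im z\<bar>) \<le> C"
      unfolding Pk_norm_def by (auto simp: SUP_le_iff)
  next
    assume "\<exists>C. \<forall>z. cmod (\<phi> z) * exp (- r k * \<omega> (cmod z) - c k * \<bar>Im z\<bar>) \<le> C"
    then obtain C where "Pk_norm \<omega> c r k \<phi> \<le> ereal C"
      unfolding Pk_norm_def by (auto simp: SUP_le_iff)
    then show "Pk_norm \<omega> c r k \<phi> < \<infinity>"
      by auto
  qed
  then show ?thesis
    unfolding Pk_def by (simp only: eq mem_Collect_eq)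
qed

lemma Pk_combination:
  assumes "f \<in> Pk \<omega> c r k" "g \<in> Pk \<omega> c r k"
  shows "cscale s f + cscale t g \<in> Pk \<omega> c r k"
proof -
  let ?E = "\<lambda>z. exp (r k * \<omega> (cmod z) + c k * \<bar>Im z\<bar>)"
  obtain A B where A: "\<And>z. cmod (f z) \<le> A * ?E z" and B: "\<And>z. cmod (g z) \<le> B * ?E z"
    using assms unfolding Pk_iff by blast
  have "cmod ((cscale s f + cscale t g) z) \<le> (cmod s * A + cmod t * B) * ?E z" for z
  proof -
    have "cmod ((cscale s f + cscale t g) z) \<le> cmod s * cmod (f z) + cmod t * cmod (g z)"
      by (auto simp: cscale_def norm_mult intro: order_trans[OF norm_triangle_ineq])
    also have "\<dots> \<le> cmod s * (A * ?E z) + cmod t * (B * ?E z)"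
      by (intro add_mono mult_left_mono A B) auto
    finally show ?thesis by (simp add: algebra_simps)
  qed
  moreover have "(cscale s f + cscale t g) holomorphic_on UNIV"
    using assms unfolding Pk_iff cscale_def plus_fun_def
    by (intro holomorphic_intros) auto
  ultimately show ?thesis unfolding Pk_iff by blast
qed

lemma Pk_mono:
  assumes "weight \<omega>" "incseq c" "incseq r" "k \<le> l"
  shows "Pk \<omega> c r k \<subseteq> Pk \<omega> c r l"
proof
  fix f assume f: "f \<in> Pk \<omega> c r k"
  then obtain A where A: "\<And>z. cmod (f z) \<le> A * exp (r k * \<omega> (cmod z) + c k * \<bar>Im z\<bar>)"
    unfolding Pk_iff by blast
  have "cmod (f z) \<le> \<bar>A\<bar> * exp (r l * \<omega> (cmod z) + c l * \<bar>Im z\<bar>)" for z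
  proof -
    have "0 \<le> \<omega> (cmod z)" using assms(1) unfolding weight_def by simp
    then have "r k * \<omega> (cmod z) + c k * \<bar>Im z\<bar> \<le> r l * \<omega> (cmod z) + c l * \<bar>Im z\<bar>"
      using assms(2-4) by (intro add_mono mult_right_mono) (auto simp: incseq_def)
    then have "A * exp (r k * \<omega> (cmod z) + c k * \<bar>Im z\<bar>)
        \<le> \<bar>A\<bar> * exp (r l * \<omega> (cmod z) + c l * \<bar>Im z\<bar>)"
      by (intro mult_mono) auto
    then show ?thesis using A[of z] by linarith
  qed
  then show "f \<in> Pk \<omega> c r l" using f unfolding Pk_iff by blast
qed

lemma Pa_combination:
  assumes "weight \<omega>" "incseq c" "incseq r" "f \<in> Pa \<omega> c r" "g \<in> Pa \<omega> c r"
  shows "cscale s f + cscale t g \<in> Pa \<omega> c r"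
proof -
  obtain k l where "f \<in> Pk \<omega> c r k" "g \<in> Pk \<omega> c r l"
    using assms unfolding Pa_def by blast
  then have "f \<in> Pk \<omega> c r (max k l)" "g \<in> Pk \<omega> c r (max k l)"
    using Pk_mono[OF assms(1-3)] by (meson max.cobounded1 max.cobounded2 subsetD)+
  from Pk_combination[OF this] show ?thesis unfolding Pa_def by blast
qed

lemma topspace_Pa_topology:
  assumes "weight \<omega>" "incseq c" "incseq r"
  shows "topspace (Pa_topology \<omega> c r) = Pa \<omega> c r"
proof -
  have "Pa_zero_nhd \<omega> c r (Pa \<omega> c r)"
    unfolding Pa_zero_nhd_def
  proof (intro conjI allI)
    show "\<forall>f\<in>Pa \<omega> c r. \<forall>g\<in>Pa \<omega> c r. \<forall>s t. cmod s + cmod t \<le> 1 \<longrightarrow> cscale s f + cscale t g \<in> Pa \<omega> c r"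
      using Pa_combination[OF assms] by blast
    show "\<exists>\<delta>>0. {\<phi> \<in> Pk \<omega> c r k. Pk_norm \<omega> c r k \<phi> < ereal \<delta>} \<subseteq> Pa \<omega> c r" for k
      by (rule exI[of _ 1]) (auto simp: Pa_def)
  qed simp
  moreover have "f + g \<in> Pa \<omega> c r" if "f \<in> Pa \<omega> c r" "g \<in> Pa \<omega> c r" for f g
    using Pa_combination[OF assms that, of 1 1] by (simp add: cscale_def)
  ultimately have "openin (Pa_topology \<omega> c r) (Pa \<omega> c r)"
    unfolding openin_Pa_topology by blast
  then show ?thesis
    by (metis openin_Pa_topology openin_subset openin_topspace subset_antisym)
qed

definition Fourier_Laplace ::
  "ereal \<Rightarrow> ((real \<Rightarrow> complex) \<Rightarrow> complex) \<Rightarrow> complex \<Rightarrow> complex" where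
  "Fourier_Laplace a S = (\<lambda>z. S (exp_monomial a 0 z))"

definition annihilator ::
  "(real \<Rightarrow> real) \<Rightarrow> ereal \<Rightarrow> (nat \<Rightarrow> real) \<Rightarrow> (real \<Rightarrow> complex) set
    \<Rightarrow> ((real \<Rightarrow> complex) \<Rightarrow> complex) set" where
  "annihilator \<omega> a c W = {S \<in> Ua_dual \<omega> a c. \<forall>f\<in>W. S f = 0}"

definition annihilator_submodule ::
  "(real \<Rightarrow> real) \<Rightarrow> ereal \<Rightarrow> (nat \<Rightarrow> real) \<Rightarrow> (real \<Rightarrow> complex) set
    \<Rightarrow> (complex \<Rightarrow> complex) set" where
  "annihilator_submodule \<omega> a c W = Fourier_Laplace a ` annihilator \<omega> a c W"

definition submodule ::
  "(real \<Rightarrow> real) \<Rightarrow> (nat \<Rightarrow> real) \<Rightarrow> (nat \<Rightarrow> real) \<Rightarrow> (complex \<Rightarrow> complex) set \<Rightarrow> bool" where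
  "submodule \<omega> c r J \<longleftrightarrow>
     J \<subseteq> Pa \<omega> c r \<and> cfun.subspace J \<and> closedin (Pa_topology \<omega> c r) J \<and>
     (\<forall>p. \<forall>\<phi>\<in>J. poly p * \<phi> \<in> J)"

definition principal_submodule ::
  "(real \<Rightarrow> real) \<Rightarrow> (nat \<Rightarrow> real) \<Rightarrow> (nat \<Rightarrow> real) \<Rightarrow> (complex \<Rightarrow> complex)
    \<Rightarrow> (complex \<Rightarrow> complex) set" where
  "principal_submodule \<omega> c r \<phi> = Pa_topology \<omega> c r closure_of {poly p * \<phi> |p. True}"

text \<open>The multiplicity of vanishing of a nonzero entire function is its \<^const>\<open>zorder\<close>; the zero
  function vanishes everywhere with infinite multiplicity, so it is left out of the minimum.\<close>

definition min_mult :: "(complex \<Rightarrow> complex) set \<Rightarrow> complex \<Rightarrow> nat" where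
  "min_mult J \<mu> = (INF \<phi>\<in>J - {0}. nat (zorder \<phi> \<mu>))"

text \<open>The entire function \<open>\<phi> / (z - \<mu>)\<close>, for \<open>\<phi> \<mu> = 0\<close>.\<close>

definition quotient_at :: "(complex \<Rightarrow> complex) \<Rightarrow> complex \<Rightarrow> complex \<Rightarrow> complex" where
  "quotient_at \<phi> \<mu> = (\<lambda>z. if z = \<mu> then deriv \<phi> \<mu> else \<phi> z / (z - \<mu>))"

definition stable_submodule :: "(complex \<Rightarrow> complex) set \<Rightarrow> bool" where
  "stable_submodule J \<longleftrightarrow>
     (\<forall>\<mu>. \<forall>\<phi>\<in>J - {0}. zorder \<phi> \<mu> > int (min_mult J \<mu>) \<longrightarrow> quotient_at \<phi> \<mu> \<in> J)"

text \<open>Here \<open>ln 0\<close> is \<open>-\<infinity>\<close>.\<close>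

definition indicator_fun :: "(complex \<Rightarrow> complex) \<Rightarrow> real \<Rightarrow> ereal" where
  "indicator_fun \<phi> \<theta> =
     Limsup at_top (\<lambda>R. if \<phi> (of_real R * cis \<theta>) = 0 then -\<infinity>
                        else ereal (ln (cmod (\<phi> (of_real R * cis \<theta>))) / R))"

definition ind_left :: "(complex \<Rightarrow> complex) set \<Rightarrow> ereal" where
  "ind_left J = (INF \<phi>\<in>J - {0}. - indicator_fun \<phi> (- pi / 2))"

definition ind_right :: "(complex \<Rightarrow> complex) set \<Rightarrow> ereal" where
  "ind_right J = (SUP \<phi>\<in>J - {0}. indicator_fun \<phi> (pi / 2))"

text \<open>Equality of zero sets, counted with multiplicities, is equality of the functions
  \<^const>\<open>min_mult\<close>.\<close>

definition weakly_localisable ::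
  "(real \<Rightarrow> real) \<Rightarrow> (nat \<Rightarrow> real) \<Rightarrow> (nat \<Rightarrow> real) \<Rightarrow> (complex \<Rightarrow> complex) set \<Rightarrow> bool" where
  "weakly_localisable \<omega> c r J \<longleftrightarrow>
     submodule \<omega> c r J \<and> J \<noteq> {0} \<and>
     (\<forall>J'. submodule \<omega> c r J' \<and> J' \<noteq> {0} \<and> min_mult J' = min_mult J \<and>
           ind_left J' = ind_left J \<and> ind_right J' = ind_right J \<and> J \<subseteq> J' \<longrightarrow> J' = J)"


section \<open>Completeness radius and Beurling--Malliavin density\<close>

definition completeness_radius :: "(complex \<Rightarrow> nat) \<Rightarrow> ereal" where
  "completeness_radius \<Lambda> =
     (INF \<rho>\<in>{\<rho>. 0 < \<rho> \<and> Cinf_topology (ereal \<rho>) closure_of cfun.span (exp_system (ereal \<rho>) \<Lambda>)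
                          \<noteq> Cinf (ereal \<rho>)}. ereal \<rho>)"

text \<open>The density is introduced through the Beurling--Malliavin theorem, \<open>r(\<Lambda>) = \<pi> D(\<Lambda>)\<close>.\<close>

definition BM_density :: "(complex \<Rightarrow> nat) \<Rightarrow> ereal" where
  "BM_density \<Lambda> = completeness_radius \<Lambda> / ereal pi"

end

theory Submission
  imports Defs
begin

text \<open>Let \<open>S\<close> annihilate \<open>Exp(W)\<close> and \<open>W\<^sub>I\<close>; by the Hahn--Banach theorem it suffices that \<open>S = 0\<close> on \<open>W\<close>. With
  \<open>R\<^sub>z\<close> the solution operator of \<open>u' + \<i> z u = f\<close>, \<open>u 0 = 0\<close>, stability of the annihilator submodule makes
  \<open>E = S(R\<^sub>z f) - FL(S) T(R\<^sub>z f) / FL(T)\<close> an entire function that does not depend on \<open>T \<in> W\<^sup>0\<close>, for each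
  \<open>f \<in> W\<close>. If all these functions are constant, then \<open>S = 0\<close> on \<open>W\<close>. Minimality of the residual interval gives \<open>E\<close>
  zero exponential type along the imaginary axis, so multiplication by \<open>E\<close> does not change indicator segments and
  is bounded on each step of the inductive limit; hence \<open>E\<close> is constant as soon as \<open>E^n \<psi>\<close> lies in the submodule for all \<open>n\<close>
  and some nonzero \<open>\<psi>\<close>. In case (b), \<open>\<psi> = \<phi>\<^sub>0\<close> works, because a weakly localisable submodule is determined by zeros and indicator
  segment. In case (a), incompleteness of \<open>\<Lambda>\<close> on a shorter interval gives a functional vanishing on \<open>\<Lambda>\<close> that is supported
  strictly inside \<open>I\<close>; comparing it with its small translates shows that such functionals always annihilate \<open>W\<close>.\<close>

text \<open>Why constancy is enough: passing from \<open>f\<close> to its derivative changes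
  \<open>E\<close> into \<open>S f - \<i> * z * E\<close>. If both are constant in \<open>z\<close>,
  then \<open>E = 0\<close>; the same holds for the derivative, which leaves \<open>S f = 0\<close>.
  The obstacle is that \<open>E\<close> is a quotient whose denominator is controlled only from
  above. The numerator is estimated by integrating from that end of the interval at which the
  exponential decays. For the denominator a lower bound at one point suffices: Blaschke factors and
  Harnack's inequality carry it across discs. Such a point exists on the imaginary axis, since
  faster decay there would shrink the support. The isomorphism of the dual with the module must be
  quantitative: a functional with given transform is bounded by constants that depend only on the
  step of the inductive limit. Hence \<open>E^n \<psi>\<close> is at most \<open>K^n\<close> times a
  fixed majorant, and n-th roots give \<open>|E| <= K\<close> off the zeros of
  \<open>\<psi>\<close>. Its proof needs smooth cut-off functions in the class, which the integral
  condition on the weight provides.\<close>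

lemma entire_compose:
 assumes "f holomorphic_on UNIV" "g holomorphic_on UNIV"
 shows "(%z. f (g z)) holomorphic_on UNIV"
 using holomorphic_on_compose[OF assms(2) holomorphic_on_subset[OF assms(1)]] by (simp add: o_def)

section \<open>Maximum principle, orders of vanishing and division of entire functions\<close>

lemma entire_maximum_modulus:
 assumes "f holomorphic_on UNIV" "0 < R" "!!z. cmod (z - c) = R ==> cmod (f z) <= B" "cmod (z - c) <= R"
 shows "cmod (f z) <= B"
proof (rule maximum_modulus_frontier[of f "cball c R"])
 show "f holomorphic_on interior (cball c R)" "continuous_on (closure (cball c R)) f"
  using assms(1) holomorphic_on_imp_continuous_on holomorphic_on_subset by blast+
 show "cmod (f w) <= B" if "w \<in> frontier (cball c R)" for w
  using that assms(2,3) by (auto simp: dist_norm norm_minus_commute)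
qed (use assms in \<open>auto simp: dist_norm norm_minus_commute\<close>)

text \<open>The factor \<open>(w - x)^2 - 4\<close>, with \<open>x = Re z\<close>, has its zeros
  where the circle of radius 2 meets the real axis, and its modulus on that circle is exactly
  \<open>4 * |Im w|\<close>. At \<open>z\<close> its modulus is at least 4, so the maximum principle
  removes the weight. This carries bounds of order \<open>1 / |Im w|\<close> across the real
  axis.\<close>

lemma strip_bound:
 assumes H: "H holomorphic_on UNIV" and z: "abs (Im z) <= 1"
  and Q: "!!w. cmod (w - of_real (Re z)) = 2 ==> cmod (H w) * abs (Im w) <= Q"
 shows "cmod (H z) <= Q"
proof -
 let ?x = "complex_of_real (Re z)"
 have G: "cmod (H w * ((w - ?x)^2 - 4)) <= 4 * Q" if "cmod (w - ?x) = 2" for w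
 proof -
  obtain x y where w: "w - ?x = Complex x y" by (metis complex.exhaust)
  have n: "x^2 + y^2 = 4" using that w by (auto simp: cmod_def real_sqrt_eq_iff[of _ 4] simp del: real_sqrt_eq_iff intro: real_sqrt_eq_iff[THEN iffD1])
  have "Im w = y" using w by (metis Im_complex_of_real complex.sel(2) diff_zero minus_complex.sel(2))
  have "(Complex x y)^2 - 4 = Complex (x^2 - y^2 - 4) (2*x*y)"
   by (simp add: complex_eq_iff power2_eq_square)
  hence "cmod ((w - ?x)^2 - 4) = sqrt ((x^2-y^2-4)^2 + (2*x*y)^2)" using w by (simp add: cmod_def)
  also have "(x^2-y^2-4)^2 + (2*x*y)^2 = (4*y)^2"
  proof -
   have "x^2 = 4 - y^2" using n by simp
   thus ?thesis by (simp add: power_mult_distrib) (simp add: power2_eq_square power4_eq_xxxx algebra_simps)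
  qed
  finally have "cmod ((w - ?x)^2 - 4) = 4 * abs (Im w)" using \<open>Im w = y\<close> real_sqrt_abs[of "4*y"] by (simp add: abs_mult del: real_sqrt_abs)
  thus ?thesis using Q[OF that] by (simp add: norm_mult)
 qed
 have "cmod (z - ?x) <= 2"
 proof -
  have "z - ?x = \<i> * of_real (Im z)" by (simp add: complex_eq_iff)
  thus ?thesis using z by (simp add: norm_mult)
 qed
 hence "cmod (H z * ((z - ?x)^2 - 4)) <= 4 * Q"
 proof -
  have "(%w. H w * ((w - ?x)^2 - 4)) holomorphic_on UNIV" using H by (intro holomorphic_intros)
  from entire_maximum_modulus[OF this, of 2 ?x "4*Q" z] show ?thesis using G \<open>cmod (z - ?x) <= 2\<close> by simp
 qed
 moreover have "(z - ?x)^2 - 4 = - of_real ((Im z)^2 + 4)"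
  by (simp add: complex_eq_iff power2_eq_square)
 hence "cmod ((z - ?x)^2 - 4) = (Im z)^2 + 4" by (simp only: norm_minus_cancel norm_of_real) simp
 ultimately have *: "cmod (H z) * ((Im z)^2 + 4) <= 4 * Q" by (simp add: norm_mult)
 have "cmod (H z) * 4 <= cmod (H z) * ((Im z)^2 + 4)" by (intro mult_left_mono) auto
 with * show ?thesis by simp
qed

text \<open>Divisibility instead of a condition on \<open>zorder\<close>: it covers the zero
  function and is stable under multiplication by entire functions.\<close>

definition vanishes :: "nat => complex => (complex => complex) => bool" where
 "vanishes n a f \<longleftrightarrow> (EX g. g holomorphic_on UNIV & (ALL z. f z = (z - a)^n * g z))"

lemma vanishes_mult: "vanishes n a f ==> h holomorphic_on UNIV ==> vanishes n a (%z. h z * f z)"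
 unfolding vanishes_def by (elim exE conjE, rule_tac x="%z. h z * g z" in exI) (auto intro!: holomorphic_intros)

lemma quotient_at_holomorphic:
 assumes "f holomorphic_on UNIV" "f a = 0"
 shows "quotient_at f a holomorphic_on UNIV"
 by (rule pole_theorem_open_0[OF assms(1), of a]) (auto simp: quotient_at_def assms(2))

lemma quotient_at_mult: "f a = 0 ==> f z = (z - a) * quotient_at f a z"
 by (simp add: quotient_at_def)

text \<open>The local factorisation lives on a ball only and serves to bound the exponents. The
  global factor belongs to the greatest exponent; if it vanished at \<open>a\<close>, one more
  division would be possible.\<close>

lemma entire_zero_factor:
 assumes f: "f holomorphic_on UNIV" and nz: "f b ~= 0"
 obtains n g where "g holomorphic_on UNIV" "g a ~= 0" "!!z. f z = (z - a)^n * g z"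
proof -
 let ?P = "%n. vanishes n a f"
 obtain m where m: "!!n. ?P n ==> n <= m"
 proof (cases "f a = 0")
  case False
  hence "n <= 0" if "?P n" for n using that unfolding vanishes_def by (cases n) auto
  thus ?thesis using that by blast
 next
  case True
  hence "~ f constant_on UNIV" using nz unfolding constant_on_def by (metis UNIV_I)
  then obtain g r n where g: "0 < r" "g holomorphic_on ball a r"
   "!!w. w \<in> ball a r ==> f w = (w - a)^n * g w" "!!w. w \<in> ball a r ==> g w ~= 0"
   using holomorphic_factor_zero_nonconstant[OF f open_UNIV connected_UNIV UNIV_I True] by metis
  have "k <= n" if Pk: "?P k" for k
  proof (rule ccontr)
   assume "~ k <= n"
   then obtain d where k: "k = n + Suc d" by (metis add_Suc_right less_imp_Suc_add not_le)
   obtain h where h: "h holomorphic_on UNIV" "!!z. f z = (z - a)^k * h z" using Pk unfolding vanishes_def by blast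
   have eq: "g w = (w - a)^Suc d * h w" if "w \<in> ball a r - {a}" for w
   proof -
    have "(w - a)^n * g w = (w-a)^n * ((w - a)^Suc d * h w)" using g(3)[of w] h(2)[of w] that k by (simp add: power_add mult_ac)
    thus ?thesis using that by (subst (asm) mult_left_cancel) auto
   qed
   have "(g \<longlongrightarrow> g a) (at a)" using g(1,2) by (metis centre_in_ball continuous_on_interior holomorphic_on_imp_continuous_on interior_ball isCont_def)
   moreover have "((%w. (w - a)^Suc d * h w) \<longlongrightarrow> (a - a)^Suc d * h a) (at a)"
    using holomorphic_on_imp_continuous_on[OF h(1)] by (intro tendsto_intros) (auto simp: continuous_on_def)
   hence "(g \<longlongrightarrow> (a - a)^Suc d * h a) (at a)"
    by (rule Lim_transform_within_open[OF _ open_ball[of a r]]) (use g(1) eq in auto)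
   ultimately have "g a = 0" using LIM_unique by fastforce
   thus False using g(1,4) by simp
  qed
  thus ?thesis using that by blast
 qed
 have "?P 0" unfolding vanishes_def using f by auto
 then obtain n where n: "?P n" "!!k. ?P k ==> k <= n" using GreatestI_nat[of ?P 0 m] Greatest_le_nat[of ?P _ m] m by metis
 obtain g where g: "g holomorphic_on UNIV" "!!z. f z = (z - a)^n * g z" using n(1) unfolding vanishes_def by blast
 have "g a ~= 0"
 proof
  assume "g a = 0"
  hence "?P (Suc n)" unfolding vanishes_def using g quotient_at_holomorphic[OF g(1)] quotient_at_mult[of g a]
   by (intro exI[of _ "quotient_at g a"]) (auto simp: mult_ac)
  thus False using n(2) by fastforce
 qed
 thus ?thesis using that g by blast
qed

lemma vanishes_zorder:
 assumes f: "f holomorphic_on UNIV" and nz: "f b ~= 0"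
 shows "vanishes n a f \<longleftrightarrow> int n <= zorder f a"
proof -
 obtain m g where g: "g holomorphic_on UNIV" "g a ~= 0" "!!z. f z = (z - a)^m * g z" using entire_zero_factor[OF assms] by blast
 have z: "zorder f a = int m"
  by (rule zorder_eqI[OF open_UNIV UNIV_I g(1,2)]) (simp add: g(3) mult.commute)
 show ?thesis
 proof
  assume "vanishes n a f"
  then obtain h where h: "h holomorphic_on UNIV" "!!z. f z = (z - a)^n * h z" unfolding vanishes_def by blast
  have "h b ~= 0" using h(2)[of b] nz by auto
  from entire_zero_factor[OF h(1) this, of a] obtain k g' where g': "g' holomorphic_on UNIV" "g' a ~= 0" "!!z. h z = (z - a)^k * g' z" by blast
  have "zorder f a = int (n + k)"
   by (rule zorder_eqI[OF open_UNIV UNIV_I g'(1,2)]) (use h(2) g'(3) in \<open>simp only: power_int_of_nat power_add mult_ac\<close>)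
  thus "int n <= zorder f a" by simp
 next
  assume "int n <= zorder f a"
  then obtain d where "m = n + d" using z by (metis le_Suc_ex of_nat_le_iff)
  thus "vanishes n a f" unfolding vanishes_def using g
   by (intro exI[of _ "%z. (z - a)^d * g z"]) (auto intro!: holomorphic_intros simp: power_add)
 qed
qed

lemma vanishes_iff_deriv:
 assumes f: "f holomorphic_on UNIV"
 shows "vanishes n a f \<longleftrightarrow> (ALL j<n. (deriv ^^ j) f a = 0)"
proof (cases "EX b. f b ~= 0")
 case False
 hence "f = (%z. 0)" by auto
 thus ?thesis by (auto simp: vanishes_def intro: exI[of _ "%z. 0"])
next
 case True
 then obtain b where b: "f b ~= 0" by blast
 have "EX m. (deriv ^^ m) f a ~= 0"
  using holomorphic_fun_eq_0_on_connected[OF f open_UNIV connected_UNIV _ UNIV_I UNIV_I, of a b] b by blast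
 then obtain m where m: "(deriv ^^ m) f a ~= 0" "!!i. i < m ==> (deriv ^^ i) f a = 0"
  using exists_least_iff[of "%m. (deriv ^^ m) f a ~= 0"] by blast
 have "zorder f a = int m"
  by (rule zorder_zero_eqI[OF f open_UNIV UNIV_I]) (use m in auto)
 hence "vanishes n a f \<longleftrightarrow> n <= m" using vanishes_zorder[OF f b] by simp
 thus ?thesis using m by (metis leI less_le_trans)
qed

text \<open>Two local representations of \<open>g / h\<close> agree off the zeros of
  \<open>h\<close> and of their denominators, hence by continuity wherever both denominators are
  non-zero. The denominators may change from point to point.\<close>

lemma local_quotient_entire:
 assumes g: "g holomorphic_on UNIV" and h: "h holomorphic_on UNIV" "h b ~= 0"
  and loc: "!!x. EX k l. k holomorphic_on UNIV & l holomorphic_on UNIV & l x ~= 0 & (ALL z. g z * l z = h z * k z)"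
 obtains E where "E holomorphic_on UNIV" "!!z. E z * h z = g z"
proof -
 obtain k l where kl: "!!x. k x holomorphic_on UNIV" "!!x. l x holomorphic_on UNIV" "!!x::complex. l x x ~= 0"
  "!!x z. g z * l x z = h z * k x z" using loc by metis
 \<comment> \<open>The diagonal choice: at \<open>z\<close> the fraction belonging to
   \<open>z\<close> itself, whose denominator is non-zero there.\<close>
 define E where "E z = k z z / l z z" for z
 have E: "E w = k x w / l x w" if "l x w ~= 0" for x w
 proof -
  have ev: "eventually (%z. k w z / l w z = k x z / l x z) (at w)"
  proof -
   have ev_h: "eventually (%z. h z ~= 0) (at w)"
   proof (cases "h w = 0")
    case True
    then obtain r where "0 < r" "!!z. z \<in> ball w r - {w} ==> h z ~= 0"
     using isolated_zeros[OF h(1) open_UNIV connected_UNIV UNIV_I _ UNIV_I h(2)] by metis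
    thus ?thesis unfolding eventually_at by (auto intro!: exI[of _ r] simp: dist_commute)
   next
    case False
    have "(h \<longlongrightarrow> h w) (at w)" using holomorphic_on_imp_continuous_on[OF h(1)] by (auto simp: continuous_on_def)
    thus ?thesis using False tendsto_imp_eventually_ne by blast
   qed
   have nz: "eventually (%z. l y z ~= 0) (at w)" if "l y w ~= 0" for y
   proof -
    have "(l y \<longlongrightarrow> l y w) (at w)" using holomorphic_on_imp_continuous_on[OF kl(2)] by (auto simp: continuous_on_def)
    thus ?thesis using that tendsto_imp_eventually_ne by blast
   qed
   show ?thesis using ev_h nz[OF kl(3)] nz[OF that]
   proof eventually_elim
    case (elim z)
    have "k y z / l y z = g z / h z" if "l y z ~= 0" for y
     using kl(4)[of z y] elim(1) that by (simp add: frac_eq_eq mult.commute)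
    thus ?case using elim(2,3) by simp
   qed
  qed
  have t: "((%z. k y z / l y z) \<longlongrightarrow> k y w / l y w) (at w)" if "l y w ~= 0" for y
   using holomorphic_on_imp_continuous_on[OF kl(1)] holomorphic_on_imp_continuous_on[OF kl(2)] that
   by (intro tendsto_intros) (auto simp: continuous_on_def)
  have "((%z. k x z / l x z) \<longlongrightarrow> k w w / l w w) (at w)"
   by (rule Lim_transform_eventually[OF t[OF kl(3)] ev])
  from LIM_unique[OF this t[OF that]] show ?thesis by (simp add: E_def)
 qed
 show ?thesis
 proof
  show "E z * h z = g z" for z using kl(4)[of z z] kl(3)[of z] by (simp add: E_def field_simps)
  have "E field_differentiable at x" for x
  proof -
   have "open (l x -` (-{0}))" using holomorphic_on_imp_continuous_on[OF kl(2)] by (intro open_vimage) auto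
   then obtain r where r: "0 < r" "ball x r \<subseteq> l x -` (-{0})" using kl(3)[of x] by (meson openE vimageI2 ComplI singletonD)
   have "(%z. k x z / l x z) holomorphic_on ball x r"
    using kl(1,2) r(2) by (intro holomorphic_intros) (auto intro: holomorphic_on_subset)
   hence "E holomorphic_on ball x r" by (rule holomorphic_transform) (use E r(2) in fastforce)
   thus ?thesis using r(1) holomorphic_on_imp_differentiable_at by (metis centre_in_ball open_ball)
  qed
  thus "E holomorphic_on UNIV" by (simp add: holomorphic_on_def field_differentiable_at_within)
 qed
qed

text \<open>Cancellation of a factor \<open>h\<close> that may have zeros: the set where
  \<open>f\<close> and \<open>g\<close> differ is open and \<open>h\<close> vanishes on it, so the
  identity theorem makes it empty.\<close>

lemma entire_eqI:
 assumes f: "f holomorphic_on UNIV" and g: "g holomorphic_on UNIV" and h: "h holomorphic_on UNIV" "h b ~= 0"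
  and eq: "!!z. f z * h z = g z * h z"
 shows "f z = g z"
proof -
 define d where "d z = f z - g z" for z
 have d: "d holomorphic_on UNIV" unfolding d_def using f g by (intro holomorphic_intros)
 have dz: "d z * h z = 0" for z using eq[of z] by (simp add: d_def left_diff_distrib)
 have "d z = 0"
 proof (rule ccontr)
  assume "d z ~= 0"
  hence "open (d -` (-{0}))" "z \<in> d -` (-{0})" using holomorphic_on_imp_continuous_on[OF d] by (auto intro: open_vimage)
  moreover have "h w = 0" if "w \<in> d -` (-{0})" for w using dz[of w] that by auto
  ultimately have "h b = 0" using analytic_continuation_open[of "d -` (-{0})" UNIV h "%z. 0" b] h(1) by auto
  thus False using h(2) by simp
 qed
 thus ?thesis by (simp add: d_def)
qed

section \<open>Harnack's inequality and bounds for quotients\<close>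

lemma harnack_at_center:
 assumes g: "g holomorphic_on ball 0 1" and nz: "!!z. cmod z < 1 ==> g z ~= 0" and B: "!!z. cmod z < 1 ==> cmod (g z) <= B"
  and z: "cmod z < 1"
 shows "ln (B / cmod (g z)) * (1 - cmod z) <= ln (B / cmod (g 0)) * (1 + cmod z)"
  and "ln (B / cmod (g 0)) * (1 - cmod z) <= ln (B / cmod (g z)) * (1 + cmod z)"
proof -
 have "0 < cmod (g 0)" using nz[of 0] by simp
 also have "... <= B" using B[of 0] by simp
 finally have Bp: "0 < B" .
 have "simply_connected (ball (0::complex) 1)" by (simp add: convex_imp_simply_connected)
 then obtain h where h: "h holomorphic_on ball 0 1" "!!z. cmod z < 1 ==> g z = exp (h z)"
  using simply_connected_eq_holomorphic_log[OF open_ball, of 0 1] g nz by (metis dist_0_norm mem_ball)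
 define u where "u w = ln B - Re (h w)" for w
 have u: "ln (B / cmod (g w)) = u w" "u w >= 0" if "cmod w < 1" for w
 proof -
  have "cmod (g w) = exp (Re (h w))" using h(2)[OF that] by simp
  thus "ln (B / cmod (g w)) = u w" using Bp by (simp add: u_def ln_div)
  thus "u w >= 0" using B[OF that] nz[OF that] Bp by (auto simp flip: \<open>ln (B / cmod (g w)) = u w\<close>)
 qed
 have key: "abs (u z - u 0) <= cmod z * (u z + u 0 + 2 * e)" if e: "e > 0" for e
 proof -
  \<comment> \<open>The real part is \<open>ln (B / |g|)\<close> raised by \<open>e\<close>, which
    makes it strictly positive even where \<open>|g|\<close> equals \<open>B\<close>;
    \<open>e\<close> tends to 0 afterwards.\<close>
  define U where "U w = of_real (ln B + e) - h w" for w
  have ReU: "Re (U w) = u w + e" for w by (simp add: U_def u_def)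
  have pos: "Re (U w) > 0" if "cmod w < 1" for w using u(2)[OF that] e by (simp add: ReU)
  \<comment> \<open>The Cayley transform of the right half-plane that sends \<open>U 0\<close> to 0;
    the Schwarz lemma applies to it.\<close>
  define F where "F w = (U w - U 0) / (U w + cnj (U 0))" for w
  have den: "U w + cnj (U 0) ~= 0" if "cmod w < 1" for w
  proof
   assume "U w + cnj (U 0) = 0"
   hence "Re (U w + cnj (U 0)) = 0" by simp
   thus False using pos[OF that] pos[of 0] by simp
  qed
  have "F holomorphic_on ball 0 1" unfolding F_def U_def using den h(1)
   by (intro holomorphic_intros) (auto simp: U_def)
  moreover have "cmod (F w) < 1" if w: "cmod w < 1" for w
  proof -
   have "(cmod (U w - U 0))^2 < (cmod (U w + cnj (U 0)))^2"
   proof -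
    have "(cmod (U w + cnj (U 0)))^2 - (cmod (U w - U 0))^2 = 4 * Re (U w) * Re (U 0)"
     unfolding cmod_power2 by (simp add: power2_eq_square algebra_simps)
    thus ?thesis using pos[OF w] pos[of 0] by (smt (verit) mult_pos_pos norm_zero)
   qed
   hence "cmod (U w - U 0) < cmod (U w + cnj (U 0))" using power2_less_imp_less norm_ge_zero by blast
   thus ?thesis using den[OF w] by (simp add: F_def norm_divide)
  qed
  ultimately have "cmod (F z) <= cmod z" using Schwarz_Lemma(1)[of F z] z by (auto simp: F_def)
  hence le: "cmod (U z - U 0) <= cmod z * cmod (U z + cnj (U 0))" using den[OF z] by (simp add: F_def norm_divide field_simps)
  let ?a = "Re (U z - U 0)" and ?b = "Re (U z) + Re (U 0)" and ?y = "Im (U z) - Im (U 0)" and ?t = "cmod z"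
  have "(cmod (U z - U 0))^2 <= (?t * cmod (U z + cnj (U 0)))^2" using le by (intro power_mono) auto
  \<comment> \<open>Numerator and denominator of \<open>F z\<close> have the same imaginary part
    \<open>?y\<close>, which drops out because \<open>?t < 1\<close>; what remains compares real
    parts.\<close>
  hence sq: "?a^2 + ?y^2 <= ?t^2 * (?b^2 + ?y^2)" by (simp add: cmod_power2 power_mult_distrib)
  have "?t^2 * ?y^2 <= 1 * ?y^2" using z by (intro mult_right_mono) (auto simp: power_le_one)
  hence "?a^2 <= ?t^2 * ?b^2" using sq unfolding distrib_left by linarith
  hence "?a^2 <= (?t * ?b)^2" by (simp only: power_mult_distrib)
  hence "abs (?a) <= ?t * ?b" using pos[OF z] pos[of 0] abs_le_square_iff[of ?a "?t * ?b"] by (simp add: abs_mult)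
  thus ?thesis by (simp add: ReU algebra_simps)
 qed
 have key0: "abs (u z - u 0) <= cmod z * (u z + u 0)"
 proof (rule field_le_epsilon)
  fix e :: real assume "e > 0"
  hence "abs (u z - u 0) <= cmod z * (u z + u 0 + 2 * (e/2))" using key[of "e/2"] by simp
  also have "... = cmod z * (u z + u 0) + cmod z * e" by (simp add: algebra_simps)
  also have "cmod z * e <= 1 * e" using z \<open>e > 0\<close> by (intro mult_right_mono) auto
  finally show "abs (u z - u 0) <= cmod z * (u z + u 0) + e" by simp
 qed
 hence k: "u z - u 0 <= cmod z * (u z + u 0)" "u 0 - u z <= cmod z * (u z + u 0)" by auto
 show "ln (B / cmod (g z)) * (1 - cmod z) <= ln (B / cmod (g 0)) * (1 + cmod z)"
  unfolding u(1)[OF z] u(1)[of 0, simplified] using k(1) by (simp add: algebra_simps)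
 show "ln (B / cmod (g 0)) * (1 - cmod z) <= ln (B / cmod (g z)) * (1 + cmod z)"
  unfolding u(1)[OF z] u(1)[of 0, simplified] using k(2) by (simp add: algebra_simps)
qed

text \<open>The product of two Harnack factors: one leads from a point at relative radius
  \<open>q\<close> to the centre, the other from there to relative radius \<open>p\<close>.\<close>

definition harnack_const :: "real => real => real" where
 "harnack_const p q = (1 + p) / (1 - p) * ((1 + q) / (1 - q))"

text \<open>Blaschke factors remove the zeros of the denominator \<^term>\<open>b\<close> without changing its modulus on
 the circle; Harnack's inequality then carries the lower bound from \<^term>\<open>v\<close> to \<^term>\<open>w\<close>.\<close>

lemma quotient_bound_unit:
 assumes E: "E holomorphic_on UNIV" and b: "b holomorphic_on UNIV"
  and bB: "!!z. cmod z = 1 ==> cmod (b z) <= B" and EB: "!!z. cmod z = 1 ==> cmod (E z) * cmod (b z) <= A * B"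
  and v: "cmod v < 1" "b v ~= 0" and w: "cmod w < 1"
 shows "cmod (E w) <= A * exp (harnack_const (cmod w) (cmod v) * ln (B / cmod (b v)))"
proof -
 have "finite {z \<in> cball 0 1. b z = 0}"
 proof (cases "b constant_on UNIV")
  case True
  hence "{z \<in> cball 0 1. b z = 0} = {}" using v(2) unfolding constant_on_def by auto
  thus ?thesis by (simp only: finite.emptyI)
 next
  case False
  thus ?thesis
   by (intro holomorphic_compact_finite_zeros[OF b open_UNIV connected_UNIV compact_cball subset_UNIV])
 qed
 hence "finite {z. cmod z < 1 & b z = 0}" by (rule rev_finite_subset) auto
 thus ?thesis using b bB EB v
 proof (induction "{z. cmod z < 1 & b z = 0}" arbitrary: b rule: finite_psubset_induct)
  case psubset
  note b = psubset.prems(1) and bB = psubset.prems(2) and EB = psubset.prems(3) and v = psubset.prems(4,5)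
  have bv: "cmod (b v) > 0" using v by simp
  have bB': "cmod (b z) <= B" if "cmod z <= 1" for z
   using entire_maximum_modulus[OF b, of 1 0 B z] bB that by simp
  have Bp: "B > 0" using bB'[of v] v bv by linarith
  have AB: "0 <= A * B" using EB[of 1] by (meson mult_nonneg_nonneg norm_ge_zero norm_one order_trans)
  hence A0: "0 <= A" using Bp by (simp add: zero_le_mult_iff)
  show ?case
  proof (cases "EX a. cmod a < 1 & b a = 0")
   case False
   hence nz: "!!z. cmod z < 1 ==> b z ~= 0" by blast
   have hb: "b holomorphic_on ball 0 1" using b holomorphic_on_subset by blast
   have lw: "ln (B / cmod (b w)) * (1 - cmod w) <= ln (B / cmod (b 0)) * (1 + cmod w)"
    by (rule harnack_at_center(1)[OF hb nz _ w]) (auto intro: bB')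
   have lv: "ln (B / cmod (b 0)) * (1 - cmod v) <= ln (B / cmod (b v)) * (1 + cmod v)"
    by (rule harnack_at_center(2)[OF hb nz _ v(1)]) (auto intro: bB')
   have "ln (B / cmod (b w)) <= ln (B / cmod (b 0)) * ((1 + cmod w) / (1 - cmod w))"
    using lw w by (simp add: field_simps)
   also have "... <= (ln (B / cmod (b v)) * ((1 + cmod v) / (1 - cmod v))) * ((1 + cmod w) / (1 - cmod w))"
    using lv v w by (intro mult_right_mono) (auto simp: field_simps)
   finally have L: "ln (B / cmod (b w)) <= harnack_const (cmod w) (cmod v) * ln (B / cmod (b v))"
    by (simp add: harnack_const_def mult_ac)
   have bw: "cmod (b w) > 0" using nz[OF w] by simp
   have "(%z. E z * b z) holomorphic_on UNIV" using E b by (intro holomorphic_intros)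
   hence "cmod (E w * b w) <= A * B"
    using entire_maximum_modulus[of "%z. E z * b z" 1 0 "A * B" w] EB w by (simp add: norm_mult)
   hence "cmod (E w) <= A * (B / cmod (b w))" using bw by (simp add: norm_mult field_simps)
   also have "B / cmod (b w) = exp (ln (B / cmod (b w)))" using Bp bw by simp
   also have "A * ... <= A * exp (harnack_const (cmod w) (cmod v) * ln (B / cmod (b v)))"
    using L A0 by (intro mult_left_mono) auto
   finally show ?thesis .
  next
   case True
   then obtain a where a: "cmod a < 1" "b a = 0" by blast
   obtain n g where g: "g holomorphic_on UNIV" "g a ~= 0" "!!z. b z = (z - a)^n * g z"
    using entire_zero_factor[OF b v(2)] by blast
   \<comment> \<open>This identity gives equal moduli on the unit circle and, inside the disc,
     \<open>|z - a| <= |1 - cnj a * z|\<close>. So the new denominator keeps its bound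
     \<open>B\<close> and is not smaller at \<open>v\<close>.\<close>
   have fac: "cmod (1 - cnj a * z)^2 - cmod (z - a)^2 = (1 - cmod a^2) * (1 - cmod z^2)" for z
    unfolding cmod_power2 by (simp add: power2_eq_square algebra_simps)
   define b' where "b' z = (1 - cnj a * z)^n * g z" for z
   have hb': "b' holomorphic_on UNIV" unfolding b'_def using g(1) by (intro holomorphic_intros)
   have eq: "cmod (b' z) = cmod (b z)" if "cmod z = 1" for z
   proof -
    have "cmod (1 - cnj a * z) = cmod (z - a)" using fac[of z] that by (simp add: power2_eq_iff_nonneg)
    thus ?thesis by (simp add: b'_def g(3) norm_mult norm_power)
   qed
   have ge: "cmod (b v) <= cmod (b' v)"
   proof -
    have "0 <= (1 - cmod a^2) * (1 - cmod v^2)" using a v by (intro mult_nonneg_nonneg) (auto simp: power_le_one)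
    hence "cmod (v - a)^2 <= cmod (1 - cnj a * v)^2" using fac[of v] by linarith
    hence "cmod (v - a) <= cmod (1 - cnj a * v)" by (rule power2_le_imp_le) simp
    thus ?thesis by (simp add: b'_def g(3) norm_mult norm_power mult_right_mono power_mono)
   qed
   have nz1: "1 - cnj a * z ~= 0" if "cmod z < 1" for z
   proof
    assume "1 - cnj a * z = 0"
    hence "cmod (cnj a * z) = 1" by simp
    moreover have "cmod a * cmod z <= cmod a * 1" using that by (intro mult_left_mono) auto
    ultimately show False using a(1) by (simp add: norm_mult)
   qed
   have "{z. cmod z < 1 & b' z = 0} \<subset> {z. cmod z < 1 & b z = 0}"
    using nz1 a g(2) by (auto simp: b'_def g(3))
   moreover have "b' v ~= 0" using ge bv by auto
   ultimately have IH: "cmod (E w) <= A * exp (harnack_const (cmod w) (cmod v) * ln (B / cmod (b' v)))"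
    using psubset.hyps(2)[OF _ hb'] eq bB EB v(1) by auto
   have "0 <= harnack_const (cmod w) (cmod v)" using v w by (simp add: harnack_const_def)
   moreover have "ln (B / cmod (b' v)) <= ln (B / cmod (b v))"
    using ge bv Bp by (intro ln_mono divide_left_mono mult_pos_pos) (auto simp: divide_simps)
   ultimately have "A * exp (harnack_const (cmod w) (cmod v) * ln (B / cmod (b' v)))
     <= A * exp (harnack_const (cmod w) (cmod v) * ln (B / cmod (b v)))"
    using A0 by (intro mult_left_mono) (auto intro: mult_left_mono)
   with IH show ?thesis by linarith
  qed
 qed
qed

lemma quotient_bound:
 assumes E: "E holomorphic_on UNIV" and b: "b holomorphic_on UNIV" and R: "0 < R"
  and bB: "!!z. cmod (z - c) = R ==> cmod (b z) <= B" and EB: "!!z. cmod (z - c) = R ==> cmod (E z) * cmod (b z) <= A * B"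
  and v: "cmod (v - c) < R" "b v ~= 0" and w: "cmod (w - c) < R"
 shows "cmod (E w) <= A * exp (harnack_const (cmod (w - c) / R) (cmod (v - c) / R) * ln (B / cmod (b v)))"
proof -
 define T where "T z = c + of_real R * z" for z
 have T: "T holomorphic_on UNIV" unfolding T_def by (intro holomorphic_intros)
 have inv: "T ((z - c) / of_real R) = z" for z using R by (simp add: T_def)
 note hol = entire_compose[OF _ T]
 have n: "cmod (T z - c) = R * cmod z" for z using R by (simp add: T_def norm_mult)
 have "cmod (E (T ((w - c) / of_real R))) <= A * exp (harnack_const (cmod ((w - c) / of_real R)) (cmod ((v - c) / of_real R)) * ln (B / cmod (b (T ((v - c) / of_real R)))))"
  by (rule quotient_bound_unit[OF hol[OF E] hol[OF b]]) (use bB EB v w R in \<open>auto simp: n inv norm_divide\<close>)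
 thus ?thesis using R by (simp add: inv norm_divide)
qed

section \<open>Phragmen-Lindelof principles for a sector and for a half-plane\<close>

lemma sector_cube: "Re ((Complex x y)^3) = x^3 - 3 * x * y^2"
 by (simp add: power3_eq_cube power2_eq_square algebra_simps)

text \<open>In the coordinate \<^term>\<open>w\<close> with \<^term>\<open>z = w^2\<close> the sector becomes one of opening
 \<^term>\<open>pi/4\<close>, where the entire function \<^term>\<open>exp (- e * w^3)\<close> decays faster than
 \<^term>\<open>exp (- K * cmod (w^2))\<close>.\<close>

lemma Phragmen_Lindelof_sector:
 assumes G: "G holomorphic_on UNIV" and grow: "!!z. cmod (G z) <= C * exp (K * cmod z)"
  and M: "0 < M" and ray: "!!z. abs (Im z) = Re z ==> cmod (G z) <= M" and z: "abs (Im z) <= Re z"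
 shows "cmod (G z) <= M"
proof -
 \<comment> \<open>This is the tangent of \<open>pi / 8\<close>: squaring maps the sector
   \<open>|Im w| <= k * Re w\<close> onto \<open>|Im z| <= Re z\<close>.\<close>
 define k :: real where "k = sqrt 2 - 1"
 have k2: "k^2 = 1 - 2 * k" by (simp add: k_def power2_eq_square algebra_simps)
 have k0: "0 < k" "k < 1" using real_sqrt_less_iff[of 1 2] real_sqrt_less_iff[of 2 4] by (auto simp: k_def)
 have k3: "3 * k^2 <= 3/4"
 proof -
  have "1.5^2 >= (2::real)" by (simp add: power2_eq_square)
  hence "sqrt 2 <= 1.5" by (intro real_le_lsqrt) auto
  hence "k <= 1/2" by (simp add: k_def)
  hence "k^2 <= (1/2)^2" using k0 by (intro power_mono) auto
  thus ?thesis by (simp add: power2_eq_square)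
 qed
 have cube: "Re (w^3) >= (Re w)^3 / 4" if "abs (Im w) <= k * Re w" for w
 proof -
  have pos: "0 <= Re w" using that k0 by (smt (verit) mult_neg_pos mult.commute)
  have "(Im w)^2 <= (k * Re w)^2" using that pos k0 by (simp add: abs_le_square_iff[symmetric])
  hence "3 * (Im w)^2 <= 3/4 * (Re w)^2" using mult_right_mono[OF k3, of "(Re w)^2"] by (simp add: power_mult_distrib)
  hence "Re w * (3 * (Im w)^2) <= Re w * (3/4 * (Re w)^2)" using pos by (intro mult_left_mono)
  moreover have "Re w * (3/4 * (Re w)^2) = 3/4 * (Re w)^3" by (simp add: power3_eq_cube power2_eq_square)
  ultimately show ?thesis using sector_cube[of "Re w" "Im w"] by simp
 qed
 have sq: "Re (w^2) = (Re w)^2 - (Im w)^2" "Im (w^2) = 2 * Re w * Im w" for w by (auto simp: power2_eq_square)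
 define w where "w = csqrt z"
 have wz: "w^2 = z" by (simp add: w_def)
 have Rw: "0 <= Re w" by (metis csqrt_principal w_def order_le_less)
 have w: "abs (Im w) <= k * Re w"
 proof (cases "Re w = 0")
  case True
  thus ?thesis using z sq[of w] wz by (auto simp: power2_eq_square) (smt (verit) zero_less_mult_iff not_real_square_gt_zero)
 next
  case False
  hence p: "0 < Re w" using Rw by simp
  have "2 * Re w * abs (Im w) <= (Re w)^2 - (Im w)^2" using z sq[of w] wz p by (simp add: abs_mult)
  hence "(abs (Im w) + Re w)^2 <= 2 * (Re w)^2" by (simp add: power2_sum mult_ac)
  hence "abs (Im w) + Re w <= sqrt (2 * (Re w)^2)" by (rule real_le_rsqrt)
  thus ?thesis using p by (simp add: real_sqrt_mult k_def algebra_simps)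
 qed
 have key: "cmod (G z) * exp (- e * Re (w^3)) <= M" if e: "e > 0" for e
 proof -
  \<comment> \<open>On the edge \<open>Re u = R\<close> of the truncated sector,
    \<open>|u|^2 <= 2 * R^2\<close> and \<open>Re (u^3) >= R^3 / 4\<close>; the cubic term wins for
    large \<open>R\<close>.\<close>
  obtain R where R: "R > Re w" "R >= 0" "abs C * exp (2 * abs K * R^2 - e * R^3 / 4) <= M"
  proof -
   have "((%R. abs C * exp (2 * abs K * R^2 - e * R^3 / 4)) \<longlongrightarrow> 0) at_top"
    using e by real_asymp
   hence "eventually (%R. abs C * exp (2 * abs K * R^2 - e * R^3 / 4) < M) at_top" using M by (rule order_tendstoD)
   hence "eventually (%R. abs C * exp (2 * abs K * R^2 - e * R^3 / 4) < M & R > Re w & R >= 0) at_top"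
    by (intro eventually_conj eventually_gt_at_top eventually_ge_at_top)
   thus ?thesis using that eventually_happens[of _ "at_top::real filter"] by fastforce
  qed
  define S where "S = {w. abs (Im w) <= k * Re w & Re w <= R}"
  define F where "F w = G (w^2) * exp (- of_real e * w^3)" for w
  have F: "F holomorphic_on UNIV" unfolding F_def
   by (intro holomorphic_intros entire_compose[OF G])
  have nF: "cmod (F w) = cmod (G (w^2)) * exp (- e * Re (w^3))" for w
   by (simp add: F_def norm_mult)
  have cl: "closed S" unfolding S_def
   by (intro closed_Collect_conj closed_Collect_le continuous_intros)
  have pos: "0 <= Re w" if "abs (Im w) <= k * Re w" for w
   using that k0 by (smt (verit) mult_neg_pos mult.commute)
  have "cmod (F w) <= M"
  proof (rule maximum_modulus_frontier[of F S])
   show "F holomorphic_on interior S" "continuous_on (closure S) F"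
    using F holomorphic_on_imp_continuous_on holomorphic_on_subset by blast+
   have "S \<subseteq> cball 0 (2 * R)"
   proof
    fix w assume "w \<in> S"
    hence "abs (Im w) <= k * Re w" "Re w <= R" "0 <= Re w" using pos by (auto simp: S_def)
    moreover have "k * Re w <= 1 * Re w" using k0 \<open>0 <= Re w\<close> by (intro mult_right_mono) auto
    ultimately show "w \<in> cball 0 (2*R)" using cmod_le[of w] by simp
   qed
   thus "bounded S" using bounded_cball bounded_subset by blast
   show "w \<in> S" using w R by (simp add: S_def)
   fix u assume u: "u \<in> frontier S"
   hence uS: "u \<in> S" using cl by (metis frontier_subset_closed subsetD)
   have "open {w. abs (Im w) < k * Re w & Re w < R}"
    by (intro open_Collect_conj open_Collect_less continuous_intros)
   hence "{w. abs (Im w) < k * Re w & Re w < R} \<subseteq> interior S" by (intro interior_maximal) (auto simp: S_def)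
   hence "~ (abs (Im u) < k * Re u & Re u < R)" using u by (auto simp: frontier_def)
   then consider "abs (Im u) = k * Re u" | "Re u = R" using uS by (force simp: S_def)
   thus "cmod (F u) <= M"
   proof cases
    case 1
    have p: "0 <= Re u" using uS pos by (simp add: S_def)
    have "(Im u)^2 = (1 - 2 * k) * (Re u)^2" using power2_abs[of "Im u"] 1 by (simp add: power_mult_distrib k2)
    hence "Re (u^2) = 2 * k * (Re u)^2" using sq(1)[of u] by (simp add: algebra_simps)
    moreover have "abs (Im (u^2)) = 2 * k * (Re u)^2" using 1 p sq(2)[of u] by (simp add: abs_mult power2_eq_square)
    ultimately have "cmod (G (u^2)) <= M" using ray by simp
    moreover have "Re (u^3) >= 0" using cube[of u] uS p by (smt (verit) S_def mem_Collect_eq zero_le_divide_iff zero_le_power)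
    hence "exp (- e * Re (u^3)) <= 1" using e by simp
    ultimately have "cmod (G (u^2)) * exp (- e * Re (u^3)) <= M * 1" using M by (intro mult_mono) auto
    thus ?thesis by (simp add: nF)
   next
    case 2
    have "(Im u)^2 <= R^2"
    proof -
     have "k * R <= 1 * R" using k0 R(2) by (intro mult_right_mono) auto
     thus ?thesis using uS 2 by (intro abs_le_square_iff[THEN iffD1]) (auto simp: S_def)
    qed
    hence "(cmod u)^2 <= 2 * R^2" using 2 by (simp add: cmod_power2)
    hence "cmod (u^2) <= 2 * R^2" by (simp add: norm_power)
    hence "abs K * cmod (u^2) <= 2 * abs K * R^2" using mult_left_mono[of "cmod (u^2)" "2*R^2" "abs K"] by simp
    moreover have "K * cmod (u^2) <= abs K * cmod (u^2)" by (intro mult_right_mono) auto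
    moreover have "e * (R^3/4) <= e * Re (u^3)" using cube[of u] uS 2 e by (intro mult_left_mono) (auto simp: S_def)
    ultimately have ex: "K * cmod (u^2) + - e * Re (u^3) <= 2 * abs K * R^2 - e * R^3 / 4" by simp
    have "cmod (G (u^2)) * exp (- e * Re (u^3)) <= (C * exp (K * cmod (u^2))) * exp (- e * Re (u^3))"
     using grow by (intro mult_right_mono) auto
    also have "... = C * exp (K * cmod (u^2) + - e * Re (u^3))" by (simp only: exp_add mult.assoc)
    also have "... <= abs C * exp (2 * abs K * R^2 - e * R^3 / 4)" using ex by (intro mult_mono) auto
    finally show ?thesis using R(3) nF by simp
   qed
  qed
  thus ?thesis by (simp add: nF wz)
 qed
 have "((%e. cmod (G z) * exp (- e * Re (w^3))) \<longlongrightarrow> cmod (G z) * exp (- 0 * Re (w^3))) (at_right 0)"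
  by (intro tendsto_intros)
 hence "cmod (G z) * exp (- 0 * Re (w^3)) <= M"
  by (rule tendsto_upperbound) (auto intro!: eventually_mono[OF eventually_at_right_less[of 0]] simp: key[simplified])
 thus ?thesis by simp
qed

text \<open>Exponential type is critical in a half-plane but not in a quadrant. The bound on the
  positive imaginary axis splits the half-plane into two quadrants, each of which is a rotated copy
  of the sector above.\<close>

lemma Phragmen_Lindelof_half_plane:
 assumes G: "G holomorphic_on UNIV" and grow: "!!z. cmod (G z) <= C * exp (K * cmod z)"
  and M: "0 < M" and re: "!!x. cmod (G (of_real x)) <= M" and im: "!!y. 0 <= y ==> cmod (G (\<i> * of_real y)) <= M" and z: "0 <= Im z"
 shows "cmod (G z) <= M"
proof -
 define c where "c = Complex (1/sqrt 2) (1/sqrt 2)"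
 have c1: "cmod c = 1" by (simp add: c_def cmod_def power_divide)
 have cc: "c * cnj c = 1" using c1 by (metis complex_norm_square mult_1 norm_one of_real_1 power2_eq_square power_one)
 have quad: "cmod (H z) <= M" if H: "H holomorphic_on UNIV" "!!z. cmod (H z) <= C * exp (K * cmod z)"
  "!!x. 0 <= x ==> cmod (H (of_real x)) <= M" "!!y. 0 <= y ==> cmod (H (\<i> * of_real y)) <= M" "0 <= Re z" "0 <= Im z" for H z
 proof -
  have "cmod (H (c * (cnj c * z))) <= M"
  proof (rule Phragmen_Lindelof_sector[of "%z. H (c * z)"])
   show "(%z. H (c * z)) holomorphic_on UNIV"
    by (intro entire_compose[OF H(1)] holomorphic_intros)
   show "cmod (H (c * z)) <= C * exp (K * cmod z)" for z using H(2)[of "c*z"] c1 by (simp add: norm_mult)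
   show "abs (Im (cnj c * z)) <= Re (cnj c * z)" using that(5,6) by (auto simp: c_def field_simps)
   show "cmod (H (c * u)) <= M" if "abs (Im u) = Re u" for u
   proof (cases "0 <= Im u")
    case True
    hence "c * u = \<i> * of_real (sqrt 2 * Re u)" using that by (auto simp: c_def complex_eq_iff field_simps)
    moreover have "0 <= sqrt 2 * Re u" using that by (smt (verit) mult_nonneg_nonneg real_sqrt_ge_zero)
    ultimately show ?thesis using H(4) by metis
   next
    case False
    hence "c * u = of_real (sqrt 2 * Re u)" using that by (auto simp: c_def complex_eq_iff field_simps)
    moreover have "0 <= sqrt 2 * Re u" using that by (smt (verit) mult_nonneg_nonneg real_sqrt_ge_zero)
    ultimately show ?thesis using H(3) by metis
   qed
  qed (use M in auto)
  thus ?thesis using cc by (simp flip: mult.assoc)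
 qed
 show ?thesis
 proof (cases "0 <= Re z")
  case True
  thus ?thesis using quad[OF G grow] re im z by blast
 next
  case False
  \<comment> \<open>\<open>G (\<i> * z)\<close> moves the second quadrant to the first; the negative
    real axis takes the place of the positive imaginary axis.\<close>
  have "cmod (G (\<i> * (- \<i> * z))) <= M"
  proof (rule quad[of "%z. G (\<i> * z)"])
   show "(%z. G (\<i> * z)) holomorphic_on UNIV"
    by (intro entire_compose[OF G] holomorphic_intros)
   show "cmod (G (\<i> * z)) <= C * exp (K * cmod z)" for z using grow[of "\<i>*z"] by (simp add: norm_mult)
   show "cmod (G (\<i> * (\<i> * of_real y))) <= M" for y using re[of "-y"] by (simp flip: mult.assoc)
  qed (use im False z in auto)
  thus ?thesis by (simp flip: mult.assoc)
 qed
qed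

section \<open>Integrals over the real line and Cauchy's formula\<close>

lemma integrable_inverse_1_plus_square: "integrable lborel (%x::real. C / (1 + x^2))"
proof -
 have half: "integrable lborel (%x::real. indicator {0..} x * (1 / (1 + x^2)))"
 proof (rule integrableI_nonneg)
  have "(\<integral>\<^sup>+x. ennreal (1 / (1 + x^2)) * indicator {0..} x \<partial>lborel) = ennreal (pi/2 - arctan 0)"
   by (rule nn_integral_FTC_atLeast) (auto intro!: derivative_eq_intros tendsto_arctan_at_top simp: field_simps add_nonneg_eq_0_iff)
  moreover have "ennreal (indicator {0..} x * (1 / (1 + x^2))) = ennreal (1 / (1 + x^2)) * indicator {0..} x" for x :: real
   by (simp add: indicator_def)
  ultimately show "(\<integral>\<^sup>+x. ennreal (indicator {0..} x * (1 / (1 + x^2))) \<partial>lborel) < \<infinity>" by simp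
 qed auto
 have "integrable lborel (%x::real. indicator {0..} (0 + (-1) * x) * (1 / (1 + (0 + (-1) * x)^2)))"
  by (rule lborel_integrable_real_affine[OF half]) simp
 hence "integrable lborel (%x::real. C * (indicator {0..} x * (1 / (1 + x^2)) + indicator {0..} (0 + (-1) * x) * (1 / (1 + (0 + (-1) * x)^2))))"
  using half by (intro integrable_mult_right Bochner_Integration.integrable_add)
 thus ?thesis
 proof (rule Bochner_Integration.integrable_bound)
  have "norm (C / (1 + x^2)) <= norm (C * (indicator {0..} x * (1 / (1 + x^2)) + indicator {0..} (0 + (-1) * x) * (1 / (1 + (0 + (-1) * x)^2))))" for x
   by (cases "x > 0"; cases "x < 0") (simp_all add: indicator_def abs_mult)
  thus "AE x in lborel. norm (C / (1 + x^2)) <= norm (C * (indicator {0..} x * (1 / (1 + x^2)) + indicator {0..} (0 + (-1) * x) * (1 / (1 + (0 + (-1) * x)^2))))"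
   by (intro AE_I2)
 qed simp
qed

lemma integrable_of_decay:
 fixes f :: "real => complex"
 assumes "continuous_on UNIV f" "!!x. cmod (f x) <= C / (1 + x^2)"
 shows "integrable lborel f"
proof (rule Bochner_Integration.integrable_bound[OF integrable_inverse_1_plus_square[of C]])
 show "f \<in> borel_measurable lborel" using assms(1) by (simp add: borel_measurable_continuous_onI)
 show "AE x in lborel. cmod (f x) <= norm (C / (1 + x^2))" 
  using order_trans[OF assms(2) abs_ge_self] by (intro AE_I2) (simp only: real_norm_def)
qed

lemma tendsto_integral_symmetric:
 fixes f :: "real => complex"
 assumes f: "integrable lborel f" and c: "continuous_on UNIV f"
 shows "(%n. integral {- real n..real n} f) \<longlonglongrightarrow> integral\<^sup>L lborel f"
proof -
 have "(%n. \<integral>x. indicator {- real n..real n} x *\<^sub>R f x \<partial>lborel) \<longlonglongrightarrow> integral\<^sup>L lborel f"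
 proof (rule integral_dominated_convergence[where w = "%x. norm (f x)"])
  show "AE x in lborel. (%n. indicator {- real n..real n} x *\<^sub>R f x) \<longlonglongrightarrow> f x"
  proof (rule AE_I2)
   fix x :: real
   obtain N where "abs x <= real N" using real_arch_simple by blast
   hence "eventually (%n. indicator {- real n..real n} x *\<^sub>R f x = f x) sequentially"
    unfolding eventually_sequentially by (intro exI[of _ N]) (auto simp: indicator_def)
   thus "(%n. indicator {- real n..real n} x *\<^sub>R f x) \<longlonglongrightarrow> f x" by (rule tendsto_eventually)
  qed
 qed (use f in \<open>auto simp: indicator_def\<close>)
 moreover have "(\<integral>x. indicator {- real n..real n} x *\<^sub>R f x \<partial>lborel) = integral {- real n..real n} f" for n
  using set_borel_integral_eq_integral(2)[of "{- real n..real n}" f] borel_integrable_atLeastAtMost'[of "-real n" "real n" f] c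
  by (simp add: set_lebesgue_integral_def continuous_on_subset)
 ultimately show ?thesis by simp
qed

lemma contour_integral_quadrangle:
 assumes "f contour_integrable_on linepath a b" "f contour_integrable_on linepath b c"
  "f contour_integrable_on linepath c d" "f contour_integrable_on linepath d a"
 shows "contour_integral (linepath a b +++ linepath b c +++ linepath c d +++ linepath d a) f =
  contour_integral (linepath a b) f + (contour_integral (linepath b c) f
   + (contour_integral (linepath c d) f + contour_integral (linepath d a) f))"
 using assms by simp

text \<open>Cauchy's formula on the rectangle over \<open>{-R..R}\<close> of height
  \<open>R\<close>. By the quadratic decay the three other sides contribute at most a constant times
  \<open>1 / R^2\<close>.\<close>

lemma line_Cauchy:
 assumes F: "F holomorphic_on UNIV" and dec: "!!w. 0 <= Im w ==> cmod (F w) <= C / (1 + (cmod w)^2)" and z: "Im z ~= 0"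
 shows "integrable lborel (%x. F (of_real x) / (of_real x - z))"
  and "(\<integral>x. F (of_real x) / (of_real x - z) \<partial>lborel) = (if Im z > 0 then 2 * pi * \<i> * F z else 0)"
proof -
 let ?g = "%w. F w / (w - z)" and ?f = "%x. F (of_real x) / (of_real x - z)"
 have "cmod (F 0) <= C" using dec[of 0] by simp
 hence C: "0 <= C" using norm_ge_zero order_trans by blast
 have nz: "complex_of_real x - z ~= 0" for x using z by (metis Im_complex_of_real eq_iff_diff_eq_0)
 have cont: "continuous_on UNIV ?f"
  using nz by (intro continuous_on_divide continuous_on_compose2[OF holomorphic_on_imp_continuous_on[OF F]] continuous_intros) auto
 have dist: "abs (Im z) <= cmod (of_real x - z)" for x using abs_Im_le_cmod[of "of_real x - z"] by simp
 show int: "integrable lborel ?f"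
 proof (rule integrable_of_decay[OF cont])
  fix x :: real
  have F1: "cmod (F (of_real x)) <= C / (1 + x^2)" using dec[of "of_real x"] by simp
  have "0 < abs (Im z)" using z by simp
  from frac_le[OF order_trans[OF norm_ge_zero F1] F1 this dist] have "cmod (?f x) <= (C / (1 + x^2)) / abs (Im z)"
   by (simp only: norm_divide)
  thus "cmod (?f x) <= (C / abs (Im z)) / (1 + x^2)" by (simp add: mult.commute)
 qed
 define I where "I = (if Im z > 0 then 2 * pi * \<i> * F z else 0)"
 \<comment> \<open>The condition on \<open>R\<close> places a point \<open>z\<close> of the upper
   half-plane inside the rectangle, keeps \<open>|w - z| >= R / 2\<close> on the three far sides and
   makes \<open>R\<close> at least 1.\<close>
 have est: "cmod (integral {-R..R} ?f - I) <= 8 * C / R" if R: "R > 2 * cmod z + 1" for R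
 proof -
  have R0: "R > 0" "R > cmod z" using R norm_ge_zero[of z] by linarith+
  let ?a1 = "complex_of_real (-R)" and ?a2 = "complex_of_real R" and ?a3 = "Complex R R" and ?a4 = "Complex (-R) R"
  have cont_on: "?g contour_integrable_on linepath a b" if "z \<notin> closed_segment a b" for a b
  proof (rule contour_integrable_continuous_linepath)
   have "continuous_on (closed_segment a b) F" using holomorphic_on_imp_continuous_on[OF F] continuous_on_subset by blast
   thus "continuous_on (closed_segment a b) ?g" using that by (intro continuous_intros) auto
  qed
  have rp: "rectpath ?a1 ?a3 = linepath ?a1 ?a2 +++ linepath ?a2 ?a3 +++ linepath ?a3 ?a4 +++ linepath ?a4 ?a1"

  proof -
   have "Complex (Re ?a3) (Im ?a1) = ?a2" "Complex (Re ?a1) (Im ?a3) = ?a4" by (simp_all add: complex_eq_iff)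
   thus ?thesis by (simp only: rectpath_def Let_def)
  qed
  have far: "cmod z < cmod w" "0 <= Im w" "cmod w >= R" if "w \<in> closed_segment ?a2 ?a3 \<union> closed_segment ?a3 ?a4 \<union> closed_segment ?a4 ?a1" for w
  proof -
   have "closed_segment ?a2 ?a3 = {w. Re w = R & Im w \<in> {0..R}}" "closed_segment ?a4 ?a1 = {w. Re w = - R & Im w \<in> {0..R}}"
    using R0 by (simp_all add: closed_segment_same_Re closed_segment_eq_real_ivl)
   moreover have "closed_segment ?a3 ?a4 = {w. Im w = R & Re w \<in> closed_segment R (- R)}"
    by (simp add: closed_segment_same_Im)
   ultimately have "(Re w = R & 0 <= Im w) | Im w = R | (Re w = - R & 0 <= Im w)" using that by auto
   hence "R <= cmod w" "0 <= Im w" using abs_Re_le_cmod[of w] abs_Im_le_cmod[of w] R0 by linarith+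
   thus "cmod z < cmod w" "0 <= Im w" "cmod w >= R" using R0 by auto
  qed
  have zb: "z \<notin> closed_segment ?a1 ?a2" using z by (auto simp: closed_segment_same_Im)
  have zf: "z \<notin> closed_segment ?a2 ?a3" "z \<notin> closed_segment ?a3 ?a4" "z \<notin> closed_segment ?a4 ?a1" using far(1)[of z] by auto
  have zo: "z \<notin> path_image (rectpath ?a1 ?a3)" unfolding rp using zb zf by (simp only: path_image_join path_image_linepath pathstart_join pathstart_linepath pathfinish_linepath Un_iff) simp
  have "(?g has_contour_integral (2 * pi * \<i> * winding_number (rectpath ?a1 ?a3) z * F z)) (rectpath ?a1 ?a3)"
   using zo by (intro Cauchy_integral_formula_convex_simple[OF convex_UNIV F]) auto
  moreover have "2 * pi * \<i> * winding_number (rectpath ?a1 ?a3) z * F z = I"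
  proof (cases "Im z > 0")
   case True
   hence "z \<in> box ?a1 ?a3" using R0 abs_Re_le_cmod[of z] abs_Im_le_cmod[of z] unfolding in_box_complex_iff by (simp, linarith)
   from winding_number_rectpath[OF this] show ?thesis using True by (simp only: I_def if_True mult_1_right)
  next
   case False
   hence "z \<notin> cbox ?a1 ?a3" using z by (simp add: in_cbox_complex_iff)
   hence "winding_number (rectpath ?a1 ?a3) z = 0" using R0 by (intro winding_number_rectpath_outside) auto
   thus ?thesis using False by (simp only: I_def if_False mult_zero_right mult_zero_left)
  qed
  ultimately have "contour_integral (rectpath ?a1 ?a3) ?g = I" by (simp only: contour_integral_unique)
  hence sum: "contour_integral (linepath ?a1 ?a2) ?g + (contour_integral (linepath ?a2 ?a3) ?g + (contour_integral (linepath ?a3 ?a4) ?g + contour_integral (linepath ?a4 ?a1) ?g)) = I"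
   unfolding rp contour_integral_quadrangle[OF cont_on[OF zb] cont_on[OF zf(1)] cont_on[OF zf(2)] cont_on[OF zf(3)]] .
  have low: "contour_integral (linepath ?a1 ?a2) ?g = integral {-R..R} ?f"
   using R0 by (subst contour_integral_linepath_Reals_eq) auto
  have bd: "cmod (contour_integral (linepath a b) ?g) <= C / R^2 * (2 / R) * cmod (b - a)"
   if "closed_segment a b \<subseteq> closed_segment ?a2 ?a3 \<union> closed_segment ?a3 ?a4 \<union> closed_segment ?a4 ?a1" for a b
  proof (rule contour_integral_bound_linepath)
    show "?g contour_integrable_on linepath a b" by (rule cont_on) (use that zf in blast)
    show "0 <= C / R^2 * (2 / R)" using C R0 by simp
    fix w assume "w \<in> closed_segment a b"
    hence "w \<in> closed_segment ?a2 ?a3 \<union> closed_segment ?a3 ?a4 \<union> closed_segment ?a4 ?a1" using that by (rule rev_subsetD)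
    hence w: "0 <= Im w" "cmod w >= R" using far by metis+
    have "cmod w ^2 >= R^2" using w R0 by (intro power_mono) auto
    hence "R^2 <= 1 + (cmod w)^2" by linarith
    from divide_left_mono[OF this C] have "C / (1 + (cmod w)^2) <= C / R^2" using R0 by (simp add: add_pos_nonneg)
    hence 1: "cmod (F w) <= C / R^2" using dec[OF w(1)] by linarith
    have "R / 2 <= cmod (w - z)" using w R norm_triangle_ineq2[of w z] by linarith
    hence "1 / cmod (w - z) <= 1 / (R / 2)" using R0 by (intro divide_left_mono mult_pos_pos) auto
    hence "1 / cmod (w - z) <= 2 / R" by simp
    hence "cmod (F w) * (1 / cmod (w - z)) <= C / R^2 * (2 / R)" using 1 C by (intro mult_mono) auto
    thus "cmod (?g w) <= C / R^2 * (2 / R)" by (simp add: norm_divide)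
  qed
  have e: "cmod (?a3 - ?a2) = R" "cmod (?a4 - ?a3) = 2 * R" "cmod (?a1 - ?a4) = R"
  proof -
   have "?a3 - ?a2 = \<i> * of_real R" "?a4 - ?a3 = - of_real (2 * R)" "?a1 - ?a4 = - (\<i> * of_real R)" by (simp_all add: complex_eq_iff)
   thus "cmod (?a3 - ?a2) = R" "cmod (?a4 - ?a3) = 2 * R" "cmod (?a1 - ?a4) = R"
    using R0 by (simp_all only: norm_minus_cancel norm_mult norm_of_real norm_ii)
  qed
  have aux: "a + x = i ==> a - i = - x" for a x i :: complex by auto
  have "integral {-R..R} ?f - I = - (contour_integral (linepath ?a2 ?a3) ?g + (contour_integral (linepath ?a3 ?a4) ?g + contour_integral (linepath ?a4 ?a1) ?g))"
   using sum unfolding low by (rule aux)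
  hence "cmod (integral {-R..R} ?f - I) <= cmod (contour_integral (linepath ?a2 ?a3) ?g) + (cmod (contour_integral (linepath ?a3 ?a4) ?g) + cmod (contour_integral (linepath ?a4 ?a1) ?g))"
   by (simp only: norm_minus_cancel) (rule order_trans[OF norm_triangle_ineq add_left_mono[OF norm_triangle_ineq]])
  also have "... <= C / R^2 * (2 / R) * R + (C / R^2 * (2 / R) * (2 * R) + C / R^2 * (2 / R) * R)"
   using bd[of ?a2 ?a3] bd[of ?a3 ?a4] bd[of ?a4 ?a1] unfolding e by (intro add_mono) blast+
  also have "... = 8 * C / R^2" using R0 by (simp add: divide_simps)
  also have "... <= 8 * C / R"
  proof (rule divide_left_mono)
   have "1 <= R" using R norm_ge_zero[of z] by linarith
   thus "R <= R^2" "0 < R^2 * R" by (simp_all add: power2_eq_square)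
  qed (use C in simp)
  finally show ?thesis .
 qed
 have "(%n. integral {- real n..real n} ?f) \<longlonglongrightarrow> I"
 proof (rule Lim_null[THEN iffD2], rule tendsto_norm_zero_cancel, rule tendsto_sandwich[where f = "%n. 0" and h = "%n. 8 * C / real n"])
  obtain N where "2 * cmod z + 1 < real N" using reals_Archimedean2 by blast
  hence "cmod (integral {- real n..real n} ?f - I) <= 8 * C / real n" if "n >= N" for n
   using est[of "real n"] that by simp
  thus "\<forall>\<^sub>F n in sequentially. cmod (integral {- real n..real n} ?f - I) <= 8 * C / real n"
   unfolding eventually_sequentially by blast
  show "(%n. 8 * C / real n) \<longlonglongrightarrow> 0" by real_asymp
 qed auto
 from LIMSEQ_unique[OF tendsto_integral_symmetric[OF int cont] this] show "integral\<^sup>L lborel ?f = (if Im z > 0 then 2 * pi * \<i> * F z else 0)"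
  by (simp add: I_def)
qed

text \<open>Divide and multiply by \<open>w + \<i>\<close>: Cauchy's formula for
  \<open>F w * (w + \<i>)\<close> with the pole \<open>- \<i>\<close> in the lower half-plane gives
  0. The extra factor \<open>1 + cmod w\<close> in the hypothesis pays for the
  multiplication.\<close>

lemma line_Cauchy_vanish:
 assumes F: "F holomorphic_on UNIV" and dec: "!!w. 0 <= Im w ==> cmod (F w) * (1 + (cmod w)^2) * (1 + cmod w) <= C"
 shows "(\<integral>x. F (of_real x) \<partial>lborel) = 0"
proof -
 have "cmod (F 0) <= C" using dec[of 0] by simp
 hence C: "0 <= C" using norm_ge_zero order_trans by blast
 have "(\<integral>x. (F (of_real x) * (of_real x + \<i>)) / (of_real x - (-\<i>)) \<partial>lborel) = 0"
 proof (subst line_Cauchy(2)[of "%w. F w * (w + \<i>)" C "-\<i>"])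
  show "(%w. F w * (w + \<i>)) holomorphic_on UNIV" using F by (intro holomorphic_intros)
  fix w assume "0 <= Im w"
  have "cmod (F w * (w + \<i>)) <= cmod (F w) * (1 + cmod w)"
   unfolding norm_mult using norm_triangle_ineq[of w \<i>] by (intro mult_left_mono) auto
  hence "cmod (F w * (w + \<i>)) * (1 + (cmod w)^2) <= cmod (F w) * (1 + cmod w) * (1 + (cmod w)^2)"
   by (intro mult_right_mono) auto
  also have "... <= C" using dec[OF \<open>0 <= Im w\<close>] by (simp add: mult_ac)
  finally show "cmod (F w * (w + \<i>)) <= C / (1 + (cmod w)^2)" by (subst pos_le_divide_eq) (auto intro: add_pos_nonneg)
 qed auto
 moreover have "of_real x + \<i> ~= 0" for x by (simp add: complex_eq_iff)
 ultimately show ?thesis by simp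
qed

section \<open>The weight and the sequences of derivative bounds attached to it\<close>

lemma convex_on_subgradient:
 fixes f :: "real => real"
 assumes f: "convex_on {0..} f" and x: "0 < x"
 obtains p where "!!y. 0 <= y ==> f x + p * (y - x) <= f y"
 using convex_le_Inf_differential[OF f, of x] x that by (metis atLeast_iff greaterThan_iff interior_real_atLeast)

text \<open>The sequence \<open>r\<close> enters only in a later locale, so that this one can also
  be interpreted on a shorter interval, where no module is considered.\<close>

locale Ua_space =
 fixes om :: "real => real" and a :: ereal and c :: "nat => real"
 assumes weight: "weight om" and a_pos: "0 < a" and c_inc: "incseq c" and c_pos: "!!k. 0 < c k"
  and c_less: "!!k. ereal (c k) < a" and c_lim: "(%k. ereal (c k)) \<longlonglongrightarrow> a"
begin

lemma w_nonneg: "0 <= x ==> 0 <= om x"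
 and w_mono: "0 <= x ==> x <= y ==> om x <= om y"
 and w_convex: "convex_on {0..} (%t. om (exp t))"
 using weight unfolding weight_def mono_on_def by auto

lemma w_subadd: "1 < s ==> EX C>0. ALL x>=0. ALL y>=0. om (x + y) <= s * (om x + om y) + C"
 using weight unfolding weight_def by (elim conjE allE[of _ s]) simp

lemma w_small:
 assumes "0 < e"
 obtains C where "0 <= C" "!!x. 0 <= x ==> om x <= e * x + C"
proof -
 have "om \<in> o[at_top](%x. x)" using weight unfolding weight_def by blast
 from landau_o.smallD[OF this assms] obtain X where X: "!!x. X <= x ==> norm (om x) <= e * norm x"
  unfolding eventually_at_top_linorder by blast
 have "om x <= e * x + om (max X 0)" if "0 <= x" for x
 proof (cases "X <= x")
  case True
  thus ?thesis using X[of x] that w_nonneg[of x] w_nonneg[of "max X 0"] by simp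
 next
  case False
  hence "om x <= om (max X 0)" using that by (intro w_mono) auto
  moreover have "0 <= e * x" using assms that by simp
  ultimately show ?thesis by linarith
 qed
 thus ?thesis using that[of "om (max X 0)"] w_nonneg[of "max X 0"] by auto
qed

lemma ln_small:
 assumes "0 < e"
 obtains C where "0 <= C" "!!x. 0 <= x ==> ln (1 + x) <= e * om x + C"
proof -
 have "ln \<in> o[at_top](om)" using weight unfolding weight_def by blast
 from landau_o.smallD[OF this assms] obtain X where X: "!!x. X <= x ==> norm (ln x) <= e * norm (om x)"
  unfolding eventually_at_top_linorder by blast
 have "ln (1 + x) <= e * om x + (ln (1 + max X 1) + ln 2)" if "0 <= x" for x
 proof (cases "max X 1 <= x")
  case True
  hence "1 + x <= 2 * x" "0 < 1 + x" by linarith+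
  hence "ln (1 + x) <= ln (2 * x)" by (rule ln_mono)
  also have "... = ln 2 + ln x" using True by (simp add: ln_mult)
  also have "ln x <= e * om x" using X[of x] True w_nonneg[of x] by auto
  finally have "ln (1 + x) <= ln 2 + e * om x" by simp
  moreover have "0 <= ln (1 + max X 1)" by simp
  ultimately show ?thesis by linarith
 next
  case False
  hence "1 + x <= 1 + max X 1" "0 < 1 + x" using that by linarith+
  hence "ln (1 + x) <= ln (1 + max X 1)" by (rule ln_mono)
  moreover have "0 <= e * om x" using assms w_nonneg[OF that] by simp
  moreover have "0 <= ln (2::real)" by simp
  ultimately show ?thesis by linarith
 qed
 moreover have "0 <= ln (1 + max X 1) + ln 2" by simp
 ultimately show ?thesis using that by blast
qed

lemma power_exp_decay:
 assumes "0 < e"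
 obtains C where "0 < C" "!!x. 0 <= x ==> (1 + x)^n * exp (- e * om x) <= C"
proof -
 have "0 < e / (real n + 1)" using assms by simp
 from ln_small[OF this] obtain C where C: "!!x. 0 <= x ==> ln (1 + x) <= e / (real n + 1) * om x + C" by blast
 have "(1 + x)^n * exp (- e * om x) <= exp (real n * C)" if x: "0 <= x" for x
 proof -
  have "(1 + x)^n = exp (real n * ln (1 + x))" using x by (simp add: exp_of_nat_mult)
  also have "... * exp (- e * om x) = exp (real n * ln (1 + x) + - e * om x)" by (simp only: exp_add)
  also have "... <= exp (real n * C)"
  proof -
   have "real n * ln (1 + x) <= real n * (e / (real n + 1) * om x + C)" using C[OF x] by (intro mult_left_mono) auto
   also have "... = (real n / (real n + 1)) * (e * om x) + real n * C" by (simp add: algebra_simps)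
   also have "(real n / (real n + 1)) * (e * om x) <= 1 * (e * om x)" using assms w_nonneg[OF x] by (intro mult_right_mono) auto
   finally show ?thesis by simp
  qed
  finally show ?thesis .
 qed
 thus ?thesis using that[of "exp (real n * C)"] by auto
qed

text \<open>A convex function of \<^term>\<open>ln x\<close> that is \<^term>\<open>o(x)\<close> has bounded increments over bounded steps.\<close>

lemma w_shift:
 assumes h: "0 <= h"
 obtains C where "0 <= C" "!!x. 0 <= x ==> om (x + h) <= om x + C"
proof -
 obtain D where D: "0 <= D" "!!x. 0 <= x ==> om x <= 1 * x + D" using w_small[of 1] by auto
 have "om (x + h) <= om x + (2 * h * (exp 1 + D) + om (1 + 2 * h))" if x: "0 <= x" for x
 proof (cases "1 + h < x")
  case False
  hence "om (x + h) <= om (1 + 2 * h)" using x h by (intro w_mono) auto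
  thus ?thesis using w_nonneg[OF x] h D(1) exp_ge_zero[of 1] by (smt (verit) mult_nonneg_nonneg)
 next
  case True
  define l where "l = ln ((x + h) / x)"
  have l: "0 <= l" "l <= h / x" "l <= 1"
  proof -
   have "(x + h) / x = 1 + h / x" using True x h by (simp add: field_simps)
   moreover have "0 <= h / x" "h / x <= 1" using True h x by auto
   ultimately show "0 <= l" "l <= h / x" "l <= 1" unfolding l_def using ln_add_one_self_le_self[of "h/x"] by auto
  qed
  have xh: "x + h = exp (ln x + l)" using True h x unfolding l_def by (simp add: ln_div exp_add)
  \<comment> \<open>Convexity between \<open>ln x\<close> and \<open>ln x + 1\<close>. The
    coefficient \<open>l\<close> is at most \<open>h / x\<close>, and \<open>om (x * exp 1)\<close>
    grows at most linearly, so the increment stays bounded.\<close>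
  have "ln x + l = (1 - l) *\<^sub>R ln x + l *\<^sub>R (ln x + 1)" by (simp add: algebra_simps)
  hence "om (x + h) = om (exp ((1 - l) *\<^sub>R ln x + l *\<^sub>R (ln x + 1)))" using xh by simp
  also have "... <= (1 - l) * om (exp (ln x)) + l * om (exp (ln x + 1))"
   using l True h by (intro convex_onD[OF w_convex]) auto
  also have "... <= om x + l * om (x * exp 1)" using l(1) True h w_nonneg[of x] by (simp add: exp_add algebra_simps)
  also have "l * om (x * exp 1) <= (h / x) * (x * exp 1 + D)"
   using l D(2)[of "x * exp 1"] True h w_nonneg[of "x * exp 1"] by (intro mult_mono) auto
  also have "... = h * exp 1 + h * D / x" using True h by (simp add: field_simps)
  also have "h * D / x <= h * D / 1" using True h D(1) by (intro divide_left_mono) auto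
  finally have "om (x + h) <= om x + h * (exp 1 + D)" by (simp add: algebra_simps)
  moreover have "0 <= h * (exp 1 + D)" using h D by simp
  moreover have "0 <= om (1 + 2 * h)" using w_nonneg h by simp
  ultimately show ?thesis by simp
 qed
 moreover have "0 <= 2 * h * (exp 1 + D) + om (1 + 2 * h)" using h D w_nonneg by simp
 ultimately show ?thesis using that by blast
qed

text \<open>Legendre duality in multiplicative form: \<open>M q j\<close> is the supremum of
  \<open>x^j * exp (- q * om x)\<close> over \<open>x >= 1\<close>. \<open>M_ge\<close> and
  \<open>M_le\<close> say this, and most properties of \<open>M\<close> follow by choosing test
  points \<open>x\<close>.\<close>

definition M :: "real => nat => real" where "M q j = exp (q * young_conj om (real j / q))"

lemma M_pos[simp]: "0 < M q j" and M_nonneg[simp]: "0 <= M q j" and M_nz[simp]: "M q j ~= 0" by (auto simp: M_def)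

lemma power_exp_eq: "0 < q ==> exp (q * (real j / q * t - om (exp t))) = (exp t)^j * exp (- q * om (exp t))"
proof -
 assume "0 < q"
 hence "q * (real j / q * t - om (exp t)) = real j * t + - q * om (exp t)" by (simp add: field_simps)
 thus ?thesis by (simp only: exp_add exp_of_nat_mult)
qed

lemma M_ge:
 assumes q: "0 < q" and x: "1 <= x"
 shows "x^j * exp (- q * om x) <= M q j"
proof -
 let ?f = "%t. real j / q * t - om (exp t)"
 have "0 < 1 / (real j / q + 1)" using q by (simp add: add_nonneg_pos)
 from ln_small[OF this] obtain C where C: "!!x. 0 <= x ==> ln (1 + x) <= 1 / (real j / q + 1) * om x + C" by blast
 have "bdd_above (?f ` {0..})"
 proof (rule bdd_aboveI2[where M = "(real j / q + 1) * C"])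
  fix t :: real assume "t \<in> {0..}"
  have k: "0 < real j / q + 1" using q by (simp add: add_nonneg_pos)
  have "t <= ln (1 + exp t)" by (simp add: ln_ge_iff add_pos_pos)
  also have "... <= 1 / (real j / q + 1) * om (exp t) + C" by (rule C) simp
  finally have "(real j / q + 1) * t <= (real j / q + 1) * (1 / (real j / q + 1) * om (exp t) + C)" using k by (intro mult_left_mono) auto
  also have "... = om (exp t) + (real j / q + 1) * C" using k by (simp add: field_simps)
  finally show "?f t <= (real j / q + 1) * C" using \<open>t \<in> {0..}\<close> by (simp add: algebra_simps)
 qed
 hence "?f (ln x) <= young_conj om (real j / q)" unfolding young_conj_def using x by (intro cSUP_upper) auto
 hence "exp (q * ?f (ln x)) <= M q j" using q unfolding M_def by simp
 thus ?thesis using x by (subst (asm) power_exp_eq[OF q]) auto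
qed

lemma M_le:
 assumes q: "0 < q" and B: "!!x. 1 <= x ==> x^j * exp (- q * om x) <= B"
 shows "M q j <= B"
proof -
 have "0 < 1^j * exp (- q * om 1)" by simp
 also have "... <= B" using B[of 1] by simp
 finally have Bp: "0 < B" .
 have "real j / q * t - om (exp t) <= ln B / q" if "0 <= t" for t
 proof -
  have "exp (q * (real j / q * t - om (exp t))) <= B" unfolding power_exp_eq[OF q] using B[of "exp t"] that by simp
  hence "q * (real j / q * t - om (exp t)) <= ln B" using Bp by (simp add: ln_ge_iff)
  thus ?thesis using q by (simp add: field_simps)
 qed
 hence "young_conj om (real j / q) <= ln B / q" unfolding young_conj_def by (intro cSUP_least) auto
 hence "q * young_conj om (real j / q) <= ln B" using q by (simp add: field_simps)
 thus ?thesis unfolding M_def using Bp by (simp add: ln_ge_iff)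
qed

lemma M_mono: "0 < q ==> i <= j ==> M q i <= M q j"
 by (rule M_le) (auto intro!: order_trans[OF _ M_ge] mult_right_mono power_increasing)

lemma M_antimono:
 assumes "0 < p" "p <= q"
 shows "M q j <= M p j"
proof (rule M_le)
 fix x :: real assume x: "1 <= x"
 have "x^j * exp (- q * om x) <= x^j * exp (- p * om x)" using x assms w_nonneg[of x] by (intro mult_left_mono) (auto intro: mult_right_mono)
 also have "... <= M p j" using M_ge assms(1) x by blast
 finally show "x^j * exp (- q * om x) <= M p j" .
qed (use assms in simp)

text \<open>The factor \<open>exp (om 1)\<close> pays for \<open>x < 1\<close>, which the supremum
  defining \<open>M\<close> leaves out.\<close>

lemma power_le_M:
 assumes q: "0 < q" "q <= 1" and x: "0 <= x"
 shows "x^j <= exp (om 1) * M q j * exp (q * om x)"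
proof (cases "1 <= x")
 case True
 hence "x^j <= M q j * exp (q * om x)" using M_ge[OF q(1) True, of j] by (simp add: exp_minus field_simps)
 also have "... = 1 * (M q j * exp (q * om x))" by simp
 also have "... <= exp (om 1) * (M q j * exp (q * om x))" using w_nonneg[of 1] by (intro mult_right_mono) auto
 finally show ?thesis by (simp only: mult.assoc)
next
 case False
 have "q * om 1 <= 1 * om 1" using q w_nonneg[of 1] by (intro mult_right_mono) auto
 have "x^j <= 1" using False x by (simp add: power_le_one)
 also have "1 = exp (om 1) * exp (- om 1) * 1" by (simp flip: exp_add)
 also have "... <= exp (om 1) * M q j * exp (q * om x)"
 proof (intro mult_mono)
  have "exp (- om 1) <= 1^j * exp (- q * om 1)" using \<open>q * om 1 <= 1 * om 1\<close> by simp
  from order_trans[OF this M_ge[OF q(1) order_refl]] show "exp (- om 1) <= M q j" .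
  show "1 <= exp (q * om x)" using q w_nonneg[OF x] by simp
 qed auto
 finally show ?thesis .
qed

text \<open>Given test points \<open>x\<close> and \<open>y\<close> for the two factors, the larger
  of them is a test point for the product: the powers grow, and the sum of the weights is at least
  the weight there.\<close>

lemma M_mult: assumes q: "0 < q" shows "M q i * M q j <= M q (i + j)"
proof -
 have *: "(x^i * exp (- q * om x)) * (y^j * exp (- q * om y)) <= M q (i + j)" if x: "1 <= x" and y: "1 <= y" for x y
 proof -
  define m where "m = max x y"
  have m: "1 <= m" using x by (simp add: m_def)
  have 1: "x^i * y^j <= m^i * m^j" using x y by (intro mult_mono power_mono) (auto simp: m_def)
  have 2: "exp (- q * om x) * exp (- q * om y) <= exp (- q * om m)"
   using q w_nonneg[of x] w_nonneg[of y] x y by (auto simp: m_def max_def simp flip: exp_add)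
  have "(x^i * exp (- q * om x)) * (y^j * exp (- q * om y)) = (x^i * y^j) * (exp (- q * om x) * exp (- q * om y))" by (simp only: mult_ac)
  also have "... <= (m^i * m^j) * exp (- q * om m)"
   using m by (intro mult_mono[OF 1 2]) auto
  also have "... <= M q (i + j)" using M_ge[OF q m, of "i + j"] by (simp only: power_add)
  finally show ?thesis .
 qed
 have "M q i <= M q (i + j) / (y^j * exp (- q * om y))" if y: "1 <= y" for y
  using * y by (intro M_le[OF q]) (simp add: pos_le_divide_eq)
 hence "y^j * exp (- q * om y) <= M q (i + j) / M q i" if "1 <= y" for y
  using that by (simp add: pos_le_divide_eq mult.commute)
 hence "M q j <= M q (i + j) / M q i" by (rule M_le[OF q])
 thus ?thesis by (simp add: pos_le_divide_eq mult.commute)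
qed

text \<open>Lowering \<open>q\<close> pays for the factor \<open>j + 1\<close>: by
  \<open>(j + 1) * x^j <= (1 + x)^(j + 1)\<close> the test point moves to \<open>x + 1\<close>, and
  the surplus factor \<open>1 + x\<close> is absorbed by
  \<open>exp (- (q - p) * om x)\<close>.\<close>

lemma M_Suc_mult:
 assumes "0 < p" "p < q"
 obtains C where "0 < C" "!!j. (real j + 1) * M q j <= C * M p j"
proof -
 obtain S where S: "0 <= S" "!!x. 0 <= x ==> om (x + 1) <= om x + S" using w_shift[of 1] by auto
 have "0 < q - p" using assms by simp
 from power_exp_decay[OF this, of 1] obtain D where D: "0 < D" "!!x. 0 <= x ==> (1 + x)^1 * exp (- (q - p) * om x) <= D" by blast
 have pow: "(real j + 1) * x^j <= (1 + x)^(j + 1)" if "0 <= x" for x :: real and j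
 proof (induction j)
  case (Suc j)
  have "(real (Suc j) + 1) * x^Suc j = x * ((real j + 1) * x^j) + x^Suc j" by (simp add: algebra_simps)
  also have "... <= x * (1 + x)^(j + 1) + (1 + x)^Suc j" using Suc that by (intro add_mono mult_left_mono power_mono) auto
  also have "... = (1 + x)^(Suc j + 1)" by (simp add: algebra_simps)
  finally show ?case .
 qed (use that in simp)
 have "(real j + 1) * M q j <= D * exp (p * S) * M p j" for j
 proof -
  have "M q j <= D * exp (p * S) * M p j / (real j + 1)"
  proof (rule M_le)
   fix x :: real assume x: "1 <= x"
   have "(real j + 1) * (x^j * exp (- q * om x)) <= (1 + x)^(j + 1) * exp (- q * om x)"
    using pow[of x j] x by (simp add: mult_right_mono flip: mult.assoc)
   also have "(1 + x)^(j + 1) * exp (- q * om x) = ((1 + x)^1 * exp (- (q - p) * om x)) * ((1 + x)^j * exp (- p * om x))"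
   proof -
    have "exp (- q * om x) = exp (- (q - p) * om x) * exp (- p * om x)" by (simp add: algebra_simps flip: exp_add)
    thus ?thesis by (simp only: power_add mult_ac)
   qed
   also have "... <= D * ((1 + x)^j * (exp (p * S) * exp (- p * om (x + 1))))"
   proof (intro mult_mono D(2) order_refl)
    have "p * om (x + 1) <= p * (om x + S)" using S(2)[of x] x assms by (intro mult_left_mono) auto
    thus "exp (- p * om x) <= exp (p * S) * exp (- p * om (x + 1))" by (simp add: algebra_simps flip: exp_add)
   qed (use x D in auto)
   also have "... = D * exp (p * S) * ((x + 1)^j * exp (- p * om (x + 1)))" by (simp only: mult_ac add.commute)
   also have "... <= D * exp (p * S) * M p j" using M_ge[OF assms(1), of "x + 1" j] x D(1) by (intro mult_left_mono) auto
   finally show "x^j * exp (- q * om x) <= D * exp (p * S) * M p j / (real j + 1)"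
    by (simp add: pos_le_divide_eq mult.commute)
  qed (use assms in simp)
  thus ?thesis by (simp add: pos_le_divide_eq mult.commute)
 qed
 thus ?thesis using that[of "D * exp (p * S)"] D(1) by simp
qed

text \<open>The estimate behind the Leibniz rule. A single binomial term is at most
  \<open>(x + y)^j\<close>, and almost subadditivity with the factor \<open>q / s\<close>,
  \<open>p < s < q\<close>, turns the weights at \<open>x\<close> and \<open>y\<close> into the
  weight at \<open>x + y\<close>. The number \<open>j + 1\<close> of terms is paid for by passing
  from \<open>s\<close> to \<open>p\<close>.\<close>

lemma M_convolution:
 assumes "0 < p" "p < q"
 obtains C where "0 < C" "!!j. (\<Sum>i\<le>j. real (j choose i) * (M q i * M q (j - i))) <= C * M p j"
proof -
 obtain s where s: "p < s" "s < q" using dense assms(2) by blast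
 obtain D where D: "0 < D" "!!j. (real j + 1) * M s j <= D * M p j" using M_Suc_mult[OF assms(1) s(1)] by blast
 have "1 < q / s" using s assms by simp
 then obtain K where K: "!!x y. 0 <= x ==> 0 <= y ==> om (x + y) <= q / s * (om x + om y) + K"
  using w_subadd by metis
 have s0: "0 < s" and q0: "0 < q" using s assms by auto
 have t: "real (j choose i) * (M q i * M q (j - i)) <= exp (s * K) * M s j" if ij: "i <= j" for i j
 proof -
  define b where "b = real (j choose i)"
  have b: "0 < b" using ij by (simp add: b_def)
  have *: "b * ((x^i * exp (- q * om x)) * (y^(j - i) * exp (- q * om y))) <= exp (s * K) * M s j" if x: "1 <= x" and y: "1 <= y" for x y
  proof -
   have "b * (x^i * y^(j - i)) <= (\<Sum>k\<le>j. real (j choose k) * x^k * y^(j - k))"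
    unfolding b_def using x y ij member_le_sum[of i "{..j}" "%k. real (j choose k) * x^k * y^(j - k)"] by (simp add: mult.assoc)
   also have "... = (x + y)^j" by (simp add: binomial_ring)
   finally have 1: "b * (x^i * y^(j - i)) <= (x + y)^j" .
   have "s * om (x + y) <= s * (q / s * (om x + om y) + K)" using K[of x y] x y s0 by (intro mult_left_mono) auto
   also have "... = q * om x + q * om y + s * K" using s0 by (simp add: field_simps)
   finally have 2: "exp (- q * om x) * exp (- q * om y) <= exp (s * K) * exp (- s * om (x + y))" by (simp flip: exp_add)
   have "(b * (x^i * y^(j - i))) * (exp (- q * om x) * exp (- q * om y)) <= (x + y)^j * (exp (s * K) * exp (- s * om (x + y)))"
    using x y by (intro mult_mono[OF 1 2]) auto
   also have "... <= exp (s * K) * M s j" using M_ge[OF s0, of "x + y" j] x y by (simp add: mult_ac)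
   finally show ?thesis by (simp add: mult_ac)
  qed
  define B where "B = exp (s * K) * M s j"
  have "M q i <= B / (b * (y^(j-i) * exp (- q * om y)))" if y: "1 <= y" for y
   using *[OF _ y] y b unfolding B_def by (intro M_le[OF q0]) (simp add: pos_le_divide_eq mult_ac)
  hence "y^(j-i) * exp (- q * om y) <= B / (b * M q i)" if "1 <= y" for y
   using that b by (simp add: pos_le_divide_eq mult_ac)
  hence "M q (j - i) <= B / (b * M q i)" by (rule M_le[OF q0])
  thus ?thesis using b by (simp add: pos_le_divide_eq mult_ac B_def b_def)
 qed
 have "(\<Sum>i\<le>j. real (j choose i) * (M q i * M q (j - i))) <= exp (s * K) * D * M p j" for j
 proof -
  have "(\<Sum>i\<le>j. real (j choose i) * (M q i * M q (j - i))) <= (\<Sum>i\<le>j. exp (s * K) * M s j)" by (intro sum_mono t) simp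
  also have "... = exp (s * K) * ((real j + 1) * M s j)" by simp
  also have "... <= exp (s * K) * (D * M p j)" by (intro mult_left_mono D(2)) simp
  finally show ?thesis by (simp add: mult_ac)
 qed
 thus ?thesis using that[of "exp (s * K) * D"] D(1) by simp
qed

text \<open>Since \<open>om\<close> is sublinear, \<open>M q j\<close> outgrows
  \<open>R^j * fact j\<close> for every \<open>R\<close>. The test point is \<open>j / e\<close>,
  and \<open>e = 1 / (exp 1 * R)\<close> makes \<open>(j / e)^j * exp (- j)\<close> equal to
  \<open>R^j * j^j\<close>.\<close>

lemma M_fact:
 assumes q: "0 < q" and R: "0 < R"
 obtains C where "0 < C" "!!j. R^j * fact j <= C * M q j"
proof -
 define e where "e = 1 / (exp 1 * R)"
 have e: "0 < e" using R by (simp add: e_def)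
 obtain C where C: "0 <= C" "!!x. 0 <= x ==> om x <= e / q * x + C" using w_small[of "e/q"] e q by auto
 have "R^j * fact j <= exp (e + q * C) * M q j" for j
 proof -
  define x where "x = max 1 (real j / e)"
  have x: "1 <= x" "0 <= x" by (auto simp: x_def)
  have "q * om x <= q * (e / q * x + C)" using C(2)[OF x(2)] q by (intro mult_left_mono) auto
  also have "... = e * x + q * C" using q by (simp add: field_simps)
  also have "e * x <= e + real j" using e by (simp add: x_def max_def)
  finally have ex: "exp (- (e + real j + q * C)) <= exp (- q * om x)" by simp
  have "R^j * fact j <= R^j * real j ^ j" using fact_le_power[of j, where 'a = real] R by (intro mult_left_mono) simp_all
  also have "... = (real j / e)^j * exp (- real j)"
   by (simp add: e_def power_mult_distrib exp_minus field_simps flip: exp_of_nat_mult)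
  also have "... <= x^j * exp (- real j)" using e by (intro mult_right_mono power_mono) (auto simp: x_def)
  also have "... = exp (e + q * C) * (x^j * exp (- (e + real j + q * C)))" by (simp add: mult_ac flip: exp_add)
  also have "... <= exp (e + q * C) * (x^j * exp (- q * om x))" using x ex by (intro mult_left_mono) auto
  also have "... <= exp (e + q * C) * M q j" using M_ge[OF q x(1)] by (intro mult_left_mono) auto
  finally show ?thesis .
 qed
 thus ?thesis using that[of "exp (e + q * C)"] by simp
qed

text \<open>Legendre duality: the integer part of the slope of the convex function
 \<^term>\<open>%t. om (exp t)\<close> at \<^term>\<open>t = ln x\<close> is the exponent that gives the bound.\<close>

lemma M_Legendre:
 assumes q: "0 < q"
 obtains C where "0 < C" "!!x y B. 0 <= x ==> 0 <= B ==> (!!j. y * x^j <= B * M q j) ==> y <= C * B * (1 + x) * exp (- q * om x)"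
proof -
 define C where "C = max 1 (M q 0 * exp (q * om 1))"
 have "y <= C * B * (1 + x) * exp (- q * om x)" if x: "0 <= x" and B: "0 <= B" and y: "!!j. y * x^j <= B * M q j" for x y B
 proof (cases "1 < x")
  case False
  have "q * om x <= q * om 1" using w_mono[of x 1] False x q by (intro mult_left_mono) auto
  have "y <= (M q 0 * exp (q * om 1)) * B * 1 * exp (- q * om 1)" using y[of 0] by (simp add: exp_minus field_simps)
  also have "... <= C * B * (1 + x) * exp (- q * om x)"
   using x B \<open>q * om x <= q * om 1\<close> by (intro mult_mono) (auto simp: C_def)
  finally show ?thesis .
 next
  case True
  define t where "t = ln x"
  have t: "0 < t" "exp t = x" using True by (auto simp: t_def)
  obtain p where p: "!!u. 0 <= u ==> om (exp t) + p * (u - t) <= om (exp u)" using convex_on_subgradient[OF w_convex t(1)] by blast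
  have p0: "0 <= p"
  proof (rule ccontr)
   assume "~ 0 <= p"
   hence "0 < p * (0 - t)" using t(1) by (intro mult_neg_neg) auto
   hence "om (exp t) < om (exp 0)" using p[of 0] by simp
   moreover have "om (exp 0) <= om (exp t)" using t(1) by (intro w_mono) auto
   ultimately show False by simp
  qed
  \<comment> \<open>Rounding the optimal exponent \<open>q * p\<close> down costs at most one power
    of \<open>x\<close>, which becomes the factor \<open>1 + x\<close> of the conclusion.\<close>
  define j where "j = nat \<lfloor>q * p\<rfloor>"
  have j: "real j <= q * p" "q * p <= real j + 1" using p0 q unfolding j_def by (auto simp: of_nat_nat intro: le_of_int_ceiling)
  have "M q j <= exp ((real j + 1) * t - q * om x)"
  proof (rule M_le[OF q])
   fix z :: real assume z: "1 <= z"
   have "z^j = exp (real j * ln z)" using z by (simp add: exp_of_nat_mult)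
   moreover have "real j * ln z - q * om z <= (real j + 1) * t - q * om x"
   proof -
    have "q * (om x + p * (ln z - t)) <= q * om z" using p[of "ln z"] z q t by (intro mult_left_mono) auto
    hence "real j * ln z - q * om z <= real j * ln z - q * om x - q * p * ln z + q * p * t" by (simp add: algebra_simps)
    also have "real j * ln z <= q * p * ln z" using j z by (intro mult_right_mono) auto
    also have "q * p * t <= (real j + 1) * t" using j t by (intro mult_right_mono) auto
    finally show ?thesis by simp
   qed
   ultimately show "z^j * exp (- q * om z) <= exp ((real j + 1) * t - q * om x)" by (simp flip: exp_add)
  qed
  also have "... = x^(j + 1) * exp (- q * om x)"
   using t(2) exp_of_nat_mult[of "j + 1" t] by (simp add: exp_diff exp_minus field_simps)
  finally have "y * x^j <= B * (x^(j + 1) * exp (- q * om x))" using y[of j] B by (meson mult_left_mono order_trans)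
  hence "y * x^j <= (B * x * exp (- q * om x)) * x^j" by (simp add: mult_ac)
  hence "y <= B * x * exp (- q * om x)" using True by (simp add: mult_le_cancel_right)
  also have "... <= (C * B) * (1 + x) * exp (- q * om x)"
   using x B mult_right_mono[of 1 C B] by (intro mult_mono) (auto simp: C_def)
  finally show ?thesis .
 qed
 thus ?thesis using that[of C] by (simp add: C_def)
qed

end

section \<open>The Hahn-Banach theorem\<close>

definition sublinear_on :: "('x => complex) set => (('x => complex) => real) => bool" where
 "sublinear_on X p \<longleftrightarrow> (\<forall>f\<in>X. \<forall>g\<in>X. p (f + g) <= p f + p g) & (\<forall>f\<in>X. ALL t>=0. p (cscale (of_real t) f) <= t * p f)"

lemma cscale_simps [simp]: "cscale 1 f = f" "cscale s (cscale t f) = cscale (s * t) f" "cscale 0 f = 0" "cscale s 0 = 0"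
 by (auto simp: cscale_def fun_eq_iff)

text \<open>Lowers a sublinear functional as far as its values along the ray of \<open>h\<close>
  allow. It stays sublinear and becomes linear on the line through \<open>h\<close>, which is what a
  minimality argument needs.\<close>

definition tilt :: "(('x => complex) => real) => ('x => complex) => ('x => complex) => real" where
 "tilt p h g = (INF t\<in>{0..}. p (g + cscale (of_real t) h) - t * p h)"

context
 fixes X :: "('x => complex) set"
 assumes X: "cfun.subspace X"
begin

lemma X_closed: "0 \<in> X" "f \<in> X ==> g \<in> X ==> f + g \<in> X" "f \<in> X ==> cscale s f \<in> X" "f \<in> X ==> - f \<in> X" "f \<in> X ==> g \<in> X ==> f - g \<in> X"
 using cfun.subspace_0[OF X] cfun.subspace_add[OF X] cfun.subspace_scale[OF X] cfun.subspace_neg[OF X] cfun.subspace_diff[OF X] by auto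

lemma sublinear_hom:
 assumes p: "sublinear_on X p" and f: "f \<in> X" "0 <= t"
 shows "p (cscale (of_real t) f) = t * p f"
proof (cases "t = 0")
 case True
 have "p 0 <= 0 * p 0" using p X_closed(1) unfolding sublinear_on_def by (metis cscale_simps(4) order_refl)
 moreover have "p (0 + 0) <= p 0 + p 0" using p X_closed(1) unfolding sublinear_on_def by blast
 ultimately show ?thesis using True by simp
next
 case False
 have "p (cscale (of_real (1/t)) (cscale (of_real t) f)) <= (1/t) * p (cscale (of_real t) f)"
  using p X_closed(3)[OF f(1)] f(2) unfolding sublinear_on_def by (meson divide_nonneg_nonneg zero_le_one)
 hence "t * p f <= p (cscale (of_real t) f)" using False f(2) by (simp add: field_simps flip: of_real_mult)
 thus ?thesis using p f unfolding sublinear_on_def by (meson antisym)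
qed

lemma sublinear_0: "sublinear_on X p ==> p 0 = 0"
 using sublinear_hom[of p 0 0] X_closed(1) by simp

lemma tilt_properties:
 assumes p: "sublinear_on X p" and h: "h \<in> X"
 shows "sublinear_on X (tilt p h)" "!!g. g \<in> X ==> tilt p h g <= p g" "tilt p h (- h) <= - p h"
proof -
 note sub = p[unfolded sublinear_on_def, THEN conjunct1, rule_format] and hom = sublinear_hom[OF p]
 have bdd: "bdd_below ((%t. p (g + cscale (of_real t) h) - t * p h) ` {0..})" if g: "g \<in> X" for g
 proof (rule bdd_belowI2[where m = "- p (- g)"])
  fix t :: real assume t: "t \<in> {0..}"
  have "t * p h = p ((g + cscale (of_real t) h) + - g)" using hom[OF h] t by simp
  also have "... <= p (g + cscale (of_real t) h) + p (- g)" using g h by (intro sub) (auto intro: X_closed)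
  finally show "- p (- g) <= p (g + cscale (of_real t) h) - t * p h" by simp
 qed
 have le: "tilt p h g <= p (g + cscale (of_real t) h) - t * p h" if "g \<in> X" "0 <= t" for g t
  unfolding tilt_def using bdd[OF that(1)] that(2) by (intro cINF_lower) auto
 have ge: "B <= tilt p h g" if "!!t. 0 <= t ==> B <= p (g + cscale (of_real t) h) - t * p h" for B g
  unfolding tilt_def using that by (intro cINF_greatest) auto
 show "tilt p h g <= p g" if "g \<in> X" for g using le[OF that, of 0] by simp
 show "tilt p h (- h) <= - p h" using le[of "-h" 1] h X_closed sublinear_0[OF p] by auto
 show "sublinear_on X (tilt p h)" unfolding sublinear_on_def
 proof (intro conjI ballI allI impI)
  fix f g assume f: "f \<in> X" and g: "g \<in> X"
  have "tilt p h (f + g) - (p (f + cscale (of_real t) h) - t * p h) <= tilt p h g" if t: "0 <= t" for t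
  proof (rule ge)
   fix u :: real assume u: "0 <= u"
   have eq: "(f + cscale (of_real t) h) + (g + cscale (of_real u) h) = (f + g) + cscale (of_real (t + u)) h"
    by (auto simp: cscale_def fun_eq_iff algebra_simps)
   have "tilt p h (f + g) <= p ((f + g) + cscale (of_real (t + u)) h) - (t + u) * p h"
    using t u f g by (intro le) (auto intro: X_closed)
   also have "p ((f + g) + cscale (of_real (t + u)) h) <= p (f + cscale (of_real t) h) + p (g + cscale (of_real u) h)"
    unfolding eq[symmetric] using f g h by (intro sub) (auto intro!: X_closed)
   finally show "tilt p h (f + g) - (p (f + cscale (of_real t) h) - t * p h) <= p (g + cscale (of_real u) h) - u * p h"
    by (simp add: algebra_simps)
  qed
  hence "tilt p h (f + g) - tilt p h g <= tilt p h f" by (intro ge) (smt (verit))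
  thus "tilt p h (f + g) <= tilt p h f + tilt p h g" by simp
 next
  fix f and t :: real assume f: "f \<in> X" and t: "0 <= t"
  have one: "tilt p h (cscale (of_real s) f) <= s * tilt p h f" if s: "0 < s" and f: "f \<in> X" for s f
  proof -
   have "tilt p h (cscale (of_real s) f) / s <= tilt p h f"
   proof (rule ge)
    fix u :: real assume u: "0 <= u"
    have eq: "cscale (of_real s) f + cscale (of_real (s * u)) h = cscale (of_real s) (f + cscale (of_real u) h)"
     by (auto simp: cscale_def fun_eq_iff algebra_simps)
    have "tilt p h (cscale (of_real s) f) <= p (cscale (of_real s) f + cscale (of_real (s * u)) h) - (s * u) * p h"
     using f s u by (intro le) (auto intro: X_closed)
    also have "... = s * (p (f + cscale (of_real u) h) - u * p h)"
     unfolding eq using hom[of "f + cscale (of_real u) h" s] f h s by (simp add: X_closed algebra_simps)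
    finally show "tilt p h (cscale (of_real s) f) / s <= p (f + cscale (of_real u) h) - u * p h"
     using s by (simp add: divide_le_eq mult.commute)
   qed
   thus ?thesis using s by (simp add: divide_le_eq mult.commute)
  qed
  show "tilt p h (cscale (of_real t) f) <= t * tilt p h f"
  proof (cases "t = 0")
   case True
   thus ?thesis using le[of 0 0] X_closed(1) sublinear_0[OF p] by simp
  qed (use one[OF _ f] t in simp)
 qed
qed

text \<open>A sublinear functional that is minimal below \<^term>\<open>p\<close> coincides with all its tilts, hence is additive.\<close>

lemma linear_minorant:
 assumes p: "sublinear_on X p"
 obtains q where "!!f g. f \<in> X ==> g \<in> X ==> q (f + g) = q f + q g" "!!f t. f \<in> X ==> q (cscale (of_real t) f) = t * q f"
  "!!f. f \<in> X ==> q f <= p f"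
proof -
 \<comment> \<open>With the values outside \<open>X\<close> fixed, comparing two members of
   \<open>A\<close> at all arguments is the same as comparing them on \<open>X\<close>.\<close>
 define A where "A = {q. sublinear_on X q & (\<forall>f\<in>X. q f <= p f) & (ALL f. f \<notin> X --> q f = 0)}"
 define P where "P q q' \<longleftrightarrow> (ALL f. q' f <= q f)" for q q' :: "('x => complex) => real"
 have "\<exists>m\<in>A. \<forall>q\<in>A. P m q --> q = m"
 proof (rule predicate_Zorn)
  show "partial_order_on A (relation_of P A)"
   by (rule partial_order_on_relation_ofI) (auto simp: P_def fun_eq_iff intro: order_trans antisym)
  fix C assume C: "C \<in> Chains (relation_of P A)"
  have CA: "C \<subseteq> A" using C unfolding Chains_def relation_of_def by auto
  have tot: "P q q' | P q' q" if "q \<in> C" "q' \<in> C" for q q' using C that unfolding Chains_def relation_of_def by auto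
  show "\<exists>u\<in>A. \<forall>q\<in>C. P q u"
  proof (cases "C = {}")
   case True
   have "(%f. if f \<in> X then p f else 0) \<in> A" using p by (auto simp: A_def sublinear_on_def X_closed)
   thus ?thesis using True by auto
  next
   case False
   then obtain q0 where q0: "q0 \<in> C" by blast
   define u where "u f = (INF q\<in>C. q f)" for f
   have CD: "sublinear_on X q" "!!f. f \<in> X ==> q f <= p f" "!!f. f \<notin> X ==> q f = 0" if "q \<in> C" for q
    using CA that by (auto simp: A_def)
   have bdd: "bdd_below ((%q. q f) ` C)" for f
   proof (cases "f \<in> X")
    case True
    show ?thesis
    proof (rule bdd_belowI2[where m = "- p (- f)"])
     fix q assume q: "q \<in> C"
     have "0 = q (f + - f)" using sublinear_0[OF CD(1)[OF q]] by simp
     also have "... <= q f + q (- f)" using CD(1)[OF q] True X_closed unfolding sublinear_on_def by blast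
     also have "q (- f) <= p (- f)" using CD(2)[OF q] True X_closed by blast
     finally show "- p (- f) <= q f" by simp
    qed
   next
    case False
    show ?thesis
    proof (rule bdd_belowI2[where m = 0])
     fix q assume "q \<in> C"
     from CD(3)[OF this False] show "0 <= q f" by simp
    qed
   qed
   have le: "u f <= q f" if "q \<in> C" for q f unfolding u_def using bdd that by (intro cINF_lower)
   have ge: "B <= u f" if "!!q. q \<in> C ==> B <= q f" for B f unfolding u_def using that False by (intro cINF_greatest)
   have "u \<in> A" unfolding A_def mem_Collect_eq sublinear_on_def
   proof (intro conjI ballI allI impI)
    show "u f <= p f" if "f \<in> X" for f using le[OF q0, of f] CD(2)[OF q0 that] by simp
    show "u f = 0" if "f \<notin> X" for f
    proof (rule antisym)
     show "u f <= 0" using le[OF q0, of f] CD(3)[OF q0 that] by simp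
     show "0 <= u f"
     proof (rule ge)
      fix q assume "q \<in> C"
      from CD(3)[OF this that] show "0 <= q f" by simp
     qed
    qed
    fix f assume f: "f \<in> X"
    show "u (f + g) <= u f + u g" if g: "g \<in> X" for g
    proof -
     have "u (f + g) <= q f + q' g" if qq: "q \<in> C" "q' \<in> C" for q q'
     proof -
      obtain r where r: "r \<in> C" "r f <= q f" "r g <= q' g" using tot[OF qq] qq unfolding P_def by blast
      have "u (f + g) <= r (f + g)" using le[OF r(1)] by blast
      also have "... <= r f + r g" using CD(1)[OF r(1)] f g unfolding sublinear_on_def by blast
      finally show ?thesis using r by simp
     qed
     note two = this
     have "u (f + g) - q f <= u g" if q: "q \<in> C" for q
     proof (rule ge)
      fix q' assume "q' \<in> C"
      from two[OF q this] show "u (f + g) - q f <= q' g" by simp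
     qed
     note one = this
     have "u (f + g) - u g <= u f"
     proof (rule ge)
      fix q assume "q \<in> C"
      from one[OF this] show "u (f + g) - u g <= q f" by simp
     qed
     thus ?thesis by simp
    qed
    fix t :: real assume t: "0 <= t"
    have hom: "q (cscale (of_real t) f) = t * q f" if "q \<in> C" for q by (rule sublinear_hom[OF CD(1)[OF that] f t])
    show "u (cscale (of_real t) f) <= t * u f"
    proof (cases "t = 0")
     case True
     thus ?thesis using le[OF q0, of 0] sublinear_0[OF CD(1)[OF q0]] by simp
    next
     case False
     have "u (cscale (of_real t) f) / t <= u f"
     proof (rule ge)
      fix q assume q: "q \<in> C"
      show "u (cscale (of_real t) f) / t <= q f" using le[OF q, of "cscale (of_real t) f"] hom[OF q] t False
       by (simp add: divide_le_eq mult.commute)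
     qed
     thus ?thesis using t False by (simp add: divide_le_eq mult.commute)
    qed
   qed
   thus ?thesis using le by (auto simp: P_def)
  qed
 qed
 then obtain m where m: "m \<in> A" and min': "\<forall>q\<in>A. P m q --> q = m" by (elim bexE)
 have min: "q = m" if "q \<in> A" "P m q" for q using min' that by simp
 have ms: "sublinear_on X m" and mp: "!!f. f \<in> X ==> m f <= p f" using m by (auto simp: A_def)
 have neg: "m (- h) <= - m h" if h: "h \<in> X" for h
 proof -
  let ?q = "%f. if f \<in> X then tilt m h f else 0"
  note t = tilt_properties[OF ms h]
  have "sublinear_on X ?q" using t(1) by (simp add: sublinear_on_def X_closed)
  moreover have "\<forall>f\<in>X. ?q f <= p f" using t(2) mp by (simp, meson order_trans)
  ultimately have "?q \<in> A" by (simp add: A_def)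
  moreover have "P m ?q" using t(2) m by (simp add: P_def A_def)
  ultimately have "?q = m" by (rule min)
  from fun_cong[OF this, of "- h"] show ?thesis using t(3) X_closed(4)[OF h] by simp
 qed
 have sub: "m (f + g) <= m f + m g" if "f \<in> X" "g \<in> X" for f g using ms that unfolding sublinear_on_def by blast
 note hom = sublinear_hom[OF ms]
 have neg': "m (- h) = - m h" if h: "h \<in> X" for h
 proof -
  have "0 <= m h + m (- h)" using sub[OF h X_closed(4)[OF h]] sublinear_0[OF ms] by simp
  thus ?thesis using neg[OF h] by simp
 qed
 show ?thesis
 proof
  fix f assume f: "f \<in> X"
  show "m f <= p f" by (rule mp[OF f])
  show "m (f + g) = m f + m g" if g: "g \<in> X" for g
  proof -
   have "m f = m ((f + g) + - g)" by simp
   also have "... <= m (f + g) + m (- g)" using f g by (intro sub) (auto intro: X_closed)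
   finally show ?thesis using neg'[OF g] sub[OF f g] by simp
  qed
  show "m (cscale (of_real t) f) = t * m f" for t
  proof (cases "0 <= t")
   case False
   have "cscale (of_real t) f = - cscale (of_real (- t)) f" by (auto simp: cscale_def fun_eq_iff)
   thus ?thesis using neg'[OF X_closed(3)[OF f]] hom[OF f, of "-t"] False by simp
  qed (use hom f in simp)
 qed
qed

text \<open>The distance to \<open>Y\<close>, measured by \<open>p\<close>, is sublinear, vanishes
  on \<open>Y\<close> and is at least 1 at \<open>f\<close>. Tilting it along \<open>f\<close>
  before taking a linear minorant keeps the value at \<open>f\<close> at least 1. The factor 2 comes
  from estimating the complexified functional by the sum of its real and imaginary parts.\<close>

lemma Hahn_Banach_separation:
 assumes sub: "!!f g. f \<in> X ==> g \<in> X ==> p (f + g) <= p f + p g"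
  and hom: "!!f s. f \<in> X ==> p (cscale s f) = cmod s * p f"
  and Y: "cfun.subspace Y" "Y \<subseteq> X" and f: "f \<in> X" and far: "!!y. y \<in> Y ==> 1 <= p (f - y)"
 obtains S :: "('x => complex) => complex" where "!!g h. g \<in> X ==> h \<in> X ==> S (g + h) = S g + S h" "!!g s. g \<in> X ==> S (cscale s g) = s * S g"
  "!!g. g \<in> X ==> cmod (S g) <= 2 * p g" "!!y. y \<in> Y ==> S y = 0" "S f ~= 0"
proof -
 note Yc = cfun.subspace_0[OF Y(1)] cfun.subspace_add[OF Y(1)] cfun.subspace_scale[OF Y(1)] cfun.subspace_diff[OF Y(1)]
 have p_neg: "p (- g) = p g" if "g \<in> X" for g
 proof -
  have "- g = cscale (-1) g" by (simp add: cscale_def fun_eq_iff)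
  thus ?thesis using hom[OF that, of "-1"] by simp
 qed
 have p0: "0 <= p g" if g: "g \<in> X" for g
 proof -
  have "p (cscale 0 g) = 0" using hom[OF g, of 0] by simp
  hence "0 = p 0" by simp
  also have "... <= p g + p (- g)" using sub[OF g X_closed(4)[OF g]] by simp
  finally show ?thesis using p_neg[OF g] by simp
 qed
 define d where "d g = (INF y\<in>Y. p (g - y))" for g
 have Yne: "Y ~= {}" using Yc(1) by auto
 have le: "d g <= p (g - y)" if "g \<in> X" "y \<in> Y" for g y
  unfolding d_def using that Y(2) by (intro cINF_lower bdd_belowI2[where m = 0] p0 X_closed) auto
 have ge: "B <= d g" if "!!y. y \<in> Y ==> B <= p (g - y)" for B g unfolding d_def using that Yne by (intro cINF_greatest)
 have dp: "d g <= p g" if "g \<in> X" for g using le[OF that Yc(1)] by simp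
 have d: "sublinear_on X d" unfolding sublinear_on_def
 proof (intro conjI ballI allI impI)
  fix g h assume g: "g \<in> X" and h: "h \<in> X"
  have "d (g + h) <= p (g - y) + p (h - z)" if yz: "y \<in> Y" "z \<in> Y" for y z
  proof -
   have "d (g + h) <= p ((g + h) - (y + z))" using g h yz Yc by (intro le X_closed) auto
   also have "(g + h) - (y + z) = (g - y) + (h - z)" by simp
   also have "p ... <= p (g - y) + p (h - z)" using g h yz Y(2) by (intro sub X_closed) auto
   finally show ?thesis .
  qed
  note two = this
  have "d (g + h) - p (g - y) <= d h" if y: "y \<in> Y" for y
  proof (rule ge)
   fix z assume "z \<in> Y"
   from two[OF y this] show "d (g + h) - p (g - y) <= p (h - z)" by simp
  qed
  note one = this
  have "d (g + h) - d h <= d g"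
  proof (rule ge)
   fix y assume "y \<in> Y"
   from one[OF this] show "d (g + h) - d h <= p (g - y)" by simp
  qed
  thus "d (g + h) <= d g + d h" by simp
 next
  fix g and t :: real assume g: "g \<in> X" and t: "0 <= t"
  show "d (cscale (of_real t) g) <= t * d g"
  proof (cases "t = 0")
   case True
   have "p 0 = 0" using hom[OF g, of 0] by (simp only: norm_zero mult_zero_left cscale_simps)
   thus ?thesis using dp[OF X_closed(1)] True by simp
  next
   case False
   have "d (cscale (of_real t) g) / t <= p (g - y)" if y: "y \<in> Y" for y
   proof -
    have "cscale (of_real t) g - cscale (of_real t) y = cscale (of_real t) (g - y)" by (auto simp: cscale_def fun_eq_iff algebra_simps)
    hence "p (cscale (of_real t) g - cscale (of_real t) y) = t * p (g - y)" using hom[of "g - y" "of_real t"] y g Y(2) X_closed t by auto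
    thus ?thesis using le[OF X_closed(3)[OF g] Yc(3)[OF y], of "of_real t" "of_real t"] t False by (simp add: divide_le_eq mult.commute)
   qed
   hence "d (cscale (of_real t) g) / t <= d g" by (rule ge)
   thus ?thesis using t False by (simp add: divide_le_eq mult.commute)
  qed
 qed
 show ?thesis
 proof (rule linear_minorant[OF tilt_properties(1)[OF d f]])
 fix q assume q: "!!f g. f \<in> X ==> g \<in> X ==> q (f + g) = q f + q g" "!!f t. f \<in> X ==> q (cscale (of_real t) f) = t * q f"
  "!!g. g \<in> X ==> q g <= tilt d f g"
 have qd: "q g <= d g" if "g \<in> X" for g using q(3)[OF that] tilt_properties(2)[OF d f that] by simp
 have qneg: "q (- g) = - q g" if g: "g \<in> X" for g
 proof -
  have "- g = cscale (of_real (- 1)) g" by (auto simp: cscale_def fun_eq_iff)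
  thus ?thesis using q(2)[OF g, of "-1"] by simp
 qed
 have qabs: "abs (q g) <= p g" if g: "g \<in> X" for g
  using qd[OF g] qd[OF X_closed(4)[OF g]] dp[OF g] dp[OF X_closed(4)[OF g]] qneg[OF g] p_neg[OF g] by simp
 have qf: "1 <= q f"
 proof -
  have "q (- f) <= - d f" using q(3)[OF X_closed(4)[OF f]] tilt_properties(3)[OF d f] by simp
  moreover have "1 <= d f" by (rule ge) (rule far)
  ultimately show ?thesis using qneg[OF f] by simp
 qed
 have qY: "q y = 0" if y: "y \<in> Y" for y
 proof -
  have yX: "y \<in> X" using y Y by auto
  have dY: "d z <= 0" if "z \<in> Y" for z
  proof -
   have "z \<in> X" using that Y by auto
   hence "d z <= p (z - z)" using that by (intro le)
   thus ?thesis using hom[OF X_closed(1), of 0] by simp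
  qed
  have "- y = cscale (-1) y" by (simp add: cscale_def fun_eq_iff)
  hence "- y \<in> Y" using Yc(3)[OF y, of "-1"] by simp
  thus ?thesis using qd[OF yX] qd[OF X_closed(4)[OF yX]] dY[OF y] dY[of "-y"] qneg[OF yX] by simp
 qed
 define S where "S g = Complex (q g) (- q (cscale \<i> g))" for g
 have i: "cscale \<i> g \<in> X" if "g \<in> X" for g using that by (rule X_closed)
 show ?thesis
 proof
  fix g assume g: "g \<in> X"
  show add: "S (g + h) = S g + S h" if h: "h \<in> X" for h
  proof -
   have "cscale \<i> (g + h) = cscale \<i> g + cscale \<i> h" by (auto simp: cscale_def fun_eq_iff algebra_simps)
   thus ?thesis using q(1)[OF g h] q(1)[OF i[OF g] i[OF h]] by (simp add: S_def complex_eq_iff)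
  qed
  show "S (cscale s g) = s * S g" for s
  proof -
   have e: "cscale s g = cscale (of_real (Re s)) g + cscale (of_real (Im s)) (cscale \<i> g)"
    "cscale \<i> (cscale s g) = cscale (of_real (Re s)) (cscale \<i> g) + cscale (of_real (- Im s)) g"
    by (auto simp: cscale_def fun_eq_iff complex_eq_iff)
   have "q (cscale s g) = Re s * q g + Im s * q (cscale \<i> g)"
    unfolding e(1) using q(1)[OF X_closed(3)[OF g] X_closed(3)[OF i[OF g]]] q(2)[OF g] q(2)[OF i[OF g]] by simp
   moreover have "q (cscale \<i> (cscale s g)) = Re s * q (cscale \<i> g) - Im s * q g"
    unfolding e(2) using q(1)[OF X_closed(3)[OF i[OF g]] X_closed(3)[OF g]] q(2)[OF g] q(2)[OF i[OF g]] by (simp del: of_real_minus)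
   ultimately show ?thesis unfolding S_def by (simp add: complex_eq_iff algebra_simps)
  qed
  show "cmod (S g) <= 2 * p g"
   using cmod_le[of "S g"] qabs[OF g] qabs[OF i[OF g]] hom[OF g, of \<i>] by (simp add: S_def)
 next
  show "S y = 0" if "y \<in> Y" for y using qY[OF that] qY[OF Yc(3)[OF that]] by (simp add: S_def complex_eq_iff)
  show "S f ~= 0" using qf by (auto simp: S_def complex_eq_iff)
 qed
 qed
qed

end

section \<open>Topologies given by a directed family of semi-norms\<close>

locale seminormed_space =
 fixes X :: "('x => complex) set" and P :: "(('x => complex) => ereal) set"
 assumes X: "cfun.subspace X" and P_nonempty: "P ~= {}"
  and finite_nonneg: "!!p f. p \<in> P ==> f \<in> X ==> 0 <= p f & p f < \<infinity>"
  and triangle: "!!p f g. p \<in> P ==> f \<in> X ==> g \<in> X ==> p (f + g) <= p f + p g"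
  and homogeneous: "!!p f s. p \<in> P ==> f \<in> X ==> p (cscale s f) = ereal (cmod s) * p f"
  and directed: "!!p1 p2. p1 \<in> P ==> p2 \<in> P ==> \<exists>p\<in>P. \<forall>f\<in>X. p1 f <= p f & p2 f <= p f"
begin

lemmas Xc = X_closed[OF X]

definition val :: "(('x => complex) => ereal) => ('x => complex) => real" where "val p f = real_of_ereal (p f)"

lemma val: "p \<in> P ==> f \<in> X ==> p f = ereal (val p f)" and val_nonneg: "p \<in> P ==> f \<in> X ==> 0 <= val p f"
 using finite_nonneg[of p f] by (cases "p f"; simp add: val_def)+

lemma val_triangle: "p \<in> P ==> f \<in> X ==> g \<in> X ==> val p (f + g) <= val p f + val p g"
 using triangle[of p f g] by (simp add: val Xc)

lemma val_homogeneous: "p \<in> P ==> f \<in> X ==> val p (cscale s f) = cmod s * val p f"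
 using homogeneous[of p f s] by (simp add: val Xc)

lemma val_0: "p \<in> P ==> val p 0 = 0" using val_homogeneous[of p 0 0] Xc(1) by simp

lemma topspace_eq: "topspace (seminorm_topology X P) = X"
proof -
 obtain p where "p \<in> P" using P_nonempty by blast
 thus ?thesis using topspace_seminorm_topology[of p P X] val[of p 0] Xc(1) val_0 by simp
qed

lemma open_ball:
 assumes "p \<in> P" "f \<in> X" "0 < e"
 shows "openin (seminorm_topology X P) {g \<in> X. val p (g - f) < e}"
proof -
 have "{g \<in> X. val p (g - f) < e} = {g \<in> X. p (g - f) < ereal e}" using assms by (auto simp: val Xc)
 thus ?thesis unfolding seminorm_topology_def using assms by (auto intro!: topology_generated_by_Basis)
qed

text \<open>Induction over the generation of the topology. Directedness is what makes one semi-norm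
  enough for a finite intersection.\<close>

lemma contains_ball:
 assumes "openin (seminorm_topology X P) U" "f \<in> U"
 shows "\<exists>p\<in>P. EX e>0. {g \<in> X. val p (g - f) < e} \<subseteq> U"
proof -
 have "generate_topology_on {{g \<in> X. p (g - f) < ereal e} |f p e. f \<in> X & p \<in> P & 0 < e} U"
  using assms(1) unfolding seminorm_topology_def by (simp add: openin_topology_generated_by_iff)
 thus ?thesis using assms(2)
 proof (induction arbitrary: f)
  case (Int a b)
  have fab: "f \<in> a" "f \<in> b" using Int.prems by auto
  from Int.IH(1)[OF fab(1)] obtain p1 e1 where 1: "p1 \<in> P" "0 < e1" "{g \<in> X. val p1 (g - f) < e1} \<subseteq> a" by (elim bexE exE conjE)
  from Int.IH(2)[OF fab(2)] obtain p2 e2 where 2: "p2 \<in> P" "0 < e2" "{g \<in> X. val p2 (g - f) < e2} \<subseteq> b" by (elim bexE exE conjE)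
  from directed[OF 1(1) 2(1)] obtain p where p: "p \<in> P" "\<forall>f\<in>X. p1 f <= p f & p2 f <= p f" by (elim bexE)
  have fX: "f \<in> X"
  proof -
   have "openin (seminorm_topology X P) a" using Int.hyps(1) unfolding seminorm_topology_def by (simp add: openin_topology_generated_by_iff)
   thus ?thesis using Int.prems openin_subset topspace_eq by blast
  qed
  have "val p1 (g - f) <= val p (g - f)" "val p2 (g - f) <= val p (g - f)" if "g \<in> X" for g
   using bspec[OF p(2) Xc(5)[OF that fX]] unfolding val[OF 1(1) Xc(5)[OF that fX]] val[OF 2(1) Xc(5)[OF that fX]] val[OF p(1) Xc(5)[OF that fX]] by auto
  hence "{g \<in> X. val p (g - f) < min e1 e2} \<subseteq> a \<inter> b" using 1(3) 2(3) by fastforce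
  moreover have "0 < min e1 e2" using 1(2) 2(2) by simp
  ultimately show ?case using p(1) by (intro bexI[of _ p] exI[of _ "min e1 e2"] conjI)
 next
  case (UN K)
  from UN.prems obtain k where k: "k \<in> K" "f \<in> k" by (rule UnionE)
  from UN.IH[OF k] obtain p e where "p \<in> P" "0 < e" "{g \<in> X. val p (g - f) < e} \<subseteq> k" by (elim bexE exE conjE)
  moreover from this(3) have "{g \<in> X. val p (g - f) < e} \<subseteq> \<Union> K" using k(1) by (rule subset_trans[OF _ Union_upper])
  ultimately show ?case by (intro bexI[of _ p] exI[of _ e] conjI)
 next
  case (Basis s)
  from Basis.hyps obtain h p e where s: "s = {g \<in> X. p (g - h) < ereal e}" "h \<in> X" "p \<in> P" "0 < e"
   unfolding mem_Collect_eq by (elim exE conjE)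
  hence f: "f \<in> X" "val p (f - h) < e" using Basis.prems by (auto simp: val Xc)
  have "val p (g - h) < e" if g: "g \<in> X" "val p (g - f) < e - val p (f - h)" for g
  proof -
   have "val p ((g - f) + (f - h)) <= val p (g - f) + val p (f - h)" using s f g by (intro val_triangle Xc) auto
   thus ?thesis using g by simp
  qed
  hence "{g \<in> X. val p (g - f) < e - val p (f - h)} \<subseteq> s" using s by (auto simp: val Xc)
  moreover have "0 < e - val p (f - h)" using f(2) by simp
  ultimately show ?case using s(3) by (intro bexI[of _ p] exI[of _ "e - val p (f - h)"] conjI)
 qed auto
qed

lemma continuous_iff:
 assumes add: "!!f g. f \<in> X ==> g \<in> X ==> S (f + g) = S f + S g" and hom: "!!f s. f \<in> X ==> S (cscale s f) = s * S f"
 shows "continuous_map (seminorm_topology X P) (euclidean :: complex topology) S \<longleftrightarrow> (\<exists>p\<in>P. EX C. \<forall>f\<in>X. cmod (S f) <= C * val p f)"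
proof
 have S0: "S 0 = 0" using hom[OF Xc(1), of 0] by simp
 assume cont: "continuous_map (seminorm_topology X P) (euclidean :: complex topology) S"
 have "openin (seminorm_topology X P) {f \<in> X. S f \<in> ball 0 1}"
  using openin_continuous_map_preimage[OF cont, of "ball 0 1"] by (simp add: topspace_eq)
 from contains_ball[OF this, of 0] obtain p e where p: "p \<in> P" "0 < e" "{g \<in> X. val p (g - 0) < e} \<subseteq> {f \<in> X. S f \<in> ball 0 1}"
  using Xc(1) S0 by auto
 have "cmod (S f) <= (2 / e) * val p f" if f: "f \<in> X" for f
 proof (rule field_le_epsilon)
  fix d :: real assume d: "0 < d"
  \<comment> \<open>Scales \<open>f\<close> into the ball of radius \<open>e\<close>. The summand
    with \<open>d\<close> keeps the denominator positive when the semi-norm of \<open>f\<close> is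
    0; it reappears as the error \<open>d\<close> in the final estimate.\<close>
  define k where "k = e / (2 * (val p f + d * e / 2))"
  have pos: "0 < val p f + d * e / 2" using val_nonneg[OF p(1) f] d p(2) by (simp add: add_nonneg_pos)
  have k: "0 < k" using pos p(2) by (simp add: k_def)
  have "val p (cscale (of_real k) f) = k * val p f" using val_homogeneous[OF p(1) f] k by simp
  also have "... < k * (2 * (val p f + d * e / 2))" using k pos val_nonneg[OF p(1) f] d p(2) by (intro mult_strict_left_mono) (auto intro: add_nonneg_pos)
  also have "... = e" using pos by (simp add: k_def)
  finally have "cscale (of_real k) f \<in> {g \<in> X. val p (g - 0) < e}" using f by (simp add: Xc)
  hence "cmod (S (cscale (of_real k) f)) < 1" using p(3) by (auto simp: dist_norm)
  hence "k * cmod (S f) < 1" using hom[OF f] k by (simp add: norm_mult)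
  hence "cmod (S f) < 1 / k" using k by (simp add: pos_less_divide_eq mult.commute)
  also have "1 / k = 2 / e * val p f + d" using p(2) by (simp add: k_def field_simps)
  finally show "cmod (S f) <= 2 / e * val p f + d" by simp
 qed
 thus "\<exists>p\<in>P. EX C. \<forall>f\<in>X. cmod (S f) <= C * val p f" using p(1) by blast
next
 assume "\<exists>p\<in>P. EX C. \<forall>f\<in>X. cmod (S f) <= C * val p f"
 then obtain p C where p: "p \<in> P" "!!f. f \<in> X ==> cmod (S f) <= C * val p f" by blast
 show "continuous_map (seminorm_topology X P) (euclidean :: complex topology) S"
  unfolding continuous_map_def topspace_eq
 proof (intro conjI allI impI)
  fix V :: "complex set" assume "openin euclidean V"
  hence V: "open V" by simp
  show "openin (seminorm_topology X P) {f \<in> X. S f \<in> V}"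
  proof (subst openin_subopen, intro ballI)
   fix f assume f: "f \<in> {f \<in> X. S f \<in> V}"
   then obtain r where r: "0 < r" "ball (S f) r \<subseteq> V" using V by (auto elim: openE)
   let ?B = "{g \<in> X. val p (g - f) < r / (abs C + 1)}"
   have "S g \<in> V" if g: "g \<in> ?B" for g
   proof -
    have "S (g - f) = S g - S f"
    proof -
     have "S g = S ((g - f) + f)" by simp
     also have "... = S (g - f) + S f" by (rule add) (use f g in \<open>auto intro: Xc\<close>)
     finally show ?thesis by simp
    qed
    hence "cmod (S g - S f) <= C * val p (g - f)" using p(2)[of "g - f"] f g by (simp add: Xc)
    also have "... <= (abs C + 1) * val p (g - f)" using val_nonneg[OF p(1), of "g - f"] f g by (intro mult_right_mono) (auto simp: Xc)
    also have "... < r" using g by (simp add: pos_less_divide_eq mult.commute)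
    finally show ?thesis using r(2) by (auto simp: dist_norm norm_minus_commute)
   qed
   moreover have "f \<in> ?B" using f r(1) val_0[OF p(1)] by (simp add: divide_pos_pos add_nonneg_pos)
   moreover have "openin (seminorm_topology X P) ?B" using f r(1) p(1) by (intro open_ball) (auto simp: divide_pos_pos add_nonneg_pos)
   ultimately show "EX T. openin (seminorm_topology X P) T & f \<in> T & T \<subseteq> {f \<in> X. S f \<in> V}" by (intro exI[of _ ?B]) auto
  qed
 qed auto
qed

lemma separation:
 assumes Y: "cfun.subspace Y" "Y \<subseteq> X" and f: "f \<in> X" "f \<notin> (seminorm_topology X P) closure_of Y"
 shows "EX S. (\<forall>f\<in>X. \<forall>g\<in>X. S (f + g) = S f + S g) & (ALL s. \<forall>f\<in>X. S (cscale s f) = s * S f)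
  & continuous_map (seminorm_topology X P) (euclidean :: complex topology) S & (\<forall>y\<in>Y. S y = 0) & S f ~= 0"
proof -
 obtain U where U: "openin (seminorm_topology X P) U" "f \<in> U" "!!y. y \<in> Y ==> y \<notin> U"
  using f unfolding in_closure_of topspace_eq by metis
 then obtain p e where p: "p \<in> P" "0 < e" "{g \<in> X. val p (g - f) < e} \<subseteq> U" using contains_ball[OF U(1,2)] by (elim bexE exE conjE)
 have far: "1 <= val p (f - y) / e" if y: "y \<in> Y" for y
 proof -
  have yX: "y \<in> X" using y Y by auto
  have "y \<notin> {g \<in> X. val p (g - f) < e}" using U(3)[OF y] p(3) by (rule contra_subsetD[rotated])
  moreover have "val p (f - y) = val p (y - f)"
  proof -
   have "f - y = cscale (-1) (y - f)" by (simp add: cscale_def fun_eq_iff)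
   thus ?thesis using val_homogeneous[OF p(1) Xc(5)[OF yX f(1)], of "-1"] by simp
  qed
  ultimately show ?thesis using yX p(2) by simp
 qed
 show ?thesis
 proof (rule Hahn_Banach_separation[OF X, of "%f. val p f / e" Y f])
  show "val p (g + h) / e <= val p g / e + val p h / e" if "g \<in> X" "h \<in> X" for g h
   using val_triangle[OF p(1) that] p(2) by (simp add: divide_right_mono flip: add_divide_distrib)
  show "val p (cscale s g) / e = cmod s * (val p g / e)" if "g \<in> X" for g s
   using val_homogeneous[OF p(1) that] by simp
  fix S assume S: "!!g h. g \<in> X ==> h \<in> X ==> S (g + h) = S g + S h" "!!g s. g \<in> X ==> S (cscale s g) = s * S g"
   "!!g. g \<in> X ==> cmod (S g) <= 2 * (val p g / e)" "!!y. y \<in> Y ==> S y = 0" "S f ~= 0"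
  have "\<exists>p\<in>P. EX C. \<forall>f\<in>X. cmod (S f) <= C * val p f" using S(3) p(1) by (intro bexI[of _ p] exI[of _ "2 / e"]) auto
  hence "continuous_map (seminorm_topology X P) (euclidean :: complex topology) S"
   using continuous_iff[of S] S(1,2) by blast
  thus ?thesis using S by (intro exI[of _ S]) simp
 qed (use Y f far in auto)
qed

end

text \<open>The conditions speak only of upper bounds \<open>p f <= ereal A\<close>: a semi-norm
  defined by a supremum is most easily handled through them.\<close>

lemma seminormed_spaceI:
 fixes X :: "('x => complex) set"
 assumes X: "cfun.subspace X" and ne: "P ~= {}" and nonneg: "!!p f. p \<in> P ==> 0 <= p f"
  and fin: "!!p f. p \<in> P ==> f \<in> X ==> EX B. p f <= ereal B"
  and add: "!!p f g A B. p \<in> P ==> f \<in> X ==> g \<in> X ==> p f <= ereal A ==> p g <= ereal B ==> p (f + g) <= ereal (A + B)"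
  and scale: "!!p f s A. p \<in> P ==> f \<in> X ==> p f <= ereal A ==> p (cscale s f) <= ereal (cmod s * A)"
  and directed: "!!p1 p2. p1 \<in> P ==> p2 \<in> P ==> \<exists>p\<in>P. \<forall>f\<in>X. p1 f <= p f & p2 f <= p f"
 shows "seminormed_space X P"
proof
 fix p f assume p: "p \<in> P" and f: "f \<in> X"
 have e: "EX x>=0. p h = ereal x" if "h \<in> X" for h
  using fin[OF p that] nonneg[OF p, of h] by (cases "p h") auto
 obtain x where x: "0 <= x" "p f = ereal x" using e[OF f] by (elim exE conjE)
 thus "0 <= p f & p f < \<infinity>" by simp
 show "p (f + g) <= p f + p g" if g: "g \<in> X" for g
 proof -
  obtain y where "p g = ereal y" using e[OF g] by (elim exE conjE)
  thus ?thesis using add[OF p f g, of x y] x by simp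
 qed
 have sX: "cscale s f \<in> X" for s using X f by (rule cfun.subspace_scale)
 show "p (cscale s f) = ereal (cmod s) * p f" for s
 proof (cases "s = 0")
  case True
  hence "p (cscale s f) <= 0" using scale[OF p f, of x s] x by (simp add: zero_ereal_def)
  hence "p (cscale s f) = 0" using nonneg[OF p] by (rule antisym)
  thus ?thesis using True x by (simp add: zero_ereal_def)
 next
  case False
  obtain y where y: "p (cscale s f) = ereal y" using e[OF sX[of s]] by (elim exE conjE)
  have "p (cscale (1 / s) (cscale s f)) <= ereal (cmod (1 / s) * y)" by (rule scale[OF p sX]) (simp add: y)
  hence "x <= cmod (1 / s) * y" using False x by simp
  hence "cmod s * x <= y" using False by (simp add: norm_divide pos_le_divide_eq mult.commute)
  moreover have "y <= cmod s * x" using scale[OF p f, of x s] x y by simp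
  ultimately show ?thesis using x y by simp
 qed
qed (use assms in auto)

section \<open>Ultradifferentiable functions and their dual, through explicit bounds\<close>

context Ua_space
begin

abbreviation Om :: "real set" where "Om \<equiv> sym_ival a"
abbreviation dual :: "((real => complex) => complex) set" where "dual \<equiv> Ua_dual om a c"
abbreviation Dn :: "nat => (real => complex) => real => complex" where "Dn j f \<equiv> (Diff a ^^ j) f"
abbreviation U :: "(real => complex) set" where "U \<equiv> Ua om a c"

text \<open>Arbitrary radii of compact subintervals replace the sequence \<open>c\<close>. Since
  \<open>c\<close> tends to \<open>a\<close> and the bounds are monotone in the radius, space and
  dual stay the same, see \<open>Ua_iff\<close> and \<open>dual_iff\<close>.\<close>

definition inrad :: "real => bool" where "inrad b \<longleftrightarrow> 0 < b & ereal b < a"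

lemma Om_iff: "t \<in> Om \<longleftrightarrow> ereal (abs t) < a" by (simp add: sym_ival_def)

lemma Om_mono: "t \<in> Om ==> abs u <= abs t ==> u \<in> Om"
 unfolding Om_iff by (meson ereal_less_eq(3) order_le_less_trans)

lemma Om_inner: "inrad b ==> abs t <= b ==> t \<in> Om"
 unfolding Om_iff inrad_def by (meson ereal_less_eq(3) order_le_less_trans)

lemma zero_in_Om: "0 \<in> Om" using a_pos by (simp add: Om_iff zero_ereal_def)

lemma inrad_above:
 assumes "t \<in> Om"
 obtains b where "inrad b" "abs t < b"
proof -
 obtain b where "ereal (abs t) < ereal b" "ereal b < a"
  using assms ereal_dense2[of "ereal (abs t)" a] unfolding Om_iff by blast
 thus ?thesis using that[of b] by (auto simp: inrad_def)
qed

lemma inrad_c: "inrad (c k)" using c_pos c_less by (simp add: inrad_def)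

lemma inrad_le_c:
 assumes "inrad b"
 obtains k where "b <= c k"
proof -
 have "eventually (%k. ereal b < ereal (c k)) sequentially"
  using c_lim assms unfolding inrad_def by (intro order_tendstoD(1)) auto
 thus ?thesis using that by (auto simp: eventually_sequentially) (meson le_refl less_imp_le)
qed

lemma open_Om: "open Om"
proof (rule openI)
 fix t assume "t \<in> Om"
 then obtain b where b: "inrad b" "abs t < b" by (rule inrad_above)
 have "ball t (b - abs t) \<subseteq> Om" using Om_inner[OF b(1)] by (auto simp: dist_real_def)
 thus "EX e>0. ball t e \<subseteq> Om" using b(2) by (intro exI[of _ "b - abs t"]) auto
qed

lemma interval_Om: "s \<in> Om ==> t \<in> Om ==> {s..t} \<subseteq> Om"
proof
 fix u assume "s \<in> Om" "t \<in> Om" "u \<in> {s..t}"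
 thus "u \<in> Om" using Om_mono[of s u] Om_mono[of t u] by (cases "0 <= u") (auto simp: abs_le_iff)
qed

text \<open>All candidate derivatives are given at once; \<open>Dn_cut\<close> then identifies them
  with the iterated derivatives, so that smoothness need not be shown order by order.\<close>

definition jet :: "(nat => real => complex) => bool" where
 "jet H \<longleftrightarrow> (ALL j. \<forall>t\<in>Om. (H j has_vector_derivative H (Suc j) t) (at t))"

definition cut :: "(real => complex) => real => complex" where "cut h = (%t. if t \<in> Om then h t else 0)"

lemma cut_derivative: "t \<in> Om ==> (h has_vector_derivative h') (at t) ==> (cut h has_vector_derivative h') (at t)"
 by (rule has_vector_derivative_transform_within_open[OF _ open_Om]) (auto simp: cut_def)

lemma Dn_cut: "jet H ==> Dn j (cut (H 0)) = cut (H j)"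
proof (induction j)
 case (Suc j)
 have "Diff a (cut (H j)) = cut (H (Suc j))"
 proof
  fix t
  have "(cut (H j) has_vector_derivative H (Suc j) t) (at t)" if "t \<in> Om"
   using Suc.prems that unfolding jet_def by (intro cut_derivative) auto
  thus "Diff a (cut (H j)) t = cut (H (Suc j)) t"
   by (simp add: Diff_def cut_def vector_derivative_at)
 qed
 thus ?case using Suc by simp
qed simp

lemma cut_Cinf:
 assumes "jet H"
 shows "cut (H 0) \<in> Cinf a"
proof -
 have "(cut (H j)) differentiable (at t)" if "t \<in> Om" for j t
  using cut_derivative[OF that, of "H j" "H (Suc j) t"] assms that unfolding jet_def
  by (meson differentiableI_vector)
 thus ?thesis unfolding Cinf_def using Dn_cut[OF assms] by (auto simp: cut_def)
qed

lemma Cinf_jet: "f \<in> Cinf a ==> jet (%j. Dn j f)"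
 unfolding jet_def Cinf_def by (auto simp: Diff_def vector_derivative_works)

lemma Cinf_cut: "f \<in> Cinf a ==> f = cut f"
 unfolding Cinf_def cut_def by auto

lemma Dn_outside: "f \<in> Cinf a ==> t \<notin> Om ==> Dn j f t = 0"
 using Dn_cut[OF Cinf_jet, of f j] Cinf_cut[of f] by (simp add: cut_def) metis

lemma jet_add: "jet H ==> jet G ==> jet (%j t. H j t + G j t)"
 unfolding jet_def by (auto intro!: derivative_intros)
lemma jet_scale: "jet H ==> jet (%j t. s * H j t)"
 unfolding jet_def by (auto intro!: has_vector_derivative_mult_right)

lemma Cinf_add: "f \<in> Cinf a ==> g \<in> Cinf a ==> f + g \<in> Cinf a & Dn j (f + g) = Dn j f + Dn j g"
proof -
 assume f: "f \<in> Cinf a" and g: "g \<in> Cinf a"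
 note J = jet_add[OF Cinf_jet[OF f] Cinf_jet[OF g]]
 have "cut (%t. f t + g t) = f + g" using f g by (auto simp: cut_def fun_eq_iff Cinf_def)
 moreover have "cut (%t. Dn j f t + Dn j g t) = Dn j f + Dn j g" using Dn_outside f g by (auto simp: cut_def fun_eq_iff)
 ultimately show ?thesis using cut_Cinf[OF J] Dn_cut[OF J, of j] by simp
qed

lemma Cinf_scale: "f \<in> Cinf a ==> cscale s f \<in> Cinf a & Dn j (cscale s f) = cscale s (Dn j f)"
proof -
 assume f: "f \<in> Cinf a"
 note J = jet_scale[OF Cinf_jet[OF f], of s]
 have "cut (%t. s * f t) = cscale s f" using f by (auto simp: cut_def fun_eq_iff Cinf_def cscale_def)
 moreover have "cut (%t. s * Dn j f t) = cscale s (Dn j f)" using Dn_outside f by (auto simp: cut_def fun_eq_iff cscale_def)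
 ultimately show ?thesis using cut_Cinf[OF J] Dn_cut[OF J, of j] by simp
qed

text \<open>By \<open>seminorm_le_iff\<close> this says that a semi-norm is at most
  \<open>B\<close>, in terms of real numbers and for an arbitrary radius.\<close>

definition nb :: "real => real => (real => complex) => real => bool" where
 "nb q b f B \<longleftrightarrow> (ALL j t. abs t <= b --> cmod (Dn j f t) <= B * M q j)"

lemma nbD: "nb q b f B ==> abs t <= b ==> cmod (Dn j f t) <= B * M q j" by (simp add: nb_def)

lemma nb_nonneg: assumes "nb q b f B" "0 <= b" shows "0 <= B"
proof -
 have "0 <= B * M q 0" using nbD[OF assms(1), of 0 0] assms(2) norm_ge_zero order_trans by (metis abs_zero)
 thus ?thesis using M_pos[of q 0] by (auto simp: zero_le_mult_iff)
qed

lemma nb_mono: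
 assumes "nb q b f B" "0 < p" "p <= q" "0 <= b'" "b' <= b" "B <= B'"
 shows "nb p b' f B'"
 unfolding nb_def
proof (intro allI impI)
 fix j t assume t: "abs t <= b'"
 have "cmod (Dn j f t) <= B * M q j" using nbD[OF assms(1)] t assms(5) by simp
 also have "... <= B' * M p j" using M_antimono[OF assms(2,3)] assms(6) nb_nonneg[OF assms(1)] assms(4,5) by (intro mult_mono) auto
 finally show "cmod (Dn j f t) <= B' * M p j" .
qed

lemma nb_add:
 assumes "nb q b f A" "nb q b g B" "f \<in> Cinf a" "g \<in> Cinf a"
 shows "nb q b (f + g) (A + B)"
 unfolding nb_def
proof (intro allI impI)
 fix j t assume t: "abs t <= b"
 have "cmod (Dn j (f + g) t) <= cmod (Dn j f t) + cmod (Dn j g t)" using Cinf_add[OF assms(3,4), of j] by (simp add: norm_triangle_ineq)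
 thus "cmod (Dn j (f + g) t) <= (A + B) * M q j" using nbD[OF assms(1) t, of j] nbD[OF assms(2) t, of j] by (simp add: distrib_right)
qed

lemma nb_scale:
 assumes "nb q b f A" "f \<in> Cinf a"
 shows "nb q b (cscale s f) (cmod s * A)"
 using assms(1) Cinf_scale[OF assms(2), of s] unfolding nb_def by (simp add: cscale_def norm_mult mult_left_mono mult.assoc)

lemma seminorm_le_iff: "0 < q ==> Ua_seminorm om a c q k f <= ereal B \<longleftrightarrow> nb q (c k) f B"
proof -
 have "cmod (Dn j f t) * exp (- q * young_conj om (real j / q)) <= B \<longleftrightarrow> cmod (Dn j f t) <= B * M q j" for j t
  by (simp add: M_def exp_minus field_simps)
 thus ?thesis unfolding Ua_seminorm_def nb_def SUP_le_iff by (auto simp: abs_le_iff)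
qed

lemma seminorm_nonneg: "0 <= Ua_seminorm om a c q k f"
proof -
 have "0 <= ereal (cmod (Dn 0 f 0) * exp (- q * young_conj om (real 0 / q)))" by simp
 also have "... <= Ua_seminorm om a c q k f" unfolding Ua_seminorm_def using c_pos[of k] by (intro SUP_upper2[of 0] SUP_upper) auto
 finally show ?thesis .
qed

lemma seminorm_finite_iff: "0 < q ==> Ua_seminorm om a c q k f < \<infinity> \<longleftrightarrow> (EX B. nb q (c k) f B)"
 using seminorm_le_iff[of q k f] seminorm_nonneg[of q k f]
 by (metis ereal_infty_less(1) PInfty_neq_ereal(1) ereal_cases order_refl ereal_less_PInfty less_ereal.simps(3) not_le order_le_less_trans MInfty_neq_PInfty(1))

lemma Ua_iff: "f \<in> U \<longleftrightarrow> f \<in> Cinf a & (ALL q b. 0 < q & q < 1 & inrad b --> (EX B. nb q b f B))"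
proof -
 have "(ALL q k. 0 < q & q < 1 --> (EX B. nb q (c k) f B)) \<longleftrightarrow> (ALL q b. 0 < q & q < 1 & inrad b --> (EX B. nb q b f B))"
 proof (intro iffI allI impI)
  fix q b :: real assume H: "ALL q k. 0 < q & q < 1 --> (EX B. nb q (c k) f B)" and qb: "0 < q & q < 1 & inrad b"
  obtain k where k: "b <= c k" using inrad_le_c qb by blast
  obtain B where "nb q (c k) f B" using H qb by blast
  thus "EX B. nb q b f B" using k qb nb_mono[of q "c k" f B q b B] unfolding inrad_def by auto
 qed (use inrad_c in blast)
 thus ?thesis unfolding Ua_def using seminorm_finite_iff by auto
qed

lemma Ua_Cinf: "f \<in> U ==> f \<in> Cinf a" by (simp add: Ua_iff)
lemma Ua_nb: "f \<in> U ==> 0 < q ==> q < 1 ==> inrad b ==> EX B. nb q b f B" by (simp add: Ua_iff)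

lemma Ua_add: "f \<in> U ==> g \<in> U ==> f + g \<in> U"
 unfolding Ua_iff using nb_add Cinf_add by meson

lemma Ua_scale: "f \<in> U ==> cscale s f \<in> U"
 unfolding Ua_iff using nb_scale Cinf_scale by meson

lemma Ua_0: "0 \<in> U"
proof -
 have J: "jet (%j t. 0)" by (simp add: jet_def)
 have "cut (%t. 0) = 0" by (simp add: cut_def fun_eq_iff)
 hence "0 \<in> Cinf a" "Dn j 0 = 0" for j using cut_Cinf[OF J] Dn_cut[OF J, of j] by simp_all
 thus ?thesis unfolding Ua_iff nb_def by (auto intro!: exI[of _ 0])
qed

lemma subspace_Ua: "cfun.subspace U"
 using Ua_0 Ua_add Ua_scale by (simp add: cfun.subspace_def)

lemma Ua_minus: "f \<in> U ==> g \<in> U ==> f - g \<in> U"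
 by (rule cfun.subspace_diff[OF subspace_Ua])

definition lin :: "((real => complex) => complex) => bool" where
 "lin S \<longleftrightarrow> (\<forall>f\<in>U. \<forall>g\<in>U. S (f + g) = S f + S g) & (ALL s. \<forall>f\<in>U. S (cscale s f) = s * S f)"

lemma lin_add: "lin S ==> f \<in> U ==> g \<in> U ==> S (f + g) = S f + S g"
 and lin_scale: "lin S ==> f \<in> U ==> S (cscale s f) = s * S f" by (auto simp: lin_def)

lemma lin_minus: "lin S ==> f \<in> U ==> g \<in> U ==> S (f - g) = S f - S g"
 using lin_add[of S "f - g" g] Ua_minus[of f g] by simp

text \<open>Continuity with its constant kept explicit, because later estimates have to be uniform
  over a family of functionals.\<close>

definition bdd :: "((real => complex) => complex) => real => real => real => bool" where
 "bdd S q b C \<longleftrightarrow> (\<forall>f\<in>U. ALL B. nb q b f B --> cmod (S f) <= C * B)"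

lemma bddD: "bdd S q b C ==> f \<in> U ==> nb q b f B ==> cmod (S f) <= C * B" by (simp add: bdd_def)

lemma bdd_mono:
 assumes "bdd S q b C" "0 < q" "q <= q'" "0 <= b" "b <= b'" "C <= C'"
 shows "bdd S q' b' C'"
 unfolding bdd_def
proof (intro ballI allI impI)
 fix f B assume f: "f \<in> U" and n: "nb q' b' f B"
 have "nb q b f B" using nb_mono[OF n] assms by simp
 hence "cmod (S f) <= C * B" using assms(1) f by (simp add: bdd_def)
 also have "... <= C' * B" using assms nb_nonneg[OF n] by (intro mult_right_mono) auto
 finally show "cmod (S f) <= C' * B" .
qed

lemma seminormed: "seminormed_space U {Ua_seminorm om a c q k |q k. 0 < q & q < 1}" (is "seminormed_space _ ?P")
proof (rule seminormed_spaceI[OF subspace_Ua])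
 have "Ua_seminorm om a c (1/2) 0 \<in> ?P" by (intro CollectI exI[of _ "1/2"] exI[of _ 0]) simp
 thus "?P ~= {}" by auto
 fix p f assume "p \<in> ?P"
 then obtain q k where q: "p = Ua_seminorm om a c q k" "0 < q" "q < 1" by blast
 note le = seminorm_le_iff[OF q(2), of k]
 show "0 <= p f" unfolding q(1) by (rule seminorm_nonneg)
 assume f: "f \<in> U"
 show "EX B. p f <= ereal B" unfolding q(1) le by (rule Ua_nb[OF f q(2,3) inrad_c])
 show "p (f + g) <= ereal (A + B)" if "g \<in> U" "p f <= ereal A" "p g <= ereal B" for g A B
  using that(2,3) unfolding q(1) le by (rule nb_add[OF _ _ Ua_Cinf[OF f] Ua_Cinf[OF that(1)]])
 show "p (cscale s f) <= ereal (cmod s * A)" if "p f <= ereal A" for s A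
  using that unfolding q(1) le by (rule nb_scale[OF _ Ua_Cinf[OF f]])
next
 fix p1 p2 assume "p1 \<in> {Ua_seminorm om a c q k |q k. 0 < q & q < 1}" "p2 \<in> {Ua_seminorm om a c q k |q k. 0 < q & q < 1}"
 then obtain q1 k1 q2 k2 where 1: "p1 = Ua_seminorm om a c q1 k1" "0 < q1" "q1 < 1" and 2: "p2 = Ua_seminorm om a c q2 k2" "0 < q2" "q2 < 1" by blast
 have le: "Ua_seminorm om a c q1 k1 f <= Ua_seminorm om a c q k f" if f: "f \<in> U" and "0 < q1" "q1 <= q" "k1 <= k" "q < 1" for q1 k1 q k f
 proof -
  have q: "0 < q" using that by simp
  obtain B where B: "nb q (c k) f B" using Ua_nb[OF f q \<open>q < 1\<close> inrad_c] by blast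
  hence fin: "Ua_seminorm om a c q k f < \<infinity>" using seminorm_finite_iff[OF q] by blast
  obtain B where B: "Ua_seminorm om a c q k f = ereal B" using fin seminorm_nonneg[of q k f] by (cases "Ua_seminorm om a c q k f") auto
  hence n: "nb q (c k) f B" using seminorm_le_iff[OF q, of k f B] by simp
  have "c k1 <= c k" using c_inc \<open>k1 <= k\<close> by (rule incseqD)
  from nb_mono[OF n \<open>0 < q1\<close> \<open>q1 <= q\<close> less_imp_le[OF c_pos] this order_refl] have "nb q1 (c k1) f B" .
  thus ?thesis using seminorm_le_iff[OF \<open>0 < q1\<close>] B by simp
 qed
 show "\<exists>p\<in>{Ua_seminorm om a c q k |q k. 0 < q & q < 1}. \<forall>f\<in>U. p1 f <= p f & p2 f <= p f"
 proof (rule bexI[of _ "Ua_seminorm om a c (max q1 q2) (max k1 k2)"])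
  have "0 < max q1 q2" "max q1 q2 < 1" using 1 2 by auto
  thus "Ua_seminorm om a c (max q1 q2) (max k1 k2) \<in> {Ua_seminorm om a c q k |q k. 0 < q & q < 1}" by blast
  show "\<forall>f\<in>U. p1 f <= Ua_seminorm om a c (max q1 q2) (max k1 k2) f & p2 f <= Ua_seminorm om a c (max q1 q2) (max k1 k2) f"
   unfolding 1(1) 2(1) using 1 2 \<open>max q1 q2 < 1\<close> by (intro ballI conjI le) simp_all
 qed
qed

lemma dual_iff: "S \<in> dual \<longleftrightarrow> lin S & (EX q b C. 0 < q & q < 1 & inrad b & bdd S q b C)"
proof -
 interpret sn: seminormed_space U "{Ua_seminorm om a c q k |q k. 0 < q & q < 1}" by (rule seminormed)
 have "continuous_map (Ua_topology om a c) euclidean S \<longleftrightarrow> (EX q b C. 0 < q & q < 1 & inrad b & bdd S q b C)" if lin: "lin S"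
  unfolding Ua_topology_def
 proof (subst sn.continuous_iff)
  show "(\<exists>p\<in>{Ua_seminorm om a c q k |q k. 0 < q & q < 1}. EX C. \<forall>f\<in>U. cmod (S f) <= C * sn.val p f) \<longleftrightarrow> (EX q b C. 0 < q & q < 1 & inrad b & bdd S q b C)"
  proof
   assume "\<exists>p\<in>{Ua_seminorm om a c q k |q k. 0 < q & q < 1}. EX C. \<forall>f\<in>U. cmod (S f) <= C * sn.val p f"
   then obtain p q k C where q: "0 < q" "q < 1" and p: "p = Ua_seminorm om a c q k" and C': "\<forall>f\<in>U. cmod (S f) <= C * sn.val p f"
    by (elim bexE CollectE exE conjE)
   have C: "cmod (S f) <= C * sn.val (Ua_seminorm om a c q k) f" if "f \<in> U" for f using C' p that by simp
   have "bdd S q (c k) (abs C)" unfolding bdd_def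
   proof (intro ballI allI impI)
    fix f B assume f: "f \<in> U" and n: "nb q (c k) f B"
    let ?p = "Ua_seminorm om a c q k"
    have pP: "?p \<in> {Ua_seminorm om a c q k |q k. 0 < q & q < 1}" using q by (intro CollectI exI[of _ q] exI[of _ k]) simp
    have "ereal (sn.val ?p f) <= ereal B" using iffD2[OF seminorm_le_iff[OF q(1)] n] unfolding sn.val[OF pP f] .
    hence le: "sn.val ?p f <= B" by simp
    have "cmod (S f) <= abs C * sn.val ?p f" by (rule order_trans[OF C[OF f] mult_right_mono[OF abs_ge_self sn.val_nonneg[OF pP f]]])
    also have "... <= abs C * B" using le by (intro mult_left_mono) auto
    finally show "cmod (S f) <= abs C * B" .
   qed
   thus "EX q b C. 0 < q & q < 1 & inrad b & bdd S q b C" using q inrad_c by blast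
  next
   assume "EX q b C. 0 < q & q < 1 & inrad b & bdd S q b C"
   then obtain q b C where q: "0 < q" "q < 1" and b: "inrad b" and C: "bdd S q b C" by blast
   obtain k where k: "b <= c k" using inrad_le_c[OF b] .
   have C': "bdd S q (c k) C" using bdd_mono[OF C q(1) order_refl _ k order_refl] b by (simp add: inrad_def)
   let ?p = "Ua_seminorm om a c q k"
   have pP: "?p \<in> {Ua_seminorm om a c q k |q k. 0 < q & q < 1}" using q by (intro CollectI exI[of _ q] exI[of _ k]) simp
   have "cmod (S f) <= C * sn.val ?p f" if f: "f \<in> U" for f
   proof -
    have "Ua_seminorm om a c q k f <= ereal (sn.val ?p f)" unfolding sn.val[OF pP f] by (rule order_refl)
    hence "nb q (c k) f (sn.val ?p f)" by (rule iffD1[OF seminorm_le_iff[OF q(1)]])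
    thus ?thesis using bddD[OF C' f] by blast
   qed
   thus "\<exists>p\<in>{Ua_seminorm om a c q k |q k. 0 < q & q < 1}. EX C. \<forall>f\<in>U. cmod (S f) <= C * sn.val p f"
    using pP by (intro bexI[of _ ?p] exI[of _ C] ballI)
  qed
 qed (simp_all add: lin_add[OF lin] lin_scale[OF lin])
 moreover have "S \<in> dual \<longleftrightarrow> lin S & continuous_map (Ua_topology om a c) euclidean S"
  unfolding Ua_dual_def lin_def mem_Collect_eq by (simp only: conj_assoc)
 ultimately show ?thesis by (cases "lin S") simp_all
qed

lemma dualI: "lin S ==> bdd S q b C ==> 0 < q ==> q < 1 ==> inrad b ==> S \<in> dual"
 using dual_iff by blast

lemma dualE:
 assumes "S \<in> dual"
 obtains q b C where "lin S" "0 < q" "q < 1" "inrad b" "bdd S q b C" "0 <= C"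
proof -
 obtain q b C where q: "lin S" "0 < q" "q < 1" "inrad b" "bdd S q b C" using assms dual_iff by blast
 have "bdd S q b (abs C)" using q by (intro bdd_mono[OF q(5)]) (auto simp: inrad_def)
 thus ?thesis using that q by (meson abs_ge_zero)
qed

lemma Ua_separation:
 assumes "cfun.subspace Y" "Y \<subseteq> U" "f \<in> U" "f \<notin> Ua_topology om a c closure_of Y"
 shows "\<exists>S\<in>dual. (\<forall>y\<in>Y. S y = 0) & S f ~= 0"
 using seminormed_space.separation[OF seminormed assms(1-3)] assms(4) unfolding Ua_topology_def[symmetric] Ua_dual_def by auto

end

section \<open>Products, exponentials and the solution operator\<close>

lemma leibniz_sum:
 fixes x y :: "nat => complex"
 shows "(\<Sum>i\<le>n. of_nat (n choose i) * (x (Suc i) * y (n - i) + x i * y (Suc (n - i))))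
  = (\<Sum>i\<le>Suc n. of_nat (Suc n choose i) * (x i * y (Suc n - i)))"
proof -
 have "(\<Sum>i\<le>Suc n. of_nat (Suc n choose i) * (x i * y (Suc n - i)))
   = x 0 * y (Suc n) + (\<Sum>i\<le>n. of_nat (Suc n choose Suc i) * (x (Suc i) * y (n - i)))"
  by (subst sum.atMost_Suc_shift) simp
 also have "... = (\<Sum>i\<le>n. of_nat (n choose i) * (x (Suc i) * y (n - i))) + (x 0 * y (Suc n) + (\<Sum>i\<le>n. of_nat (n choose Suc i) * (x (Suc i) * y (n - i))))"
  by (simp add: sum.distrib algebra_simps)
 also have "x 0 * y (Suc n) + (\<Sum>i\<le>n. of_nat (n choose Suc i) * (x (Suc i) * y (n - i))) = (\<Sum>i\<le>Suc n. of_nat (n choose i) * (x i * y (Suc n - i)))"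
  by (subst sum.atMost_Suc_shift) simp
 also have "... = (\<Sum>i\<le>n. of_nat (n choose i) * (x i * y (Suc (n - i))))"
  by (simp add: Suc_diff_le binomial_eq_0)
 finally show ?thesis by (simp add: sum.distrib distrib_left)
qed

lemma vector_derivative_increment_bound:
 fixes g :: "real => complex"
 assumes "!!x. abs x <= b ==> (g has_vector_derivative g' x) (at x)" "!!x. abs x <= b ==> cmod (g' x) <= K" "abs t <= b"
 shows "cmod (g t - g 0) <= K * abs t"
proof -
 have "norm (g t - g 0) <= K * norm (t - 0)"
 proof (rule differentiable_bound[of "{-b..b}" g "%x h. h *\<^sub>R g' x" K])
  show "(g has_derivative (%h. h *\<^sub>R g' x)) (at x within {-b..b})" if "x \<in> {-b..b}" for x
   using assms(1)[of x] that by (auto simp: has_vector_derivative_def has_derivative_at_withinI abs_le_iff)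
  have "0 <= K" using assms(2)[of 0] assms(3) norm_ge_zero[of "g' 0"] by (smt (verit))
  show "onorm (%h. h *\<^sub>R g' x) <= K" if "x \<in> {-b..b}" for x
  proof (rule onorm_bound[OF \<open>0 <= K\<close>])
   have "cmod (g' x) <= K" using assms(2)[of x] that by (simp add: abs_le_iff)
   thus "norm (h *\<^sub>R g' x) <= K * norm h" for h by (simp add: mult.commute[of K] mult_left_mono)
  qed
 qed (use assms(3) in \<open>auto simp: abs_le_iff\<close>)
 thus ?thesis by simp
qed

lemma exp_iz_derivative:
 fixes w :: complex
 shows "((%t. exp (w * of_real t)) has_vector_derivative w * exp (w * of_real t)) (at t)"
 by (rule has_vector_derivative_real_field[of "%u. exp (w * u)"]) (auto intro!: derivative_eq_intros)

context Ua_space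
begin

lemma jet_mult: "jet H ==> jet G ==> jet (%j t. \<Sum>i\<le>j. of_nat (j choose i) * (H i t * G (j - i) t))"
 unfolding jet_def
proof (intro allI ballI)
 fix j t assume H: "ALL j. \<forall>t\<in>Om. (H j has_vector_derivative H (Suc j) t) (at t)"
  and G: "ALL j. \<forall>t\<in>Om. (G j has_vector_derivative G (Suc j) t) (at t)" and t: "t \<in> Om"
 have "((%t. \<Sum>i\<le>j. of_nat (j choose i) * (H i t * G (j - i) t)) has_vector_derivative
   (\<Sum>i\<le>j. of_nat (j choose i) * (H (Suc i) t * G (j - i) t + H i t * G (Suc (j - i)) t))) (at t)"
 proof (intro has_vector_derivative_sum has_vector_derivative_mult_right)
  fix i
  have "((%t. H i t * G (j - i) t) has_vector_derivative H i t * G (Suc (j - i)) t + H (Suc i) t * G (j - i) t) (at t)"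
   using H G t by (intro has_vector_derivative_mult) auto
  thus "((%t. H i t * G (j - i) t) has_vector_derivative H (Suc i) t * G (j - i) t + H i t * G (Suc (j - i)) t) (at t)"
   by (simp only: add.commute)
 qed
 thus "((%t. \<Sum>i\<le>j. of_nat (j choose i) * (H i t * G (j - i) t)) has_vector_derivative (\<Sum>i\<le>Suc j. of_nat (Suc j choose i) * (H i t * G (Suc j - i) t))) (at t)"
  by (simp only: leibniz_sum[of j "%i. H i t" "%i. G i t"])
qed

lemma Cinf_outside: "f \<in> Cinf a ==> t \<notin> Om ==> f t = 0" by (simp add: Cinf_def)

lemma Cinf_mult:
 assumes f: "f \<in> Cinf a" and g: "g \<in> Cinf a"
 shows "f * g \<in> Cinf a" "Dn j (f * g) t = (\<Sum>i\<le>j. of_nat (j choose i) * (Dn i f t * Dn (j - i) g t))"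
proof -
 note J = jet_mult[OF Cinf_jet[OF f] Cinf_jet[OF g]]
 have e: "cut (%t. \<Sum>i\<le>0. of_nat (0 choose i) * (Dn i f t * Dn (0 - i) g t)) = f * g"
  using Cinf_outside[OF f] by (auto simp: cut_def fun_eq_iff)
 show "f * g \<in> Cinf a" using cut_Cinf[OF J] by (simp only: e)
 show "Dn j (f * g) t = (\<Sum>i\<le>j. of_nat (j choose i) * (Dn i f t * Dn (j - i) g t))"
  using fun_cong[OF Dn_cut[OF J, of j], of t] Dn_outside[OF f] unfolding e by (auto simp: cut_def)
qed

text \<open>Stated at a single point \<open>t\<close>, because in \<open>FL_supp_bound\<close> one
  factor is bounded suitably on a part of the interval only.\<close>

lemma mult_bound:
 assumes "0 < p" "p < q"
 shows "EX C>0. ALL f g A B t j. f \<in> Cinf a --> g \<in> Cinf a --> (ALL i. cmod (Dn i f t) <= A * M q i)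
  --> (ALL i. cmod (Dn i g t) <= B * M q i) --> cmod (Dn j (f * g) t) <= C * A * B * M p j"
proof -
 obtain C where C: "0 < C" "!!j. (\<Sum>i\<le>j. real (j choose i) * (M q i * M q (j - i))) <= C * M p j" using M_convolution[OF assms] by blast
 have "cmod (Dn j (f * g) t) <= C * A * B * M p j" if f: "f \<in> Cinf a" and g: "g \<in> Cinf a"
  and A: "!!i. cmod (Dn i f t) <= A * M q i" and B: "!!i. cmod (Dn i g t) <= B * M q i" for f g A B t j
 proof -
  have A0: "0 <= A" using order_trans[OF norm_ge_zero A[of 0]] M_pos[of q 0] by (auto simp: zero_le_mult_iff)
  have B0: "0 <= B" using order_trans[OF norm_ge_zero B[of 0]] M_pos[of q 0] by (auto simp: zero_le_mult_iff)
  have "cmod (Dn j (f * g) t) <= (\<Sum>i\<le>j. real (j choose i) * (cmod (Dn i f t) * cmod (Dn (j - i) g t)))"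
   unfolding Cinf_mult(2)[OF f g] by (rule order_trans[OF norm_sum]) (simp add: norm_mult)
  also have "... <= (\<Sum>i\<le>j. real (j choose i) * ((A * M q i) * (B * M q (j - i))))"
   using A0 by (intro sum_mono mult_left_mono mult_mono A B) auto
  also have "... = A * B * (\<Sum>i\<le>j. real (j choose i) * (M q i * M q (j - i)))"
   by (simp add: sum_distrib_left mult_ac)
  also have "... <= A * B * (C * M p j)" using A0 B0 by (intro mult_left_mono C(2)) auto
  finally show ?thesis by (simp only: mult_ac)
 qed
 thus ?thesis using C(1) by (intro exI[of _ C] conjI allI impI) simp_all
qed

lemma nb_mult:
 assumes "0 < p" "p < q"
 shows "EX C>0. ALL f g A B b. f \<in> Cinf a --> g \<in> Cinf a --> nb q b f A --> nb q b g B --> nb p b (f * g) (C * A * B)"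
proof -
 from mult_bound[OF assms] obtain C where C: "0 < C" "ALL f g A B t j. f \<in> Cinf a --> g \<in> Cinf a --> (ALL i. cmod (Dn i f t) <= A * M q i)
  --> (ALL i. cmod (Dn i g t) <= B * M q i) --> cmod (Dn j (f * g) t) <= C * A * B * M p j" by (elim exE conjE)
 have "nb p b (f * g) (C * A * B)" if "f \<in> Cinf a" "g \<in> Cinf a" "nb q b f A" "nb q b g B" for f g A B b
  unfolding nb_def using that by (intro allI impI C(2)[rule_format]) (simp_all add: nbD)
 thus ?thesis using C(1) by (intro exI[of _ C] conjI allI impI) simp_all
qed

lemma Ua_mult: assumes f: "f \<in> U" and g: "g \<in> U" shows "f * g \<in> U"
 unfolding Ua_iff
proof (intro conjI allI impI)
 show "f * g \<in> Cinf a" using Cinf_mult(1) f g Ua_Cinf by blast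
 fix q b :: real assume q: "0 < q & q < 1 & inrad b"
 then obtain q' where q': "q < q'" "q' < 1" using dense by blast
 have "0 < q" "0 < q'" using q q' by auto
 obtain A B where "nb q' b f A" "nb q' b g B" using Ua_nb[OF f \<open>0 < q'\<close> q'(2)] Ua_nb[OF g \<open>0 < q'\<close> q'(2)] q by blast
 moreover from nb_mult[OF \<open>0 < q\<close> q'(1)] obtain C where "ALL f g A B b. f \<in> Cinf a --> g \<in> Cinf a --> nb q' b f A --> nb q' b g B --> nb q b (f * g) (C * A * B)"
  by (elim exE conjE)
 ultimately show "EX B. nb q b (f * g) B" using Ua_Cinf[OF f] Ua_Cinf[OF g] by (intro exI[of _ "C * A * B"]) simp
qed

abbreviation em :: "nat => complex => real => complex" where "em \<equiv> exp_monomial a"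
abbreviation ez :: "complex => real => complex" where "ez \<equiv> exp_monomial a 0"

lemma ez_cut: "ez z = cut (%t. exp (- \<i> * z * of_real t))"
 by (auto simp: exp_monomial_def cut_def)

lemma ez_jet: "jet (%j t. (- \<i> * z)^j * exp (- \<i> * z * of_real t))"
 unfolding jet_def
proof (intro allI ballI)
 fix j t
 show "((%t. (- \<i> * z)^j * exp (- \<i> * z * of_real t)) has_vector_derivative (- \<i> * z)^Suc j * exp (- \<i> * z * of_real t)) (at t)"
  by (rule has_vector_derivative_eq_rhs[OF has_vector_derivative_mult_right[OF exp_iz_derivative]]) (simp add: mult_ac)
qed

lemma ez_Cinf: "ez z \<in> Cinf a" and Dn_ez: "t \<in> Om ==> Dn j (ez z) t = (- \<i> * z)^j * exp (- \<i> * z * of_real t)"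
 using cut_Cinf[OF ez_jet, of z] Dn_cut[OF ez_jet[of z], of j] unfolding ez_cut power_0 mult_1_left by (simp, simp add: cut_def)

lemma norm_exp_iz: "cmod (exp (- \<i> * z * of_real t)) = exp (t * Im z)" by (simp add: mult.commute)

lemma ez_bound:
 assumes q: "0 < q" "q <= 1"
 shows "cmod (Dn j (ez z) t) <= (exp (om 1) * exp (q * om (cmod z)) * exp (t * Im z)) * M q j"
proof (cases "t \<in> Om")
 case True
 have "cmod (Dn j (ez z) t) = cmod z ^ j * exp (t * Im z)" unfolding Dn_ez[OF True] by (simp add: norm_mult norm_power mult.commute)
 also have "... <= (exp (om 1) * M q j * exp (q * om (cmod z))) * exp (t * Im z)" by (intro mult_right_mono power_le_M[OF q]) auto
 finally show ?thesis by (simp only: mult_ac)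
qed (simp add: Dn_outside[OF ez_Cinf])

lemma ez_nb:
 assumes q: "0 < q" "q <= 1" and b: "0 <= b"
 shows "nb q b (ez z) (exp (om 1) * exp (q * om (cmod z) + b * abs (Im z)))"
 unfolding nb_def
proof (intro allI impI)
 fix j t assume t: "abs t <= b"
 have "t * Im z <= abs t * abs (Im z)" using abs_ge_self[of "t * Im z"] by (simp add: abs_mult)
 also have "... <= b * abs (Im z)" using t by (intro mult_right_mono) auto
 finally have "exp (om 1) * exp (q * om (cmod z)) * exp (t * Im z) <= exp (om 1) * exp (q * om (cmod z) + b * abs (Im z))"
  by (simp add: exp_add)
 thus "cmod (Dn j (ez z) t) <= exp (om 1) * exp (q * om (cmod z) + b * abs (Im z)) * M q j"
  using ez_bound[OF q, of j z t] mult_right_mono[of _ _ "M q j"] by (meson M_nonneg order_trans)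
qed

lemma ez_U: "ez z \<in> U"
 unfolding Ua_iff using ez_Cinf ez_nb by (metis inrad_def less_imp_le)

definition FL :: "((real => complex) => complex) => complex => complex" where "FL S z = S (ez z)"

lemma FL_bound:
 assumes "bdd S q b C" "0 < q" "q <= 1" "0 <= b"
 shows "cmod (FL S z) <= C * exp (om 1) * exp (q * om (cmod z) + b * abs (Im z))"
 using bddD[OF assms(1) ez_U ez_nb[OF assms(2-4)], of z] by (simp add: FL_def mult.assoc)

text \<open>\<^term>\<open>res z\<close> inverts \<^term>\<open>D + \<i> * z\<close> with value \<open>0\<close> at the origin.\<close>

definition res :: "complex => (real => complex) => real => complex" where
 "res z f = cut (%t. exp (- \<i> * z * of_real t) * (LBINT s=0..t. exp (\<i> * z * of_real s) * f s))"

lemma Cinf_derivative: "f \<in> Cinf a ==> t \<in> Om ==> (Dn j f has_vector_derivative Dn (Suc j) f t) (at t)"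
 using Cinf_jet unfolding jet_def by blast

lemma Cinf_continuous: "f \<in> Cinf a ==> S \<subseteq> Om ==> continuous_on S (Dn j f)"
proof (rule continuous_at_imp_continuous_on, rule ballI)
 fix x assume "f \<in> Cinf a" "S \<subseteq> Om" "x \<in> S"
 hence "f \<in> Cinf a" "x \<in> Om" by auto
 from has_vector_derivative_continuous[OF Cinf_derivative[OF this]] show "isCont (Dn j f) x" .
qed

lemma integral_derivative:
 assumes f: "f \<in> Cinf a" and t: "t \<in> Om"
 shows "((%t. LBINT s=0..t. exp (\<i> * z * of_real s) * f s) has_vector_derivative exp (\<i> * z * of_real t) * f t) (at t)"
proof -
 obtain b where b: "inrad b" "abs t < b" using inrad_above[OF t] .
 have "{-b..b} \<subseteq> Om" using Om_inner[OF b(1)] by auto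
 hence "continuous_on {-b..b} f" using Cinf_continuous[OF f, of "{-b..b}" 0] by simp
 hence cont: "continuous_on {-b..b} (%s. exp (\<i> * z * of_real s) * f s)" by (intro continuous_intros)
 have "((%t. LBINT s=0..t. exp (\<i> * z * of_real s) * f s) has_vector_derivative exp (\<i> * z * of_real t) * f t) (at t within {-b..b})"
  unfolding zero_ereal_def by (rule interval_integral_FTC2[OF _ _ cont]) (use b(2) in auto)
 moreover have "t \<in> interior {-b..b}" using b(2) unfolding interior_atLeastAtMost_real by (auto simp: abs_less_iff)
 ultimately show ?thesis by (simp only: at_within_interior)
qed

lemma ode_jet:
 assumes f: "f \<in> Cinf a" and u: "!!t. t \<in> Om ==> (u has_vector_derivative - \<i> * z * u t + f t) (at t)"
 shows "cut u \<in> Cinf a" "t \<in> Om ==> Dn (Suc j) (cut u) t = - \<i> * z * Dn j (cut u) t + Dn j f t"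
proof -
 define R where "R = rec_nat u (%j h t. - \<i> * z * h t + Dn j f t)"
 have R: "R 0 = u" "R (Suc j) = (%t. - \<i> * z * R j t + Dn j f t)" for j by (simp_all add: R_def)
 have "(R j has_vector_derivative R (Suc j) t) (at t)" if t: "t \<in> Om" for j t
 proof (induction j)
  case 0
  show ?case using u[OF t] by (simp add: R)
 next
  case (Suc j)
  have "((%t. - \<i> * z * R j t + Dn j f t) has_vector_derivative - \<i> * z * R (Suc j) t + Dn (Suc j) f t) (at t)"
   by (intro has_vector_derivative_add has_vector_derivative_mult_right Suc Cinf_derivative[OF f t])
  thus ?case by (simp only: R(2))
 qed
 hence J: "jet R" by (simp add: jet_def)
 show "cut u \<in> Cinf a" using cut_Cinf[OF J] by (simp only: R(1))
 show "Dn (Suc j) (cut u) t = - \<i> * z * Dn j (cut u) t + Dn j f t" if "t \<in> Om"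
  using Dn_cut[OF J, of j] Dn_cut[OF J, of "Suc j"] that unfolding R(1) by (simp add: R(2) cut_def)
qed

lemma res_derivative:
 assumes f: "f \<in> Cinf a" and t: "t \<in> Om"
 shows "((%t. exp (- \<i> * z * of_real t) * (LBINT s=0..t. exp (\<i> * z * of_real s) * f s)) has_vector_derivative
  - \<i> * z * (exp (- \<i> * z * of_real t) * (LBINT s=0..t. exp (\<i> * z * of_real s) * f s)) + f t) (at t)"
proof -
 have "exp (- \<i> * z * of_real t) * (exp (\<i> * z * of_real t) * f t) = f t" by (simp flip: mult.assoc exp_add)
 thus ?thesis
  by (intro has_vector_derivative_eq_rhs[OF has_vector_derivative_mult[OF exp_iz_derivative[of "- \<i> * z" t] integral_derivative[OF f t, of z]]]) (simp only: mult.assoc add.commute)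
qed

lemma res_Cinf: "f \<in> Cinf a ==> res z f \<in> Cinf a"
 unfolding res_def by (rule ode_jet(1)[OF _ res_derivative])

lemma Dn_res: "f \<in> Cinf a ==> t \<in> Om ==> Dn (Suc j) (res z f) t = - \<i> * z * Dn j (res z f) t + Dn j f t"
 unfolding res_def by (rule ode_jet(2)[OF _ res_derivative])

lemma res_0: "res z f 0 = 0"
 using zero_in_Om by (simp add: res_def cut_def zero_ereal_def[symmetric])

text \<open>The difference of two solutions times the integrating factor has derivative 0. The
  interval is free because \<open>near_resolvent\<close> compares equations whose right-hand sides
  agree on a subinterval.\<close>

lemma ode_unique:
 assumes u: "u \<in> Cinf a" "!!t. t \<in> {l..r} ==> Diff a u t = - \<i> * z * u t + f t" and v: "v \<in> Cinf a" "!!t. t \<in> {l..r} ==> Diff a v t = - \<i> * z * v t + f t"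
  and I: "{l..r} \<subseteq> Om" and s: "s \<in> {l..r}" "u s = v s" and t: "t \<in> {l..r}"
 shows "u t = v t"
proof -
 define w where "w t = exp (\<i> * z * of_real t) * (u t - v t)" for t
 have "(w has_vector_derivative 0) (at t within {l..r})" if t: "t \<in> {l..r}" for t
 proof -
  have tO: "t \<in> Om" using t I by auto
  have "((%t. u t - v t) has_vector_derivative (- \<i> * z * u t + f t) - (- \<i> * z * v t + f t)) (at t)"
   using Cinf_derivative[OF u(1) tO, of 0] Cinf_derivative[OF v(1) tO, of 0] u(2)[OF t] v(2)[OF t] by (intro has_vector_derivative_diff) auto
  hence "(w has_vector_derivative 0) (at t)" unfolding w_def
   by (rule has_vector_derivative_eq_rhs[OF has_vector_derivative_mult[OF exp_iz_derivative[of "\<i> * z" t]]]) (simp add: algebra_simps)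
  thus ?thesis by (rule has_vector_derivative_at_within)
 qed
 then obtain d where "!!t. t \<in> {l..r} ==> w t = d" using has_vector_derivative_zero_constant[of "{l..r}" w] by auto
 hence "w t = w s" using s(1) t by simp
 thus ?thesis using s(2) by (simp add: w_def)
qed

text \<open>The algebra of \<open>res\<close> below rests on this: a formula is verified by checking
  that its candidate solves the initial value problem.\<close>

lemma res_unique:
 assumes f: "f \<in> Cinf a" and u: "u \<in> Cinf a" "!!t. t \<in> Om ==> Diff a u t = - \<i> * z * u t + f t" "u 0 = 0"
 shows "u = res z f"
proof
 fix t
 show "u t = res z f t"
 proof (cases "t \<in> Om")
  case True
  have sub: "{- abs t.. abs t} \<subseteq> Om" using True Om_mono by (auto simp: abs_le_iff)
  have z0: "0 \<in> {- abs t.. abs t}" and tt: "t \<in> {- abs t.. abs t}" by auto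
  show ?thesis
  proof (rule ode_unique[OF u(1) _ res_Cinf[OF f] _ sub z0 _ tt])
   show "Diff a u s = - \<i> * z * u s + f s" if "s \<in> {- abs t.. abs t}" for s using u(2) sub that by blast
   show "Diff a (res z f) s = - \<i> * z * res z f s + f s" if "s \<in> {- abs t.. abs t}" for s using Dn_res[OF f, of s 0] sub that by auto
  qed (simp add: u(3) res_0)
 next
  case False
  thus ?thesis using Cinf_outside[OF u(1)] Cinf_outside[OF res_Cinf[OF f]] by simp
 qed
qed

end

lemma cscale_apply: "cscale s f t = s * f t" by (simp add: cscale_def)

context Ua_space
begin

text \<open>The room in \<open>M_fact\<close> yields the extra factor \<open>(1/2)^j\<close>, which
  makes a geometric sum converge in \<open>Dn_solution_bound\<close>.\<close>

lemma power_le_half_M: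
 assumes "0 < q" "0 <= R"
 obtains C where "0 < C" "!!j. R^j <= C * (1/2)^j * M q j"
proof -
 have "0 < 2 * (R + 1)" using assms by simp
 from M_fact[OF assms(1) this] obtain C where C: "0 < C" "!!j. (2 * (R + 1))^j * fact j <= C * M q j" by blast
 have "R^j <= C * (1/2)^j * M q j" for j
 proof -
  have "(2 * R)^j * 1 <= (2 * (R + 1))^j * fact j" using assms by (intro mult_mono power_mono) (auto simp: fact_ge_1)
  hence "(2 * R)^j <= C * M q j" using C(2)[of j] by linarith
  hence le: "(1/2)^j * (2 * R)^j <= (1/2)^j * (C * M q j)" by (intro mult_left_mono) auto
  have "(1/2)^j * (2 * R)^j = (1/2 * (2 * R))^j" by (rule power_mult_distrib[symmetric])
  hence "R^j = (1/2)^j * (2 * R)^j" by simp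
  also note le
  finally show ?thesis by (simp only: mult_ac)
 qed
 thus ?thesis using that[OF C(1)] by blast
qed

text \<open>Unrolling the equation expresses the j-th derivative of \<open>u\<close> by
  \<open>u\<close> and the lower derivatives of \<open>f\<close> with powers of \<open>z\<close> as
  coefficients. These powers are bounded by \<open>M\<close> with a geometric factor, and
  \<open>M_mult\<close> recombines the products without any loss in \<open>q\<close>.\<close>

lemma Dn_solution_bound:
 assumes q: "0 < q" and R: "0 <= R"
 shows "EX C>0. ALL z u f t A B. cmod z <= R --> (ALL j. Dn (Suc j) u t = - \<i> * z * Dn j u t + Dn j f t) --> cmod (u t) <= A
  --> (ALL j. cmod (Dn j f t) <= B * M q j) --> (ALL j. cmod (Dn j u t) <= C * (A + B) * M q j)"
proof -
 obtain C where C: "0 < C" "!!j. R^j <= C * (1/2)^j * M q j" using power_le_half_M[OF q R] by blast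
 have "cmod (Dn j u t) <= (2 * C) * (A + B) * M q j" if z: "cmod z <= R" and u: "!!j. Dn (Suc j) u t = - \<i> * z * Dn j u t + Dn j f t"
  and A: "cmod (u t) <= A" and B: "!!j. cmod (Dn j f t) <= B * M q j" for z u f t A B j
 proof -
  have A0: "0 <= A" using A norm_ge_zero order_trans by blast
  have B0: "0 <= B" using order_trans[OF norm_ge_zero B[of 0]] M_pos[of q 0] by (auto simp: zero_le_mult_iff)
  have 1: "cmod (Dn j u t) <= R^j * A + (\<Sum>i<j. R^(j - 1 - i) * (B * M q i))" for j
  proof (induction j)
   case (Suc j)
   have "cmod (Dn (Suc j) u t) <= cmod z * cmod (Dn j u t) + cmod (Dn j f t)"
    unfolding u by (rule order_trans[OF norm_triangle_ineq]) (simp add: norm_mult)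
   also have "... <= R * (R^j * A + (\<Sum>i<j. R^(j - 1 - i) * (B * M q i))) + B * M q j"
    using z R by (intro add_mono mult_mono Suc B) auto
   also have "R * (R^j * A + (\<Sum>i<j. R^(j - 1 - i) * (B * M q i))) = R^Suc j * A + (\<Sum>i<j. R^(Suc j - 1 - i) * (B * M q i))"
   proof -
    have "R * (R^(j - 1 - i) * (B * M q i)) = R^(Suc j - 1 - i) * (B * M q i)" if "i \<in> {..<j}" for i
    proof -
     have "Suc j - 1 - i = Suc (j - 1 - i)" using that by auto
     thus ?thesis by simp
    qed
    hence "R * (\<Sum>i<j. R^(j - 1 - i) * (B * M q i)) = (\<Sum>i<j. R^(Suc j - 1 - i) * (B * M q i))"
     unfolding sum_distrib_left by (intro sum.cong) auto
    thus ?thesis by (simp only: distrib_left power_Suc mult.assoc)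
   qed
   also have "... + B * M q j = R^Suc j * A + (\<Sum>i<Suc j. R^(Suc j - 1 - i) * (B * M q i))" by simp
   finally show ?case .
  qed (use A in simp)
  have "R^j <= C * M q j"
  proof -
   have "C * (1/2)^j * M q j <= C * 1 * M q j" using C(1) by (intro mult_right_mono mult_left_mono) (auto simp: power_le_one)
   thus ?thesis using C(2)[of j] by simp
  qed
  hence 2: "R^j * A <= C * M q j * A" using A0 by (rule mult_right_mono)
  have "(\<Sum>i<j. R^(j - 1 - i) * (B * M q i)) <= (\<Sum>i<j. (1/2)^(j - 1 - i) * (C * B * M q j))"
  proof (rule sum_mono)
   fix i assume i: "i \<in> {..<j}"
   have "R^(j - 1 - i) * (B * M q i) <= (C * (1/2)^(j - 1 - i) * M q (j - 1 - i)) * (B * M q i)"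
    using B0 by (intro mult_right_mono C(2)) auto
   also have "... = (C * (1/2)^(j - 1 - i) * B) * (M q (j - 1 - i) * M q i)" by (simp only: mult_ac)
   also have "... <= (C * (1/2)^(j - 1 - i) * B) * M q j"
   proof (rule mult_left_mono)
    have "M q (j - 1 - i) * M q i <= M q (j - 1 - i + i)" by (rule M_mult[OF q])
    also have "... <= M q j" using i by (intro M_mono[OF q]) auto
    finally show "M q (j - 1 - i) * M q i <= M q j" .
   qed (use C(1) B0 in simp)
   finally show "R^(j - 1 - i) * (B * M q i) <= (1/2)^(j - 1 - i) * (C * B * M q j)" by (simp only: mult_ac)
  qed
  also have "... = (\<Sum>i<j. (1/2)^(j - 1 - i)) * (C * B * M q j)" by (simp only: sum_distrib_right)
  also have "(\<Sum>i<j. (1/2::real)^(j - 1 - i)) = (\<Sum>i<j. (1/2)^i)" by (subst sum.nat_diff_reindex[symmetric]) simp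
  also have "... <= 2" by (simp add: sum_gp_strict)
  finally have 3: "(\<Sum>i<j. R^(j - 1 - i) * (B * M q i)) <= 2 * (C * B * M q j)" using C(1) B0 by (simp add: mult_right_mono)
  have "cmod (Dn j u t) <= C * M q j * A + 2 * (C * B * M q j)" using 1[of j] 2 3 by linarith
  also have "... <= 2 * (C * M q j * A) + 2 * (C * B * M q j)" using C(1) A0 by simp
  finally show ?thesis by (simp add: algebra_simps)
 qed
 thus ?thesis using C(1) by (intro exI[of _ "2 * C"] conjI allI impI) simp_all
qed

lemma res_nb:
 assumes q: "0 < q" and b: "inrad b" and R: "0 <= R"
 shows "EX C>0. ALL z f B. cmod z <= R --> f \<in> Cinf a --> nb q b f B --> nb q b (res z f) (C * B)"
proof -
 from Dn_solution_bound[OF q R] obtain C where C: "0 < C" "ALL z u f t A B. cmod z <= R --> (ALL j. Dn (Suc j) u t = - \<i> * z * Dn j u t + Dn j f t) --> cmod (u t) <= A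
  --> (ALL j. cmod (Dn j f t) <= B * M q j) --> (ALL j. cmod (Dn j u t) <= C * (A + B) * M q j)" by (elim exE conjE)
 have b0: "0 < b" using b by (simp add: inrad_def)
 define K where "K = exp (b * R) * (exp (b * R) * M q 0 * b)"
 have K: "0 < K" using b0 by (simp add: K_def)
 have "nb q b (res z f) (C * (K + 1) * B)" if z: "cmod z <= R" and f: "f \<in> Cinf a" and n: "nb q b f B" for z f B
  unfolding nb_def
 proof (intro allI impI)
  fix j t assume t: "abs t <= b"
  have tO: "t \<in> Om" using Om_inner[OF b t] .
  let ?I = "%t::real. LBINT s=0..ereal t. exp (\<i> * z * of_real s) * f s"
  have ex: "exp (s * Im z) <= exp (b * R)" "exp (- (s * Im z)) <= exp (b * R)" if "abs s <= b" for s
  proof -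
   have "abs (s * Im z) <= b * R" unfolding abs_mult using that abs_Im_le_cmod[of z] z by (intro mult_mono) auto
   thus "exp (s * Im z) <= exp (b * R)" "exp (- (s * Im z)) <= exp (b * R)" by (auto simp: abs_le_iff)
  qed
  have "cmod (?I t - ?I 0) <= (exp (b * R) * (B * M q 0)) * abs t"
  proof (rule vector_derivative_increment_bound[of b ?I "%s. exp (\<i> * z * of_real s) * f s", OF _ _ t])
   fix s :: real assume s: "abs s <= b"
   show "(?I has_vector_derivative exp (\<i> * z * of_real s) * f s) (at s)" using integral_derivative[OF f Om_inner[OF b s]] .
   have nexp: "cmod (exp (\<i> * z * of_real s)) = exp (- (s * Im z))" by (simp add: mult.commute)
   show "cmod (exp (\<i> * z * of_real s) * f s) <= exp (b * R) * (B * M q 0)"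
    unfolding norm_mult nexp using ex(2)[OF s] nbD[OF n s, of 0] by (intro mult_mono) auto
  qed
  moreover have "?I 0 = 0" by (simp add: zero_ereal_def[symmetric])
  ultimately have I: "cmod (?I t) <= exp (b * R) * (B * M q 0) * abs t" by simp
  have "cmod (res z f t) = exp (t * Im z) * cmod (?I t)" using tO norm_exp_iz[of z t] by (simp add: res_def cut_def norm_mult)
  also have "... <= exp (b * R) * (exp (b * R) * (B * M q 0) * b)"
   using ex(1)[OF t] t nb_nonneg[OF n] b0 by (intro mult_mono order_trans[OF I] mult_left_mono) auto
  also have "... = K * B" by (simp add: K_def)
  finally have "cmod (Dn j (res z f) t) <= C * (K * B + B) * M q j"
   by (intro C(2)[rule_format, where z = z and f = f] z Dn_res[OF f tO] nbD[OF n t])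
  thus "cmod (Dn j (res z f) t) <= C * (K + 1) * B * M q j" by (simp add: algebra_simps)
 qed
 thus ?thesis using C(1) K by (intro exI[of _ "C * (K + 1)"] conjI allI impI) simp_all
qed

lemma res_U: "f \<in> U ==> res z f \<in> U"
 unfolding Ua_iff
proof (intro conjI allI impI)
 assume f: "f \<in> Cinf a & (ALL q b. 0 < q & q < 1 & inrad b --> (EX B. nb q b f B))"
 thus "res z f \<in> Cinf a" using res_Cinf by blast
 fix q b :: real assume q: "0 < q & q < 1 & inrad b"
 then obtain B where B: "nb q b f B" using f by blast
 from res_nb[of q b "cmod z"] q obtain C where "ALL w f B. cmod w <= cmod z --> f \<in> Cinf a --> nb q b f B --> nb q b (res w f) (C * B)"
  by auto
 thus "EX B. nb q b (res z f) B" using B f by (intro exI[of _ "C * B"]) simp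
qed

lemma Diff_add: "f \<in> Cinf a ==> g \<in> Cinf a ==> Diff a (f + g) t = Diff a f t + Diff a g t"
 using Cinf_add[of f g 1] by simp
lemma Diff_scale: "f \<in> Cinf a ==> Diff a (cscale s f) t = s * Diff a f t"
 using Cinf_scale[of f s 1] by (simp add: cscale_def)
lemma Cinf_minus: "f \<in> Cinf a ==> g \<in> Cinf a ==> f - g \<in> Cinf a" and Cinf_neg: "f \<in> Cinf a ==> - f \<in> Cinf a"
 and Diff_minus: "f \<in> Cinf a ==> g \<in> Cinf a ==> Diff a (f - g) t = Diff a f t - Diff a g t"
 and Diff_neg: "f \<in> Cinf a ==> Diff a (- f) t = - Diff a f t"
proof -
 have n: "- f = cscale (-1) f" for f :: "real => complex" by (simp add: fun_eq_iff cscale_apply del: cfun.scale_minus_left)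
 have m: "f - g = f + cscale (-1) g" for f g :: "real => complex" by (simp add: fun_eq_iff cscale_apply del: cfun.scale_minus_left)
 show "f \<in> Cinf a ==> - f \<in> Cinf a" "f \<in> Cinf a ==> Diff a (- f) t = - Diff a f t"
  unfolding n using Cinf_scale[of f "-1"] Diff_scale[of f "-1" t] by (simp_all del: cfun.scale_minus_left)
 show "f \<in> Cinf a ==> g \<in> Cinf a ==> f - g \<in> Cinf a" "f \<in> Cinf a ==> g \<in> Cinf a ==> Diff a (f - g) t = Diff a f t - Diff a g t"
  unfolding m using Cinf_scale[of g "-1"] Cinf_add[of f "cscale (-1) g"] Diff_add[of f "cscale (-1) g" t] Diff_scale[of g "-1" t] by (simp_all del: cfun.scale_minus_left)
qed

lemmas Cinf_ops = Cinf_add Cinf_scale Cinf_minus Cinf_neg res_Cinf ez_Cinf Diff_add Diff_scale Diff_minus Diff_neg res_0 cscale_apply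

lemma Diff_res: "f \<in> Cinf a ==> t \<in> Om ==> Diff a (res z f) t = - \<i> * z * res z f t + f t"
 using Dn_res[of f t 0 z] by simp
lemma Diff_ez: "t \<in> Om ==> Diff a (ez z) t = - \<i> * z * ez z t"
 using Dn_ez[of t 1 z] by (simp add: exp_monomial_def)
lemma ez_0: "ez z 0 = 1" using zero_in_Om by (simp add: exp_monomial_def)

lemma res_add: "f \<in> Cinf a ==> g \<in> Cinf a ==> res z (f + g) = res z f + res z g"
 by (rule res_unique[symmetric]) (simp_all add: Cinf_ops Diff_res, (simp add: algebra_simps)?)

lemma res_scale: "f \<in> Cinf a ==> res z (cscale s f) = cscale s (res z f)"
 by (rule res_unique[symmetric]) (simp_all add: Cinf_ops Diff_res, (simp add: algebra_simps)?)

text \<open>The resolvent equation. Together with \<open>ez_ez\<close> it shows that both the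
  solutions \<open>res w f\<close> and the exponentials satisfy the equation on which
  \<open>family_derivative\<close> is built.\<close>

lemma res_res: "f \<in> Cinf a ==> res w f = res z f - cscale (\<i> * (w - z)) (res z (res w f))" (is "_ ==> ?lhs = ?rhs")
proof -
 assume f: "f \<in> Cinf a"
 have "res w f + cscale (\<i> * (w - z)) (res z (res w f)) = res z f"
  by (rule res_unique, insert f) (simp_all add: Cinf_ops Diff_res, (simp add: algebra_simps)?)
 note eq = fun_cong[OF this]
 show ?thesis
 proof
  fix t
  show "?lhs t = ?rhs t" using eq[of t] by (simp add: cscale_apply algebra_simps)
 qed
qed

lemma ez_ez: "ez w = ez z - cscale (\<i> * (w - z)) (res z (ez w))" (is "?lhs = ?rhs")
proof -
 have "ez w + cscale (-1) (ez z) = res z (cscale (- (\<i> * (w - z))) (ez w))"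
  by (rule res_unique) (simp_all add: Cinf_ops Diff_ez ez_0, (simp add: algebra_simps)?)
 hence "ez w + cscale (-1) (ez z) = cscale (- (\<i> * (w - z))) (res z (ez w))" using res_scale[OF ez_Cinf, of z "- (\<i> * (w - z))" w] by simp
 note eq = fun_cong[OF this]
 show ?thesis
 proof
  fix t
  show "?lhs t = ?rhs t" using eq[of t] by (simp add: cscale_apply algebra_simps)
 qed
qed

text \<open>Integration by parts. This formula produces the relation between the functions
  \<open>E\<close> that belong to \<open>f\<close> and to its derivative.\<close>

lemma res_Diff:
 assumes f: "f \<in> Cinf a" "Diff a f \<in> Cinf a"
 shows "res z (Diff a f) = f - cscale (f 0) (ez z) - cscale (\<i> * z) (res z f)" (is "?lhs = ?rhs")
proof -
 have "f + (cscale (- f 0) (ez z) + cscale (- (\<i> * z)) (res z f)) = res z (Diff a f)"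
  by (rule res_unique, insert f) (simp_all add: Cinf_ops Diff_ez Diff_res ez_0, (simp add: algebra_simps)?)
 note eq = fun_cong[OF this]
 show ?thesis
 proof
  fix t
  show "?lhs t = ?rhs t" using eq[of t] by (simp add: cscale_apply algebra_simps)
 qed
qed

lemma em_Suc: "em (Suc j) z = em 1 0 * em j z"
 by (auto simp: exp_monomial_def fun_eq_iff)

lemma em1_jet: "jet (%j t. if j = 0 then of_real t else if j = 1 then 1 else 0)"
 unfolding jet_def by (auto intro!: derivative_eq_intros)

lemma Dn_em1: "t \<in> Om ==> Dn j (em 1 0) t = (if j = 0 then of_real t else if j = 1 then 1 else 0)" and em1_Cinf: "em 1 0 \<in> Cinf a"
proof -
 have e: "cut (%t. if (0::nat) = 0 then of_real t else if (0::nat) = 1 then 1 else 0) = em 1 0" by (auto simp: cut_def exp_monomial_def)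
 show "em 1 0 \<in> Cinf a" using cut_Cinf[OF em1_jet] by (simp only: e)
 show "Dn j (em 1 0) t = (if j = 0 then of_real t else if j = 1 then 1 else 0)" if "t \<in> Om"
  using fun_cong[OF Dn_cut[OF em1_jet, of j], of t] that unfolding e by (simp add: cut_def)
qed

lemma em1_U: "em 1 0 \<in> U"
 unfolding Ua_iff
proof (intro conjI allI impI em1_Cinf)
 fix q b :: real assume q: "0 < q & q < 1 & inrad b"
 have "nb q b (em 1 0) (b / M q 0 + 1 / M q 1)" unfolding nb_def
 proof (intro allI impI)
  fix j t assume t: "abs t <= b"
  have "t \<in> Om" using q t Om_inner by blast
  show "cmod (Dn j (em 1 0) t) <= (b / M q 0 + 1 / M q 1) * M q j"
  proof (cases "j = 0")
   case True
   have "b <= (b / M q 0 + 1 / M q 1) * M q 0" by (simp add: distrib_right less_imp_le)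
   thus ?thesis using True t Dn_em1[OF \<open>t \<in> Om\<close>, of j] by simp
  next
   case F: False
   show ?thesis
   proof (cases "j = 1")
    case True
    have "1 <= (b / M q 0 + 1 / M q 1) * M q 1" using t by (simp add: distrib_right)
    thus ?thesis using True Dn_em1[OF \<open>t \<in> Om\<close>, of j] by simp
   next
    case False
    thus ?thesis using F t Dn_em1[OF \<open>t \<in> Om\<close>, of j] by (simp add: add_nonneg_nonneg)
   qed
  qed
 qed
 thus "EX B. nb q b (em 1 0) B" by blast
qed

lemma em_U: "em j z \<in> U"
proof (induction j)
 case (Suc j)
 show ?case by (subst em_Suc) (rule Ua_mult[OF em1_U Suc])
qed (rule ez_U)

lemma res_ez: "res z (ez z) = em 1 z"
proof (rule res_unique[symmetric, OF ez_Cinf])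
 show "em 1 z \<in> Cinf a" using em_U Ua_Cinf by blast
 show "em 1 z 0 = 0" by (simp add: exp_monomial_def)
 fix t assume t: "t \<in> Om"
 have "Dn 1 (em 1 0 * ez z) t = (\<Sum>i\<le>1. of_nat (1 choose i) * (Dn i (em 1 0) t * Dn (1 - i) (ez z) t))"
  by (rule Cinf_mult(2)[OF em1_Cinf ez_Cinf])
 also have "... = of_real t * (- \<i> * z * ez z t) + ez z t" using t Dn_em1[OF t, of 0] Dn_em1[OF t, of 1] Diff_ez[OF t] by simp
 finally show "Diff a (em 1 z) t = - \<i> * z * em 1 z t + ez z t"
  using em_Suc[of 0 z] t by (simp add: exp_monomial_def)
qed

subsection \<open>Operations on functionals\<close>

lemma dual_res: assumes "S \<in> dual" shows "(%f. S (res z f)) \<in> dual"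
proof (rule dualE[OF assms])
 fix q b C assume S: "lin S" "0 < q" "q < 1" "inrad b" "bdd S q b C" "0 <= C"
 from res_nb[OF S(2,4) norm_ge_zero[of z]] obtain K where K: "ALL w f B. cmod w <= cmod z --> f \<in> Cinf a --> nb q b f B --> nb q b (res w f) (K * B)" by (elim exE conjE)
 show ?thesis
 proof (rule dualI[OF _ _ S(2,3,4)])
  show "lin (%f. S (res z f))" unfolding lin_def
   by (simp add: res_add res_scale Ua_Cinf lin_add[OF S(1)] lin_scale[OF S(1)] res_U)
  show "bdd (%f. S (res z f)) q b (C * K)" unfolding bdd_def
  proof (intro ballI allI impI)
   fix f B assume f: "f \<in> U" and n: "nb q b f B"
   have "nb q b (res z f) (K * B)" using K n Ua_Cinf[OF f] by simp
   from bddD[OF S(5) res_U[OF f] this] show "cmod (S (res z f)) <= C * K * B" by (simp only: mult.assoc)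
  qed
 qed
qed

lemma dual_mult: assumes "S \<in> dual" and h: "h \<in> U" shows "(%f. S (h * f)) \<in> dual"
proof (rule dualE[OF assms(1)])
 fix q b C assume S: "lin S" "0 < q" "q < 1" "inrad b" "bdd S q b C" "0 <= C"
 obtain q' where q': "q < q'" "q' < 1" using S(3) dense by blast
 have q0: "0 < q'" using S q' by simp
 obtain A where A: "nb q' b h A" using Ua_nb[OF h q0 q'(2) S(4)] by blast
 from nb_mult[OF S(2) q'(1)] obtain K where K: "ALL f g A B b. f \<in> Cinf a --> g \<in> Cinf a --> nb q' b f A --> nb q' b g B --> nb q b (f * g) (K * A * B)" by (elim exE conjE)
 show ?thesis
 proof (rule dualI[OF _ _ q0 q'(2) S(4)])
  show "lin (%f. S (h * f))" unfolding lin_def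
  proof (intro conjI ballI allI)
   fix f s assume f: "f \<in> U"
   have "h * cscale s f = cscale s (h * f)" by (auto simp: cscale_def fun_eq_iff)
   thus "S (h * cscale s f) = s * S (h * f)" using lin_scale[OF S(1) Ua_mult[OF h f]] by simp
   fix g assume g: "g \<in> U"
   have "h * (f + g) = h * f + h * g" by (auto simp: fun_eq_iff distrib_left)
   thus "S (h * (f + g)) = S (h * f) + S (h * g)" using lin_add[OF S(1) Ua_mult[OF h f] Ua_mult[OF h g]] by simp
  qed
  show "bdd (%f. S (h * f)) q' b (C * (K * A))" unfolding bdd_def
  proof (intro ballI allI impI)
   fix f B assume f: "f \<in> U" and n: "nb q' b f B"
   have "nb q b (h * f) (K * A * B)" using K n A Ua_Cinf[OF f] Ua_Cinf[OF h] by simp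
   from bddD[OF S(5) Ua_mult[OF h f] this] show "cmod (S (h * f)) <= C * (K * A) * B" by (simp only: mult.assoc)
  qed
 qed
qed

lemma Dn_Diff: "Dn j (Diff a f) = Dn (Suc j) f" by (simp add: funpow_swap1)

lemma Diff_Cinf: "f \<in> Cinf a ==> Diff a f \<in> Cinf a"
 unfolding Cinf_def mem_Collect_eq
proof (intro conjI allI ballI impI)
 fix j t assume f: "(ALL x. x \<notin> Om --> f x = 0) & (ALL j. \<forall>x\<in>Om. Dn j f differentiable at x)"
 show "t \<notin> Om ==> Diff a f t = 0" by (simp add: Diff_def)
 assume "t \<in> Om"
 hence "Dn (Suc j) f differentiable at t" using f by blast
 thus "Dn j (Diff a f) differentiable at t" by (simp only: Dn_Diff)
qed

text \<open>One more derivative raises the index of \<open>M\<close> by one, which adds a factor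
  \<open>x\<close> under the supremum; \<open>exp (- (q' - q) * om x)\<close> absorbs it.\<close>

lemma Diff_nb:
 assumes "0 < q" "q < q'"
 shows "EX K>0. ALL f b B. nb q' b f B --> 0 <= b --> nb q b (Diff a f) (K * B)"
proof -
 have "0 < q' - q" using assms by simp
 from power_exp_decay[OF this, of 1] obtain K where K: "0 < K" "!!x. 0 <= x ==> (1 + x)^1 * exp (- (q' - q) * om x) <= K" by blast
 have MK: "M q' (Suc j) <= K * M q j" for j
 proof (rule M_le)
  fix x :: real assume x: "1 <= x"
  have "exp (- q' * om x) = exp (- (q' - q) * om x) * exp (- q * om x)" by (simp add: algebra_simps flip: exp_add)
  hence "x^Suc j * exp (- q' * om x) = (x * exp (- (q' - q) * om x)) * (x^j * exp (- q * om x))" by (simp only: power_Suc mult_ac)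
  also have "... <= ((1 + x)^1 * exp (- (q' - q) * om x)) * M q j" using x by (intro mult_mono M_ge[OF assms(1)]) auto
  also have "... <= K * M q j" using x by (intro mult_right_mono K(2)) auto
  finally show "x^Suc j * exp (- q' * om x) <= K * M q j" .
 qed (use assms in simp)
 have "nb q b (Diff a f) (K * B)" if n: "nb q' b f B" and b: "0 <= b" for f b B
  unfolding nb_def Dn_Diff
 proof (intro allI impI)
  fix j t assume "abs t <= b"
  hence "cmod (Dn (Suc j) f t) <= B * M q' (Suc j)" by (rule nbD[OF n])
  also have "... <= B * (K * M q j)" using nb_nonneg[OF n b] MK by (intro mult_left_mono)
  finally show "cmod (Dn (Suc j) f t) <= K * B * M q j" by (simp only: mult_ac)
 qed
 thus ?thesis using K(1) by (intro exI[of _ K] conjI allI impI) simp_all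
qed

lemma Diff_U: assumes f: "f \<in> U" shows "Diff a f \<in> U"
 unfolding Ua_iff
proof (intro conjI allI impI Diff_Cinf Ua_Cinf f)
 fix q b :: real assume q: "0 < q & q < 1 & inrad b"
 then obtain q' where q': "q < q'" "q' < 1" using dense by blast
 have q0: "0 < q'" using q q' by simp
 obtain B where "nb q' b f B" using Ua_nb[OF f q0 q'(2)] q by blast
 moreover from Diff_nb[of q q'] q q' obtain K where "ALL f b B. nb q' b f B --> 0 <= b --> nb q b (Diff a f) (K * B)" by auto
 ultimately show "EX B. nb q b (Diff a f) B" using q by (intro exI[of _ "K * B"]) (simp add: inrad_def)
qed

lemma dual_Diff: assumes "S \<in> dual" shows "(%f. S (Diff a f)) \<in> dual"
proof (rule dualE[OF assms(1)])
 fix q b C assume S: "lin S" "0 < q" "q < 1" "inrad b" "bdd S q b C" "0 <= C"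
 obtain q' where q': "q < q'" "q' < 1" using S(3) dense by blast
 have q0: "0 < q'" using S q' by simp
 from Diff_nb[OF S(2) q'(1)] obtain K where K: "ALL f b B. nb q' b f B --> 0 <= b --> nb q b (Diff a f) (K * B)" by (elim exE conjE)
 show ?thesis
 proof (rule dualI[OF _ _ q0 q'(2) S(4)])
  have D: "Diff a (f + g) = Diff a f + Diff a g" "Diff a (cscale s f) = cscale s (Diff a f)" if "f \<in> U" "g \<in> U" for f g s
   using Diff_add[of f g] Diff_scale[of f s] that Ua_Cinf by (auto simp: fun_eq_iff cscale_def)
  show "lin (%f. S (Diff a f))" unfolding lin_def
   by (simp add: D lin_add[OF S(1)] lin_scale[OF S(1)] Diff_U)
  show "bdd (%f. S (Diff a f)) q' b (C * K)" unfolding bdd_def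
  proof (intro ballI allI impI)
   fix f B assume f: "f \<in> U" and n: "nb q' b f B"
   have "nb q b (Diff a f) (K * B)" using K n S(4) by (simp add: inrad_def)
   from bddD[OF S(5) Diff_U[OF f] this] show "cmod (S (Diff a f)) <= C * K * B" by (simp only: mult.assoc)
  qed
 qed
qed

lemma FL_Diff: assumes "S \<in> dual" shows "FL (%f. S (Diff a f)) z = - \<i> * z * FL S z"
proof (rule dualE[OF assms])
 assume S: "lin S"
 have "Diff a (ez z) = cscale (- \<i> * z) (ez z)"
  using Diff_ez[of _ z] by (auto simp: fun_eq_iff cscale_def Diff_def exp_monomial_def)
 from lin_scale[OF S ez_U, of "- \<i> * z" z] show ?thesis by (simp only: FL_def \<open>Diff a (ez z) = _\<close>)
qed

text \<open>An analytic family of functions is described by the resolvent equation it satisfies.\<close>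

lemma family_derivative:
 assumes S: "S \<in> dual" and h: "!!z. h z \<in> U"
  and eq: "!!z w. h w = h z - cscale (\<i> * (w - z)) (res z (h w))"
  and loc: "!!q b R. 0 < q ==> q < 1 ==> inrad b ==> 0 <= R ==> EX B. ALL z. cmod z <= R --> nb q b (h z) B"
 shows "((%w. S (h w)) has_field_derivative - \<i> * S (res z (h z))) (at z)"
proof -
 have step: "T (h w) - T (h z) = - \<i> * (w - z) * T (res z (h w))" if T: "T \<in> dual" for T w
 proof -
  have lin: "lin T" using T dual_iff by blast
  have "T (h w) = T (h z) - T (cscale (\<i> * (w - z)) (res z (h w)))"
   by (rule trans[OF arg_cong[where f = T, OF eq[where w = w and z = z]] lin_minus[OF lin h Ua_scale[OF res_U[OF h]]]])
  thus ?thesis using lin_scale[OF lin res_U[OF h]] by simp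
 qed
 \<comment> \<open>One use of the equation turns the difference quotient into
   \<open>- \<i> * T (h w)\<close>; a second use bounds \<open>T (h w) - T (h z)\<close> by
   \<open>|w - z|\<close> times the locally bounded \<open>V (h w)\<close>, which gives continuity
   at \<open>z\<close>.\<close>
 define T where "T f = S (res z f)" for f
 define V where "V f = T (res z f)" for f
 have T: "T \<in> dual" unfolding T_def by (rule dual_res[OF S])
 have V: "V \<in> dual" unfolding V_def by (rule dual_res[OF T])
 obtain K where K: "!!w. cmod w <= cmod z + 1 ==> cmod (V (h w)) <= K"
 proof (rule dualE[OF V])
  fix q b C assume q: "0 < q" "q < 1" "inrad b" "bdd V q b C"
  have "0 <= cmod z + 1" by simp
  from loc[OF q(1-3) this] obtain B where B: "ALL w. cmod w <= cmod z + 1 --> nb q b (h w) B" by (elim exE)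
  show thesis by (rule that[of "C * B"]) (use bddD[OF q(4) h] B in simp)
 qed
 have "((%w. T (h w) - T (h z)) \<longlongrightarrow> 0) (at z)"
 proof (rule Lim_null_comparison)
  have "norm (T (h w) - T (h z)) <= cmod (w - z) * K" if "w \<in> ball z 1" for w
  proof -
   have "cmod (w - z) < 1" using that by (simp add: dist_norm norm_minus_commute)
   hence "cmod w <= cmod z + 1" using norm_triangle_ineq2[of w z] by simp
   from K[OF this] show ?thesis unfolding step[OF T] V_def[symmetric] by (simp add: norm_mult mult_left_mono)
  qed
  thus "eventually (%w. norm (T (h w) - T (h z)) <= cmod (w - z) * K) (at z)"
   by (intro eventually_mono[OF eventually_at_in_open'[of "ball z 1" z]]) auto
  have "((%w. cmod (w - z) * K) \<longlongrightarrow> cmod (z - z) * K) (at z)" by (intro tendsto_intros)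
  thus "((%w. cmod (w - z) * K) \<longlongrightarrow> 0) (at z)" by simp
 qed
 hence "((%w. T (h w)) \<longlongrightarrow> T (h z)) (at z)" by (simp only: Lim_null[symmetric])
 hence "isCont (%w. - \<i> * T (h w)) z" unfolding isCont_def by (rule tendsto_mult_left)
 moreover have "S (h w) - S (h z) = (- \<i> * T (h w)) * (w - z)" for w
  using step[OF S, of w] by (simp add: T_def)
 ultimately show ?thesis 
  by (intro iffD2[OF CARAT_DERIV] exI[of _ "%w. - \<i> * T (h w)"] conjI allI) (simp_all only: T_def)
qed

lemma ez_locally_bounded:
 assumes "0 < q" "q < 1" "inrad b" "0 <= R"
 shows "EX B. ALL z. cmod z <= R --> nb q b (ez z) B"
proof -
 have b: "0 <= b" using assms by (simp add: inrad_def)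
 have "nb q b (ez z) (exp (om 1) * exp (q * om R + b * R))" if z: "cmod z <= R" for z
 proof (rule nb_mono[OF ez_nb])
  have "q * om (cmod z) <= q * om R" using assms z by (intro mult_left_mono w_mono) auto
  moreover have "b * abs (Im z) <= b * R" using b z abs_Im_le_cmod[of z] by (intro mult_left_mono) auto
  ultimately show "exp (om 1) * exp (q * om (cmod z) + b * abs (Im z)) <= exp (om 1) * exp (q * om R + b * R)" by simp
 qed (use assms b in auto)
 thus ?thesis by blast
qed

lemma FL_derivative:
 assumes S: "S \<in> dual"
 shows "(FL S has_field_derivative - \<i> * S (em 1 z)) (at z)"
proof -
 have "((%w. S (ez w)) has_field_derivative - \<i> * S (res z (ez z))) (at z)"
  by (rule family_derivative[where h = ez, OF S ez_U ez_ez]) (rule ez_locally_bounded)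
 moreover have "FL S = (%w. S (ez w))" by (rule ext) (rule FL_def)
 ultimately show ?thesis by (simp only: res_ez)
qed

lemma FL_holomorphic: "S \<in> dual ==> FL S holomorphic_on UNIV"
 using FL_derivative by (auto simp: holomorphic_on_def field_differentiable_def intro: has_field_derivative_at_within)

lemma higher_deriv_FL: "S \<in> dual ==> (deriv ^^ j) (FL S) z = (- \<i>)^j * S (em j z)"
proof (induction j arbitrary: S z)
 case (Suc j)
 define T where "T f = S (em 1 0 * f)" for f
 have T: "T \<in> dual" unfolding T_def by (rule dual_mult[OF Suc.prems em1_U])
 have "deriv (FL S) = (%z. - \<i> * FL T z)"
 proof
  fix z
  have "em 1 z = em 1 0 * ez z" using em_Suc[of 0 z] by (simp only: One_nat_def)
  hence "FL T z = S (em 1 z)" by (simp only: FL_def T_def)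
  with DERIV_imp_deriv[OF FL_derivative[OF Suc.prems], of z] show "deriv (FL S) z = - \<i> * FL T z" by (simp only:)
 qed
 moreover have "(deriv ^^ Suc j) (FL S) z = (deriv ^^ j) (deriv (FL S)) z" by (simp only: funpow_Suc_right o_apply)
 ultimately have "(deriv ^^ Suc j) (FL S) z = (deriv ^^ j) (%z. - \<i> * FL T z) z" by (simp only:)
 also have "... = - \<i> * (deriv ^^ j) (FL T) z" by (rule higher_deriv_cmult[OF FL_holomorphic[OF T] UNIV_I open_UNIV])
 also have "... = - \<i> * ((- \<i>)^j * T (em j z))" using Suc.IH[OF T] by simp
 finally show ?case by (simp only: T_def em_Suc[symmetric] power_Suc mult.assoc)
qed (simp add: FL_def)

lemma res_derivative_at:
 assumes S: "S \<in> dual" and f: "f \<in> U"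
 shows "((%z. S (res z f)) has_field_derivative - \<i> * S (res z (res z f))) (at z)"
proof (rule family_derivative[where h = "%w. res w f", OF S res_U[OF f] res_res[OF Ua_Cinf[OF f]]])
 fix q b R :: real assume q: "0 < q" "q < 1" "inrad b" "0 <= R"
 obtain B where B: "nb q b f B" using Ua_nb[OF f q(1-3)] by blast
 from res_nb[OF q(1,3,4)] obtain K where "ALL w f B. cmod w <= R --> f \<in> Cinf a --> nb q b f B --> nb q b (res w f) (K * B)" by (elim exE conjE)
 thus "EX B. ALL z. cmod z <= R --> nb q b (res z f) B" using B Ua_Cinf[OF f] by blast
qed

lemma S_res_holomorphic: "S \<in> dual ==> f \<in> U ==> (%z. S (res z f)) holomorphic_on UNIV"
 using res_derivative_at by (auto simp: holomorphic_on_def field_differentiable_def intro: has_field_derivative_at_within)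

end

section \<open>Sinc products and smooth step functions\<close>

abbreviation csinc :: "complex => complex" where "csinc \<equiv> quotient_at sin 0"

lemma csinc_holomorphic: "csinc holomorphic_on UNIV"
 by (rule quotient_at_holomorphic) (auto intro!: holomorphic_intros)

lemma csinc_mult: "z * csinc z = sin z" using quotient_at_mult[of sin 0 z] by simp

lemma csinc_0: "csinc 0 = 1" by (simp add: quotient_at_def DERIV_imp_deriv[OF DERIV_sin])

lemma norm_exp_ii_le: "cmod (exp (\<i> * w)) <= exp (abs (Im w))" "cmod (exp (- (\<i> * w))) <= exp (abs (Im w))" by simp_all

lemma norm_sin_le: "cmod (sin w) <= exp (abs (Im w))" and norm_cos_le: "cmod (cos w) <= exp (abs (Im w))"
proof -
 have "cmod (exp (\<i> * w) - exp (- (\<i> * w))) <= 2 * exp (abs (Im w))" "cmod (exp (\<i> * w) + exp (- (\<i> * w))) <= 2 * exp (abs (Im w))"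
  using norm_exp_ii_le[of w] norm_triangle_ineq4[of "exp (\<i> * w)" "exp (- (\<i> * w))"] norm_triangle_ineq[of "exp (\<i> * w)" "exp (- (\<i> * w))"] by linarith+
 thus "cmod (sin w) <= exp (abs (Im w))" "cmod (cos w) <= exp (abs (Im w))"
  by (simp_all add: sin_exp_eq cos_exp_eq norm_divide norm_mult)
qed

text \<open>The mean value inequality for \<open>sin\<close> in the strip of width given by
  \<open>Im z\<close>. The constant 1 matters, because powers and products of an unbounded number of
  such factors are formed.\<close>

lemma csinc_bound: "cmod (csinc z) <= exp (abs (Im z))"
proof (cases "z = 0")
 case True
 thus ?thesis using csinc_0 by simp
next
 case False
 have "cmod (sin z - sin 0) <= exp (abs (Im z)) * cmod (z - 0)"
 proof (rule field_differentiable_bound[of "{w. abs (Im w) <= abs (Im z)}" sin cos])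
  have "{w. abs (Im w) <= abs (Im z)} = {w. Im w <= abs (Im z)} \<inter> {w. Im w >= - abs (Im z)}" by (auto simp: abs_le_iff)
  thus "convex {w. abs (Im w) <= abs (Im z)}" by (simp only:) (intro convex_Int convex_halfspace_Im_le convex_halfspace_Im_ge)
  show "cmod (cos w) <= exp (abs (Im z))" if "w \<in> {w. abs (Im w) <= abs (Im z)}" for w
   using norm_cos_le[of w] that by (auto intro: order_trans)
 qed (auto intro: DERIV_subset[OF DERIV_sin])
 hence "cmod (z * csinc z) <= cmod z * exp (abs (Im z))" unfolding csinc_mult by (simp add: mult.commute)
 thus ?thesis using False unfolding norm_mult by simp
qed

lemma csinc_decay: "cmod z * cmod (csinc z) <= exp (abs (Im z))"
 using norm_sin_le[of z] unfolding csinc_mult[of z, symmetric] norm_mult .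

text \<open>On the imaginary axis the function is \<open>sinh y / y\<close>. Products of dilates
  inherit this lower bound, so multiplying by them never destroys a lower bound on that
  axis.\<close>

lemma csinc_imaginary: "1 <= cmod (csinc (\<i> * of_real y))"
proof (cases "y = 0")
 case False
 have pos: "abs y <= sinh (abs y)"
 proof -
  have "(%x. sinh x - x) 0 <= (%x. sinh x - x) (abs y)"
   by (rule DERIV_nonneg_imp_nondecreasing) (auto intro!: exI derivative_eq_intros simp: cosh_real_ge_1)
  thus ?thesis by simp
 qed
 have "sin (\<i> * of_real y) = \<i> * of_real (sinh y)"
 proof -
  have "\<i> * (\<i> * complex_of_real y) = - of_real y" by (simp flip: mult.assoc)
  hence "sin (\<i> * of_real y) = (exp (- of_real y) - exp (of_real y)) / (2 * \<i>)" unfolding sin_exp_eq by simp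
  also have "... = of_real (exp (- y) - exp y) / (2 * \<i>)" by (simp only: of_real_diff exp_of_real of_real_minus[symmetric])
  also have "exp (- y) - exp y = - 2 * sinh y" by (simp add: sinh_field_def)
  also have "of_real (- 2 * sinh y) / (2 * \<i>) = \<i> * of_real (sinh y)" by (simp add: field_simps)
  finally show ?thesis .
 qed
 hence "abs y * cmod (csinc (\<i> * of_real y)) = abs (sinh y)"
  using arg_cong[OF csinc_mult[of "\<i> * of_real y"], of cmod] by (simp only: norm_mult norm_ii norm_of_real mult_1_left)
 moreover have "abs (sinh y) = sinh (abs y)" by (cases "0 <= y") (simp_all add: abs_of_nonneg abs_of_neg not_le)
 ultimately have "abs y * 1 <= abs y * cmod (csinc (\<i> * of_real y))" using pos by (simp only: mult_1_right)
 thus ?thesis using False by (subst (asm) mult_le_cancel_left_pos) auto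
qed (simp add: csinc_0)

context Ua_space
begin

text \<open>Condensation of the integral condition: on \<open>{2^k..<2^Suc k}\<close> the integrand
  is at least \<open>om (2^k) / 4^Suc k\<close>, and the block has length
  \<open>2^k\<close>.\<close>

lemma summable_w_dyadic: "summable (%k. om (2^k) / 2^k)"
proof -
 let ?g = "%x. indicator {1..} x * (om x / x^2)"
 have int: "integrable lborel ?g"
  using weight unfolding weight_def set_integrable_def by (simp add: mult.commute)
 have "(\<Sum>k<n. om (2^k) / (4 * 2^k)) <= integral\<^sup>L lborel ?g" for n
 proof -
  let ?f = "%k (x::real). indicator {2^k..<2^Suc k} x * (om (2^k) / 4^Suc k)"
  have pt: "(\<Sum>k<n. ?f k x) <= indicator {1..<2^n} x * (om x / x^2)" for x :: real and n
  proof (induction n)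
   case (Suc n)
   have one: "(1::real) <= 2^n" by simp
   have "?f n x <= indicator {2^n..<2^Suc n} x * (om x / x^2)"
   proof (cases "x \<in> {2^n..<2^Suc n}")
    case True
    hence x: "2^n <= x" "x <= 2^Suc n" "0 < x" using one by auto
    have "om (2^n) <= om x" using x by (intro w_mono) auto
    moreover have "x^2 <= 4^Suc n" using power_mono[OF x(2), of 2] x(3) by (simp add: power2_eq_square flip: power_mult_distrib)
    ultimately have "om (2^n) / 4^Suc n <= om x / x^2" using x w_nonneg[of "2^n"] by (intro frac_le) auto
    thus ?thesis using True by simp
   qed simp
   moreover have ind: "indicator {1..<2^Suc n} x = indicator {1..<2^n} x + (indicator {2^n..<2^Suc n} x :: real)"
    using one by (auto simp: indicator_def intro: order_trans[OF one])
   ultimately show ?case using Suc unfolding sum.lessThan_Suc ind distrib_right by linarith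
  qed simp
  have fi: "integrable lborel (?f k)" for k
  proof (rule integrable_mult_left, rule integrable_real_indicator)
   show "{2^k..<2^Suc k :: real} \<in> sets lborel" by simp
   show "emeasure lborel {2^k..<2^Suc k :: real} < \<infinity>" using emeasure_lborel_Ico[of "2^k" "2^Suc k"] by simp
  qed
  have fI: "integral\<^sup>L lborel (?f k) = om (2^k) / (4 * 2^k)" for k
  proof -
   have "integral\<^sup>L lborel (?f k) = 2^k * (om (2^k) / 4^Suc k)" by simp
   moreover have "(4::real)^Suc k = 4 * (2^k * 2^k)" using power_mult_distrib[of 2 "2::real" k] by simp
   ultimately show ?thesis by simp
  qed
  have "(\<Sum>k<n. om (2^k) / (4 * 2^k)) = (\<Sum>k<n. integral\<^sup>L lborel (?f k))" by (simp only: fI)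
  also have "... = integral\<^sup>L lborel (%x. \<Sum>k<n. ?f k x)" using fi by (intro Bochner_Integration.integral_sum[symmetric])
  also have "... <= integral\<^sup>L lborel ?g"
  proof (rule integral_mono[OF _ int])
   show "integrable lborel (%x. \<Sum>k<n. ?f k x)" using fi by (intro Bochner_Integration.integrable_sum)
   fix x :: real
   have "indicator {1..<2^n} x * (om x / x^2) <= ?g x" using w_nonneg[of x] by (auto simp: indicator_def)
   thus "(\<Sum>k<n. ?f k x) <= ?g x" using pt[where n = n and x = x] by linarith
  qed
  finally show ?thesis .
 qed
 hence "summable (%k. om (2^k) / (4 * 2^k))" using w_nonneg by (intro summableI_nonneg_bounded) auto
 from summable_mult[OF this, of 4] show ?thesis by simp
qed

text \<open>A limit of finite products of dilated sinc functions, the number of factors of size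
 \<^term>\<open>2^k\<close> being prescribed by the weight.\<close>

lemma multiplier:
 assumes e: "0 < e"
 obtains v C where "v holomorphic_on UNIV" "0 < C" "!!z. cmod (v z) <= C * exp (- 2 * om (cmod z) + e * abs (Im z))"
  "!!z. cmod (v z) <= exp (e * abs (Im z))" "!!y. 1 <= cmod (v (\<i> * of_real y))" "v 0 = 1"
proof -
 define N where "N k = nat \<lceil>2 * om (2^Suc k)\<rceil>" for k :: nat
 have N: "2 * om (2^Suc k) <= real (N k)" "real (N k) <= 2 * om (2^Suc k) + 1" for k
  using w_nonneg[of "2^Suc k"] by (auto simp: N_def of_nat_nat le_of_int_ceiling)
 \<comment> \<open>The exponential type contributed by block \<open>k\<close>: \<open>N k\<close>
   sinc factors dilated by \<open>exp 1 / 2^k\<close>.\<close>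
 define s where "s k = real (N k) * (exp 1 / 2^k)" for k
 have s0: "0 <= s k" for k by (simp add: s_def)
 have sum: "summable s"
 proof (rule summable_comparison_test')
  have "summable (%k. om (2^Suc k) / 2^Suc k)" using summable_w_dyadic by (subst summable_Suc_iff)
  thus "summable (%k. 4 * exp 1 * (om (2^Suc k) / 2^Suc k) + exp 1 * (1/2)^k)"
   by (intro summable_add summable_mult summable_geometric) auto
  fix k :: nat assume "0 <= k"
  have "s k <= (2 * om (2^Suc k) + 1) * (exp 1 / 2^k)" unfolding s_def using N by (intro mult_right_mono) auto
  also have "... = 4 * exp 1 * (om (2^Suc k) / 2^Suc k) + exp 1 * (1/2)^k" by (simp add: field_simps)
  finally show "norm (s k) <= 4 * exp 1 * (om (2^Suc k) / 2^Suc k) + exp 1 * (1/2)^k" using s0 by simp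
 qed
 \<comment> \<open>Dropping the first \<open>K\<close> blocks brings the total type below
   \<open>e\<close>; the price is the constant factor \<open>exp (2 * om (2^K))\<close> in the
   decay.\<close>
 from suminf_exist_split[OF e sum] obtain K where K: "norm (\<Sum>i. s (i + K)) < e" by blast
 have sumK: "(\<Sum>i<n. s (i + K)) <= e" for n
 proof -
  have "(\<Sum>i<n. s (i + K)) <= (\<Sum>i. s (i + K))" using s0 sum by (intro sum_le_suminf) auto
  thus ?thesis using K by simp
 qed
 define \<alpha> :: "nat => real" where "\<alpha> k = exp 1 / 2^(k + K)" for k
 have \<alpha>0: "0 < \<alpha> k" for k by (simp add: \<alpha>_def)
 define F where "F k z = csinc (of_real (\<alpha> k) * z)^N (k + K)" for k z
 define P where "P n z = (\<Prod>k<n. F k z)" for n z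
 have hF: "F k holomorphic_on UNIV" for k
  unfolding F_def by (intro holomorphic_on_power entire_compose[OF csinc_holomorphic] holomorphic_intros)
 have hP: "P n holomorphic_on UNIV" for n unfolding P_def using hF by (intro holomorphic_on_prod) auto
 have bF: "cmod (F k z) <= exp (s (k + K) * abs (Im z))" for k z
 proof -
  have "cmod (csinc (of_real (\<alpha> k) * z)) <= exp (\<alpha> k * abs (Im z))"
   using csinc_bound[of "of_real (\<alpha> k) * z"] \<alpha>0[of k] by (simp add: abs_mult)
  hence "cmod (F k z) <= exp (\<alpha> k * abs (Im z))^N (k + K)" unfolding F_def norm_power by (intro power_mono) auto
  also have "... = exp (s (k + K) * abs (Im z))" by (simp only: exp_of_nat_mult[symmetric] s_def \<alpha>_def mult.assoc)
  finally show ?thesis .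
 qed
 have expsum: "(\<Prod>k\<in>A. exp (s (k + K) * abs (Im z))) <= exp (e * abs (Im z))" if "A \<subseteq> {..<n}" for A n z
 proof -
  have fin: "finite A" by (rule finite_subset[OF that]) simp
  have "(\<Sum>k\<in>A. s (k + K)) <= (\<Sum>k<n. s (k + K))" by (rule sum_mono2[OF _ that]) (simp_all add: s0)
  from mult_right_mono[OF order_trans[OF this sumK[of n]] abs_ge_zero[of "Im z"]]
  have "(\<Sum>k\<in>A. s (k + K)) * abs (Im z) <= e * abs (Im z)" .
  moreover have "(\<Prod>k\<in>A. exp (s (k + K) * abs (Im z))) = exp ((\<Sum>k\<in>A. s (k + K)) * abs (Im z))"
   by (simp only: exp_sum[OF fin, symmetric] sum_distrib_right)
  ultimately show ?thesis by (simp only: exp_le_cancel_iff)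
 qed
 have bP: "cmod (P n z) <= exp (e * abs (Im z))" for n z
 proof -
  have "cmod (P n z) <= (\<Prod>k<n. exp (s (k + K) * abs (Im z)))" unfolding P_def prod_norm[symmetric] by (intro prod_mono) (auto intro: bF)
  thus ?thesis using expsum[of "{..<n}" n z] by simp
 qed
 \<comment> \<open>In the annulus of block \<open>k\<close> the argument of each of its factors has
   modulus at least \<open>exp 1\<close>, so each gains a factor \<open>exp (- 1)\<close>, and
   \<open>N (k + K)\<close> of them give \<open>exp (- 2 * om (cmod z))\<close>. All other factors
   only contribute type.\<close>
 have dP: "cmod (P n z) <= exp (- 2 * om (cmod z) + e * abs (Im z))" if k: "2^(k + K) <= cmod z" "cmod z <= 2^Suc (k + K)" "k < n" for k n z
 proof -
  let ?w = "of_real (\<alpha> k) * z"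
  have "exp 1 <= \<alpha> k * cmod z" using k(1) by (simp add: \<alpha>_def pos_le_divide_eq mult_left_mono)
  hence "exp 1 <= cmod ?w" using \<alpha>0[of k] by (simp add: norm_mult)
  hence "exp 1 * cmod (csinc ?w) <= cmod ?w * cmod (csinc ?w)" by (rule mult_right_mono) simp
  also have "... <= exp (\<alpha> k * abs (Im z))" using csinc_decay[of ?w] \<alpha>0[of k] by (simp add: abs_mult)
  finally have "cmod (csinc ?w) <= exp (- 1) * exp (\<alpha> k * abs (Im z))" by (simp add: exp_minus field_simps)
  hence "cmod (F k z) <= (exp (- 1) * exp (\<alpha> k * abs (Im z)))^N (k + K)" unfolding F_def norm_power by (intro power_mono) auto
  also have "... = exp (- real (N (k + K))) * exp (s (k + K) * abs (Im z))"
  proof -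
   have "exp (- 1 :: real)^N (k + K) = exp (- real (N (k + K)))" using exp_of_nat_mult[of "N (k + K)" "- 1 :: real"] by simp
   moreover have "exp (\<alpha> k * abs (Im z))^N (k + K) = exp (s (k + K) * abs (Im z))" by (simp only: exp_of_nat_mult[symmetric] s_def \<alpha>_def mult.assoc)
   ultimately show ?thesis by (simp only: power_mult_distrib)
  qed
  finally have Fk: "cmod (F k z) <= exp (- real (N (k + K))) * exp (s (k + K) * abs (Im z))" .
  have "2 * om (cmod z) <= 2 * om (2^Suc (k + K))" using w_mono[of "cmod z" "2^Suc (k + K)"] k(2) by simp
  also have "... <= real (N (k + K))" by (rule N)
  finally have N2: "exp (- real (N (k + K))) <= exp (- 2 * om (cmod z))" by simp
  have "cmod (P n z) = cmod (F k z) * (\<Prod>j\<in>{..<n} - {k}. cmod (F j z))"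
   unfolding P_def prod_norm[symmetric] using k(3) by (intro prod.remove) auto
  also have "... <= (exp (- real (N (k + K))) * exp (s (k + K) * abs (Im z))) * (\<Prod>j\<in>{..<n} - {k}. exp (s (j + K) * abs (Im z)))"
   by (intro mult_mono Fk prod_mono) (auto intro: bF prod_nonneg)
  also have "... = exp (- real (N (k + K))) * (exp (s (k + K) * abs (Im z)) * (\<Prod>j\<in>{..<n} - {k}. exp (s (j + K) * abs (Im z))))" by (simp only: mult.assoc)
  also have "exp (s (k + K) * abs (Im z)) * (\<Prod>j\<in>{..<n} - {k}. exp (s (j + K) * abs (Im z))) = (\<Prod>j<n. exp (s (j + K) * abs (Im z)))"
   using k(3) by (intro prod.remove[symmetric]) auto
  also have "exp (- real (N (k + K))) * ... <= exp (- 2 * om (cmod z)) * exp (e * abs (Im z))"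
   using N2 expsum[of "{..<n}" n z] by (intro mult_mono) (auto intro: prod_nonneg)
  finally show ?thesis by (simp only: exp_add)
 qed
 \<comment> \<open>Local boundedness is enough: by Montel's theorem some subsequence of the partial
   products converges, and all the bounds pass to its limit.\<close>
 have mont: "EX B. \<forall>h\<in>range P. \<forall>z\<in>X. cmod (h z) <= B" if X: "compact X" for X
 proof -
  obtain R where R: "!!z. z \<in> X ==> cmod z <= R" using compact_imp_bounded[OF X] bounded_iff by metis
  have "cmod (P n z) <= exp (e * R)" if "z \<in> X" for n z
  proof -
   have "e * abs (Im z) <= e * R" using R[OF that] abs_Im_le_cmod[of z] e by (intro mult_left_mono) auto
   hence "exp (e * abs (Im z)) <= exp (e * R)" by simp
   thus ?thesis by (rule order_trans[OF bP])
  qed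
  thus ?thesis by blast
 qed
 obtain v r where v: "v holomorphic_on UNIV" and r: "strict_mono (r :: nat => nat)" and lim: "!!z. (%n. P (r n) z) \<longlonglongrightarrow> v z"
  by (rule Montel[of UNIV "range P" P]) (use mont hP in auto)
 have up: "cmod (v z) <= B" if PB: "!!n. m <= n ==> cmod (P n z) <= B" for z B m
 proof (rule tendsto_upperbound[OF tendsto_norm[OF lim]])
  have "cmod (P (r n) z) <= B" if "m <= n" for n
   using PB[of "r n"] seq_suble[OF r, of n] that by simp
  thus "\<forall>\<^sub>F n in sequentially. cmod (P (r n) z) <= B"
   unfolding eventually_sequentially by (intro exI[of _ m]) simp
 qed simp
 have small: "cmod (v z) <= exp (2 * om (2^K)) * exp (- 2 * om (cmod z) + e * abs (Im z))" for z
 proof (cases "cmod z < 2^K")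
  case True
  hence "om (cmod z) <= om (2^K)" by (intro w_mono) auto
  hence "exp (e * abs (Im z)) <= exp (2 * om (2^K)) * exp (- 2 * om (cmod z) + e * abs (Im z))" by (simp flip: exp_add)
  moreover have "cmod (v z) <= exp (e * abs (Im z))" by (rule up[of 0]) (rule bP)
  ultimately show ?thesis by linarith
 next
  case False
  have "EX n. cmod z < 2^n" using real_arch_pow[of 2 "cmod z"] by auto
  then obtain m where m: "cmod z < 2^m" "!!i. i < m ==> ~ cmod z < 2^i" using exists_least_iff[of "%n. cmod z < 2^n"] by blast
  have "K < m"
  proof (rule ccontr)
   assume "~ K < m"
   hence "(2::real)^m <= 2^K" by (intro power_increasing) auto
   thus False using m(1) False by linarith
  qed
  from less_imp_Suc_add[OF this] obtain k where "m = Suc (K + k)" by (elim exE)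
  hence k: "m = Suc (k + K)" by simp
  have "2^(k + K) <= cmod z" using m(2)[of "k + K"] k by simp
  hence "cmod (v z) <= exp (- 2 * om (cmod z) + e * abs (Im z))"
   using m(1) k by (intro up[of "Suc k"] dP[of k]) auto
  also have "... <= exp (2 * om (2^K)) * ..." using w_nonneg[of "2^K"] by simp
  finally show ?thesis .
 qed
 show ?thesis
 proof
  show "cmod (v z) <= exp (e * abs (Im z))" for z by (rule up[of 0]) (rule bP)
  show "1 <= cmod (v (\<i> * of_real y))" for y
  proof (rule tendsto_lowerbound[OF tendsto_norm[OF lim]])
   have "1 <= cmod (P n (\<i> * of_real y))" for n unfolding P_def prod_norm[symmetric]
   proof (rule prod_ge_1)
    fix k assume "k \<in> {..<n}"
    have "of_real (\<alpha> k) * (\<i> * of_real y) = \<i> * of_real (\<alpha> k * y)" by simp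
    show "1 <= cmod (F k (\<i> * of_real y))" unfolding F_def norm_power \<open>of_real (\<alpha> k) * (\<i> * of_real y) = _\<close> by (intro one_le_power csinc_imaginary)
   qed
   thus "\<forall>\<^sub>F n in sequentially. 1 <= cmod (P (r n) (\<i> * of_real y))" by simp
  qed simp
  have "P n 0 = 1" for n by (simp add: P_def F_def csinc_0)
  hence "(%n. 1) \<longlonglongrightarrow> v 0" using lim[of 0] by simp
  from LIMSEQ_unique[OF this tendsto_const] show "v 0 = 1" .
 qed (use v small in auto)
qed

end

lemma has_vector_derivative_quadratic:
 fixes f :: "real => complex"
 assumes "!!h. abs h <= 1 ==> cmod (f (t + h) - f t - of_real h * D) <= K * h^2"
 shows "(f has_vector_derivative D) (at t)"
 unfolding has_vector_derivative_def has_derivative_at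
proof (intro conjI bounded_linear_scaleR_left)
 have "((%h. abs K * abs h) \<longlongrightarrow> abs K * abs 0) (at (0::real))" by (intro tendsto_intros)
 hence lim: "((%h. abs K * abs h) \<longlongrightarrow> 0) (at (0::real))" by simp
 show "(%h. norm (f (t + h) - f t - h *\<^sub>R D) / norm h) \<midarrow>0\<rightarrow> 0"
 proof (rule Lim_null_comparison[OF _ lim])
  have "norm (norm (f (t + h) - f t - h *\<^sub>R D) / norm h) <= abs K * abs h" if h: "h \<in> {-1<..<1} - {0}" for h
  proof -
   have "norm (f (t + h) - f t - h *\<^sub>R D) <= K * h^2" using assms[of h] h by (simp add: scaleR_conv_of_real abs_le_iff)
   also have "... <= abs K * h^2" by (intro mult_right_mono) auto
   finally have "norm (f (t + h) - f t - h *\<^sub>R D) / norm h <= abs K * h^2 / norm h" by (intro divide_right_mono) auto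
   also have "abs K * h^2 = abs K * abs h * norm h" by (simp add: power2_eq_square)
   also have "... / norm h = abs K * abs h" using h by simp
   finally show ?thesis by simp
  qed
  thus "eventually (%h. norm (norm (f (t + h) - f t - h *\<^sub>R D) / norm h) <= abs K * abs h) (at 0)"
   using eventually_at_in_open[of "{-1<..<1::real}" 0] by (auto elim!: eventually_mono)
 qed
qed

lemma norm_exp_remainder: "cmod (exp z - 1 - z) <= exp (abs (Re z)) * (cmod z)^2"
 using Taylor_exp[of z 1] by (simp add: power2_eq_square diff_diff_eq)

abbreviation line :: "real => complex" where "line x \<equiv> of_real x - \<i>"

lemma line_norm: "1 <= cmod (line x)" "abs x <= cmod (line x)"
 using abs_Im_le_cmod[of "line x"] abs_Re_le_cmod[of "line x"] by auto

text \<open>Two powers of \<open>line x\<close> in the hypothesis control the second-order Taylor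
  remainder of the exponential under the integral, so the derivative comes with an explicit
  quadratic error.\<close>

lemma line_exp_derivative:
 assumes cont: "continuous_on UNIV k" and k: "!!x. cmod (k x) * (cmod (line x))^2 <= C / (1 + x^2)"
 shows "integrable lborel (%x. k x * exp (\<i> * line x * of_real t))"
  and "((%t. \<integral>x. k x * exp (\<i> * line x * of_real t) \<partial>lborel) has_vector_derivative
    (\<integral>x. \<i> * line x * k x * exp (\<i> * line x * of_real t) \<partial>lborel)) (at t)"
proof -
 have ne: "cmod (exp (\<i> * line x * of_real t)) = exp t" for x t by simp
 have k1: "cmod (k x) <= C / (1 + x^2)" "cmod (\<i> * line x * k x) <= C / (1 + x^2)" for x
 proof -
  have "cmod (k x) * 1 <= cmod (k x) * (cmod (line x))^2" using line_norm(1)[of x] by (intro mult_left_mono) (auto simp: one_le_power)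
  thus "cmod (k x) <= C / (1 + x^2)" using k[of x] by linarith
  have "cmod (line x) * 1 <= cmod (line x) * cmod (line x)" using line_norm(1)[of x] by (intro mult_left_mono) auto
  hence "cmod (k x) * cmod (line x) <= cmod (k x) * (cmod (line x))^2" by (intro mult_left_mono) (auto simp: power2_eq_square)
  thus "cmod (\<i> * line x * k x) <= C / (1 + x^2)" using k[of x] by (simp add: norm_mult mult.commute)
 qed
 have int: "integrable lborel (%x. g x * exp (\<i> * line x * of_real t))" if "continuous_on UNIV g" "!!x. cmod (g x) <= C / (1 + x^2)" for g t
 proof (rule integrable_of_decay)
  show "continuous_on UNIV (%x. g x * exp (\<i> * line x * of_real t))" using that(1) by (intro continuous_intros)
  show "cmod (g x * exp (\<i> * line x * of_real t)) <= (C * exp t) / (1 + x^2)" for x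
   unfolding norm_mult[of "g x"] ne using mult_right_mono[OF that(2)[of x], of "exp t"] by simp
 qed
 have c2: "continuous_on UNIV (%x. \<i> * line x * k x)" using cont by (intro continuous_intros)
 show "integrable lborel (%x. k x * exp (\<i> * line x * of_real t))" by (rule int[OF cont k1(1)])
 have i0: "integrable lborel (%x. C * exp t * exp 1 / (1 + x^2))" by (rule integrable_inverse_1_plus_square)
 let ?K = "\<integral>x. C * exp t * exp 1 / (1 + x^2) \<partial>lborel"
 show "((%t. \<integral>x. k x * exp (\<i> * line x * of_real t) \<partial>lborel) has_vector_derivative
    (\<integral>x. \<i> * line x * k x * exp (\<i> * line x * of_real t) \<partial>lborel)) (at t)"
 proof (rule has_vector_derivative_quadratic[where K = ?K])
  fix h :: real assume h: "abs h <= 1"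
  let ?d = "%x. k x * exp (\<i> * line x * of_real (t + h)) - k x * exp (\<i> * line x * of_real t) - of_real h * (\<i> * line x * k x * exp (\<i> * line x * of_real t))"
  have I: "integrable lborel (%x. k x * exp (\<i> * line x * of_real t))" for t by (rule int[OF cont k1(1)])
  have J: "integrable lborel (%x. of_real h * (\<i> * line x * k x * exp (\<i> * line x * of_real t)))"
   by (rule integrable_mult_right[OF int[OF c2 k1(2)]])
  have eq: "(\<integral>x. k x * exp (\<i> * line x * of_real (t + h)) \<partial>lborel) - (\<integral>x. k x * exp (\<i> * line x * of_real t) \<partial>lborel)
    - of_real h * (\<integral>x. \<i> * line x * k x * exp (\<i> * line x * of_real t) \<partial>lborel) = (\<integral>x. ?d x \<partial>lborel)"
   by (simp only: integral_mult_right_zero[symmetric] Bochner_Integration.integral_diff[symmetric] I J Bochner_Integration.integrable_diff)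
  have "cmod (?d x) <= h^2 * (C * exp t * exp 1 / (1 + x^2))" for x
  proof -
   let ?z = "\<i> * line x * of_real h"
   have "?d x = k x * exp (\<i> * line x * of_real t) * (exp ?z - 1 - ?z)"
    by (simp add: algebra_simps flip: exp_add)
   hence "cmod (?d x) = cmod (k x) * exp t * cmod (exp ?z - 1 - ?z)" by (simp only: norm_mult ne)
   also have "... <= cmod (k x) * exp t * (exp 1 * (cmod (line x)^2 * h^2))"
   proof (rule mult_left_mono)
    have "abs (Re ?z) <= 1" using h by simp
    moreover have "(cmod ?z)^2 = cmod (line x)^2 * h^2" unfolding norm_mult by (simp add: power_mult_distrib)
    ultimately have "exp (abs (Re ?z)) * (cmod ?z)^2 <= exp 1 * (cmod (line x)^2 * h^2)" by (simp only:, intro mult_right_mono) auto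
    thus "cmod (exp ?z - 1 - ?z) <= exp 1 * (cmod (line x)^2 * h^2)" by (rule order_trans[OF norm_exp_remainder])
   qed simp
   also have "... = h^2 * (exp t * exp 1) * (cmod (k x) * cmod (line x)^2)" by (simp only: mult_ac)
   also have "... <= h^2 * (exp t * exp 1) * (C / (1 + x^2))" by (intro mult_left_mono k) auto
   finally show ?thesis by (simp only: mult_ac times_divide_eq_right)
  qed
  hence "cmod (\<integral>x. ?d x \<partial>lborel) <= (\<integral>x. h^2 * (C * exp t * exp 1 / (1 + x^2)) \<partial>lborel)"
   by (rule Bochner_Integration.integral_norm_bound_integral[OF Bochner_Integration.integrable_diff[OF Bochner_Integration.integrable_diff[OF I I] J] integrable_mult_right[OF i0]])
  also have "... = ?K * h^2" by (simp only: integral_mult_right_zero mult.commute)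
  finally show "cmod ((\<integral>x. k x * exp (\<i> * line x * of_real (t + h)) \<partial>lborel) - (\<integral>x. k x * exp (\<i> * line x * of_real t) \<partial>lborel)
    - of_real h * (\<integral>x. \<i> * line x * k x * exp (\<i> * line x * of_real t) \<partial>lborel)) <= ?K * h^2" unfolding eq .
 qed
qed

context Ua_space
begin

lemma exp_w_decay:
 assumes "0 < q"
 obtains C where "0 < C" "!!x. 0 <= x ==> exp (- q * om x) * (1 + x)^n * (1 + x^2) <= C"
proof -
 obtain C where C: "0 < C" "!!x. 0 <= x ==> (1 + x)^(n + 2) * exp (- q * om x) <= C" using power_exp_decay[OF assms] by blast
 have "exp (- q * om x) * (1 + x)^n * (1 + x^2) <= C" if x: "0 <= x" for x
 proof -
  have "1 + x^2 <= (1 + x)^2" using x by (simp add: power2_sum)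
  hence "(exp (- q * om x) * (1 + x)^n) * (1 + x^2) <= (exp (- q * om x) * (1 + x)^n) * (1 + x)^2" using x by (intro mult_left_mono) auto
  also have "... = (1 + x)^(n + 2) * exp (- q * om x)" by (simp only: power_add mult_ac)
  also have "... <= C" by (rule C(2)[OF x])
  finally show ?thesis .
 qed
 thus ?thesis using that[OF C(1)] by blast
qed

text \<open>The step is \<^term>\<open>v\<close> times the Fourier transform of the Heaviside function, written as an integral
 over \<^term>\<open>Im w = - 1\<close>; Cauchy's formula evaluates it on both sides of the transition interval.\<close>

lemma smooth_step:
 assumes pp: "p < p'"
 obtains H where "!!j t. (H j has_vector_derivative H (Suc j) t) (at t)" "!!t. t <= p ==> H 0 t = 0" "!!t. p' <= t ==> H 0 t = 1"
  "!!L. EX C. ALL j t. abs t <= L --> cmod (H j t) <= C * M 1 j"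
proof -
 \<comment> \<open>Centre and half-width of the transition. Since \<open>v\<close> has type at most
   \<open>e\<close>, the integrand decays in the upper half-plane for \<open>t >= m + e\<close> and
   in the lower one for \<open>t <= m - e\<close>.\<close>
 define m where "m = (p + p') / 2"
 define e where "e = (p' - p) / 2"
 have e: "0 < e" using pp by (simp add: e_def)
 obtain v C where v: "v holomorphic_on UNIV" "0 < C" "!!z. cmod (v z) <= C * exp (- 2 * om (cmod z) + e * abs (Im z))" "v 0 = 1"
  using multiplier[OF e] by metis
 have vcont: "continuous_on UNIV (%x. v (line x))"
  by (rule continuous_on_compose2[OF holomorphic_on_imp_continuous_on[OF v(1)]]) (auto intro!: continuous_intros)
 have nz: "line x ~= 0" for x using line_norm(1)[of x] by auto
 define k where "k j x = (\<i> * line x)^j * v (line x) / (2 * pi * \<i> * line x)" for j x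
 define H where "H j t = (\<integral>x. k j x * exp (\<i> * line x * of_real (t - m)) \<partial>lborel)" for j t
 have kc: "continuous_on UNIV (k j)" for j unfolding k_def using nz vcont by (intro continuous_intros) auto
 have wl: "om (abs x) <= om (cmod (line x))" for x by (intro w_mono line_norm) auto
 have vl: "cmod (v (line x)) <= C * exp e * exp (- 2 * om (cmod (line x)))" for x
 proof -
  have "exp (- 2 * om (cmod (line x)) + e * abs (Im (line x))) = exp e * exp (- 2 * om (cmod (line x)))"
   unfolding exp_add by simp
  thus ?thesis using v(3)[of "line x"] by (simp only: mult.assoc)
 qed
 have kn: "cmod (k j x) <= cmod (line x)^j * cmod (v (line x))" for j x
 proof -
  have "1 * 1 <= (2 * pi) * cmod (line x)" using line_norm(1)[of x] pi_gt3 by (intro mult_mono) auto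
  hence "cmod (line x)^j * cmod (v (line x)) / (2 * pi * cmod (line x)) <= cmod (line x)^j * cmod (v (line x)) / 1" by (intro divide_left_mono) auto
  moreover have "cmod (k j x) = cmod (line x)^j * cmod (v (line x)) / (2 * pi * cmod (line x))"
   by (simp add: k_def norm_mult norm_divide norm_power)
  ultimately show ?thesis by simp
 qed
 have kdec: "EX K. ALL x. cmod (k j x) * cmod (line x)^2 <= K / (1 + x^2)" for j
 proof -
  obtain D where D: "0 < D" "!!x. 0 <= x ==> exp (- 2 * om x) * (1 + x)^(j + 2) * (1 + x^2) <= D"
   by (rule exp_w_decay[of 2 "j + 2"]) (simp, blast)
  have "cmod (k j x) * cmod (line x)^2 <= (C * exp e * D) / (1 + x^2)" for x
  proof -
   let ?y = "cmod (line x)"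
   have "cmod (k j x) * ?y^2 <= (?y^j * (C * exp e * exp (- 2 * om ?y))) * ?y^2"
    by (intro mult_right_mono order_trans[OF kn] mult_left_mono vl) auto
   also have "... = C * exp e * (exp (- 2 * om ?y) * ?y^(j + 2))" by (simp only: power_add mult_ac)
   also have "... <= C * exp e * (exp (- 2 * om ?y) * (1 + ?y)^(j + 2))" using v(2) by (intro mult_left_mono power_mono) auto
   finally have 1: "cmod (k j x) * ?y^2 <= C * exp e * (exp (- 2 * om ?y) * (1 + ?y)^(j + 2))" .
   have "1 + x^2 <= 1 + ?y^2" using power_mono[OF line_norm(2)[of x], of 2] by simp
   hence "(cmod (k j x) * ?y^2) * (1 + x^2) <= (C * exp e * (exp (- 2 * om ?y) * (1 + ?y)^(j + 2))) * (1 + ?y^2)"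
    using order_trans[OF mult_nonneg_nonneg 1] by (intro mult_mono[OF 1]) auto
   also have "... = C * exp e * (exp (- 2 * om ?y) * (1 + ?y)^(j + 2) * (1 + ?y^2))" by (simp only: mult.assoc)
   also have "... <= C * exp e * D" using v(2) by (intro mult_left_mono D(2)) auto
   finally show ?thesis by (simp add: pos_le_divide_eq add_pos_nonneg)
  qed
  thus ?thesis by blast
 qed
 show ?thesis
 proof
  fix j t
  obtain K where K: "!!x. cmod (k j x) * cmod (line x)^2 <= K / (1 + x^2)" using kdec by blast
  have ks: "\<i> * line x * k j x = k (Suc j) x" for x by (simp add: k_def)
  have "((%t. t - m) has_vector_derivative 1 - 0) (at t)"
   by (intro has_vector_derivative_diff has_vector_derivative_id has_vector_derivative_const)
  from vector_diff_chain_at[OF this line_exp_derivative(2)[OF kc K]]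
  show "(H j has_vector_derivative H (Suc j) t) (at t)"
   unfolding ks unfolding H_def by (simp add: o_def)
 next
  fix t
  have H0: "H 0 t = (\<integral>x. v (line x) * exp (\<i> * line x * of_real (t - m)) / (line x) \<partial>lborel) / (2 * pi * \<i>)"
   unfolding H_def k_def by (simp add: mult.commute flip: Bochner_Integration.integral_divide_zero)
  obtain D where D: "0 < D" "!!x. 0 <= x ==> exp (- 2 * om x) * (1 + x)^0 * (1 + x^2) <= D"
   by (rule exp_w_decay[of 2 0]) (simp, blast)
  define G where "G w = v w * exp (\<i> * w * of_real (t - m))" for w
  have Ghol: "G holomorphic_on UNIV" unfolding G_def using v(1) by (intro holomorphic_intros)
  have G: "cmod (G w) <= C * exp (e * abs (Im w) - (t - m) * Im w) * exp (- 2 * om (cmod w))" for w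
  proof -
   have "cmod (G w) = cmod (v w) * exp (- ((t - m) * Im w))" by (simp add: G_def norm_mult mult.commute)
   also have "... <= (C * exp (- 2 * om (cmod w) + e * abs (Im w))) * exp (- ((t - m) * Im w))" by (intro mult_right_mono v(3)) auto
   also have "exp (- 2 * om (cmod w) + e * abs (Im w)) = exp (- 2 * om (cmod w)) * exp (e * abs (Im w))" by (rule exp_add)
   finally show ?thesis unfolding exp_diff exp_minus by (simp add: field_simps)
  qed
  have dec: "cmod (G w) <= (4 * C * D * exp (2 * e + abs (t - m))) / (1 + (cmod u)^2)"
   if "cmod u <= cmod w + 1" "e * abs (Im w) - (t - m) * Im w <= 2 * e + abs (t - m)" for u w
  proof -
   have "cmod (G w) <= C * exp (2 * e + abs (t - m)) * exp (- 2 * om (cmod w))"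
    using that(2) v(2) by (intro order_trans[OF G] mult_right_mono mult_left_mono) auto
   moreover have "1 + (cmod u)^2 <= 4 * (1 + (cmod w)^2)"
   proof -
    have "(cmod u)^2 <= (cmod w + 1)^2" using that(1) by (intro power_mono) auto
    also have "... <= 2 * (cmod w)^2 + 2" using sum_squares_ge_zero[of "cmod w - 1" 0] by (simp add: power2_eq_square algebra_simps)
    finally show ?thesis using zero_le_power2[of "cmod w"] by argo
   qed
   ultimately have "cmod (G w) * (1 + (cmod u)^2) <= (C * exp (2 * e + abs (t - m)) * exp (- 2 * om (cmod w))) * (4 * (1 + (cmod w)^2))"
    by (rule mult_mono) (use v(2) in auto)
   also have "... = (4 * C * exp (2 * e + abs (t - m))) * (exp (- 2 * om (cmod w)) * (1 + cmod w)^0 * (1 + (cmod w)^2))" by (simp add: mult_ac)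
   also have "... <= (4 * C * exp (2 * e + abs (t - m))) * D" using v(2) by (intro mult_left_mono D(2)) auto
   finally show ?thesis by (simp add: pos_le_divide_eq add_pos_nonneg mult_ac)
  qed
  \<comment> \<open>The shift by \<open>\<i>\<close> moves the line of integration to the real axis
    and the pole to \<open>\<i>\<close>, where the residue is \<open>v 0 = 1\<close>.\<close>
  show "H 0 t = 1" if t: "p' <= t"
  proof -
   have te: "e <= t - m" using t by (simp add: e_def m_def field_simps)
   have "(\<integral>x. G (of_real x - \<i>) / (of_real x - \<i>) \<partial>lborel) = (if Im \<i> > 0 then 2 * pi * \<i> * G (\<i> - \<i>) else 0)"
   proof (rule line_Cauchy(2)[of "%u. G (u - \<i>)"])
    show "(%u. G (u - \<i>)) holomorphic_on UNIV" by (intro entire_compose[OF Ghol] holomorphic_intros)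
    fix u assume u: "0 <= Im u"
    show "cmod (G (u - \<i>)) <= (4 * C * D * exp (2 * e + abs (t - m))) / (1 + (cmod u)^2)"
    proof (rule dec)
     show "cmod u <= cmod (u - \<i>) + 1" using norm_triangle_ineq2[of u "\<i>"] by simp
     show "e * abs (Im (u - \<i>)) - (t - m) * Im (u - \<i>) <= 2 * e + abs (t - m)"
     proof (cases "1 <= Im u")
      case True
      hence "e * (Im u - 1) <= (t - m) * (Im u - 1)" using te by (intro mult_right_mono) auto
      thus ?thesis using True e by simp
     next
      case False
      hence "e * (1 - Im u) <= e * 1" "(t - m) * (1 - Im u) <= (t - m) * 1" using u e te by (auto intro!: mult_left_mono)
      thus ?thesis using False e te by (simp add: algebra_simps)
     qed
    qed
   qed simp
   thus ?thesis unfolding H0 by (simp add: G_def v(4))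
  qed
  \<comment> \<open>The reflection turns the lower half-plane into the upper one; the pole is then
    at \<open>- \<i>\<close>, outside the contour.\<close>
  show "H 0 t = 0" if t: "t <= p"
  proof -
   have te: "e <= m - t" using t by (simp add: e_def m_def field_simps)
   have z: "(\<integral>x. G (- of_real x - \<i>) / (of_real x - (- \<i>)) \<partial>lborel) = (if Im (- \<i>) > 0 then 2 * pi * \<i> * G (- (- \<i>) - \<i>) else 0)"
   proof (rule line_Cauchy(2)[of "%u. G (- u - \<i>)"])
    show "(%u. G (- u - \<i>)) holomorphic_on UNIV" by (intro entire_compose[OF Ghol] holomorphic_intros)
    fix u assume u: "0 <= Im u"
    show "cmod (G (- u - \<i>)) <= (4 * C * D * exp (2 * e + abs (t - m))) / (1 + (cmod u)^2)"
    proof (rule dec)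
     have "cmod u = cmod (- u)" by simp
     also have "... <= cmod (- u - \<i>) + 1" using norm_triangle_ineq2[of "-u" "\<i>"] by simp
     finally show "cmod u <= cmod (- u - \<i>) + 1" .
     have "e * Im u <= (m - t) * Im u" using te u by (intro mult_right_mono) auto
     thus "e * abs (Im (- u - \<i>)) - (t - m) * Im (- u - \<i>) <= 2 * e + abs (t - m)" using u e te by (simp add: algebra_simps)
    qed
   qed simp
   have "(\<integral>x. G (- of_real x - \<i>) / (- of_real x - \<i>) \<partial>lborel) = 0"
   proof -
    have "G (- of_real x - \<i>) / (- of_real x - \<i>) = - (G (- of_real x - \<i>) / (of_real x - (- \<i>)))" for x
     using minus_divide_right[of "G (- of_real x - \<i>)" "of_real x + \<i>"] by simp
    thus ?thesis using z by simp
   qed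
   moreover have "(\<integral>x. G (line x) / line x \<partial>lborel) = (\<integral>x. G (line (0 + (-1) * x)) / line (0 + (-1) * x) \<partial>lborel)"
    using lborel_integral_real_affine[of "-1" "%x. G (line x) / line x" 0] by simp
   ultimately show ?thesis unfolding H0 by (simp add: G_def)
  qed
 next
  fix L :: real
  obtain D where D: "0 < D" "!!x. 0 <= x ==> exp (- 1 * om x) * (1 + x)^0 * (1 + x^2) <= D"
   by (rule exp_w_decay[of 1 0]) (simp, blast)
  define K where "K = (\<integral>x. C * exp e * exp (om 1) * D / (1 + x^2) \<partial>lborel)"
  have Ki: "integrable lborel (%x. C * exp e * exp (om 1) * D * A / (1 + x^2))" for A by (rule integrable_inverse_1_plus_square)
  have "cmod (H j t) <= (exp (L + abs m) * K) * M 1 j" if t: "abs t <= L" for j t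
  proof -
   have bd: "cmod (k j x * exp (\<i> * line x * of_real (t - m))) <= C * exp e * exp (om 1) * D * (M 1 j * exp (L + abs m)) / (1 + x^2)" for x
   proof -
    let ?y = "cmod (line x)"
    have "cmod (k j x) <= ?y^j * (C * exp e * exp (- 2 * om ?y))" by (intro order_trans[OF kn] mult_left_mono vl) auto
    \<comment> \<open>Of the decay \<open>exp (- 2 * om ?y)\<close> one half pays for the power
      \<open>?y^j\<close>, the other for integrability. This is how the bound with
      \<open>q = 1\<close> arises.\<close>
    also have "... <= (exp (om 1) * M 1 j * exp (1 * om ?y)) * (C * exp e * exp (- 2 * om ?y))"
     using v(2) by (intro mult_right_mono power_le_M) auto
    also have "... = C * exp e * exp (om 1) * M 1 j * exp (- 1 * om ?y)" by (simp add: mult_ac flip: exp_add)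
    also have "exp (- 1 * om ?y) <= D / (1 + x^2)"
    proof -
     have "1 + x^2 <= 1 + ?y^2" using power_mono[OF line_norm(2)[of x], of 2] by simp
     hence "exp (- 1 * om ?y) * (1 + x^2) <= exp (- 1 * om ?y) * (1 + ?y^2)" by (intro mult_left_mono) auto
     also have "... <= D" using D(2)[of ?y] by simp
     finally show ?thesis by (simp add: pos_le_divide_eq add_pos_nonneg)
    qed
    finally have kb: "cmod (k j x) <= C * exp e * exp (om 1) * M 1 j * (D / (1 + x^2))" using v(2) by (simp add: mult_left_mono)
    have "exp (t - m) <= exp (L + abs m)" using t by simp
    hence "cmod (k j x) * exp (t - m) <= (C * exp e * exp (om 1) * M 1 j * (D / (1 + x^2))) * exp (L + abs m)"
     using kb v(2) D(1) by (intro mult_mono) (auto intro!: mult_nonneg_nonneg divide_nonneg_nonneg)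
    thus ?thesis by (simp add: norm_mult mult_ac)
   qed
   have "cmod (H j t) <= (\<integral>x. C * exp e * exp (om 1) * D * (M 1 j * exp (L + abs m)) / (1 + x^2) \<partial>lborel)"
    unfolding H_def
   proof (rule Bochner_Integration.integral_norm_bound_integral)
    obtain K where "!!x. cmod (k j x) * cmod (line x)^2 <= K / (1 + x^2)" using kdec by blast
    thus "integrable lborel (%x. k j x * exp (\<i> * line x * of_real (t - m)))" by (rule line_exp_derivative(1)[OF kc])
   qed (use bd Ki in auto)
   also have "... = (\<integral>x. (exp (L + abs m) * M 1 j) * (C * exp e * exp (om 1) * D / (1 + x^2)) \<partial>lborel)" by (simp only: mult_ac times_divide_eq_right)
   also have "... = exp (L + abs m) * M 1 j * K" unfolding K_def by (simp only: integral_mult_right_zero)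
   finally show ?thesis by (simp only: mult_ac)
  qed
  thus "EX C. ALL j t. abs t <= L --> cmod (H j t) <= C * M 1 j" by blast
 qed
qed

end

section \<open>The resolvent bound and injectivity of the transform\<close>

lemma constant_jet:
 fixes H :: "nat => real => complex"
 assumes H: "!!j t. (H j has_vector_derivative H (Suc j) t) (at t)" and S: "!!t. t \<in> S ==> at t within S ~= bot"
  and c: "!!t. t \<in> S ==> H 0 t = c"
 shows "t \<in> S ==> H j t = (if j = 0 then c else 0)"
proof (induction j arbitrary: t)
 case 0 thus ?case using c by simp
next
 case (Suc j)
 have "(H j has_vector_derivative 0) (at t within S)"
  by (rule has_vector_derivative_transform[OF Suc.prems _ has_vector_derivative_const[of "if j = 0 then c else 0"]]) (use Suc.IH in auto)
 from vector_derivative_unique_within[OF S[OF Suc.prems] this has_vector_derivative_at_within[OF H]]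
 show ?case by simp
qed

lemma at_within_half_line:
 fixes t :: real
 shows "t <= p ==> at t within {..p} ~= bot" "p <= t ==> at t within {p..} ~= bot"
 using at_le[of "{..<t}" "{..p}" t] at_le[of "{t<..}" "{p..}" t] trivial_limit_at_left_real[of t] trivial_limit_at_right_real[of t]
 by (auto simp: bot_unique subset_iff)

text \<open>Integration starts at the end \<open>s * L\<close>, where \<open>u\<close> vanishes and
  from where the exponential decays inwards. After reflection by \<open>s\<close> the solution times
  its integrating factor is compared with an explicit primitive of
  \<open>B * exp (- y * x)\<close>.\<close>

lemma decay_ode:
 fixes u :: "real => complex"
 assumes s: "s = 1 | s = - 1" and u: "!!t. abs t <= L ==> (u has_vector_derivative - \<i> * z * u t + g t) (at t)"
  and g: "!!t. abs t <= L ==> cmod (g t) <= B" and end_zero: "u (s * L) = 0" and y: "0 < s * Im z" and t: "abs t <= L"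
 shows "cmod (u t) <= B / (s * Im z)"
proof -
 define y where "y = s * Im z"
 define w where "w \<tau> = exp (\<i> * z * s * of_real \<tau>) * u (s * \<tau>)" for \<tau>
 have y0: "0 < y" and ss: "s * s = 1" "abs s = 1" using y s by (auto simp: y_def)
 have abs: "abs (s * \<tau>) = abs (\<tau>)" for \<tau> using ss by (simp add: abs_mult)
 have stt: "s * (s * t) = t" using ss by (simp flip: mult.assoc)
 have B: "0 <= B" using g[OF t] norm_ge_zero order_trans by blast
 have wd: "(w has_vector_derivative exp (\<i> * z * s * of_real \<tau>) * (s * g (s * \<tau>))) (at \<tau>)" if "abs (\<tau>) <= L" for \<tau>
 proof -
  have "((%\<tau>. s * \<tau>) has_vector_derivative s) (at \<tau>)" using has_vector_derivative_mult_right[OF has_vector_derivative_id, of s] by simp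
  from vector_diff_chain_at[OF this u] have "((%\<tau>. u (s * \<tau>)) has_vector_derivative s *\<^sub>R (- \<i> * z * u (s * \<tau>) + g (s * \<tau>))) (at \<tau>)"
   using that abs by (simp add: o_def)
  from has_vector_derivative_mult[OF exp_iz_derivative[of "\<i> * z * s"] this]
  show ?thesis unfolding w_def by (simp add: scaleR_conv_of_real algebra_simps)
 qed
 have en: "cmod (exp (\<i> * z * s * of_real \<tau>)) = exp (- y * \<tau>)" for \<tau> by (simp add: y_def mult_ac)
 have st: "s * t <= L" using t abs[of t] by linarith
 have "cmod (u t) * exp (- y * (s * t)) <= (B / y) * exp (- y * (s * t))"
 proof (cases "s * t = L")
  case True thus ?thesis using end_zero stt B y0 by auto
 next
  case False
  define G where "G \<tau> = - (B / y) * exp (- y * \<tau>)" for \<tau>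
  have Gd: "(G has_vector_derivative B * exp (- y * \<tau>)) (at \<tau>)" for \<tau>
   unfolding G_def has_real_derivative_iff_has_vector_derivative[symmetric]
   using y0 by (auto intro!: derivative_eq_intros)
  have "norm (w L - w (s * t)) <= G L - G (s * t)"
  proof (rule differentiable_bound_general[where f' = "%\<tau>. exp (\<i> * z * s * of_real \<tau>) * (s * g (s * \<tau>))" and \<phi>' = "%\<tau>. B * exp (- y * \<tau>)"])
   have i: "abs (\<tau>) <= L" if "\<tau> \<in> {s * t..L}" for \<tau> using that t abs[of t] by auto
   show "s * t < L" using st False by simp
   show "continuous_on {s * t..L} w"
    using wd[OF i] by (intro continuous_at_imp_continuous_on ballI has_vector_derivative_continuous) auto
   show "continuous_on {s * t..L} G"
    using Gd by (intro continuous_at_imp_continuous_on ballI has_vector_derivative_continuous) auto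
   fix \<tau> assume "s * t < \<tau>" "\<tau> < L"
   hence \<tau>: "abs (\<tau>) <= L" using i[of \<tau>] by simp
   show "(w has_vector_derivative exp (\<i> * z * s * of_real \<tau>) * (s * g (s * \<tau>))) (at \<tau>)" by (rule wd[OF \<tau>])
   show "(G has_vector_derivative B * exp (- y * \<tau>)) (at \<tau>)" by (rule Gd)
   have "cmod (g (s * \<tau>)) <= B" using \<tau> abs by (intro g) simp
   thus "norm (exp (\<i> * z * s * of_real \<tau>) * (s * g (s * \<tau>))) <= B * exp (- y * \<tau>)"
    using ss unfolding norm_mult en by (simp add: mult.commute)
  qed
  moreover have "w L = 0" "G L <= 0" using end_zero B y0 by (simp_all add: w_def G_def)
  moreover have "cmod (w (s * t)) = cmod (u t) * exp (- y * (s * t))" unfolding w_def norm_mult en stt by simp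
  ultimately show ?thesis by (simp add: G_def)
 qed
 from mult_right_le_imp_le[OF this exp_gt_zero] show ?thesis unfolding y_def .
qed

context Ua_space
begin

lemma step_function:
 assumes pp: "p < p'"
 obtains \<theta> where "\<theta> \<in> Cinf a" "!!b. inrad b ==> EX B. nb 1 b \<theta> B" "!!j t. t <= p ==> Dn j \<theta> t = 0"
  "!!j t. t \<in> Om ==> p' <= t ==> Dn j \<theta> t = Dn j (ez 0) t"
proof -
 obtain H where H: "!!j t. (H j has_vector_derivative H (Suc j) t) (at t)" "!!t. t <= p ==> H 0 t = 0"
  "!!t. p' <= t ==> H 0 t = 1" "!!L. EX C. ALL j t. abs t <= L --> cmod (H j t) <= C * M 1 j" by (rule smooth_step[OF pp]) (rule that)
 have jH: "jet H" unfolding jet_def using H(1) by simp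
 note D = Dn_cut[OF jH]
 have e: "Dn j (ez 0) t = (if j = 0 then 1 else 0)" if "t \<in> Om" for j t using that by (simp add: Dn_ez power_0_left)
 show ?thesis
 proof (rule that[of "cut (H 0)"])
  show "cut (H 0) \<in> Cinf a" by (rule cut_Cinf[OF jH])
  show "EX B. nb 1 b (cut (H 0)) B" if b: "inrad b" for b
  proof -
   obtain C where "ALL j t. abs t <= b --> cmod (H j t) <= C * M 1 j" using H(4)[of b] by (elim exE)
   hence "nb 1 b (cut (H 0)) C" unfolding nb_def D using Om_inner[OF b] by (simp add: cut_def)
   thus ?thesis ..
  qed
  show "Dn j (cut (H 0)) t = 0" if "t <= p" for j t
   using constant_jet[where H = H and S = "{..p}" and c = 0, OF H(1) _ H(2)] that
   unfolding D by (simp add: cut_def at_within_half_line)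
  show "Dn j (cut (H 0)) t = Dn j (ez 0) t" if "t \<in> Om" "p' <= t" for j t
   using constant_jet[where H = H and S = "{p'..}" and c = 1, OF H(1) _ H(3)] that
   unfolding D by (simp add: cut_def e at_within_half_line)
 qed
qed

lemma Dn_minus: "f \<in> Cinf a ==> g \<in> Cinf a ==> Dn j (f - g) t = Dn j f t - Dn j g t"
proof -
 assume "f \<in> Cinf a" "g \<in> Cinf a"
 moreover have e: "f - g = f + cscale (-1) g" by (simp add: fun_eq_iff cscale_apply)
 ultimately show ?thesis unfolding e by (simp add: Cinf_add Cinf_scale cscale_apply del: cfun.scale_minus_left)
qed

text \<open>From here on the sign \<open>s\<close> treats both ends of the interval at once:
  \<open>s * t\<close> is large near the right end for \<open>s = 1\<close> and near the left end
  for \<open>s = - 1\<close>. A left step is the constant \<open>ez 0\<close> minus a right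
  step.\<close>

lemma side_step:
 assumes s: "s = 1 | s = - 1" and pp: "p < p'"
 obtains \<theta> where "\<theta> \<in> U" "!!b. inrad b ==> EX B. nb 1 b \<theta> B" "!!j t. s * t <= p ==> Dn j \<theta> t = 0"
  "!!j t. t \<in> Om ==> p' <= s * t ==> Dn j \<theta> t = Dn j (ez 0) t"
proof -
 have U1: "f \<in> U" if f: "f \<in> Cinf a" "!!b. inrad b ==> EX B. nb 1 b f B" for f
  unfolding Ua_iff
 proof (intro conjI allI impI f(1))
  fix q b :: real assume "0 < q & q < 1 & inrad b"
  moreover from this obtain B where "nb 1 b f B" using f(2) by auto
  ultimately show "EX B. nb q b f B" using nb_mono[of 1 b f B q b B] by (auto simp: inrad_def)
 qed
 show ?thesis
 proof (cases "s = 1")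
  case True
  obtain \<theta> where "\<theta> \<in> Cinf a" "!!b. inrad b ==> EX B. nb 1 b \<theta> B" "!!j t. t <= p ==> Dn j \<theta> t = 0"
   "!!j t. t \<in> Om ==> p' <= t ==> Dn j \<theta> t = Dn j (ez 0) t" by (rule step_function[OF pp]) (rule that)
  thus ?thesis using that[OF U1] True by simp
 next
  case False
  hence s: "s = - 1" using s by simp
  have np: "- p' < - p" using pp by simp
  obtain \<theta> where \<theta>: "\<theta> \<in> Cinf a" "!!b. inrad b ==> EX B. nb 1 b \<theta> B" "!!j t. t <= - p' ==> Dn j \<theta> t = 0"
   "!!j t. t \<in> Om ==> - p <= t ==> Dn j \<theta> t = Dn j (ez 0) t" by (rule step_function[OF np]) (rule that)
  have c: "ez 0 - \<theta> \<in> Cinf a" by (rule Cinf_minus[OF ez_Cinf \<theta>(1)])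
  have n: "EX B. nb 1 b (ez 0 - \<theta>) B" if b: "inrad b" for b
  proof -
   obtain B where B: "nb 1 b \<theta> B" using \<theta>(2)[OF b] by (elim exE)
   have "nb 1 b (ez 0) (exp (om 1) * exp (1 * om (cmod 0) + b * abs (Im 0)))" using b by (intro ez_nb) (auto simp: inrad_def)
   from nb_add[OF this nb_scale[OF B \<theta>(1), of "-1"] ez_Cinf] have "EX B. nb 1 b (ez 0 + cscale (-1) \<theta>) B" using Cinf_scale[OF \<theta>(1)] by blast
   moreover have "ez 0 + cscale (-1) \<theta> = ez 0 - \<theta>" by (simp add: fun_eq_iff cscale_apply del: cfun.scale_minus_left)
   ultimately show ?thesis by simp
  qed
  show ?thesis
  proof (rule that[OF U1[OF c n] n])
   fix j t
   show "Dn j (ez 0 - \<theta>) t = 0" if "s * t <= p"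
    using that s \<theta> Dn_outside[OF c, of t j] by (cases "t \<in> Om") (simp_all add: Dn_minus ez_Cinf)
   show "Dn j (ez 0 - \<theta>) t = Dn j (ez 0) t" if "t \<in> Om" "p' <= s * t"
    using that s \<theta> by (simp add: Dn_minus ez_Cinf)
  qed
 qed
qed

lemma ez0_mult: "f \<in> Cinf a ==> ez 0 * f = f"
 using Cinf_outside[of f] by (auto simp: fun_eq_iff exp_monomial_def)

lemma Dn_mult_0: "\<theta> \<in> Cinf a ==> f \<in> Cinf a ==> (!!i. Dn i \<theta> t = 0) ==> Dn j (\<theta> * f) t = 0"
 by (simp add: Cinf_mult(2))

lemma Dn_mult_1: "\<theta> \<in> Cinf a ==> f \<in> Cinf a ==> (!!i. Dn i \<theta> t = Dn i (ez 0) t) ==> Dn j (\<theta> * f) t = Dn j f t"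
 using Cinf_mult(2)[OF ez_Cinf[of 0], of f j t] by (simp add: Cinf_mult(2) ez0_mult)

text \<open>Modulo multiples of \<^term>\<open>ez z\<close>, the solution operator \<^term>\<open>res z\<close> has norm at most a constant times
 the inverse of \<^term>\<open> abs (Im z)\<close>: integrate from the end of the interval at which the exponential decays.\<close>

lemma near_resolvent:
 assumes f: "f \<in> U" and q: "0 < q" "q < 1" and b: "inrad b"
 shows "EX K. ALL z. Im z ~= 0 --> (EX h. nb q b (res z f + cscale h (ez z)) (K / abs (Im z)))"
proof -
 have b0: "0 < b" "b \<in> Om" using b Om_inner[OF b, of b] by (auto simp: inrad_def)
 obtain L where L: "inrad L" "b < L" using inrad_above[OF b0(2)] b0(1) by auto
 have side: "EX K. ALL z. 0 < s * Im z --> (EX h. nb q b (res z f + cscale h (ez z)) (K / (s * Im z)))" if s: "s = 1 | s = - 1" for s :: real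
 proof -
  obtain \<theta> where \<theta>: "\<theta> \<in> U" "!!b. inrad b ==> EX B. nb 1 b \<theta> B" "!!j t. s * t <= b ==> Dn j \<theta> t = 0"
   "!!j t. t \<in> Om ==> L <= s * t ==> Dn j \<theta> t = Dn j (ez 0) t" by (rule side_step[OF s L(2)]) (rule that)
  define g where "g = f - \<theta> * f"
  have gU: "g \<in> U" unfolding g_def using f \<theta>(1) by (intro Ua_minus Ua_mult)
  note c = Ua_Cinf[OF f] Ua_Cinf[OF \<theta>(1)] Ua_Cinf[OF gU] Ua_Cinf[OF Ua_mult[OF \<theta>(1) f]]
  have g1: "Dn j g t = Dn j f t" if "s * t <= b" for j t
   unfolding g_def using c Dn_mult_0[OF c(2,1) \<theta>(3)[OF that]] by (simp add: Dn_minus)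
  have g2: "Dn j g t = 0" if "t \<in> Om" "L <= s * t" for j t
   unfolding g_def using c Dn_mult_1[OF c(2,1) \<theta>(4)[OF that]] by (simp add: Dn_minus)
  obtain B where B: "nb q L g B" using Ua_nb[OF gU q L(1)] by (elim exE)
  have ab: "abs (s * x) = abs x" for x using s by auto
  have sL: "s * L \<in> Om" "s * (s * L) = L" using s Om_inner[OF L(1)] L(2) b0(1) by auto
  have "EX h. nb q b (res z f + cscale h (ez z)) (B / (s * Im z))" if z: "0 < s * Im z" for z
  proof -
   \<comment> \<open>Makes \<open>u\<close> vanish at the end \<open>s * L\<close>. As
     \<open>g\<close> is flat there, the equation makes all derivatives of \<open>u\<close> vanish
     too, so \<open>decay_ode\<close> applies to each of them.\<close>
   define h where "h = - res z g (s * L) / ez z (s * L)"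
   define u where "u = res z g + cscale h (ez z)"
   have nz: "ez z (s * L) ~= 0" using sL by (simp add: exp_monomial_def)
   have uC: "u \<in> Cinf a" unfolding u_def using c by (simp add: Cinf_ops)
   have uD: "Dn (Suc j) u t = - \<i> * z * Dn j u t + Dn j g t" if "t \<in> Om" for j t
    unfolding u_def using that Dn_res[OF c(3) that, where j = j and z = z] c
    by (simp add: Cinf_ops Dn_ez algebra_simps del: funpow.simps)
   have u0: "Dn j u (s * L) = 0" for j
   proof (induction j)
    case 0 show ?case using nz by (simp add: u_def h_def cscale_apply)
   next
    case (Suc j) thus ?case using uD[OF sL(1), of j] g2[OF sL(1), of j] sL(2) by simp
   qed
   have ub: "cmod (Dn j u t) <= B * M q j / (s * Im z)" if t: "abs t <= b" for j t
   proof (rule decay_ode[where u = "Dn j u" and g = "Dn j g" and L = L, OF s _ _ u0 z])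
    fix x assume x: "abs x <= L"
    show "(Dn j u has_vector_derivative - \<i> * z * Dn j u x + Dn j g x) (at x)"
     using Cinf_derivative[OF uC Om_inner[OF L(1) x], of j] unfolding uD[OF Om_inner[OF L(1) x]] .
    show "cmod (Dn j g x) <= B * M q j" by (rule nbD[OF B x])
   qed (use t L in simp)
   have eq: "Dn j (res z f) t = Dn j (res z g) t" if t: "abs t <= b" for j t
   proof (induction j)
    case 0
    have Om: "x \<in> Om" "s * x <= b" if "x \<in> {-b..b}" for x
     using that Om_inner[OF b, of x] ab[of x] by auto
    have "res z f t = res z g t"
    proof (rule ode_unique[OF res_Cinf[OF c(1)] _ res_Cinf[OF c(3)], where s = 0 and l = "- b" and r = b])
     show "Diff a (res z f) x = - \<i> * z * res z f x + f x" "Diff a (res z g) x = - \<i> * z * res z g x + f x" if "x \<in> {-b..b}" for x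
      using Diff_res[OF c(1) Om(1)[OF that]] Diff_res[OF c(3) Om(1)[OF that]] g1[OF Om(2)[OF that], of 0] by simp_all
    qed (use Om t b0 in \<open>auto simp: res_0\<close>)
    thus ?case by simp
   next
    case (Suc j)
    have "s * t <= b" using t ab[of t] by linarith
    thus ?case using Dn_res[OF c(1) Om_inner[OF b t]] Dn_res[OF c(3) Om_inner[OF b t]] Suc g1[of t j] by simp
   qed
   have "Dn j (res z f + cscale h (ez z)) t = Dn j u t" if "abs t <= b" for j t
    unfolding u_def using eq[OF that, of j] c by (simp add: Cinf_ops)
   hence "nb q b (res z f + cscale h (ez z)) (B / (s * Im z))"
    unfolding nb_def using ub by simp
   thus ?thesis ..
  qed
  thus ?thesis by blast
 qed
 obtain K1 where K1: "ALL z. 0 < Im z --> (EX h. nb q b (res z f + cscale h (ez z)) (K1 / Im z))" using side[of 1] by auto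
 obtain K2 where K2: "ALL z. Im z < 0 --> (EX h. nb q b (res z f + cscale h (ez z)) (K2 / - Im z))" using side[of "-1"] by auto
 have "EX h. nb q b (res z f + cscale h (ez z)) (max K1 K2 / abs (Im z))" if nz: "Im z ~= 0" for z
 proof -
  consider "0 < Im z" | "Im z < 0" using nz by linarith
  then obtain h K where h: "nb q b (res z f + cscale h (ez z)) (K / abs (Im z))" "K <= max K1 K2"
  proof cases
   case 1 thus ?thesis using K1 that[of _ K1] by auto
  next
   case 2 thus ?thesis using K2 that[of _ K2] by auto
  qed
  have "nb q b (res z f + cscale h (ez z)) (max K1 K2 / abs (Im z))"
   by (rule nb_mono[OF h(1) q(1) order_refl _ order_refl]) (use b0 h(2) in \<open>auto intro!: divide_right_mono\<close>)
  thus ?thesis ..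
 qed
 thus ?thesis by blast
qed

text \<open>The order of the quantifiers matters: \<open>h\<close> depends on \<open>z\<close> but
  not on the functional, so it can be eliminated between two functionals.\<close>

lemma FL_res_bound:
 assumes f: "f \<in> U" and q: "0 < q" "q < 1" and b: "inrad b"
 shows "EX K. ALL z. EX h. ALL S C. lin S --> bdd S q b C --> cmod (S (res z f) + h * FL S z) * abs (Im z) <= C * K"
proof -
 from near_resolvent[OF assms] obtain K where K: "ALL z. Im z ~= 0 --> (EX h. nb q b (res z f + cscale h (ez z)) (K / abs (Im z)))" by (elim exE)
 have "EX h. ALL S C. lin S --> bdd S q b C --> cmod (S (res z f) + h * FL S z) * abs (Im z) <= C * max K 0" for z
 proof (cases "Im z = 0")
  case True
  have "0 <= C * max K 0" if "bdd S q b C" for S :: "(real => complex) => complex" and C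
  proof -
   have "nb q b 0 1" using nb_scale[OF ez_nb[of q b 0] ez_Cinf, of 0] nb_mono[of q b 0 0 q b 1] q b by (simp add: inrad_def zero_fun_def cscale_def)
   from bddD[OF that Ua_0 this] have "0 <= C * 1" using norm_ge_zero order_trans by blast
   thus ?thesis by simp
  qed
  thus ?thesis using True by (intro exI[of _ 0] allI impI) simp
 next
  case False
  then obtain h where h: "nb q b (res z f + cscale h (ez z)) (K / abs (Im z))" using K by auto
  have "cmod (S (res z f) + h * FL S z) * abs (Im z) <= C * max K 0" if S: "lin S" "bdd S q b C" for S C
  proof -
   have r: "res z f \<in> U" by (rule res_U[OF f])
   have eq: "S (res z f + cscale h (ez z)) = S (res z f) + h * FL S z"
    using lin_add[OF S(1) r Ua_scale[OF ez_U]] lin_scale[OF S(1) ez_U] by (simp add: FL_def)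
   have "cmod (S (res z f) + h * FL S z) <= C * (K / abs (Im z))"
    using bddD[OF S(2) Ua_add[OF r Ua_scale[OF ez_U]] h] unfolding eq .
   moreover have "0 <= K / abs (Im z)" using nb_nonneg[OF h] b by (simp add: inrad_def)
   ultimately show ?thesis using False by (simp add: pos_le_divide_eq zero_le_divide_iff max_absorb1)
  qed
  thus ?thesis by (intro exI[of _ h] allI impI)
 qed
 thus ?thesis by (intro exI[of _ "max K 0"] allI)
qed

text \<open>With a zero transform the correction term of \<open>FL_res_bound\<close> disappears:
  \<open>S (res z g)\<close> is an entire function of \<open>z\<close> bounded by a constant over
  \<open>|Im z|\<close>, hence 0 by \<open>strip_bound\<close> and Liouville. Taking
  \<open>g\<close> as the derivative of \<open>f\<close> and \<open>z = 0\<close> recovers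
  \<open>S f\<close>.\<close>

lemma FL_injective:
 assumes S: "S \<in> dual" and z: "!!z. FL S z = 0" and f: "f \<in> U"
 shows "S f = 0"
proof -
 obtain q b C where l: "lin S" and q: "0 < q" "q < 1" and b: "inrad b" and B: "bdd S q b C" by (rule dualE[OF S])
 have zero: "S (res z g) = 0" if g: "g \<in> U" for g z
 proof -
  from FL_res_bound[OF g q b] obtain K where K: "ALL z. EX h. ALL S C. lin S --> bdd S q b C --> cmod (S (res z g) + h * FL S z) * abs (Im z) <= C * K" by (elim exE)
  have E: "cmod (S (res z g)) * abs (Im z) <= C * K" for z
  proof -
   obtain h where "ALL S C. lin S --> bdd S q b C --> cmod (S (res z g) + h * FL S z) * abs (Im z) <= C * K" using K[rule_format, of z] by (elim exE)
   hence "cmod (S (res z g) + h * FL S z) * abs (Im z) <= C * K" using l B by simp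
   thus ?thesis using assms(2) by simp
  qed
  have hol: "(%z. S (res z g)) holomorphic_on UNIV" by (rule S_res_holomorphic[OF S g])
  have "cmod (S (res z g)) <= C * K" for z
  proof (cases "abs (Im z) <= 1")
   case True
   show ?thesis by (rule strip_bound[OF hol True E])
  next
   case False
   hence "cmod (S (res z g)) * 1 <= cmod (S (res z g)) * abs (Im z)" by (intro mult_left_mono) auto
   thus ?thesis using E[of z] by simp
  qed
  hence "bounded (range (%z. S (res z g)))" unfolding bounded_iff by blast
  from Liouville_theorem[OF hol this] obtain k where k: "!!z. S (res z g) = k" by (auto simp: constant_on_def)
  have "k = 0"
  proof (rule ccontr)
   assume "k ~= 0"
   hence "cmod k * abs ((abs (C * K) + 1) / cmod k) = abs (C * K) + 1" by simp
   thus False using E[of "\<i> * of_real ((abs (C * K) + 1) / cmod k)"] abs_ge_self[of "C * K"] unfolding k by simp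
  qed
  thus ?thesis using k by simp
 qed
 have "S (res 0 (Diff a f)) = 0" by (rule zero[OF Diff_U[OF f]])
 hence "S (f - cscale (f 0) (ez 0) - cscale (\<i> * 0) (res 0 f)) = 0"
  by (simp only: res_Diff[OF Ua_Cinf[OF f] Diff_Cinf[OF Ua_Cinf[OF f]]])
 moreover have "S (ez 0) = 0" using z[of 0] by (simp add: FL_def)
 ultimately show ?thesis
  using f lin_minus[OF l Ua_minus[OF f Ua_scale[OF ez_U]] Ua_scale[OF res_U[OF f]]] lin_minus[OF l f Ua_scale[OF ez_U]]
   lin_scale[OF l ez_U] lin_scale[OF l res_U[OF f]] by simp
qed

end

section \<open>Functionals with prescribed transform, and supports\<close>

definition FT :: "real => (real => complex) => complex => complex" where
 "FT L g \<zeta> = integral {-L..L} (%t. g t * exp (\<i> * \<zeta> * of_real t))"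

context Ua_space
begin

lemma dual_combination:
 assumes "S \<in> dual" "T \<in> dual"
 shows "(%f. s * S f + t * T f) \<in> dual"
proof -
 obtain q b C where S: "lin S" "0 < q" "q < 1" "inrad b" "bdd S q b C" "0 <= C" by (rule dualE[OF assms(1)])
 obtain q' b' C' where T: "lin T" "0 < q'" "q' < 1" "inrad b'" "bdd T q' b' C'" "0 <= C'" by (rule dualE[OF assms(2)])
 let ?q = "max q q'" and ?b = "max b b'"
 have b: "0 < b" "0 < b'" "inrad ?b" using S(4) T(4) by (auto simp: inrad_def max_def)
 have 1: "bdd S ?q ?b C" "bdd T ?q ?b C'"
  using bdd_mono[OF S(5,2), of ?q ?b C] bdd_mono[OF T(5,2), of ?q ?b C'] b by auto
 show ?thesis
 proof (rule dualI[where q = ?q and b = ?b and C = "cmod s * C + cmod t * C'"])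
  show "lin (%f. s * S f + t * T f)"
   unfolding lin_def using lin_add[OF S(1)] lin_add[OF T(1)] lin_scale[OF S(1)] lin_scale[OF T(1)]
   by (auto simp: algebra_simps)
  show "bdd (%f. s * S f + t * T f) ?q ?b (cmod s * C + cmod t * C')"
   unfolding bdd_def
  proof (intro ballI allI impI)
   fix f B assume f: "f \<in> U" "nb ?q ?b f B"
   have "cmod (s * S f + t * T f) <= cmod s * cmod (S f) + cmod t * cmod (T f)"
    using norm_triangle_ineq[of "s * S f" "t * T f"] by (simp add: norm_mult)
   also have "... <= cmod s * (C * B) + cmod t * (C' * B)"
    by (intro add_mono mult_left_mono bddD[OF 1(1) f] bddD[OF 1(2) f]) auto
   finally show "cmod (s * S f + t * T f) <= (cmod s * C + cmod t * C') * B" by (simp add: algebra_simps)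
  qed
 qed (use S T b in auto)
qed

lemma FL_eqD:
 assumes "S \<in> dual" "T \<in> dual" "!!z. FL S z = FL T z" "f \<in> U"
 shows "S f = T f"
 using FL_injective[OF dual_combination[OF assms(1,2), of 1 "-1"] _ assms(4)] assms(3) by (simp add: FL_def)

context
 fixes L :: real
 assumes L: "inrad L"
begin

lemma interval_L: "{-L..L} \<subseteq> Om" "0 < L"
proof -
 show "0 < L" using L by (simp add: inrad_def)
 show "{-L..L} \<subseteq> Om" by (rule subsetI, rule Om_inner[OF L]) auto
qed

lemma FT_integrand_continuous: "g \<in> Cinf a ==> continuous_on {-L..L} (%t. g t * exp (\<i> * \<zeta> * of_real t))"
 using Cinf_continuous[OF _ interval_L(1), of g 0] by (intro continuous_intros) auto

lemma FT_add: "f \<in> Cinf a ==> g \<in> Cinf a ==> FT L (f + g) \<zeta> = FT L f \<zeta> + FT L g \<zeta>"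
 unfolding FT_def using FT_integrand_continuous
 by (simp add: distrib_right integral_add integrable_continuous_interval)

lemma FT_scale: "FT L (cscale s g) \<zeta> = s * FT L g \<zeta>"
 unfolding FT_def cscale_apply by (simp add: mult.assoc integral_mult_right)

lemma FT_norm:
 assumes g: "g \<in> Cinf a" and B: "!!t. abs t <= L ==> cmod (g t) * exp (- t * Im \<zeta>) <= B"
 shows "cmod (FT L g \<zeta>) <= 2 * L * B"
proof -
 have "cmod (FT L g \<zeta>) <= B * (L - - L)"
  unfolding FT_def
 proof (rule integral_bound[OF _ FT_integrand_continuous[OF g]])
  fix t assume "t \<in> {-L..L}"
  hence "abs t <= L" by auto
  from B[OF this] show "cmod (g t * exp (\<i> * \<zeta> * of_real t)) <= B" by (simp add: norm_mult mult.commute)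
 qed (use interval_L in simp)
 thus ?thesis by (simp add: mult_ac)
qed

lemma FT_Diff:
 assumes g: "g \<in> Cinf a"
 shows "FT L (Diff a g) \<zeta> + \<i> * \<zeta> * FT L g \<zeta> = g L * exp (\<i> * \<zeta> * of_real L) - g (- L) * exp (\<i> * \<zeta> * of_real (- L))"
proof -
 have 1: "((%t. Diff a g t * exp (\<i> * \<zeta> * of_real t) + \<i> * \<zeta> * (g t * exp (\<i> * \<zeta> * of_real t))) has_integral
   g L * exp (\<i> * \<zeta> * of_real L) - g (- L) * exp (\<i> * \<zeta> * of_real (- L))) {-L..L}"
 proof (rule fundamental_theorem_of_calculus)
  fix t assume "t \<in> {-L..L}"
  hence t: "t \<in> Om" using interval_L by auto
  have "(g has_vector_derivative Diff a g t) (at t)" using Cinf_derivative[OF g t, of 0] by simp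
  from has_vector_derivative_mult[OF this exp_iz_derivative[of "\<i> * \<zeta>" t]]
  have "((%t. g t * exp (\<i> * \<zeta> * of_real t)) has_vector_derivative Diff a g t * exp (\<i> * \<zeta> * of_real t) + \<i> * \<zeta> * (g t * exp (\<i> * \<zeta> * of_real t))) (at t)"
   by (simp add: algebra_simps)
  thus "((%t. g t * exp (\<i> * \<zeta> * of_real t)) has_vector_derivative Diff a g t * exp (\<i> * \<zeta> * of_real t) + \<i> * \<zeta> * (g t * exp (\<i> * \<zeta> * of_real t))) (at t within {-L..L})"
   by (rule has_vector_derivative_at_within)
 qed (use interval_L in simp)
 have "((%t. Diff a g t * exp (\<i> * \<zeta> * of_real t) + \<i> * \<zeta> * (g t * exp (\<i> * \<zeta> * of_real t))) has_integral
   FT L (Diff a g) \<zeta> + \<i> * \<zeta> * FT L g \<zeta>) {-L..L}"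
  unfolding FT_def
  by (intro has_integral_add has_integral_mult_right integrable_integral integrable_continuous_interval
    FT_integrand_continuous Diff_Cinf g)
 from has_integral_unique[OF this 1] show ?thesis .
qed

text \<open>Integrating by parts \<open>j\<close> times without boundary terms gives decay like
  \<open>M q j / cmod \<zeta>^j\<close>; \<open>M_Legendre\<close> optimises over \<open>j\<close>.
  The exponential stands inside the hypothesis so that functions living on one side of a point
  profit from the sign of \<open>Im \<zeta>\<close>.\<close>

lemma FT_decay:
 assumes q: "0 < q"
 shows "EX C>0. \<forall>g B \<zeta>. g \<in> Cinf a --> (ALL j. Dn j g L = 0 & Dn j g (- L) = 0)
  --> (ALL j t. abs t <= L --> cmod (Dn j g t) * exp (- t * Im \<zeta>) <= B * M q j) --> cmod (FT L g \<zeta>) <= C * B * ((1 + cmod \<zeta>) * exp (- q * om (cmod \<zeta>)))"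
proof -
 obtain C where C: "0 < C" "!!x y B. 0 <= x ==> 0 <= B ==> (!!j. y * x^j <= B * M q j) ==> y <= C * B * (1 + x) * exp (- q * om x)"
  by (rule M_Legendre[OF q]) (rule that; blast)
 have "cmod (FT L g \<zeta>) <= (C * (2 * L)) * B * ((1 + cmod \<zeta>) * exp (- q * om (cmod \<zeta>)))"
  if g: "g \<in> Cinf a" and z: "ALL j. Dn j g L = 0 & Dn j g (- L) = 0" and B: "ALL j t. abs t <= L --> cmod (Dn j g t) * exp (- t * Im \<zeta>) <= B * M q j"
  for g B \<zeta>
 proof -
  have jC: "Dn j g \<in> Cinf a" for j by (induction j) (use g Diff_Cinf in auto)
  have pow: "FT L (Dn j g) \<zeta> = (- \<i> * \<zeta>)^j * FT L g \<zeta>" for j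
  proof (induction j)
   case (Suc j)
   have "FT L (Dn (Suc j) g) \<zeta> = - \<i> * \<zeta> * FT L (Dn j g) \<zeta>"
    using FT_Diff[OF jC[of j], of \<zeta>] z[rule_format, of j] by (simp add: add_eq_0_iff2)
   thus ?case unfolding Suc by simp
  qed simp
  have B0: "0 <= B"
  proof -
   have "0 <= cmod (Dn 0 g 0) * exp (- 0 * Im \<zeta>)" by simp
   also have "... <= B * M q 0" using B interval_L(2) by (metis abs_zero less_imp_le)
   finally show ?thesis using M_pos[of q 0] unfolding zero_le_mult_iff by linarith
  qed
  have "cmod (FT L g \<zeta>) <= C * (2 * L * B) * (1 + cmod \<zeta>) * exp (- q * om (cmod \<zeta>))"
  proof (rule C(2))
   fix j
   have "cmod (FT L (Dn j g) \<zeta>) <= 2 * L * (B * M q j)" by (rule FT_norm[OF jC]) (use B in simp)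
   thus "cmod (FT L g \<zeta>) * cmod \<zeta>^j <= 2 * L * B * M q j"
    unfolding pow by (simp add: norm_mult norm_power mult_ac)
  qed (use B0 interval_L in auto)
  thus ?thesis by (simp only: mult_ac)
 qed
 thus ?thesis using C(1) interval_L(2) by (intro exI[of _ "C * (2 * L)"] conjI allI impI) auto
qed

text \<open>Integration against \<open>g\<close> is a functional in the dual, and
  \<open>FT L g\<close> is its Fourier-Laplace transform reflected at the origin.\<close>

lemma FT_holomorphic:
 assumes g: "g \<in> Cinf a"
 shows "FT L g holomorphic_on UNIV"
proof -
 define S where "S h = integral {-L..L} (%t. g t * h t)" for h
 have co: "continuous_on {-L..L} (%t. g t * h t)" if "h \<in> U" for h
  using Cinf_continuous[OF g interval_L(1), of 0] Cinf_continuous[OF Ua_Cinf[OF that] interval_L(1), of 0]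
  by (intro continuous_intros) auto
 obtain G where G: "\<forall>t\<in>{-L..L}. cmod (g t) <= G"
  using compact_imp_bounded[OF compact_continuous_image[OF Cinf_continuous[OF g interval_L(1), of 0] compact_Icc]]
  unfolding bounded_iff by auto
 have "S \<in> dual"
 proof (rule dualI[where q = "1/2" and b = L and C = "2 * L * (G * M (1/2) 0)"])
  show "lin S"
   unfolding lin_def S_def using co
   by (auto simp: distrib_left cscale_apply integral_add integrable_continuous_interval mult.left_commute)
  show "bdd S (1/2) L (2 * L * (G * M (1/2) 0))"
   unfolding bdd_def
  proof (intro ballI allI impI)
   fix f B assume f: "f \<in> U" "nb (1/2) L f B"
   have "cmod (S f) <= (G * (B * M (1/2) 0)) * (L - - L)"
    unfolding S_def
   proof (rule integral_bound[OF _ co[OF f(1)]])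
    fix t assume t: "t \<in> {-L..L}"
    hence "cmod (f t) <= B * M (1/2) 0" using nbD[OF f(2), of t 0] by auto
    thus "cmod (g t * f t) <= G * (B * M (1/2) 0)"
     unfolding norm_mult using order_trans[OF norm_ge_zero bspec[OF G t]] by (intro mult_mono bspec[OF G t]) auto
   qed (use interval_L in simp)
   thus "cmod (S f) <= 2 * L * (G * M (1/2) 0) * B" by (simp add: mult_ac)
  qed
 qed (use L in auto)
 from entire_compose[OF FL_holomorphic[OF this], of uminus]
 have "(%\<zeta>. FL S (- \<zeta>)) holomorphic_on UNIV" by (simp add: holomorphic_on_minus)
 moreover have "FL S (- \<zeta>) = FT L g \<zeta>" for \<zeta>
  unfolding FL_def S_def FT_def by (rule integral_cong) (use interval_L in \<open>auto simp: exp_monomial_def\<close>)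
 ultimately show ?thesis by (simp only:)
qed

end

lemma exp_w_integrable:
 assumes p: "p < q"
 shows "EX C>0. ALL x>=0. (1 + x)^n * exp (p * om x) * exp (- q * om x) * (1 + x^2) <= C"
proof -
 obtain C where C: "0 < C" "!!x. 0 <= x ==> exp (- (q - p) * om x) * (1 + x)^n * (1 + x^2) <= C"
  by (rule exp_w_decay[of "q - p" n]) (use p in auto)
 have eq: "(1 + x)^n * exp (p * om x) * exp (- q * om x) * (1 + x^2) = exp (- (q - p) * om x) * (1 + x)^n * (1 + x^2)" for x
 proof -
  have "exp (- (q - p) * om x) = exp (p * om x) * exp (- q * om x)" unfolding exp_add[symmetric] by (simp add: algebra_simps)
  thus ?thesis by (simp only: mult_ac)
 qed
 show ?thesis unfolding eq using C by blast
qed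

definition edge :: "real => real => real => (real => complex) => bool" where
 "edge s p L \<theta> \<longleftrightarrow> \<theta> \<in> U & (EX B. nb 1 L \<theta> B) & (ALL j t. s * t <= p --> Dn j \<theta> t = 0) & (ALL j t. t \<in> Om --> L <= s * t --> Dn j \<theta> t = Dn j (ez 0) t)"

text \<open>The derivative of \<open>\<theta>\<close> lives where \<open>p <= s * t <= L\<close>, so
  its transform decays in the half-plane of \<open>s\<close> like
  \<open>exp (- p * (s * Im w))\<close>, which beats the type \<open>b < p\<close> of
  \<open>\<psi>\<close>. Cauchy's formula in that half-plane sees the pole \<open>z\<close> for
  \<open>s = 1\<close> only.\<close>

lemma edge_Cauchy:
 assumes s: "s = 1 | s = - 1" and L: "inrad L" and p: "b < p" "p < L" "0 < b" and e: "edge s p L \<theta>" and r: "0 < r" "r < 1"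
  and psi: "\<psi> holomorphic_on UNIV" "!!z. cmod (\<psi> z) <= A * exp (r * om (cmod z) + b * abs (Im z))" and z: "Im z > 0"
 shows "integrable lborel (%x. \<psi> (of_real x) * FT L (Diff a \<theta>) (of_real x - z) / (of_real x - z))"
  "(\<integral>x. \<psi> (of_real x) * FT L (Diff a \<theta>) (of_real x - z) / (of_real x - z) \<partial>lborel) = (if s = 1 then 2 * pi * \<i> * \<psi> z else 0)"
proof -
 have \<theta>: "\<theta> \<in> U" "EX B. nb 1 L \<theta> B" "!!j t. s * t <= p ==> Dn j \<theta> t = 0" "!!j t. t \<in> Om ==> L <= s * t ==> Dn j \<theta> t = Dn j (ez 0) t"
  using e unfolding edge_def by auto
 note L1 = interval_L[OF L]
 define g where "g = Diff a \<theta>"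
 have g: "g \<in> Cinf a" unfolding g_def by (rule Diff_Cinf[OF Ua_Cinf[OF \<theta>(1)]])
 have sL: "s * L \<in> Om" "s * (s * L) = L" "s * (s * (-L)) = - L" using s Om_inner[OF L] L1 by auto
 define q where "q = (1 + r) / 2"
 have q: "0 < q" "q < 1" "r < q" using r by (auto simp: q_def)
 obtain B0 where "nb 1 L \<theta> B0" using \<theta>(2) by (elim exE)
 from Diff_nb[OF q(1,2)] obtain K where K: "K > 0" "ALL f b B. nb 1 b f B --> 0 <= b --> nb q b (Diff a f) (K * B)" by (elim exE conjE)
 define B where "B = K * B0"
 have B: "nb q L g B" unfolding B_def g_def using K(2) \<open>nb 1 L \<theta> B0\<close> L1 by simp
 have B0: "0 <= B" using nb_nonneg[OF B] L1 by simp
 have zero: "Dn j g t = 0" if "s * t <= p | t \<in> Om & L <= s * t" for j t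
  unfolding g_def Dn_Diff using that \<theta>(3)[of t "Suc j"] \<theta>(4)[of t "Suc j"] Dn_ez[of t "Suc j" 0] by auto
 from FT_decay[OF L q(1)] obtain C1 where C1: "C1 > 0" "\<forall>g B \<zeta>. g \<in> Cinf a --> (ALL j. Dn j g L = 0 & Dn j g (- L) = 0)
  --> (ALL j t. abs t <= L --> cmod (Dn j g t) * exp (- t * Im \<zeta>) <= B * M q j) --> cmod (FT L g \<zeta>) <= C1 * B * ((1 + cmod \<zeta>) * exp (- q * om (cmod \<zeta>)))"
  by (elim exE conjE)
 have ends: "Dn j g L = 0" "Dn j g (- L) = 0" for j
  using zero[of L j] zero[of "- L" j] s p L1(2) Om_inner[OF L, of L] Om_inner[OF L, of "- L"] by auto
 have dec: "cmod (FT L g \<zeta>) <= C1 * (B * exp (- p * (s * Im \<zeta>) + L * Im z)) * ((1 + cmod \<zeta>) * exp (- q * om (cmod \<zeta>)))"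
  if zeta: "- Im z <= s * Im \<zeta>" for \<zeta>
 proof (rule C1(2)[rule_format, OF g])
  fix j t assume t: "abs t <= (L::real)"
  show "cmod (Dn j g t) * exp (- t * Im \<zeta>) <= B * exp (- p * (s * Im \<zeta>) + L * Im z) * M q j"
  proof (cases "s * t <= p")
   case True thus ?thesis using zero[of t j] B0 by simp
  next
   case False
   have "s * t <= L" using s t by auto
   have "(s * t - p) * - (s * Im \<zeta>) <= (s * t - p) * Im z" using False zeta by (intro mult_left_mono) auto
   also have "... <= L * Im z" using \<open>s * t <= L\<close> p z by (intro mult_right_mono) auto
   finally have "- t * Im \<zeta> <= - p * (s * Im \<zeta>) + L * Im z" using s by (auto simp: algebra_simps)
   hence "cmod (Dn j g t) * exp (- t * Im \<zeta>) <= (B * M q j) * exp (- p * (s * Im \<zeta>) + L * Im z)"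
    using nbD[OF B t, of j] B0 by (intro mult_mono) auto
   thus ?thesis by (simp only: mult_ac)
  qed
 qed (use ends in auto)
 \<comment> \<open>For \<open>s = - 1\<close> the plane is reflected, so that the contour is always
   closed in the upper half-plane.\<close>
 define F where "F u = \<psi> (of_real s * u) * FT L g (of_real s * u - z)" for u :: complex
 have F: "F holomorphic_on UNIV"
  unfolding F_def by (intro holomorphic_on_mult entire_compose[OF psi(1)] entire_compose[OF FT_holomorphic[OF L g]] holomorphic_intros)
 obtain Cz where Cz: "0 <= Cz" "!!x. 0 <= x ==> om (x + cmod z) <= om x + Cz" by (rule w_shift[of "cmod z"]) (simp, blast)
 from exp_w_integrable[OF q(3), of 1] obtain D where D: "D > 0" "ALL x>=0. (1 + x)^1 * exp (r * om x) * exp (- q * om x) * (1 + x^2) <= D" by (elim exE conjE)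
 have A0: "0 <= A"
 proof -
  have "0 <= A * exp (r * om (cmod 0) + b * abs (Im 0))" by (rule order_trans[OF norm_ge_zero psi(2)])
  thus ?thesis by (simp add: zero_le_mult_iff)
 qed
 define Q where "Q = A * C1 * B * exp (p * Im z + L * Im z + q * Cz) * (1 + cmod z) * D"
 have Fb: "cmod (F u) <= Q / (1 + (cmod u)^2)" if u: "0 <= Im u" for u :: complex
 proof -
  have su: "cmod (of_real s * u) = cmod u" "s * Im (of_real s * u - z) = Im u - s * Im z" "abs (Im (of_real s * u)) = Im u"
   using s u by (auto simp: norm_mult)
  have sz: "s * Im z <= Im z" using s z by auto
  have "cmod u <= cmod (of_real s * u - z) + cmod z" using norm_triangle_ineq[of "of_real s * u - z" z] su(1) by simp
  hence "om (cmod u) <= om (cmod (of_real s * u - z)) + Cz" using w_mono[of "cmod u"] Cz(2)[of "cmod (of_real s * u - z)"] by (meson norm_ge_zero order_trans)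
  hence "q * om (cmod u) <= q * (om (cmod (of_real s * u - z)) + Cz)" using q by (intro mult_left_mono) auto
  hence w: "exp (- q * om (cmod (of_real s * u - z))) <= exp (q * Cz) * exp (- q * om (cmod u))" by (simp add: algebra_simps flip: exp_add)
  have n: "1 + cmod (of_real s * u - z) <= (1 + cmod z) * (1 + cmod u)"
  proof -
   have "(1 + cmod z) * (1 + cmod u) = 1 + cmod z + cmod u + cmod z * cmod u" by (simp add: algebra_simps)
   thus ?thesis using norm_triangle_ineq4[of "of_real s * u" z] su(1) mult_nonneg_nonneg[OF norm_ge_zero[of z] norm_ge_zero[of u]] by linarith
  qed
  have "cmod (FT L g (of_real s * u - z)) <= C1 * (B * exp (- p * (Im u - s * Im z) + L * Im z)) * ((1 + cmod (of_real s * u - z)) * exp (- q * om (cmod (of_real s * u - z))))"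
   using dec[of "of_real s * u - z"] unfolding su(2) using u sz by auto
  also have "... <= C1 * (B * (exp (p * Im z + L * Im z) * exp (- b * Im u))) * (((1 + cmod z) * (1 + cmod u)) * (exp (q * Cz) * exp (- q * om (cmod u))))"
  proof (intro mult_mono w n mult_left_mono)
   have "p * (s * Im z) <= p * Im z" "b * Im u <= p * Im u" using p sz u by (auto intro!: mult_left_mono mult_right_mono)
   thus "exp (- p * (Im u - s * Im z) + L * Im z) <= exp (p * Im z + L * Im z) * exp (- b * Im u)"
    unfolding exp_add[symmetric] exp_le_cancel_iff right_diff_distrib by linarith
  qed (use C1 B0 in \<open>auto intro!: mult_nonneg_nonneg\<close>)
  finally have 1: "cmod (FT L g (of_real s * u - z)) <= C1 * (B * (exp (p * Im z + L * Im z) * exp (- b * Im u))) * (((1 + cmod z) * (1 + cmod u)) * (exp (q * Cz) * exp (- q * om (cmod u))))" .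
  have 2: "cmod (\<psi> (of_real s * u)) <= A * (exp (r * om (cmod u)) * exp (b * Im u))" using psi(2)[of "of_real s * u"] unfolding su(1,3) exp_add .
  have "cmod (F u) <= (A * (exp (r * om (cmod u)) * exp (b * Im u))) * (C1 * (B * (exp (p * Im z + L * Im z) * exp (- b * Im u))) * (((1 + cmod z) * (1 + cmod u)) * (exp (q * Cz) * exp (- q * om (cmod u)))))"
   unfolding F_def norm_mult by (rule mult_mono[OF 2 1]) (use A0 in auto)
  also have "... = (A * C1 * B * (exp (p * Im z + L * Im z) * exp (q * Cz)) * (1 + cmod z)) * ((1 + cmod u)^1 * exp (r * om (cmod u)) * exp (- q * om (cmod u))) * (exp (b * Im u) * exp (- b * Im u))"
   by (simp only: mult_ac power_one_right)
  also have "exp (b * Im u) * exp (- b * Im u) = 1" by (simp flip: exp_add)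
  finally have 3: "cmod (F u) <= (A * C1 * B * (exp (p * Im z + L * Im z) * exp (q * Cz)) * (1 + cmod z)) * ((1 + cmod u)^1 * exp (r * om (cmod u)) * exp (- q * om (cmod u)))" by simp
  have "cmod (F u) * (1 + (cmod u)^2) <= (A * C1 * B * (exp (p * Im z + L * Im z) * exp (q * Cz)) * (1 + cmod z)) * ((1 + cmod u)^1 * exp (r * om (cmod u)) * exp (- q * om (cmod u)) * (1 + (cmod u)^2))"
   using mult_right_mono[OF 3, of "1 + (cmod u)^2"] by (simp only: mult.assoc) (simp add: add_nonneg_nonneg)
  also have "... <= (A * C1 * B * (exp (p * Im z + L * Im z) * exp (q * Cz)) * (1 + cmod z)) * D"
   using D(2) A0 C1(1) B0 by (intro mult_left_mono mult_nonneg_nonneg) auto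
  finally show ?thesis unfolding Q_def by (simp add: pos_le_divide_eq add_pos_nonneg exp_add)
 qed
 have im: "Im (of_real s * z) ~= 0" using s z by auto
 have ss: "of_real s * (of_real s * w) = (w::complex)" for w using s by auto
 note C = line_Cauchy[OF F Fb im]
 \<comment> \<open>The value that enters the residue: the transform of a derivative at 0 is the
   total rise of \<open>\<theta>\<close>, which is \<open>s\<close>.\<close>
 have "FT L g 0 = \<theta> L - \<theta> (- L)"
  using FT_Diff[OF L Ua_Cinf[OF \<theta>(1)], of 0] by (simp add: g_def)
 moreover have "\<theta> (s * L) = 1" "\<theta> (s * (- L)) = 0"
  using \<theta>(4)[OF sL(1), of 0] \<theta>(3)[of "s * (- L)" 0] sL p L1 by (auto simp: exp_monomial_def)
 ultimately have A: "FT L g 0 = s" using s by auto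
 have Fz: "F (of_real s * z) = s * \<psi> z" unfolding F_def ss using A by simp
 have fin: "integrable lborel (%x. \<psi> (of_real x) * FT L g (of_real x - z) / (of_real x - z)) &
  (\<integral>x. \<psi> (of_real x) * FT L g (of_real x - z) / (of_real x - z) \<partial>lborel) = (if s = 1 then 2 * pi * \<i> * \<psi> z else 0)"
 proof (cases "s = 1")
  case True
  thus ?thesis using C Fz z by (simp add: F_def)
 next
  case False
  hence s1: "s = - 1" using s by simp
  have eq: "F (of_real x) / (of_real x - of_real s * z) = - (\<psi> (of_real (0 + (-1) * x)) * FT L g (of_real (0 + (-1) * x) - z) / (of_real (0 + (-1) * x) - z))" for x
   unfolding F_def s1 by (simp add: minus_divide_right del: minus_add_distrib)
  let ?h = "%x. \<psi> (of_real x) * FT L g (of_real x - z) / (of_real x - z)"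
  have "integrable lborel (%x. ?h (0 + (-1) * x))" using C(1) unfolding eq by simp
  hence "integrable lborel ?h" using lborel_integrable_real_affine_iff[of "-1" ?h 0] by simp
  moreover have "(\<integral>x. ?h x \<partial>lborel) = (\<integral>x. ?h (0 + (-1) * x) \<partial>lborel)" using lborel_integral_real_affine[of "-1" ?h 0] by simp
  moreover have "(\<integral>x. ?h (0 + (-1) * x) \<partial>lborel) = 0" using C(2) z s1 unfolding eq by simp
  ultimately show ?thesis using s1 by simp
 qed
 thus "integrable lborel (%x. \<psi> (of_real x) * FT L (Diff a \<theta>) (of_real x - z) / (of_real x - z))"
  "(\<integral>x. \<psi> (of_real x) * FT L (Diff a \<theta>) (of_real x - z) / (of_real x - z) \<partial>lborel) = (if s = 1 then 2 * pi * \<i> * \<psi> z else 0)"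
  unfolding g_def by auto
qed

definition pair :: "(complex => complex) => real => (real => complex) => (real => complex) => complex" where
 "pair \<psi> L \<eta> f = (\<integral>x. \<psi> (of_real x) * FT L (\<eta> * f) (of_real x) \<partial>lborel) / (2 * pi)"

text \<open>Only flatness at both ends is recorded; it removes the boundary terms for
  \<open>\<eta> * f\<close> whatever \<open>f\<close> is.\<close>

definition plateau :: "real => (real => complex) => bool" where
 "plateau L \<eta> \<longleftrightarrow> \<eta> \<in> U & (ALL j. Dn j \<eta> L = 0 & Dn j \<eta> (- L) = 0)"

text \<open>Membership in a step of the inductive limit with real exponents in place of an index and
  with an explicit bound \<open>N\<close> for the norm.\<close>

definition majorant :: "real => real => (complex => complex) => real => bool" where
 "majorant r b \<psi> N \<longleftrightarrow> \<psi> holomorphic_on UNIV & (ALL z. cmod (\<psi> z) <= N * exp (r * om (cmod z) + b * abs (Im z)))"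

lemma majorant_nonneg: assumes "majorant r b \<psi> N" shows "0 <= N"
proof -
 have "0 <= N * exp (r * om (cmod 0) + b * abs (Im 0))"
  using assms norm_ge_zero order_trans unfolding majorant_def by blast
 thus ?thesis by (simp add: zero_le_mult_iff)
qed

lemma FT_mult_ends: assumes "plateau L \<eta>" "f \<in> U" shows "Dn j (\<eta> * f) L = 0 & Dn j (\<eta> * f) (- L) = 0"
 using assms Dn_mult_0[OF Ua_Cinf Ua_Cinf, of \<eta> f L j] Dn_mult_0[OF Ua_Cinf Ua_Cinf, of \<eta> f "- L" j]
 by (simp add: plateau_def)

text \<open>The functional with a prescribed transform \<^term>\<open>\<psi>\<close> is the integral of \<^term>\<open>\<psi>\<close> against the Fourier transform of
 the cut-off test function; on exponentials it is evaluated by Cauchy's formula, one half-plane for each edge of the plateau.\<close>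

lemma pairing:
 assumes r: "0 < r" "r < 1" and b: "inrad b"
 shows "\<exists>q L C \<eta>. 0 < q & q < 1 & inrad L & 0 <= C & plateau L \<eta> &
  (\<forall>\<psi> N. majorant r b \<psi> N --> lin (pair \<psi> L \<eta>) & bdd (pair \<psi> L \<eta>) q L (C * N) & (ALL z. FL (pair \<psi> L \<eta>) z = \<psi> z))"
proof -
 have b0: "0 < b" "b \<in> Om" using b Om_inner[OF b, of b] by (auto simp: inrad_def)
 obtain L where L: "inrad L" "b < L" using inrad_above[OF b0(2)] b0(1) by auto
 define p where "p = (b + L) / 2"
 have p: "b < p" "p < L" using L(2) by (auto simp: p_def)
 have edge: "\<exists>\<theta>. edge s p L \<theta>" if s: "s = 1 | s = - 1" for s
  by (rule side_step[OF s p(2)]) (use L(1) in \<open>auto simp: edge_def\<close>)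
 obtain \<theta>1 where e1: "edge 1 p L \<theta>1" using edge[of 1] by auto
 obtain \<theta>2 where e2: "edge (- 1) p L \<theta>2" using edge[of "- 1"] by auto
 define \<eta> where "\<eta> = ez 0 - \<theta>1 - \<theta>2"
 have t12: "\<theta>1 \<in> U" "\<theta>2 \<in> U" using e1 e2 by (auto simp: edge_def)
 have LL: "L \<in> Om" "- L \<in> Om" "0 < L" using Om_inner[OF L(1)] L(1) by (auto simp: inrad_def)
 have eU: "\<eta> \<in> U" unfolding \<eta>_def using t12 by (intro Ua_minus ez_U)
 note cc = Ua_Cinf[OF t12(1)] Ua_Cinf[OF t12(2)] Ua_Cinf[OF eU] ez_Cinf Cinf_minus[OF ez_Cinf Ua_Cinf[OF t12(1)]]
 have ends: "Dn j \<eta> L = 0" "Dn j \<eta> (- L) = 0" for j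
  using e1 e2 LL p b0 cc unfolding \<eta>_def edge_def by (simp_all add: Dn_minus)
 hence plat: "plateau L \<eta>" using eU by (simp add: plateau_def)
 \<comment> \<open>Two intermediate exponents: the gap from \<open>r\<close> to \<open>q1\<close>
   makes the integral converge, the gap from \<open>q1\<close> to \<open>q\<close> pays for the
   product \<open>\<eta> * f\<close>.\<close>
 define q1 where "q1 = (1 + r) / 2"
 define q where "q = (1 + q1) / 2"
 have q: "0 < q1" "q1 < q" "0 < q" "q < 1" "r < q1" using r unfolding q1_def q_def by (simp_all add: field_simps)
 obtain B\<eta> where B\<eta>: "nb q L \<eta> B\<eta>" using Ua_nb[OF eU q(3,4) L(1)] by (elim exE)
 from nb_mult[OF q(1,2)] obtain Cm where Cm: "Cm > 0" "ALL f g A B b. f \<in> Cinf a --> g \<in> Cinf a --> nb q b f A --> nb q b g B --> nb q1 b (f * g) (Cm * A * B)"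
  by (elim exE conjE)
 from FT_decay[OF L(1) q(1)] obtain C1 where C1: "C1 > 0" "\<forall>g B \<zeta>. g \<in> Cinf a --> (ALL j. Dn j g L = 0 & Dn j g (- L) = 0)
  --> (ALL j t. abs t <= L --> cmod (Dn j g t) * exp (- t * Im \<zeta>) <= B * M q1 j) --> cmod (FT L g \<zeta>) <= C1 * B * ((1 + cmod \<zeta>) * exp (- q1 * om (cmod \<zeta>)))"
  by (elim exE conjE)
 from exp_w_integrable[OF q(5), of 1] obtain D where D: "D > 0" "ALL x>=0. (1 + x)^1 * exp (r * om x) * exp (- q1 * om x) * (1 + x^2) <= D" by (elim exE conjE)
 have B\<eta>0: "0 <= B\<eta>" using nb_nonneg[OF B\<eta>] LL by simp
 have dec: "cmod (\<psi> (of_real x) * FT L (\<eta> * f) (of_real x)) <= (C1 * Cm * B\<eta> * D * N * B) / (1 + x^2)"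
  if psi: "majorant r b \<psi> N" and f: "f \<in> U" "nb q L f B" for \<psi> N f B x
 proof -
  have N0: "0 <= N" by (rule majorant_nonneg[OF psi])
  have B0: "0 <= B" using nb_nonneg[OF f(2)] LL by simp
  have n: "nb q1 L (\<eta> * f) (Cm * B\<eta> * B)" using Cm(2) cc(3) Ua_Cinf[OF f(1)] B\<eta> f(2) by simp
  have 1: "cmod (FT L (\<eta> * f) (of_real x)) <= C1 * (Cm * B\<eta> * B) * ((1 + cmod (of_real x)) * exp (- q1 * om (cmod (of_real x))))"
  proof (rule C1(2)[rule_format, OF Ua_Cinf[OF Ua_mult[OF eU f(1)]] FT_mult_ends[OF plat f(1)]])
   show "cmod (Dn j (\<eta> * f) t) * exp (- t * Im (complex_of_real x)) <= Cm * B\<eta> * B * M q1 j" if "abs t <= L" for j t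
    using nbD[OF n that, of j] by simp
  qed
  have 2: "cmod (\<psi> (of_real x)) <= N * exp (r * om (abs x))" using psi[unfolded majorant_def, THEN conjunct2, rule_format, of "of_real x"] by simp
  have "cmod (\<psi> (of_real x) * FT L (\<eta> * f) (of_real x)) * (1 + x^2)
    <= ((N * exp (r * om (abs x))) * (C1 * (Cm * B\<eta> * B) * ((1 + cmod (of_real x)) * exp (- q1 * om (cmod (of_real x)))))) * (1 + x^2)"
   unfolding norm_mult by (intro mult_right_mono mult_mono[OF 2 1]) (use N0 in auto)
  also have "... = (N * (C1 * (Cm * B\<eta> * B))) * ((1 + abs x)^1 * exp (r * om (abs x)) * exp (- q1 * om (abs x)) * (1 + abs x^2))"
   by (simp only: mult_ac norm_of_real power_one_right power2_abs)
  also have "... <= (N * (C1 * (Cm * B\<eta> * B))) * D" using D(2)[rule_format, of "abs x"] N0 C1(1) Cm(1) B\<eta>0 B0 by (intro mult_left_mono) auto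
  finally show ?thesis by (simp add: pos_le_divide_eq add_pos_nonneg mult_ac)
 qed
 have cont: "continuous_on UNIV (%x. h (of_real x))" if "h holomorphic_on UNIV" for h :: "complex => complex"
  by (rule continuous_on_compose2[OF holomorphic_on_imp_continuous_on[OF that]]) (auto intro!: continuous_intros)
 have int: "integrable lborel (%x. \<psi> (of_real x) * FT L (\<eta> * f) (of_real x))" if psi: "majorant r b \<psi> N" and f: "f \<in> U" for \<psi> N f
 proof -
  obtain B where B: "nb q L f B" using Ua_nb[OF f q(3,4) L(1)] by (elim exE)
  show ?thesis
  proof (rule integrable_of_decay[OF _ dec[OF psi f B]])
   show "continuous_on UNIV (%x. \<psi> (of_real x) * FT L (\<eta> * f) (of_real x))"
    by (intro continuous_on_mult cont FT_holomorphic[OF L(1) Ua_Cinf[OF Ua_mult[OF eU f]]] psi[unfolded majorant_def, THEN conjunct1])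
  qed
 qed
 define I where "I = (\<integral>x. 1 / (1 + (x::real)^2) \<partial>lborel)"
 have i1: "integrable lborel (%x::real. k / (1 + x^2))" for k by (rule integrable_inverse_1_plus_square)
 have I0: "0 <= I" unfolding I_def by (intro Bochner_Integration.integral_nonneg) auto
 define C where "C = C1 * Cm * B\<eta> * D * I"
 have main: "lin (pair \<psi> L \<eta>) & bdd (pair \<psi> L \<eta>) q L (C * N) & (ALL z. FL (pair \<psi> L \<eta>) z = \<psi> z)" if psi: "majorant r b \<psi> N" for \<psi> N
 proof -
  have ph: "\<psi> holomorphic_on UNIV" and pb: "!!z. cmod (\<psi> z) <= N * exp (r * om (cmod z) + b * abs (Im z))" using psi by (auto simp: majorant_def)
  have l: "lin (pair \<psi> L \<eta>)"
   unfolding lin_def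
  proof (intro conjI ballI allI)
   fix f g assume f: "f \<in> U" and g: "g \<in> U"
   have "\<psi> (of_real x) * FT L (\<eta> * (f + g)) (of_real x) = \<psi> (of_real x) * FT L (\<eta> * f) (of_real x) + \<psi> (of_real x) * FT L (\<eta> * g) (of_real x)" for x
    unfolding distrib_left FT_add[OF L(1) Ua_Cinf[OF Ua_mult[OF eU f]] Ua_Cinf[OF Ua_mult[OF eU g]]] ..
   thus "pair \<psi> L \<eta> (f + g) = pair \<psi> L \<eta> f + pair \<psi> L \<eta> g"
    unfolding pair_def using int[OF psi f] int[OF psi g] by (simp add: add_divide_distrib)
  next
   fix s f
   have "\<eta> * cscale s f = cscale s (\<eta> * f)" by (simp add: fun_eq_iff cscale_apply)
   thus "pair \<psi> L \<eta> (cscale s f) = s * pair \<psi> L \<eta> f"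
    unfolding pair_def by (simp add: FT_scale[OF L(1)] mult.left_commute[of _ s])
  qed
  have bd: "bdd (pair \<psi> L \<eta>) q L (C * N)"
   unfolding bdd_def
  proof (intro ballI allI impI)
   fix f B assume f: "f \<in> U" "nb q L f B"
   have "cmod (\<integral>x. \<psi> (of_real x) * FT L (\<eta> * f) (of_real x) \<partial>lborel) <= (\<integral>x. (C1 * Cm * B\<eta> * D * N * B) / (1 + (x::real)^2) \<partial>lborel)"
    by (rule Bochner_Integration.integral_norm_bound_integral[OF int[OF psi f(1)] i1 dec[OF psi f]])
   also have "... = (\<integral>x. (C1 * Cm * B\<eta> * D * N * B) * (1 / (1 + (x::real)^2)) \<partial>lborel)" by simp
   also have "... = C * N * B" unfolding integral_mult_right_zero I_def[symmetric] C_def by (simp only: mult_ac)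
   finally have 1: "cmod (\<integral>x. \<psi> (of_real x) * FT L (\<eta> * f) (of_real x) \<partial>lborel) <= C * N * B" .
   have "cmod (pair \<psi> L \<eta> f) = cmod (\<integral>x. \<psi> (of_real x) * FT L (\<eta> * f) (of_real x) \<partial>lborel) / (2 * pi)"
    by (simp add: pair_def norm_divide norm_mult)
   also have "... <= cmod (\<integral>x. \<psi> (of_real x) * FT L (\<eta> * f) (of_real x) \<partial>lborel) / 1" using pi_gt3 by (intro divide_left_mono) auto
   finally show "cmod (pair \<psi> L \<eta> f) <= C * N * B" using 1 by simp
  qed
  have d: "pair \<psi> L \<eta> \<in> dual" by (rule dualI[OF l bd q(3,4) L(1)])
  have up: "FL (pair \<psi> L \<eta>) z = \<psi> z" if z: "Im z > 0" for z
  proof -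
   have De: "Diff a \<eta> = cscale (-1) (Diff a \<theta>1) + cscale (-1) (Diff a \<theta>2)"
   proof
    fix t show "Diff a \<eta> t = (cscale (-1) (Diff a \<theta>1) + cscale (-1) (Diff a \<theta>2)) t"
     unfolding \<eta>_def using cc Diff_ez[of t 0] by (cases "t \<in> Om") (simp_all add: Diff_minus cscale_apply Diff_def[of a "ez 0"] del: cfun.scale_minus_left)
   qed
   have FTe: "FT L (\<eta> * ez z) (of_real x) = FT L \<eta> (of_real x - z)" for x
    unfolding FT_def
   proof (rule integral_cong)
    fix t assume "t \<in> {-L..L}"
    hence "t \<in> Om" using interval_L[OF L(1)] by auto
    thus "(\<eta> * ez z) t * exp (\<i> * of_real x * of_real t) = \<eta> t * exp (\<i> * (of_real x - z) * of_real t)"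
     by (simp add: exp_monomial_def mult.assoc algebra_simps flip: exp_add)
   qed
   \<comment> \<open>Integration by parts for the plateau function: there are no boundary terms, and
     its derivative consists of the derivatives of the two flanks with a minus sign.\<close>
   have FTn: "\<i> * \<zeta> * FT L \<eta> \<zeta> = FT L (Diff a \<theta>1) \<zeta> + FT L (Diff a \<theta>2) \<zeta>" for \<zeta>
   proof -
    have e: "FT L (Diff a \<eta>) \<zeta> = - (FT L (Diff a \<theta>1) \<zeta> + FT L (Diff a \<theta>2) \<zeta>)"
     unfolding De using cc Diff_Cinf by (simp add: FT_add[OF L(1)] Cinf_scale FT_scale[OF L(1)] del: cfun.scale_minus_left)
    have "FT L (Diff a \<eta>) \<zeta> + \<i> * \<zeta> * FT L \<eta> \<zeta> = 0" using FT_Diff[OF L(1) cc(3), of \<zeta>] ends[of 0] by simp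
    thus ?thesis unfolding add_eq_0_iff e by simp
   qed
   let ?h = "%\<theta> x. \<psi> (of_real x) * FT L (Diff a \<theta>) (of_real x - z) / (of_real x - z)"
   have eq: "\<psi> (of_real x) * FT L (\<eta> * ez z) (of_real x) = (?h \<theta>1 x + ?h \<theta>2 x) / \<i>" for x
   proof -
    have "of_real x - z ~= 0" using z by (auto simp: complex_eq_iff)
    hence "FT L \<eta> (of_real x - z) = \<i> * (of_real x - z) * FT L \<eta> (of_real x - z) / (of_real x - z) / \<i>" by simp
    hence e0: "FT L \<eta> (of_real x - z) = (FT L (Diff a \<theta>1) (of_real x - z) + FT L (Diff a \<theta>2) (of_real x - z)) / (of_real x - z) / \<i>"
     unfolding FTn .
    show ?thesis unfolding FTe e0 by (simp only: add_divide_distrib distrib_left times_divide_eq_right)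
   qed
   note E1 = edge_Cauchy[OF disjI1[OF refl] L(1) p b0(1) e1 r ph pb z]
   note E2 = edge_Cauchy[OF disjI2[OF refl] L(1) p b0(1) e2 r ph pb z]
   have "(\<integral>x. \<psi> (of_real x) * FT L (\<eta> * ez z) (of_real x) \<partial>lborel) = ((\<integral>x. ?h \<theta>1 x \<partial>lborel) + (\<integral>x. ?h \<theta>2 x \<partial>lborel)) / \<i>"
    unfolding eq using E1(1) E2(1) by simp
   also have "... = 2 * pi * \<psi> z" using E1(2) E2(2) by simp
   finally show ?thesis by (simp add: FL_def pair_def)
  qed
  \<comment> \<open>Cauchy's formula was used in the upper half-plane; since both sides are entire,
    the identity extends.\<close>
  have "FL (pair \<psi> L \<eta>) z = \<psi> z" for z
   by (rule analytic_continuation_open[of "{z. Im z > 0}" UNIV])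
    (use up FL_holomorphic[OF d] ph in \<open>auto simp: open_halfspace_Im_gt intro!: exI[of _ \<i>]\<close>)
  thus ?thesis using l bd by blast
 qed
 have "0 <= C" unfolding C_def using C1 Cm B\<eta>0 D I0 by simp
 thus ?thesis using main q(3,4) L(1) plat by blast
qed

text \<open>The support of \<open>S\<close> lies in \<open>s * t <= d\<close>; infinite order of
  vanishing there takes the place of vanishing on a neighbourhood.\<close>

definition supp :: "real => ((real => complex) => complex) => real => bool" where
 "supp s S d \<longleftrightarrow> (\<forall>f\<in>U. (ALL j t. t \<in> Om --> s * t <= d --> Dn j f t = 0) --> S f = 0)"

text \<open>A smooth step between \<open>d\<close> and \<open>d'\<close> removes the part of the
  exponential that \<open>S\<close> does not see; on the rest \<open>exp (t * Im z)\<close> is at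
  most \<open>exp (d' * (s * Im z))\<close> in the half-plane of \<open>s\<close>. The product costs
  a slightly larger exponent of the weight.\<close>

lemma FL_supp_bound:
 assumes s: "s = 1 | s = - 1" and S: "S \<in> dual" and d: "supp s S d" "d < d'"
 shows "EX C r. 0 <= C & 0 < r & r < 1 & (ALL z. 0 <= s * Im z --> cmod (FL S z) <= C * exp (r * om (cmod z) + d' * (s * Im z)))"
proof -
 obtain q b C where l: "lin S" and q: "0 < q" "q < 1" and b: "inrad b" and B: "bdd S q b C" "0 <= C" by (rule dualE[OF S])
 obtain \<theta> where \<theta>: "\<theta> \<in> U" "!!b. inrad b ==> EX B. nb 1 b \<theta> B" "!!j t. s * t <= d ==> Dn j \<theta> t = 0"
  "!!j t. t \<in> Om ==> d' <= s * t ==> Dn j \<theta> t = Dn j (ez 0) t" by (rule side_step[OF s d(2)]) (rule that)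
 define \<eta> where "\<eta> = ez 0 - \<theta>"
 have eU: "\<eta> \<in> U" unfolding \<eta>_def using \<theta>(1) by (intro Ua_minus ez_U)
 define q' where "q' = (1 + q) / 2"
 have q': "0 < q'" "q < q'" "q' < 1" using q by (auto simp: q'_def)
 obtain A where A: "nb q' b \<eta> A" using Ua_nb[OF eU q'(1,3) b] by (elim exE)
 from mult_bound[OF q(1) q'(2)] obtain K where K: "K > 0" "ALL f g A B t j. f \<in> Cinf a --> g \<in> Cinf a --> (ALL i. cmod (Dn i f t) <= A * M q' i)
  --> (ALL i. cmod (Dn i g t) <= B * M q' i) --> cmod (Dn j (f * g) t) <= K * A * B * M q j" by (elim exE conjE)
 have A0: "0 <= A" using nb_nonneg[OF A] b by (simp add: inrad_def)
 have "cmod (FL S z) <= (C * K * A * exp (om 1)) * exp (q' * om (cmod z) + d' * (s * Im z))" if z: "0 <= s * Im z" for z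
 proof -
  have hU: "\<eta> * ez z \<in> U" "\<theta> * ez z \<in> U" using Ua_mult ez_U eU \<theta>(1) by auto
  have "S (\<theta> * ez z) = 0"
   using d(1) hU(2) Dn_mult_0[OF Ua_Cinf[OF \<theta>(1)] ez_Cinf \<theta>(3)] unfolding supp_def by blast
  moreover have "ez z = \<eta> * ez z + \<theta> * ez z" unfolding \<eta>_def left_diff_distrib ez0_mult[OF ez_Cinf] by simp
  ultimately have FLe: "FL S z = S (\<eta> * ez z)" unfolding FL_def using lin_add[OF l hU] by simp
  let ?B = "exp (om 1) * (exp (q' * om (cmod z)) * exp (d' * (s * Im z)))"
  have "nb q b (\<eta> * ez z) (K * A * ?B)"
   unfolding nb_def
  proof (intro allI impI)
   fix j t assume t: "abs t <= b"
   show "cmod (Dn j (\<eta> * ez z) t) <= K * A * ?B * M q j"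
   proof (cases "d' <= s * t")
    case True
    have "Dn i \<eta> t = 0" for i
     using \<theta>(4)[OF Om_inner[OF b t] True] Ua_Cinf[OF \<theta>(1)] unfolding \<eta>_def by (simp add: Dn_minus ez_Cinf)
    thus ?thesis using Dn_mult_0[OF Ua_Cinf[OF eU] ez_Cinf] K(1) A0 by simp
   next
    case False
    have "t * Im z = (s * t) * (s * Im z)" using s by auto
    also have "... <= d' * (s * Im z)" using False z by (intro mult_right_mono) auto
    finally have e: "exp (t * Im z) <= exp (d' * (s * Im z))" by simp
    have "cmod (Dn i (ez z) t) <= ?B * M q' i" for i
    proof -
     have "cmod (Dn i (ez z) t) <= (exp (om 1) * exp (q' * om (cmod z)) * exp (t * Im z)) * M q' i"
      using q' by (intro ez_bound) auto
     also have "... <= (exp (om 1) * exp (q' * om (cmod z)) * exp (d' * (s * Im z))) * M q' i"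
      by (intro mult_right_mono mult_left_mono e) auto
     finally show ?thesis by (simp only: mult.assoc)
    qed
    thus ?thesis using K(2) Ua_Cinf[OF eU] ez_Cinf nbD[OF A t] by blast
   qed
  qed
  from bddD[OF B(1) hU(1) this] show ?thesis unfolding FLe by (simp only: exp_add mult_ac)
 qed
 moreover have "0 <= C * K * A * exp (om 1)" using B(2) K(1) A0 by simp
 ultimately show ?thesis using q'(1,3) by blast
qed

text \<open>A one-sided Paley-Wiener theorem that needs decay on one half of the imaginary axis
  only. \<open>T f\<close> is the integral of the transform against \<open>FT L g\<close>. The
  product is bounded on the real axis by the gap \<open>r < q1\<close> and on the half-axis by the
  gap \<open>d1 < d\<close>, so Phragmen-Lindelof and closing the contour give 0.\<close>

lemma supp_of_decay:
 assumes s: "s = 1 | s = - 1" and T: "T \<in> dual" and d: "d1 < d"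
  and dec: "!!y. 0 <= y ==> cmod (FL T (\<i> * of_real (s * y))) <= D * exp (d1 * y)"
 shows "supp s T d"
 unfolding supp_def
proof (intro ballI impI)
 fix f assume f: "f \<in> U" and flat: "ALL j t. t \<in> Om --> s * t <= d --> Dn j f t = 0"
 obtain r b A where l: "lin T" and r: "0 < r" "r < 1" and b: "inrad b" and A: "bdd T r b A" "0 <= A" by (rule dualE[OF T])
 define \<psi> where "\<psi> = FL T"
 have maj: "majorant r b \<psi> (A * exp (om 1))"
  unfolding majorant_def \<psi>_def using FL_holomorphic[OF T] FL_bound[OF A(1) r(1)] r b by (auto simp: inrad_def)
 from pairing[OF r b] obtain q L C \<eta> where q: "0 < q" "q < 1" and L: "inrad L" and plat: "plateau L \<eta>"
  and P: "\<forall>\<psi> N. majorant r b \<psi> N --> lin (pair \<psi> L \<eta>) & bdd (pair \<psi> L \<eta>) q L (C * N) & (ALL z. FL (pair \<psi> L \<eta>) z = \<psi> z)" by (elim exE conjE)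
 have P': "lin (pair \<psi> L \<eta>)" "bdd (pair \<psi> L \<eta>) q L (C * (A * exp (om 1)))" "!!z. FL (pair \<psi> L \<eta>) z = \<psi> z" using P maj by auto
 have Tf: "T f = pair \<psi> L \<eta> f"
  by (rule FL_eqD[OF T dualI[OF P'(1,2) q L] _ f]) (simp only: P'(3), simp only: \<psi>_def)
 have eU: "\<eta> \<in> U" using plat by (simp add: plateau_def)
 define g where "g = \<eta> * f"
 have gU: "g \<in> U" unfolding g_def by (rule Ua_mult[OF eU f])
 define q1 where "q1 = (1 + r) / 2"
 have q1: "0 < q1" "q1 < 1" "r < q1" using r by (auto simp: q1_def)
 obtain B where B: "nb q1 L g B" using Ua_nb[OF gU q1(1,2) L] by (elim exE)
 have L0: "0 < L" "L >= 0" using L by (auto simp: inrad_def)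
 have B0: "0 <= B" using nb_nonneg[OF B] L0 by simp
 from FT_decay[OF L q1(1)] obtain C1 where C1: "C1 > 0" "\<forall>g B \<zeta>. g \<in> Cinf a --> (ALL j. Dn j g L = 0 & Dn j g (- L) = 0)
  --> (ALL j t. abs t <= L --> cmod (Dn j g t) * exp (- t * Im \<zeta>) <= B * M q1 j) --> cmod (FT L g \<zeta>) <= C1 * B * ((1 + cmod \<zeta>) * exp (- q1 * om (cmod \<zeta>)))"
  by (elim exE conjE)
 have ends: "Dn j g L = 0 & Dn j g (- L) = 0" for j unfolding g_def by (rule FT_mult_ends[OF plat f])
 have FTb: "cmod (FT L g \<zeta>) <= C1 * (B * m) * ((1 + cmod \<zeta>) * exp (- q1 * om (cmod \<zeta>)))"
  if m: "!!t. abs t <= L ==> d <= s * t ==> exp (- t * Im \<zeta>) <= m" "0 <= m" for \<zeta> m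
 proof (rule C1(2)[rule_format, OF Ua_Cinf[OF gU] ends])
  fix j t assume t: "abs t <= L"
  show "cmod (Dn j g t) * exp (- t * Im \<zeta>) <= B * m * M q1 j"
  proof (cases "s * t <= d")
   case True
   have "Dn j (f * \<eta>) t = 0" using flat Om_inner[OF L t] True by (intro Dn_mult_0 Ua_Cinf f eU) auto
   thus ?thesis using B0 m(2) unfolding g_def by (simp add: mult.commute[of f])
  next
   case False
   hence "cmod (Dn j g t) * exp (- t * Im \<zeta>) <= (B * M q1 j) * m"
    using nbD[OF B t, of j] B0 m(1)[OF t] by (intro mult_mono) auto
   thus ?thesis by (simp only: mult_ac)
  qed
 qed
 define G where "G w = \<psi> (of_real s * w) * FT L g (of_real s * w)" for w
 have sh: "(%w. of_real s * w) holomorphic_on UNIV" by (intro holomorphic_intros)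
 have Gh: "G holomorphic_on UNIV"
  unfolding G_def \<psi>_def
  by (rule holomorphic_on_mult[OF entire_compose[OF FL_holomorphic[OF T] sh] entire_compose[OF FT_holomorphic[OF L Ua_Cinf[OF gU]] sh]])
 \<comment> \<open>Boundedness of \<open>H\<close> is exactly the cubic decay of \<open>G\<close>
   that \<open>line_Cauchy_vanish\<close> asks for; \<open>- \<i>\<close> lies outside the
   half-plane in question.\<close>
 define H where "H w = G w * (w + \<i>)^3" for w
 have Hh: "H holomorphic_on UNIV" unfolding H_def using Gh by (intro holomorphic_intros)
 have n3: "cmod ((w + \<i>)^3) <= (1 + cmod w)^3" for w
  unfolding norm_power using norm_triangle_ineq[of w \<i>] by (intro power_mono) auto
 have psib: "cmod (\<psi> w) <= A * exp (om 1) * exp (r * om (cmod w) + b * abs (Im w))" for w using maj by (simp add: majorant_def)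
 have sn: "cmod (of_real s * w) = cmod w" for w using s by (auto simp: norm_mult)
 obtain Cw where Cw: "0 <= Cw" "!!x. 0 <= x ==> om x <= 1 * x + Cw" by (rule w_small[of 1]) (simp, rule that)
 have grow: "cmod (H w) <= (A * exp (om 1) * exp Cw * C1 * B) * exp ((1 + b + L + 4) * cmod w)" for w
 proof -
  have iw: "abs (Im (of_real s * w)) <= cmod w" using abs_Im_le_cmod[of "of_real s * w"] sn by simp
  have "r * om (cmod w) <= 1 * om (cmod w)" using r w_nonneg by (intro mult_right_mono) auto
  moreover have "b * abs (Im (of_real s * w)) <= b * cmod w" using iw b by (intro mult_left_mono) (auto simp: inrad_def)
  ultimately have "r * om (cmod w) + b * abs (Im (of_real s * w)) <= Cw + (1 + b) * cmod w" using Cw(2)[of "cmod w"] by (simp add: algebra_simps)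
  hence "exp (r * om (cmod w) + b * abs (Im (of_real s * w))) <= exp Cw * exp ((1 + b) * cmod w)" by (simp flip: exp_add)
  hence 1: "cmod (\<psi> (of_real s * w)) <= A * exp (om 1) * (exp Cw * exp ((1 + b) * cmod w))"
   using A by (intro order_trans[OF psib[of "of_real s * w", unfolded sn]] mult_left_mono) auto
  have 2: "cmod (FT L g (of_real s * w)) <= C1 * (B * exp (L * cmod w)) * ((1 + cmod w) * 1)"
  proof -
   have "exp (- t * Im (of_real s * w)) <= exp (L * cmod w)" if "abs t <= L" for t
   proof -
    have "- t * Im (of_real s * w) <= abs t * abs (Im (of_real s * w))" by (metis abs_ge_self abs_minus_cancel abs_mult)
    also have "... <= L * cmod w" using that iw L0 by (intro mult_mono) auto
    finally show ?thesis by simp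
   qed
   hence "cmod (FT L g (of_real s * w)) <= C1 * (B * exp (L * cmod w)) * ((1 + cmod (of_real s * w)) * exp (- q1 * om (cmod (of_real s * w))))"
    by (intro FTb) auto
   also have "... <= C1 * (B * exp (L * cmod w)) * ((1 + cmod w) * 1)"
    unfolding sn using q1 w_nonneg[of "cmod w"] C1(1) B0 by (intro mult_left_mono) auto
   finally show ?thesis .
  qed
  have "1 + cmod w <= exp (cmod w)" by (rule exp_ge_add_one_self)
  hence "(1 + cmod w)^4 <= exp (cmod w)^4" by (intro power_mono) auto
  also have "... = exp (4 * cmod w)" by (simp flip: exp_of_nat_mult)
  finally have 4: "(1 + cmod w)^4 <= exp (4 * cmod w)" .
  have "cmod (H w) = (cmod (\<psi> (of_real s * w)) * cmod (FT L g (of_real s * w))) * cmod ((w + \<i>)^3)" by (simp only: H_def G_def norm_mult)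
  also have "... <= ((A * exp (om 1) * (exp Cw * exp ((1 + b) * cmod w))) * (C1 * (B * exp (L * cmod w)) * ((1 + cmod w) * 1))) * (1 + cmod w)^3"
   using A B0 C1(1) by (intro mult_mono mult_mono[OF 1 2] n3) auto
  also have "... = (A * exp (om 1) * exp Cw * C1 * B) * (exp ((1 + b) * cmod w) * exp (L * cmod w) * (1 + cmod w)^4)"
   by (simp add: power3_eq_cube power4_eq_xxxx mult_ac)
  also have "... <= (A * exp (om 1) * exp Cw * C1 * B) * (exp ((1 + b) * cmod w) * exp (L * cmod w) * exp (4 * cmod w))"
   using 4 A B0 C1(1) by (intro mult_left_mono) auto
  also have "exp ((1 + b) * cmod w) * exp (L * cmod w) * exp (4 * cmod w) = exp ((1 + b + L + 4) * cmod w)"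
   by (simp add: algebra_simps flip: exp_add)
  finally show ?thesis .
 qed
 obtain D1 where D1: "0 < D1" "!!x. 0 <= x ==> (1 + x)^4 * exp (- (q1 - r) * om x) <= D1" by (rule power_exp_decay[of "q1 - r" 4]) (use q1 in simp, rule that)
 obtain D2 where D2: "0 < D2" "!!x. 0 <= x ==> (1 + x)^4 * exp (- 1 * om x) <= D2" by (rule power_exp_decay[of 1 4]) (simp, rule that)
 \<comment> \<open>The gap between \<open>d1\<close> and \<open>d\<close> swallows the weight on the
   imaginary axis, which leaves a factor \<open>exp (- om y)\<close> to beat the polynomial.\<close>
 obtain C3 where C3: "0 <= C3" "!!x. 0 <= x ==> om x <= (d - d1) * x + C3" by (rule w_small[of "d - d1"]) (use d in simp, rule that)
 define m where "m = max 1 (max (A * exp (om 1) * C1 * B * D1) (abs D * C1 * B * exp C3 * D2))"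
 have re: "cmod (H (of_real x)) <= m" for x
 proof -
  have sx: "Im (of_real s * of_real x) = 0" "cmod (complex_of_real x) = abs x" by auto
  have 1: "cmod (\<psi> (of_real s * of_real x)) <= A * exp (om 1) * exp (r * om (abs x))" using psib[of "of_real s * of_real x"] unfolding sn sx by simp
  have 2: "cmod (FT L g (of_real s * of_real x)) <= C1 * (B * 1) * ((1 + abs x) * exp (- q1 * om (abs x)))"
   using FTb[of "of_real s * of_real x" 1] unfolding sn sx by simp
  have "cmod (H (of_real x)) <= ((A * exp (om 1) * exp (r * om (abs x))) * (C1 * (B * 1) * ((1 + abs x) * exp (- q1 * om (abs x))))) * (1 + abs x)^3"
   unfolding H_def G_def norm_mult[of _ "(_ + \<i>)^3"] norm_mult[of "\<psi> _"]
   using A B0 C1(1) n3[of "of_real x"] by (intro mult_mono mult_mono[OF 1 2]) auto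
  also have "... = (A * exp (om 1) * C1 * B) * ((1 + abs x)^4 * (exp (r * om (abs x)) * exp (- q1 * om (abs x))))"
   by (simp add: power3_eq_cube power4_eq_xxxx mult_ac)
  also have "exp (r * om (abs x)) * exp (- q1 * om (abs x)) = exp (- (q1 - r) * om (abs x))" unfolding exp_add[symmetric] by (simp add: algebra_simps)
  also have "(A * exp (om 1) * C1 * B) * ((1 + abs x)^4 * exp (- (q1 - r) * om (abs x))) <= A * exp (om 1) * C1 * B * D1"
   using A B0 C1(1) by (intro mult_left_mono D1(2)) auto
  finally show ?thesis unfolding m_def by linarith
 qed
 have im: "cmod (H (\<i> * of_real y)) <= m" if y: "0 <= y" for y
 proof -
  have sy: "of_real s * (\<i> * of_real y) = \<i> * of_real (s * y)" "cmod (\<i> * of_real y) = y" using y by (auto simp: norm_mult)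
  have 2: "cmod (FT L g (of_real s * (\<i> * of_real y))) <= C1 * (B * exp (- d * y)) * ((1 + y) * 1)"
  proof -
   have "exp (- t * Im (of_real s * (\<i> * of_real y))) <= exp (- d * y)" if "d <= s * t" for t
    using mult_right_mono[OF that y] by (simp add: mult_ac)
   hence "cmod (FT L g (of_real s * (\<i> * of_real y))) <= C1 * (B * exp (- d * y)) * ((1 + cmod (of_real s * (\<i> * of_real y))) * exp (- q1 * om (cmod (of_real s * (\<i> * of_real y)))))"
    by (intro FTb) auto
   also have "... <= C1 * (B * exp (- d * y)) * ((1 + y) * 1)"
    unfolding sn sy(2) using q1 w_nonneg[OF y] C1(1) B0 y by (intro mult_left_mono) auto
   finally show ?thesis .
  qed
  have 1: "cmod (\<psi> (of_real s * (\<i> * of_real y))) <= abs D * exp (d1 * y)"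
   unfolding sy(1) \<psi>_def using dec[OF y] by (rule order_trans) (intro mult_right_mono, auto)
  have e: "exp (d1 * y) * exp (- d * y) <= exp C3 * exp (- 1 * om y)"
   using C3(2)[OF y] by (simp add: algebra_simps flip: exp_add)
  have "cmod (H (\<i> * of_real y)) <= ((abs D * exp (d1 * y)) * (C1 * (B * exp (- d * y)) * ((1 + y) * 1))) * (1 + y)^3"
   unfolding H_def G_def norm_mult[of _ "(_ + \<i>)^3"] norm_mult[of "\<psi> _"]
   using B0 C1(1) n3[of "\<i> * of_real y"] y unfolding sy(2) by (intro mult_mono mult_mono[OF 1 2]) auto
  also have "... = (abs D * C1 * B) * ((1 + y)^4 * (exp (d1 * y) * exp (- d * y)))"
   by (simp add: power3_eq_cube power4_eq_xxxx mult_ac)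
  also have "... <= (abs D * C1 * B) * ((1 + y)^4 * (exp C3 * exp (- 1 * om y)))"
   using B0 C1(1) y e by (intro mult_left_mono) auto
  also have "... = (abs D * C1 * B * exp C3) * ((1 + y)^4 * exp (- 1 * om y))" by (simp only: mult_ac)
  also have "... <= abs D * C1 * B * exp C3 * D2" using B0 C1(1) by (intro mult_left_mono D2(2)[OF y]) auto
  finally show ?thesis unfolding m_def by linarith
 qed
 have Hm: "cmod (H w) <= m" if "0 <= Im w" for w
  by (rule Phragmen_Lindelof_half_plane[OF Hh grow _ re im that]) (auto simp: m_def)
 have "(\<integral>x. G (of_real x) \<partial>lborel) = 0"
 proof (rule line_Cauchy_vanish[OF Gh])
  fix w assume w: "0 <= Im w"
  have c: "(cmod (w + \<i>))^2 = 1 + (cmod w)^2 + 2 * Im w" unfolding cmod_power2 by (simp add: power2_eq_square algebra_simps)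
  have "(1 + cmod w)^2 <= (2 * cmod (w + \<i>))^2"
  proof -
   have "(1 + cmod w)^2 + (1 - cmod w)^2 = 2 * (1 + (cmod w)^2)" by (simp add: power2_eq_square algebra_simps)
   hence "(1 + cmod w)^2 <= 4 * (cmod (w + \<i>))^2" unfolding c using w zero_le_power2[of "1 - cmod w"] zero_le_power2[of "cmod w"] by argo
   thus ?thesis by (simp add: power_mult_distrib)
  qed
  hence 1: "1 + cmod w <= 2 * cmod (w + \<i>)" by (rule power2_le_imp_le) simp
  have 2: "1 + (cmod w)^2 <= (cmod (w + \<i>))^2" using c w by simp
  have "cmod (G w) * (1 + (cmod w)^2) * (1 + cmod w) <= cmod (G w) * (cmod (w + \<i>))^2 * (2 * cmod (w + \<i>))"
   using 1 2 by (intro mult_mono) auto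
  also have "... = 2 * cmod (H w)" by (simp add: H_def norm_mult norm_power power2_eq_square power3_eq_cube)
  also have "... <= 2 * m" using Hm[OF w] by simp
  finally show "cmod (G w) * (1 + (cmod w)^2) * (1 + cmod w) <= 2 * m" .
 qed
 moreover have "(\<integral>x. G (of_real x) \<partial>lborel) = (\<integral>x. \<psi> (of_real x) * FT L g (of_real x) \<partial>lborel)"
  using s lborel_integral_real_affine[of "-1" "%x. \<psi> (of_real x) * FT L g (of_real x)" 0] by (auto simp: G_def)
 ultimately show "T f = 0" unfolding Tf pair_def g_def by simp
qed

end

section \<open>The module of transforms and its submodules\<close>

locale Ua_Pa = Ua_space +
 fixes r :: "nat => real"
 assumes r_inc: "incseq r" and r_pos: "!!k. 0 < r k" and r_less: "!!k. r k < 1" and r_lim: "r \<longlonglongrightarrow> 1"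
begin

abbreviation P :: "(complex => complex) set" where "P \<equiv> Pa om c r"

lemma Pk_majorant: "\<psi> \<in> Pk om c r k \<longleftrightarrow> (EX N. majorant (r k) (c k) \<psi> N)"
 unfolding Pk_iff majorant_def by blast

lemma majorant_mono:
 assumes "majorant p b \<psi> N" "p <= p'" "b <= b'" "N <= N'"
 shows "majorant p' b' \<psi> N'"
 unfolding majorant_def
proof (intro conjI allI)
 show "\<psi> holomorphic_on UNIV" using assms(1) by (simp add: majorant_def)
 fix z
 have "p * om (cmod z) + b * abs (Im z) <= p' * om (cmod z) + b' * abs (Im z)"
  using assms w_nonneg by (intro add_mono mult_right_mono) auto
 hence "N * exp (p * om (cmod z) + b * abs (Im z)) <= N' * exp (p' * om (cmod z) + b' * abs (Im z))"
  using majorant_nonneg[OF assms(1)] assms(4) by (intro mult_mono) auto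
 thus "cmod (\<psi> z) <= N' * exp (p' * om (cmod z) + b' * abs (Im z))"
  using assms(1) unfolding majorant_def by (meson order_trans)
qed

lemma majorant_Pa:
 assumes "majorant p b \<psi> N" "p < 1" "inrad b"
 shows "\<psi> \<in> P"
proof -
 obtain k where k: "b <= c k" by (rule inrad_le_c[OF assms(3)])
 obtain l where l: "p <= r l" using order_tendstoD(1)[OF r_lim assms(2)] by (auto simp: eventually_sequentially intro: less_imp_le)
 have "majorant (r (max k l)) (c (max k l)) \<psi> N"
  by (rule majorant_mono[OF assms(1)]) (use k l incseqD[OF c_inc, of k "max k l"] incseqD[OF r_inc, of l "max k l"] in auto)
 thus ?thesis unfolding Pa_def using Pk_majorant by blast
qed

lemma FL_majorant:
 assumes S: "S \<in> dual"
 obtains q b N where "0 < q" "q < 1" "inrad b" "majorant q b (FL S) N"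
proof -
 obtain q b C where l: "lin S" and q: "0 < q" "q < 1" and b: "inrad b" and B: "bdd S q b C" "0 <= C" by (rule dualE[OF S])
 have "majorant q b (FL S) (C * exp (om 1))"
  unfolding majorant_def using FL_holomorphic[OF S] FL_bound[OF B(1) q(1)] q b by (auto simp: inrad_def)
 thus ?thesis using that q b by blast
qed

lemma FL_Pa: "S \<in> dual ==> FL S \<in> P"
 by (rule FL_majorant) (use majorant_Pa in blast)+

text \<open>Surjectivity with uniform constants: \<open>q\<close>, \<open>L\<close> and
  \<open>C\<close> depend on \<open>p\<close> and \<open>b\<close> but not on \<open>\<psi>\<close>.
  This gives closedness of annihilator submodules and makes the estimate for multiplication by
  \<open>E\<close> iterable.\<close>

lemma majorant_FL:
 assumes "0 < p" "p < 1" "inrad b"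
 shows "EX q L C. 0 < q & q < 1 & inrad L & 0 <= C &
  (\<forall>\<psi> N. majorant p b \<psi> N --> (\<exists>S\<in>dual. FL S = \<psi> & bdd S q L (C * N)))"
proof -
 from pairing[OF assms] obtain q L C \<eta> where q: "0 < q" "q < 1" "inrad L" "0 <= C"
  and P: "\<forall>\<psi> N. majorant p b \<psi> N --> lin (pair \<psi> L \<eta>) & bdd (pair \<psi> L \<eta>) q L (C * N) & (ALL z. FL (pair \<psi> L \<eta>) z = \<psi> z)" by (elim exE conjE)
 have "\<exists>S\<in>dual. FL S = \<psi> & bdd S q L (C * N)" if "majorant p b \<psi> N" for \<psi> N
 proof (rule bexI[of _ "pair \<psi> L \<eta>"])
  have l: "lin (pair \<psi> L \<eta>)" "bdd (pair \<psi> L \<eta>) q L (C * N)" "ALL z. FL (pair \<psi> L \<eta>) z = \<psi> z" using P that by auto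
  show "FL (pair \<psi> L \<eta>) = \<psi> & bdd (pair \<psi> L \<eta>) q L (C * N)" using l by (auto simp: fun_eq_iff)
  show "pair \<psi> L \<eta> \<in> dual" by (rule dualI[OF l(1,2) q(1-3)])
 qed
 thus ?thesis using q by blast
qed

lemma Pa_FL:
 assumes "\<psi> \<in> P"
 obtains S where "S \<in> dual" "FL S = \<psi>"
proof -
 obtain k N where "majorant (r k) (c k) \<psi> N" using assms unfolding Pa_def Pk_majorant[symmetric] by (auto simp: Pk_majorant)
 moreover from majorant_FL[OF r_pos[of k] r_less[of k] inrad_c[of k]] obtain q L C where
  "\<forall>\<psi> N. majorant (r k) (c k) \<psi> N --> (\<exists>S\<in>dual. FL S = \<psi> & bdd S q L (C * N))" by (elim exE conjE)
 ultimately show ?thesis using that by blast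
qed

lemma Fourier_Laplace_FL: "Fourier_Laplace a S = FL S"
 by (simp add: Fourier_Laplace_def FL_def fun_eq_iff)

lemma annihilator_submodule_iff:
 "\<psi> \<in> annihilator_submodule om a c X \<longleftrightarrow> (\<exists>S\<in>dual. (\<forall>f\<in>X. S f = 0) & FL S = \<psi>)"
 unfolding annihilator_submodule_def annihilator_def Fourier_Laplace_FL by blast

lemma FL_combination: "FL (%f. s * S f + t * T f) = cscale s (FL S) + cscale t (FL T)"
 by (simp add: FL_def fun_eq_iff cscale_apply)

text \<open>Stated for a set \<open>X\<close> whose annihilator is invariant under transposed
  differentiation, so as to cover both \<open>W\<close> and the sets \<open>tests\<close>. It is
  closed because evaluating the functional with a given transform at a point of \<open>X\<close> is
  continuous on the inductive limit.\<close>

lemma annihilator_submodule_is_submodule: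
 assumes XU: "X \<subseteq> U" and X: "!!S. S \<in> dual ==> (!!f. f \<in> X ==> S f = 0) ==> (\<forall>f\<in>X. S (Diff a f) = 0)"
 shows "submodule om c r (annihilator_submodule om a c X)"
 unfolding submodule_def
proof (intro conjI allI ballI)
 let ?J = "annihilator_submodule om a c X"
 show sub: "?J \<subseteq> P" using FL_Pa by (auto simp: annihilator_submodule_iff)
 have comb: "cscale s \<psi> + cscale t \<chi>' \<in> ?J" if ab: "\<psi> \<in> ?J" "\<chi>' \<in> ?J" for s t \<psi> \<chi>'
 proof -
  obtain S T where S: "S \<in> dual" "\<forall>f\<in>X. S f = 0" "FL S = \<psi>" and T: "T \<in> dual" "\<forall>f\<in>X. T f = 0" "FL T = \<chi>'"
   using ab unfolding annihilator_submodule_iff by (elim bexE conjE)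
  show ?thesis unfolding annihilator_submodule_iff
   by (rule bexI[OF _ dual_combination[OF S(1) T(1), of s t]]) (use S T FL_combination[of s S t T] in auto)
 qed
 have z0: "0 \<in> ?J"
 proof -
  have "(%f. 0) \<in> dual"
   by (rule dualI[of _ "1/2" "c 0" 0]) (use inrad_c[of 0] in \<open>auto simp: lin_def bdd_def\<close>)
  thus ?thesis unfolding annihilator_submodule_iff by (intro bexI[of _ "%f. 0"]) (auto simp: FL_def fun_eq_iff)
 qed
 show ss: "cfun.subspace ?J"
  unfolding cfun.subspace_def
  using z0 comb[of _ _ 1 1] comb[OF _ z0, of _ _ 0] by (auto simp del: cfun.scale_zero_left)
 show "poly p * \<phi> \<in> ?J" if phi: "\<phi> \<in> ?J" for p \<phi>
 proof (induction p)
  case 0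
  have e: "poly 0 * \<phi> = 0" by (simp add: fun_eq_iff)
  show ?case unfolding e by (rule z0)
 next
  case (pCons k p)
  obtain S where S: "S \<in> dual" "\<forall>f\<in>X. S f = 0" "FL S = poly p * \<phi>"
   using pCons.IH unfolding annihilator_submodule_iff by (elim bexE conjE)
  have m: "FL (%f. S (Diff a f)) \<in> ?J"
   unfolding annihilator_submodule_iff by (rule bexI[OF _ dual_Diff[OF S(1)]]) (use X[OF S(1)] S(2) in simp)
  \<comment> \<open>Transposed differentiation multiplies the transform by
    \<open>- \<i> * z\<close>; the factor \<open>\<i>\<close> makes this multiplication by
    \<open>z\<close>.\<close>
  have e: "poly (pCons k p) * \<phi> = cscale k \<phi> + cscale \<i> (FL (%f. S (Diff a f)))"
   using FL_Diff[OF S(1)] S(3) by (simp add: fun_eq_iff cscale_apply algebra_simps)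
  show ?case unfolding e by (rule comb[OF phi m])
 qed
 show "closedin (Pa_topology om c r) ?J"
  unfolding closedin_def topspace_Pa_topology[OF weight c_inc r_inc]
 proof (intro conjI sub)
  show "openin (Pa_topology om c r) (P - ?J)"
   unfolding openin_Pa_topology
  proof (intro conjI ballI)
   fix \<phi> assume phi: "\<phi> \<in> P - ?J"
   hence "\<phi> \<in> P" by simp
   then obtain S where S: "S \<in> dual" "FL S = \<phi>" by (rule Pa_FL)
   have "~ (\<forall>f\<in>X. S f = 0)"
   proof
    assume A: "\<forall>f\<in>X. S f = 0"
    have "\<phi> \<in> ?J" unfolding annihilator_submodule_iff by (intro bexI[OF _ S(1)] conjI A S(2))
    thus False using phi by simp
   qed
   then obtain x where x: "x \<in> X" "S x ~= 0" by auto
   have xU: "x \<in> U" using x XU by auto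
   \<comment> \<open>The functional is chosen arbitrarily, but its transform determines it on
     \<open>U\<close>; hence evaluation at \<open>x\<close> is linear in
     \<open>\<psi>\<close>.\<close>
   define F where "F \<psi> = (SOME T. T \<in> dual & FL T = \<psi>)" for \<psi>
   have F: "F \<psi> \<in> dual" "FL (F \<psi>) = \<psi>" if psi: "\<psi> \<in> P" for \<psi>
   proof -
    obtain T where "T \<in> dual & FL T = \<psi>" by (rule Pa_FL[OF psi]) simp
    from someI[of "%T. T \<in> dual & FL T = \<psi>", OF this]
    show "F \<psi> \<in> dual" "FL (F \<psi>) = \<psi>" unfolding F_def by auto
   qed
   define V where "V = {\<psi> \<in> P. cmod (F \<psi> x) < cmod (S x)}"
   have nhd: "Pa_zero_nhd om c r V"
    unfolding Pa_zero_nhd_def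
   proof (intro conjI ballI allI impI)
    show "V \<subseteq> P" by (auto simp: V_def)
    fix f g s t assume f: "f \<in> V" and g: "g \<in> V" and st: "cmod s + cmod t <= 1"
    have fg: "f \<in> P" "g \<in> P" using f g by (auto simp: V_def)
    have P': "cscale s f + cscale t g \<in> P" by (rule Pa_combination[OF weight c_inc r_inc fg])
    have "F (cscale s f + cscale t g) x = s * F f x + t * F g x"
     using FL_eqD[OF F(1)[OF P'] dual_combination[OF F(1)[OF fg(1)] F(1)[OF fg(2)], of s t] _ xU] unfolding F(2)[OF P'] FL_combination F(2)[OF fg(1)] F(2)[OF fg(2)] by simp
    hence "cmod (F (cscale s f + cscale t g) x) <= cmod s * cmod (F f x) + cmod t * cmod (F g x)"
     using norm_triangle_ineq[of "s * F f x" "t * F g x"] by (simp add: norm_mult)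
    also have "... <= (cmod s + cmod t) * max (cmod (F f x)) (cmod (F g x))"
     unfolding distrib_right by (intro add_mono mult_left_mono) auto
    also have "... <= 1 * max (cmod (F f x)) (cmod (F g x))" by (intro mult_right_mono st) (simp add: le_max_iff_disj)
    also have "... < cmod (S x)" using f g by (simp add: V_def)
    finally show "cscale s f + cscale t g \<in> V" using P' by (simp add: V_def)
   next
    fix k
    from majorant_FL[OF r_pos[of k] r_less[of k] inrad_c[of k]] obtain q L C where q: "0 < q" "q < 1" "inrad L" "0 <= C"
     and Q: "\<forall>\<psi> N. majorant (r k) (c k) \<psi> N --> (\<exists>S\<in>dual. FL S = \<psi> & bdd S q L (C * N))" by (elim exE conjE)
    obtain B where B: "nb q L x B" using Ua_nb[OF xU q(1-3)] by (elim exE)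
    have B0: "0 <= B" using nb_nonneg[OF B] q(3) by (simp add: inrad_def)
    \<comment> \<open>If the norm of \<open>\<psi>\<close> is below \<open>d\<close>, the functional
      takes at \<open>x\<close> a value of modulus at most \<open>C * d * B\<close>, hence below
      \<open>cmod (S x)\<close>; the summand 1 keeps the denominator positive.\<close>
    define d where "d = cmod (S x) / (C * B + 1)"
    have d: "0 < d" using x q(4) B0 by (simp add: d_def add_nonneg_pos)
    have "\<psi> \<in> V" if psi: "\<psi> \<in> Pk om c r k" "Pk_norm om c r k \<psi> < ereal d" for \<psi>
    proof -
     have maj: "majorant (r k) (c k) \<psi> d"
      unfolding majorant_def
     proof (intro conjI allI)
      show "\<psi> holomorphic_on UNIV" using psi(1) Pk_iff by blast
      fix z
      have le: "ereal (cmod (\<psi> z) * exp (- r k * om (cmod z) - c k * abs (Im z))) <= Pk_norm om c r k \<psi>"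
       unfolding Pk_norm_def by (rule SUP_upper) simp
      have "cmod (\<psi> z) * exp (- r k * om (cmod z) - c k * abs (Im z)) <= d"
       using order.strict_trans1[OF le psi(2)] unfolding less_ereal.simps by (rule less_imp_le)
      moreover have "exp (- r k * om (cmod z) - c k * abs (Im z)) = inverse (exp (r k * om (cmod z) + c k * abs (Im z)))" by (simp flip: exp_minus)
      ultimately show "cmod (\<psi> z) <= d * exp (r k * om (cmod z) + c k * abs (Im z))"
       by (simp only: divide_inverse[symmetric] pos_divide_le_eq exp_gt_zero)
     qed
     from Q[rule_format, OF maj] obtain T where T: "T \<in> dual" "FL T = \<psi>" "bdd T q L (C * d)" by (elim bexE conjE)
     have psiP: "\<psi> \<in> P" using FL_Pa[OF T(1)] T(2) by simp
     have "F \<psi> x = T x" by (rule FL_eqD[OF F(1)[OF psiP] T(1) _ xU]) (simp add: F(2)[OF psiP] T(2))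
     hence "cmod (F \<psi> x) <= C * d * B" using bddD[OF T(3) xU B] by simp
     also have "... < (C * B + 1) * d" using d by (simp add: algebra_simps)
     also have "... = cmod (S x)" using q(4) B0 by (simp add: d_def add_nonneg_eq_0_iff)
     finally show ?thesis using psiP by (simp add: V_def)
    qed
    thus "\<exists>\<delta>>0. {\<phi> \<in> Pk om c r k. Pk_norm om c r k \<phi> < ereal \<delta>} \<subseteq> V" using d by (intro exI[of _ d]) auto
   qed
   have out: "\<phi> + v \<in> P - ?J" if v: "v \<in> V" for v
   proof
    have vP: "v \<in> P" "cmod (F v x) < cmod (S x)" using v by (auto simp: V_def)
    show "\<phi> + v \<in> P" using Pa_combination[OF weight c_inc r_inc _ vP(1), of \<phi> 1 1] phi by simp
    show "\<phi> + v \<notin> ?J"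
    proof
     assume "\<phi> + v \<in> ?J"
     then obtain T where T: "T \<in> dual" "\<forall>f\<in>X. T f = 0" "FL T = \<phi> + v" unfolding annihilator_submodule_iff by (elim bexE conjE)
     have "T x = 1 * S x + 1 * F v x"
      using FL_eqD[OF T(1) dual_combination[OF S(1) F(1)[OF vP(1)], of 1 1] _ xU] unfolding T(3) FL_combination S(2) F(2)[OF vP(1)] by simp
     hence "S x = - F v x" using T(2) x by (simp add: add_eq_0_iff2)
     thus False using vP(2) by simp
    qed
   qed
   show "EX V. Pa_zero_nhd om c r V & (\<forall>v\<in>V. \<phi> + v \<in> P - ?J)" by (rule exI[of _ V], intro conjI ballI nhd out)
  qed auto
 qed
qed

lemma principal_submodule_subset:
 assumes "submodule om c r J" "\<phi> \<in> J"
 shows "principal_submodule om c r \<phi> \<subseteq> J"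
 unfolding principal_submodule_def
 by (rule closure_of_minimal) (use assms in \<open>auto simp: submodule_def\<close>)

lemma principal_submodule_mem:
 assumes "\<phi> \<in> P"
 shows "\<phi> \<in> principal_submodule om c r \<phi>"
proof -
 have sub: "{poly p * \<phi> |p. True} \<subseteq> topspace (Pa_topology om c r)"
 proof -
  \<comment> \<open>The annihilator of the empty set is the whole dual, so this says that the module
    itself is closed under multiplication by polynomials.\<close>
  have "submodule om c r (annihilator_submodule om a c {})" by (rule annihilator_submodule_is_submodule) auto
  moreover obtain S where S: "S \<in> dual" "FL S = \<phi>" by (rule Pa_FL[OF assms])
  have "\<phi> \<in> annihilator_submodule om a c {}" unfolding annihilator_submodule_iff by (rule bexI[OF _ S(1)]) (simp add: S(2))
  ultimately show ?thesis unfolding topspace_Pa_topology[OF weight c_inc r_inc] submodule_def by blast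
 qed
 have "\<phi> \<in> {poly p * \<phi> |p. True}" by (rule CollectI, rule exI[of _ 1]) (simp add: fun_eq_iff)
 thus ?thesis unfolding principal_submodule_def by (rule subsetD[OF closure_of_subset[OF sub]])
qed

end

context Ua_space
begin

lemma supp_mono: "supp s S d ==> d <= d' ==> supp s S d'"
 unfolding supp_def by (meson order_trans)

lemma supp_bdd:
 assumes s: "s = 1 | s = - 1" and B: "bdd S q b C" and b: "inrad b" "b <= d"
 shows "supp s S d"
 unfolding supp_def
proof (intro ballI impI)
 fix f assume f: "f \<in> U" and z: "ALL j t. t \<in> Om --> s * t <= d --> Dn j f t = 0"
 have "nb q b f 0"
  unfolding nb_def
 proof (intro allI impI)
  fix j t assume t: "abs t <= b"
  hence "s * t <= d" using s b by auto
  thus "cmod (Dn j f t) <= 0 * M q j" using z Om_inner[OF b(1) t] by simp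
 qed
 from bddD[OF B f this] show "S f = 0" by simp
qed

text \<open>A quotient of two functions of exponential type is of exponential type when it is
  entire: \<open>quotient_bound\<close> is applied on discs about 0 whose radius is proportional to
  \<open>cmod w\<close>.\<close>

lemma quotient_growth:
 assumes E: "E holomorphic_on UNIV" and 1: "majorant p b \<psi> N" and 2: "majorant p b (%z. E z * \<psi> z) N'"
  and p: "p <= 1" "0 <= b" and v: "\<psi> v ~= 0"
 shows "EX C K. ALL z. cmod (E z) <= C * exp (K * cmod z)"
proof -
 obtain C0 where C0: "0 <= C0" "!!x. 0 <= x ==> om x <= 1 * x + C0" by (rule w_small[of 1]) (simp, rule that)
 have maj: "cmod (\<chi>' z) <= n * exp (C0 + (1 + b) * R)" if "majorant p b \<chi>' n" "cmod z <= R" for \<chi>' n z R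
 proof -
  have "p * om (cmod z) <= 1 * om (cmod z)" using p w_nonneg by (intro mult_right_mono) auto
  moreover have "b * abs (Im z) <= b * R" using p abs_Im_le_cmod[of z] that(2) by (intro mult_left_mono) auto
  ultimately have "p * om (cmod z) + b * abs (Im z) <= C0 + (1 + b) * R" using C0(2)[of "cmod z"] that(2) by (simp add: algebra_simps)
  hence "n * exp (p * om (cmod z) + b * abs (Im z)) <= n * exp (C0 + (1 + b) * R)" using majorant_nonneg[OF that(1)] by (intro mult_left_mono) auto
  thus ?thesis using that(1) unfolding majorant_def by (meson order_trans)
 qed
 have N: "0 <= N" "0 <= N'" using majorant_nonneg[OF 1] majorant_nonneg[OF 2] by auto
 define L where "L = ln ((N + 1) / cmod (\<psi> v)) + C0"
 have "cmod (E w) <= ((N' + 1) * exp (9 * (L + (1 + b) * (2 * cmod v + 1)))) * exp (18 * (1 + b) * cmod w)" for w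
 proof -
  \<comment> \<open>Both points lie at relative radius at most 1/2, where a Harnack factor is at
    most 3; the product of the two is the constant 9.\<close>
  define R where "R = 2 * cmod w + 2 * cmod v + 1"
  have R: "0 < R" "cmod v <= R" by (auto simp: R_def add_nonneg_pos)
  define B where "B = (N + 1) * exp (C0 + (1 + b) * R)"
  have B: "n * exp (C0 + (1 + b) * R) <= (n + 1) * B" if "0 <= n" for n
  proof -
   have "n * exp (C0 + (1 + b) * R) <= (n + 1) * exp (C0 + (1 + b) * R)" by simp
   also have "... <= (n + 1) * B" unfolding B_def using that N by (intro mult_left_mono) (simp_all add: distrib_right)
   finally show ?thesis .
  qed
  have h: "cmod (E w) <= (N' + 1) * exp (harnack_const (cmod (w - 0) / R) (cmod (v - 0) / R) * ln (B / cmod (\<psi> v)))"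
  proof (rule quotient_bound[OF E _ R(1)])
   show "\<psi> holomorphic_on UNIV" using 1 by (simp add: majorant_def)
   fix z assume "cmod (z - 0) = R"
   hence z: "cmod z <= R" by simp
   show "cmod (\<psi> z) <= B" using maj[OF 1 z] unfolding B_def by (simp add: distrib_right add_increasing2)
   have "cmod (E z) * cmod (\<psi> z) = cmod (E z * \<psi> z)" by (simp add: norm_mult)
   thus "cmod (E z) * cmod (\<psi> z) <= (N' + 1) * B" using maj[OF 2 z] B[OF N(2)] by linarith
  qed (use v in \<open>auto simp: R_def add_nonneg_pos\<close>)
  have lnB: "ln (B / cmod (\<psi> v)) = L + (1 + b) * R"
   unfolding B_def L_def using v N by (simp add: ln_mult ln_div add_nonneg_pos)
  have "cmod (\<psi> v) <= B" using maj[OF 1 R(2)] unfolding B_def by (simp add: distrib_right add_increasing2)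
  hence ln0: "0 <= ln (B / cmod (\<psi> v))" using v by simp
  have fr: "(1 + q) / (1 - q) <= 3" "0 <= (1 + q) / (1 - q)" if "0 <= q" "q <= 1/2" for q :: real
   using that by (auto simp: pos_divide_le_eq)
  have half: "cmod (w - 0) / R <= 1/2" "cmod (v - 0) / R <= 1/2" using R(1) by (auto simp: R_def pos_divide_le_eq)
  have "harnack_const (cmod (w - 0) / R) (cmod (v - 0) / R) <= 3 * 3"
   unfolding harnack_const_def using R(1) half by (intro mult_mono fr) auto
  hence "harnack_const (cmod (w - 0) / R) (cmod (v - 0) / R) * ln (B / cmod (\<psi> v)) <= 9 * (L + (1 + b) * R)"
   using mult_right_mono[OF _ ln0, of _ 9] unfolding lnB by simp
  hence "exp (harnack_const (cmod (w - 0) / R) (cmod (v - 0) / R) * ln (B / cmod (\<psi> v)))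
    <= exp (9 * (L + (1 + b) * (2 * cmod v + 1))) * exp (18 * (1 + b) * cmod w)"
   unfolding R_def by (simp add: algebra_simps flip: exp_add)
  thus ?thesis using h mult_left_mono[of _ _ "N' + 1"] N(2) by (smt (verit) mult.assoc)
 qed
 thus ?thesis by blast
qed

end

section \<open>The annihilator of an invariant subspace and the function \<open>E\<close>\<close>

locale invariant = Ua_Pa +
 fixes W :: "(real => complex) set" and I :: "real set"
 assumes W: "D_invariant_subspace om a c W" and W_proper: "W ~= U" and residual: "residual_interval om a c W I"
  and stable: "stable_submodule (annihilator_submodule om a c W)"
begin

abbreviation J :: "(complex => complex) set" where "J \<equiv> annihilator_submodule om a c W"
abbreviation W0 :: "((real => complex) => complex) set" where "W0 \<equiv> annihilator om a c W"
abbreviation mm :: "complex => nat" where "mm \<equiv> min_mult J"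

lemma W_facts: "f \<in> W ==> f \<in> U" "cfun.subspace W" "closedin (Ua_topology om a c) W" "f \<in> W ==> Diff a f \<in> W"
 using W unfolding D_invariant_subspace_def by auto

lemma W0_D: "T \<in> W0 ==> T \<in> dual" "T \<in> W0 ==> f \<in> W ==> T f = 0"
 and W0_I: "T \<in> dual ==> (!!f. f \<in> W ==> T f = 0) ==> T \<in> W0"
 by (auto simp: annihilator_def)

lemma J_iff: "\<psi> \<in> J \<longleftrightarrow> (\<exists>T\<in>W0. FL T = \<psi>)"
 unfolding annihilator_submodule_def Fourier_Laplace_FL by blast

lemma W0_separates: assumes f: "f \<in> U" and T: "!!T. T \<in> W0 ==> T f = 0" shows "f \<in> W"
proof (rule ccontr)
 assume "f \<notin> W"
 hence n: "f \<notin> Ua_topology om a c closure_of W" using closure_of_closedin[OF W_facts(3)] by simp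
 have "W \<subseteq> U" using W_facts(1) by blast
 from Ua_separation[OF W_facts(2) this f n] obtain S where "S \<in> dual" "\<forall>y\<in>W. S y = 0" "S f ~= 0" by (elim bexE conjE)
 thus False using T[OF W0_I] by auto
qed

lemma W0_nontrivial: "\<exists>T\<in>W0. EX v. FL T v ~= 0"
proof (rule ccontr)
 assume n: "~ ?thesis"
 have "f \<in> W" if f: "f \<in> U" for f
 proof (rule W0_separates[OF f])
  fix T assume T: "T \<in> W0"
  show "T f = 0" by (rule FL_injective[OF W0_D(1)[OF T] _ f]) (use n T in auto)
 qed
 thus False using W_proper W_facts(1) by blast
qed

lemma FL_zero_iff: "FL T = 0 \<longleftrightarrow> (ALL v. FL T v = 0)"
 by (simp add: fun_eq_iff)

lemma W0_vanishes: assumes T: "T \<in> W0" shows "vanishes (mm \<mu>) \<mu> (FL T)"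
proof (cases "FL T = 0")
 case True
 thus ?thesis unfolding vanishes_def by (intro exI[of _ "%z. 0"]) simp
next
 case False
 then obtain v where v: "FL T v ~= 0" unfolding FL_zero_iff by auto
 note vz = vanishes_zorder[OF FL_holomorphic[OF W0_D(1)[OF T]] v]
 have "vanishes 0 \<mu> (FL T)" unfolding vanishes_def using FL_holomorphic[OF W0_D(1)[OF T]] by auto
 hence z0: "0 <= zorder (FL T) \<mu>" using vz[of 0 \<mu>] by simp
 have "FL T \<in> J - {0}" using T False by (auto simp: J_iff)
 hence "mm \<mu> <= nat (zorder (FL T) \<mu>)" unfolding min_mult_def by (rule cINF_lower[OF bdd_below_bot])
 thus ?thesis unfolding vz using z0 by linarith
qed

text \<open>An infimum of natural numbers is attained. A transform of least order at
  \<open>\<mu>\<close> serves as the local denominator in \<open>sol_exists\<close>.\<close>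

lemma min_mult_attained: "\<exists>T\<in>W0. EX g. g holomorphic_on UNIV & g \<mu> ~= 0 & (ALL z. FL T z = (z - \<mu>)^mm \<mu> * g z)"
proof -
 from W0_nontrivial obtain T0 where T0: "T0 \<in> W0" "FL T0 ~= 0" unfolding FL_zero_iff by blast
 hence "FL T0 \<in> J - {0}" by (auto simp: J_iff)
 hence "(%\<phi>. nat (zorder \<phi> \<mu>)) ` (J - {0}) ~= {}" by (metis empty_iff image_is_empty)
 from Inf_nat_def1[OF this] obtain \<phi> where phi: "\<phi> \<in> J - {0}" "mm \<mu> = nat (zorder \<phi> \<mu>)"
  unfolding min_mult_def by (elim imageE)
 from phi(1) have "\<phi> \<in> J" by simp
 then obtain T where T': "T \<in> W0" "FL T = \<phi>" unfolding J_iff by (elim bexE)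
 have T: "T \<in> W0" "FL T ~= 0" "mm \<mu> = nat (zorder (FL T) \<mu>)" using T' phi by auto
 obtain v where v: "FL T v ~= 0" using T(2) unfolding FL_zero_iff by auto
 note hol = FL_holomorphic[OF W0_D(1)[OF T(1)]]
 obtain n g where g: "g holomorphic_on UNIV" "g \<mu> ~= 0" "!!z. FL T z = (z - \<mu>)^n * g z" by (rule entire_zero_factor[OF hol v]) (rule that)
 note vz = vanishes_zorder[OF hol v]
 have 1: "~ vanishes (Suc n) \<mu> (FL T)"
 proof
  assume "vanishes (Suc n) \<mu> (FL T)"
  then obtain k where k: "k holomorphic_on UNIV" "ALL z. FL T z = (z - \<mu>)^Suc n * k z" unfolding vanishes_def by (elim exE conjE)
  have "g \<mu> = (\<mu> - \<mu>) * k \<mu>"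
  proof (rule entire_eqI[where f = g and g = "%z. (z - \<mu>) * k z" and h = "%z. (z - \<mu>)^n" and b = "\<mu> + 1"])
   fix z
   have "g z * (z - \<mu>)^n = FL T z" using g(3) by (simp add: mult.commute)
   also have "FL T z = ((z - \<mu>) * k z) * (z - \<mu>)^n" using k(2) by (simp add: mult_ac)
   finally show "g z * (z - \<mu>)^n = ((z - \<mu>) * k z) * (z - \<mu>)^n" .
  qed (use g k in \<open>auto intro!: holomorphic_intros\<close>)
  thus False using g(2) by simp
 qed
 have 2: "vanishes n \<mu> (FL T)" unfolding vanishes_def using g by blast
 have "mm \<mu> = n" using 1 2 unfolding T(3) vz by simp
 thus ?thesis using T(1) g by blast
qed

text \<open>Here stability enters: the transform of the functional composed with
  \<open>res \<mu>\<close> is \<open>\<i>\<close> times the quotient of \<open>FL T\<close> by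
  \<open>z - \<mu>\<close>, which stability keeps in the submodule.\<close>

lemma res_annihilated:
 assumes mu: "mm \<mu> = 0" and T: "T \<in> W0" "FL T \<mu> = 0" and f: "f \<in> W"
 shows "T (res \<mu> f) = 0"
proof (cases "FL T = 0")
 case True
 show ?thesis by (rule FL_injective[OF W0_D(1)[OF T(1)] _ res_U[OF W_facts(1)[OF f]]]) (simp add: True)
next
 case False
 then obtain v where v: "FL T v ~= 0" unfolding FL_zero_iff by auto
 note hol = FL_holomorphic[OF W0_D(1)[OF T(1)]]
 obtain q b C where l: "lin T" by (rule dualE[OF W0_D(1)[OF T(1)]])
 have "vanishes 1 \<mu> (FL T)" unfolding vanishes_iff_deriv[OF hol] using T(2) by simp
 hence "0 < zorder (FL T) \<mu>" unfolding vanishes_zorder[OF hol v] by simp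
 moreover have "FL T \<in> J - {0}" using T False by (auto simp: J_iff)
 ultimately have "quotient_at (FL T) \<mu> \<in> J" using stable mu unfolding stable_submodule_def by simp
 then obtain T' where T': "T' \<in> W0" "FL T' = quotient_at (FL T) \<mu>" unfolding J_iff by blast
 have "FL (%f. T (res \<mu> f)) w = FL (%f. \<i> * T' f + 0 * T' f) w" for w
 proof (cases "w = \<mu>")
  case True
  have "deriv (FL T) \<mu> = - \<i> * T (em 1 \<mu>)" by (rule DERIV_imp_deriv[OF FL_derivative[OF W0_D(1)[OF T(1)]]])
  thus ?thesis unfolding FL_combination True T'(2) by (simp add: FL_def res_ez quotient_at_def cscale_apply)
 next
  case False
  have "T (ez w) = T (ez \<mu>) - \<i> * (w - \<mu>) * T (res \<mu> (ez w))"
   using lin_minus[OF l ez_U Ua_scale[OF res_U[OF ez_U]], of \<mu> "\<i> * (w - \<mu>)" \<mu> w] lin_scale[OF l res_U[OF ez_U]] ez_ez[of w \<mu>] by simp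
  hence "FL T w = - \<i> * (w - \<mu>) * T (res \<mu> (ez w))" using T(2) by (simp add: FL_def)
  thus ?thesis unfolding FL_combination T'(2) using False by (simp add: FL_def[of "%f. T (res \<mu> f)"] quotient_at_def cscale_apply)
 qed
 from FL_eqD[OF dual_res[OF W0_D(1)[OF T(1)]] dual_combination[OF W0_D(1)[OF T'(1)] W0_D(1)[OF T'(1)]] this W_facts(1)[OF f]]
 show ?thesis using W0_D(2)[OF T'(1) f] by simp
qed

text \<open>The combination of \<open>T\<close> and \<open>T'\<close> whose transform vanishes at
  \<open>z\<close> stays in the annihilator after \<open>res z\<close>. At a common zero of the
  submodule both sides are 0.\<close>

lemma cross_identity:
 assumes T: "T \<in> W0" and T': "T' \<in> W0" and f: "f \<in> W"
 shows "T (res z f) * FL T' z = T' (res z f) * FL T z"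
proof (cases "mm z = 0")
 case True
 have d: "(%f. FL T' z * T f + (- FL T z) * T' f) \<in> W0"
  by (rule W0_I[OF dual_combination[OF W0_D(1)[OF T] W0_D(1)[OF T']]]) (use W0_D(2)[OF T] W0_D(2)[OF T'] in simp)
 have "FL T' z * T (res z f) + (- FL T z) * T' (res z f) = 0"
  by (rule res_annihilated[OF True d _ f]) (simp add: FL_def)
 thus ?thesis by (simp add: mult.commute)
next
 case False
 hence "FL T z = 0" "FL T' z = 0" using W0_vanishes[OF T, of z] W0_vanishes[OF T', of z] by (auto simp: vanishes_def)
 thus ?thesis by simp
qed

text \<open>By the cross identity, \<open>E\<close> does not depend on \<open>T\<close>; it measures the failure of \<open>S\<close> to annihilate \<open>f\<close>.\<close>

definition sol :: "((real => complex) => complex) => (real => complex) => (complex => complex) => bool" where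
 "sol S f E \<longleftrightarrow> E holomorphic_on UNIV & (\<forall>T\<in>W0. ALL z. E z * FL T z = FL T z * S (res z f) - FL S z * T (res z f))"

text \<open>Near \<open>\<mu>\<close> the cross identity replaces the denominator by a transform of
  least order; \<open>FL S\<close> vanishes to that order as well, so the common power of
  \<open>z - \<mu>\<close> cancels. The local quotients form one entire function.\<close>

lemma sol_exists:
 assumes S: "S \<in> dual" "!!\<mu>. vanishes (mm \<mu>) \<mu> (FL S)" and f: "f \<in> W"
 shows "EX E. sol S f E"
proof -
 note fU = W_facts(1)[OF f]
 obtain T0 v where T0: "T0 \<in> W0" "FL T0 v ~= 0" using W0_nontrivial by blast
 note h0 = FL_holomorphic[OF W0_D(1)[OF T0(1)]] FL_holomorphic[OF S(1)] S_res_holomorphic[OF S(1) fU] S_res_holomorphic[OF W0_D(1)[OF T0(1)] fU]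
 define g where "g z = FL T0 z * S (res z f) - FL S z * T0 (res z f)" for z
 have gh: "g holomorphic_on UNIV" unfolding g_def using h0 by (intro holomorphic_intros)
 have loc: "EX k l. k holomorphic_on UNIV & l holomorphic_on UNIV & l \<mu> ~= 0 & (ALL z. g z * l z = FL T0 z * k z)" for \<mu>
 proof -
  from min_mult_attained[of \<mu>] obtain T1 g1 where T1: "T1 \<in> W0" and g1: "g1 holomorphic_on UNIV" "g1 \<mu> ~= 0" "ALL z. FL T1 z = (z - \<mu>)^mm \<mu> * g1 z"
   by (elim bexE exE conjE)
  obtain \<phi>1 where \<phi>1: "\<phi>1 holomorphic_on UNIV" "ALL z. FL S z = (z - \<mu>)^mm \<mu> * \<phi>1 z" using S(2)[of \<mu>] unfolding vanishes_def by (elim exE conjE)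
  note h1 = S_res_holomorphic[OF W0_D(1)[OF T1] fU]
  define k where "k z = g1 z * S (res z f) - \<phi>1 z * T1 (res z f)" for z
  have kh: "k holomorphic_on UNIV" unfolding k_def using g1 \<phi>1 h0 h1 by (intro holomorphic_intros)
  have "g z * g1 z = FL T0 z * k z" for z
  proof (rule entire_eqI[where f = "%z. g z * g1 z" and g = "%z. FL T0 z * k z" and h = "%z. (z - \<mu>)^mm \<mu>" and b = "\<mu> + 1"])
   fix z
   have "(g z * g1 z) * (z - \<mu>)^mm \<mu> = g z * FL T1 z" using g1(3) by simp
   also have "... = FL T0 z * (FL T1 z * S (res z f)) - FL S z * (T0 (res z f) * FL T1 z)" unfolding g_def by (simp add: algebra_simps)
   also have "... = FL T0 z * (FL T1 z * S (res z f)) - FL S z * (T1 (res z f) * FL T0 z)" using cross_identity[OF T0(1) T1 f, of z] by simp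
   also have "... = (FL T0 z * k z) * (z - \<mu>)^mm \<mu>" unfolding k_def using g1(3) \<phi>1(2) by (simp add: algebra_simps)
   finally show "(g z * g1 z) * (z - \<mu>)^mm \<mu> = (FL T0 z * k z) * (z - \<mu>)^mm \<mu>" .
  qed (use gh g1(1) kh h0 in \<open>auto intro!: holomorphic_intros\<close>)
  thus ?thesis using kh g1(1,2) by blast
 qed
 from local_quotient_entire[OF gh h0(1) T0(2) loc] obtain E where E: "E holomorphic_on UNIV" "!!z. E z * FL T0 z = g z" by blast
 have "E z * FL T z = FL T z * S (res z f) - FL S z * T (res z f)" if T: "T \<in> W0" for T z
 proof (rule entire_eqI[where f = "%z. E z * FL T z" and g = "%z. FL T z * S (res z f) - FL S z * T (res z f)" and h = "FL T0" and b = v])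
  note hT = FL_holomorphic[OF W0_D(1)[OF T]] S_res_holomorphic[OF W0_D(1)[OF T] fU]
  show "(%z. E z * FL T z) holomorphic_on UNIV" "(%z. FL T z * S (res z f) - FL S z * T (res z f)) holomorphic_on UNIV"
   using E(1) hT h0 by (intro holomorphic_intros; simp)+
  fix z
  have "(E z * FL T z) * FL T0 z = FL T z * g z" using E(2)[of z] by (simp add: mult_ac)
  also have "... = FL T0 z * (FL T z * S (res z f)) - FL S z * (T0 (res z f) * FL T z)" unfolding g_def by (simp add: algebra_simps)
  also have "... = (FL T z * S (res z f) - FL S z * T (res z f)) * FL T0 z"
   unfolding cross_identity[OF T0(1) T f, of z] by (simp add: algebra_simps)
  finally show "(E z * FL T z) * FL T0 z = (FL T z * S (res z f) - FL S z * T (res z f)) * FL T0 z" .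
 qed (use h0 T0 in auto)
 thus ?thesis unfolding sol_def using E(1) by blast
qed

lemma constant_solutions_annihilate:
 assumes S: "S \<in> dual" and E: "!!f. f \<in> W ==> EX E k. sol S f E & (ALL z. E z = k)" and f: "f \<in> W"
 shows "S f = 0"
proof -
 obtain T v where T: "T \<in> W0" "FL T v ~= 0" using W0_nontrivial by blast
 obtain q b C where l: "lin S" by (rule dualE[OF S])
 obtain q b C where lT: "lin T" by (rule dualE[OF W0_D(1)[OF T(1)]])
 have rel: "k' = S f - \<i> * z * k" if f: "f \<in> W" and E: "sol S f E" "ALL z. E z = k" "sol S (Diff a f) E'" "ALL z. E' z = k'" for f E E' k k' z
 proof (rule entire_eqI[where f = "%z. k'" and g = "%z. S f - \<i> * z * k" and h = "FL T" and b = v])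
  fix z
  note fU = W_facts(1)[OF f]
  have r: "res z (Diff a f) = f - cscale (f 0) (ez z) - cscale (\<i> * z) (res z f)"
   by (rule res_Diff[OF Ua_Cinf[OF fU] Diff_Cinf[OF Ua_Cinf[OF fU]]])
  have L: "L (res z (Diff a f)) = L f - f 0 * FL L z - \<i> * z * L (res z f)" if "lin L" for L
   unfolding r using lin_minus[OF that Ua_minus[OF fU Ua_scale[OF ez_U]] Ua_scale[OF res_U[OF fU]]]
    lin_minus[OF that fU Ua_scale[OF ez_U]] lin_scale[OF that ez_U] lin_scale[OF that res_U[OF fU]] by (simp add: FL_def)
  have "k' * FL T z = FL T z * S (res z (Diff a f)) - FL S z * T (res z (Diff a f))" using E(3,4) T(1) by (auto simp: sol_def)
  also have "... = FL T z * S f - \<i> * z * (FL T z * S (res z f) - FL S z * T (res z f))"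
   unfolding L[OF l] L[OF lT] W0_D(2)[OF T(1) f] by (simp add: algebra_simps)
  also have "FL T z * S (res z f) - FL S z * T (res z f) = k * FL T z" using E(1,2) T(1) by (auto simp: sol_def)
  finally show "k' * FL T z = (S f - \<i> * z * k) * FL T z" by (simp add: algebra_simps)
 qed (use FL_holomorphic[OF W0_D(1)[OF T(1)]] T in \<open>auto intro!: holomorphic_intros\<close>)
 \<comment> \<open>\<open>S f - \<i> * z * k\<close> is constant in \<open>z\<close> only if
   \<open>k = 0\<close>; the points 0 and 1 suffice.\<close>
 have zero: "k = 0" if zf: "f \<in> W" "sol S f E" "ALL z. E z = k" for f E k
 proof -
  obtain E' k' where "sol S (Diff a f) E'" "ALL z. E' z = k'" using E[OF W_facts(4)[OF zf(1)]] by (elim exE conjE)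
  from rel[OF zf this, of 0] rel[OF zf this, of 1] show "k = 0" by simp
 qed
 obtain E1 k where 1: "sol S f E1" "ALL z. E1 z = k" using E[OF f] by (elim exE conjE)
 obtain E2 k' where 2: "sol S (Diff a f) E2" "ALL z. E2 z = k'" using E[OF W_facts(4)[OF f]] by (elim exE conjE)
 show ?thesis using rel[OF f 1 2, of 0] zero[OF W_facts(4)[OF f] 2] by simp
qed

lemma I_facts: "I \<subseteq> Om" "is_interval I" "closedin (top_of_set Om) I" "flat_on om a c I \<subseteq> W"
 "rel_closed_interval a I' ==> I' \<subset> I ==> flat_on om a c I' - W ~= {}"
 using residual unfolding residual_interval_def rel_closed_interval_def by (auto dest: closedin_imp_subset)

text \<open>Otherwise a step function between \<open>d\<close> and \<open>s * t\<close> shows that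
  flatness on the part of \<open>I\<close> with \<open>s * x <= e\<close> already implies membership
  in \<open>W\<close>. That part misses \<open>t\<close>, which contradicts minimality of the
  residual interval, or \<open>W\<close> would be everything if the part is empty.\<close>

lemma W0_reaches:
 assumes s: "s = 1 | s = - 1" and t: "t \<in> I" "d < s * t"
 shows "\<exists>T\<in>W0. ~ supp s T d"
proof (rule ccontr)
 assume "~ ?thesis"
 hence S: "supp s T d" if "T \<in> W0" for T using that by blast
 define e where "e = (d + s * t) / 2"
 have e: "d < e" "e < s * t" using t by (auto simp: e_def)
 obtain \<theta> where \<theta>: "\<theta> \<in> U" "!!b. inrad b ==> EX B. nb 1 b \<theta> B" "!!j t. s * t <= d ==> Dn j \<theta> t = 0"
  "!!j t. t \<in> Om ==> e <= s * t ==> Dn j \<theta> t = Dn j (ez 0) t" by (rule side_step[OF s e(1)]) (rule that)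
 \<comment> \<open>Split \<open>f\<close> by the step function: \<open>\<theta> * f\<close> is
   invisible to every \<open>T\<close> by the support assumption, and
   \<open>f - \<theta> * f\<close> is flat on all of \<open>I\<close>.\<close>
 have claim: "f \<in> W" if f: "f \<in> U" and flat: "ALL j. \<forall>x\<in>I. s * x <= e --> Dn j f x = 0" for f
 proof (rule W0_separates[OF f])
  fix T assume T: "T \<in> W0"
  obtain q b C where l: "lin T" by (rule dualE[OF W0_D(1)[OF T]])
  note cc = Ua_Cinf[OF f] Ua_Cinf[OF \<theta>(1)]
  have hU: "\<theta> * f \<in> U" "f - \<theta> * f \<in> U" using f \<theta>(1) Ua_mult Ua_minus by auto
  have 1: "T (\<theta> * f) = 0" using S[OF T] hU(1) Dn_mult_0[OF cc(2,1) \<theta>(3)] unfolding supp_def by blast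
  have "Dn j (f - \<theta> * f) x = 0" if x: "x \<in> I" for j x
  proof (cases "s * x <= e")
   case True
   have "Dn j (f * \<theta>) x = 0" "Dn j f x = 0" using flat x True by (auto intro!: Dn_mult_0 cc)
   thus ?thesis using Dn_minus[OF cc(1) Ua_Cinf[OF hU(1)], of j x] by (simp add: mult.commute[of f])
  next
   case False
   hence "Dn j (\<theta> * f) x = Dn j f x" using x I_facts(1) \<theta>(4)[of x] by (intro Dn_mult_1 cc) auto
   thus ?thesis using Dn_minus[OF cc(1) Ua_Cinf[OF hU(1)], of j x] by simp
  qed
  hence "f - \<theta> * f \<in> W" using hU(2) I_facts(4) unfolding flat_on_def by blast
  from W0_D(2)[OF T this] show "T f = 0" using 1 lin_minus[OF l f hU(1)] by simp
 qed
 define I' where "I' = I \<inter> {x. s * x <= e}"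
 show False
 proof (cases "I' = {}")
  case True
  hence "U \<subseteq> W" using claim unfolding I'_def by blast
  thus False using W_proper W_facts(1) by blast
 next
  case False
  have h: "{x. s * x <= e} = {..e} | {x. s * x <= e} = {- e..}" using s by auto
  have "rel_closed_interval a I'"
   unfolding rel_closed_interval_def
  proof (intro conjI False)
   show "is_interval I'" unfolding I'_def using h I_facts(2) by (auto intro!: is_interval_Int is_interval_ci is_interval_ic)
   show "closedin (top_of_set Om) I'" unfolding I'_def
   proof -
    have "closed {x. s * x <= e}" using h by auto
    from closedin_Int[OF I_facts(3) closedin_closed_Int[OF this]] show "closedin (top_of_set Om) (I \<inter> {x. s * x <= e})"
     using I_facts(1) by (simp add: Int_absorb2 flip: Int_assoc)
   qed
  qed
  moreover have "t \<notin> I'" unfolding I'_def using e(2) by simp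
  hence "I' \<subset> I" using t(1) unfolding I'_def by blast
  ultimately obtain f where "f \<in> flat_on om a c I'" "f \<notin> W" using I_facts(5) by blast
  thus False using claim unfolding flat_on_def I'_def by auto
 qed
qed

text \<open>Adding \<open>h\<close> times the transform to both solution terms leaves the expression
  for \<open>E * FL T\<close> unchanged, and with the common \<open>h\<close> of
  \<open>FL_res_bound\<close> both terms are small away from the real axis.\<close>

lemma sol_bound:
 assumes f: "f \<in> W" and q: "0 < q" "q < 1" and b: "inrad b"
 shows "EX K. ALL S T C C' E z. S \<in> dual --> bdd S q b C --> T \<in> W0 --> bdd T q b C' --> sol S f E
  --> cmod (E z * FL T z) * abs (Im z) <= K * (C * cmod (FL T z) + C' * cmod (FL S z))"
proof -
 from FL_res_bound[OF W_facts(1)[OF f] q b] obtain K where K: "ALL z. EX h. ALL S C. lin S --> bdd S q b C --> cmod (S (res z f) + h * FL S z) * abs (Im z) <= C * K" by (elim exE)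
 show ?thesis
 proof (intro exI[of _ K] allI impI)
  fix S T C C' E z
  assume S: "S \<in> dual" "bdd S q b C" and T: "T \<in> W0" "bdd T q b C'" and E: "sol S f E"
  from K[rule_format, of z] obtain h where h: "ALL S C. lin S --> bdd S q b C --> cmod (S (res z f) + h * FL S z) * abs (Im z) <= C * K" by (elim exE)
  obtain q' b' D where lS: "lin S" by (rule dualE[OF S(1)])
  obtain q' b' D where lT: "lin T" by (rule dualE[OF W0_D(1)[OF T(1)]])
  have "E z * FL T z = FL T z * (S (res z f) + h * FL S z) - FL S z * (T (res z f) + h * FL T z)"
   using E T(1) unfolding sol_def by (simp add: algebra_simps)
  hence "cmod (E z * FL T z) <= cmod (FL T z) * cmod (S (res z f) + h * FL S z) + cmod (FL S z) * cmod (T (res z f) + h * FL T z)"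
   by (metis norm_mult norm_triangle_ineq4)
  hence "cmod (E z * FL T z) * abs (Im z) <= (cmod (FL T z) * cmod (S (res z f) + h * FL S z) + cmod (FL S z) * cmod (T (res z f) + h * FL T z)) * abs (Im z)"
   by (rule mult_right_mono) simp
  also have "... = cmod (FL T z) * (cmod (S (res z f) + h * FL S z) * abs (Im z)) + cmod (FL S z) * (cmod (T (res z f) + h * FL T z) * abs (Im z))"
   by (simp add: algebra_simps)
  also have "... <= cmod (FL T z) * (C * K) + cmod (FL S z) * (C' * K)"
   using h lS lT S(2) T(2) by (intro add_mono mult_left_mono) auto
  finally show "cmod (E z * FL T z) * abs (Im z) <= K * (C * cmod (FL T z) + C' * cmod (FL S z))" by (simp add: algebra_simps)
 qed
qed

lemma dual_common_bdd:
 assumes "S \<in> dual" "0 < q0" "q0 < 1" "inrad b0"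
 shows "EX q b C. q0 <= q & q < 1 & b0 <= b & inrad b & bdd S q b C & 0 <= C"
proof -
 obtain q b C where S: "lin S" "0 < q" "q < 1" "inrad b" "bdd S q b C" "0 <= C" by (rule dualE[OF assms(1)])
 have b: "0 < b" "inrad (max b0 b)" using S(4) assms(4) by (auto simp: inrad_def max_def)
 have "bdd S (max q0 q) (max b0 b) C" by (rule bdd_mono[OF S(5,2)]) (use b in auto)
 thus ?thesis using S assms b(2) by (intro exI[of _ "max q0 q"] exI[of _ "max b0 b"] exI[of _ C]) auto
qed

text \<open>Near the real axis, where the bound of \<^term>\<open>res z f\<close> degenerates, the strip lemma takes over; the exponents are
 not worsened, so the estimate can be iterated.\<close>

lemma sol_step:
 assumes S: "S \<in> dual" and f: "f \<in> W" and E: "sol S f E" and p: "0 < p" "p < 1" and b: "inrad b"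
  and A: "majorant p b (FL S) A"
 shows "EX K>=0. \<forall>T\<in>W0. ALL N. majorant p b (FL T) N --> majorant p b (%z. E z * FL T z) (K * N)"
proof -
 from majorant_FL[OF p b] obtain q0 L C where q0: "0 < q0" "q0 < 1" "inrad L" "0 <= C"
  and Q: "\<forall>\<psi> N. majorant p b \<psi> N --> (\<exists>S\<in>dual. FL S = \<psi> & bdd S q0 L (C * N))" by (elim exE conjE)
 from dual_common_bdd[OF S q0(1-3)] obtain q l CS where q: "q0 <= q" "q < 1" "L <= l" "inrad l" "bdd S q l CS" "0 <= CS" by (elim exE conjE)
 have q_pos: "0 < q" "0 <= L" using q(1) q0 by (auto simp: inrad_def)
 from sol_bound[OF f q_pos(1) q(2,4)] obtain K0 where K0: "ALL S T C C' E z. S \<in> dual --> bdd S q l C --> T \<in> W0 --> bdd T q l C' --> sol S f E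
  --> cmod (E z * FL T z) * abs (Im z) <= K0 * (C * cmod (FL T z) + C' * cmod (FL S z))" by (elim exE)
 define K1 where "K1 = abs K0 * (CS + C * A)"
 have A0: "0 <= A" by (rule majorant_nonneg[OF A])
 have K1: "0 <= K1" using q(6) q0(4) A0 by (simp add: K1_def)
 obtain C2 where C2: "0 <= C2" "!!x. 0 <= x ==> om (x + 2) <= om x + C2" by (rule w_shift[of 2]) (simp, rule that)
 have b0: "0 < b" using b by (simp add: inrad_def)
 define G where "G z = exp (p * om (cmod z) + b * abs (Im z))" for z :: complex
 have "majorant p b (%z. E z * FL T z) (K1 * exp (C2 + 2 * b) * N)" if T: "T \<in> W0" and N: "majorant p b (FL T) N" for T N
 proof -
  have N0: "0 <= N" by (rule majorant_nonneg[OF N])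
  \<comment> \<open>\<open>T\<close> comes without a bound in terms of \<open>N\<close>. The
    functional \<open>T'\<close> with the same transform has one, and it agrees with
    \<open>T\<close> on \<open>U\<close> by injectivity.\<close>
  from Q[rule_format, OF N] obtain T' where T': "T' \<in> dual" "FL T' = FL T" "bdd T' q0 L (C * N)" by (elim bexE conjE)
  have TT: "T' \<in> W0"
  proof (rule W0_I[OF T'(1)])
   fix g assume g: "g \<in> W"
   have "T' g = T g" by (rule FL_eqD[OF T'(1) W0_D(1)[OF T] _ W_facts(1)[OF g]]) (simp add: T'(2))
   thus "T' g = 0" using W0_D(2)[OF T g] by simp
  qed
  have Bd: "bdd T' q l (C * N)" by (rule bdd_mono[OF T'(3) q0(1) q(1) q_pos(2) q(3) order_refl])
  have psi: "cmod (FL T z) <= N * G z" and phi: "cmod (FL S z) <= A * G z" for z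
   using N A unfolding majorant_def G_def by auto
  have main: "cmod (E z * FL T z) * abs (Im z) <= K1 * N * G z" for z
  proof -
   have "cmod (E z * FL T' z) * abs (Im z) <= K0 * (CS * cmod (FL T' z) + C * N * cmod (FL S z))"
    using K0 S q(5) TT Bd E by blast
   also have "... <= abs K0 * (CS * (N * G z) + C * N * (A * G z))"
    unfolding T'(2) using q(6) q0(4) N0 psi[of z] phi[of z] by (intro mult_mono add_mono mult_left_mono) auto
   finally show ?thesis unfolding T'(2) K1_def by (simp add: algebra_simps)
  qed
  have hol: "(%z. E z * FL T z) holomorphic_on UNIV"
   using E FL_holomorphic[OF W0_D(1)[OF T]] unfolding sol_def by (intro holomorphic_intros) auto
  have ex: "1 <= exp (C2 + 2 * b)" using C2(1) b0 by simp
  have "cmod (E z * FL T z) <= K1 * exp (C2 + 2 * b) * N * G z" for z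
  proof (cases "abs (Im z) <= 1")
   case True
   show ?thesis
   proof (rule strip_bound[OF hol True])
    fix w assume w: "cmod (w - of_real (Re z)) = 2"
    have "abs (Im w) <= 2" using abs_Im_le_cmod[of "w - of_real (Re z)"] w by simp
    moreover have "cmod w <= cmod z + 2"
     using norm_triangle_ineq2[of w "of_real (Re z)"] w abs_Re_le_cmod[of z] by simp
    hence "om (cmod w) <= om (cmod z) + C2" using w_mono[of "cmod w" "cmod z + 2"] C2(2)[of "cmod z"] by auto
    hence "p * om (cmod w) <= p * (om (cmod z) + C2)" using p by (intro mult_left_mono) auto
    moreover have "p * C2 <= 1 * C2" using p C2(1) by (intro mult_right_mono) auto
    moreover have "b * abs (Im w) <= b * 2" "0 <= b * abs (Im z)" using b0 \<open> abs (Im w) <= 2\<close> by auto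
    ultimately have "G w <= exp (C2 + 2 * b) * G z" unfolding G_def exp_add[symmetric] by (simp add: algebra_simps)
    hence "K1 * N * G w <= K1 * N * (exp (C2 + 2 * b) * G z)" using K1 N0 by (intro mult_left_mono) auto
    thus "cmod (E w * FL T w) * abs (Im w) <= K1 * exp (C2 + 2 * b) * N * G z" using main[of w] by (simp add: mult_ac)
   qed
  next
   case False
   hence "cmod (E z * FL T z) * 1 <= cmod (E z * FL T z) * abs (Im z)" by (intro mult_left_mono) auto
   also have "... <= (K1 * N * G z) * 1" using main[of z] by simp
   also have "... <= (K1 * N * G z) * exp (C2 + 2 * b)" using ex K1 N0 by (intro mult_left_mono) (auto simp: G_def)
   finally show ?thesis by (simp add: mult_ac)
  qed
  thus ?thesis using hol unfolding majorant_def G_def by simp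
 qed
 thus ?thesis using K1 by (intro exI[of _ "K1 * exp (C2 + 2 * b)"]) auto
qed

lemma FL_common_majorant:
 assumes "S \<in> dual" "T \<in> dual"
 shows "EX p b N N'. 0 < p & p < 1 & inrad b & majorant p b (FL S) N & majorant p b (FL T) N'"
proof -
 obtain p b N where S: "0 < p" "p < 1" "inrad b" "majorant p b (FL S) N" by (rule FL_majorant[OF assms(1)])
 obtain p' b' N' where T: "0 < p'" "p' < 1" "inrad b'" "majorant p' b' (FL T) N'" by (rule FL_majorant[OF assms(2)])
 have "inrad (max b b')" using S T by (auto simp: inrad_def max_def)
 moreover have "majorant (max p p') (max b b') (FL S) N" "majorant (max p p') (max b b') (FL T) N'"
  using majorant_mono[OF S(4), of "max p p'" "max b b'" N] majorant_mono[OF T(4), of "max p p'" "max b b'" N'] by auto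
 ultimately show ?thesis using S T by (intro exI[of _ "max p p'"] exI[of _ "max b b'"] exI[of _ N] exI[of _ N']) auto
qed

lemma sol_constant:
 assumes S: "S \<in> dual" and f: "f \<in> W" and E: "sol S f E" and T0: "T0 \<in> W0" "FL T0 v ~= 0"
  and pow: "!!n. \<exists>T\<in>W0. ALL z. FL T z = E z^n * FL T0 z"
 shows "EX k. ALL z. E z = k"
proof -
 from FL_common_majorant[OF S W0_D(1)[OF T0(1)]] obtain p b A N where p: "0 < p" "p < 1" "inrad b"
  and A: "majorant p b (FL S) A" and N: "majorant p b (FL T0) N" by (elim exE conjE)
 from sol_step[OF S f E p A] obtain K where K: "K >= 0" "\<forall>T\<in>W0. ALL N. majorant p b (FL T) N --> majorant p b (%z. E z * FL T z) (K * N)" by (elim exE conjE)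
 have M: "majorant p b (%z. E z^n * FL T0 z) (K^n * N)" for n
 proof (induction n)
  case 0 thus ?case using N by simp
 next
  case (Suc n)
  from pow[of n] obtain T where T: "T \<in> W0" "ALL z. FL T z = E z^n * FL T0 z" by (elim bexE)
  have "FL T = (%z. E z^n * FL T0 z)" using T(2) by (simp add: fun_eq_iff)
  hence "majorant p b (FL T) (K^n * N)" using Suc by simp
  hence "majorant p b (%z. E z * FL T z) (K * (K^n * N))" using K(2) T(1) by blast
  thus ?case using T(2) by (simp add: mult.assoc)
 qed
 have Eh: "E holomorphic_on UNIV" using E by (simp add: sol_def)
 note Th = FL_holomorphic[OF W0_D(1)[OF T0(1)]]
 have small: "cmod (E z) <= K" if nz: "FL T0 z ~= 0" for z
 proof (rule ccontr)
  assume "~ cmod (E z) <= K"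
  hence lt: "K < cmod (E z)" by simp
  define x where "x = K / cmod (E z)"
  have Ez: "0 < cmod (E z)" using lt K(1) by linarith
  have x: "0 <= x" "x < 1" "K = x * cmod (E z)" using lt K(1) Ez by (auto simp: x_def pos_divide_less_eq)
  let ?G = "N * exp (p * om (cmod z) + b * abs (Im z))"
  have "cmod (FL T0 z) <= x^n * ?G" for n
  proof -
   have "cmod (E z^n * FL T0 z) <= K^n * N * exp (p * om (cmod z) + b * abs (Im z))" using M[of n] unfolding majorant_def by blast
   hence "cmod (E z)^n * cmod (FL T0 z) <= K^n * ?G" by (simp only: norm_mult norm_power mult.assoc)
   hence "cmod (E z)^n * cmod (FL T0 z) <= (x * cmod (E z))^n * ?G" by (subst (asm) x(3))
   hence "cmod (E z)^n * cmod (FL T0 z) <= cmod (E z)^n * (x^n * ?G)" by (simp only: power_mult_distrib mult_ac)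
   thus ?thesis using Ez by simp
  qed
  moreover have "(%n. x^n * ?G) \<longlonglongrightarrow> 0 * ?G" using x by (intro tendsto_mult LIMSEQ_realpow_zero tendsto_const) auto
  ultimately have "cmod (FL T0 z) <= 0 * ?G" by (intro LIMSEQ_le_const) auto
  thus False using nz by simp
 qed
 \<comment> \<open>The zeros of \<open>FL T0\<close> remain: the set where \<open>|E|\<close>
   exceeds \<open>K\<close> is open and consists of such zeros, so it is empty.\<close>
 have "cmod (E z) <= K" for z
 proof (rule ccontr)
  assume "~ cmod (E z) <= K"
  hence z: "z \<in> {z. K < cmod (E z)}" by simp
  have "continuous_on UNIV E" by (rule holomorphic_on_imp_continuous_on[OF Eh])
  hence o: "open {z. K < cmod (E z)}" by (intro open_Collect_less continuous_intros)
  have "FL T0 v = 0"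
   by (rule analytic_continuation_open[of "{z. K < cmod (E z)}" UNIV "FL T0" "%z. 0"])
    (use o z Th small in \<open>auto simp: not_less[symmetric]\<close>)
  thus False using T0(2) by simp
 qed
 hence "bounded (range E)" unfolding bounded_iff by blast
 from Liouville_theorem[OF Eh this] show ?thesis by (auto simp: constant_on_def)
qed

text \<open>Minimality of \<open>I\<close> supplies \<open>T\<close> in the annihilator whose
  support reaches, on the side \<open>s\<close>, almost as far as that of \<open>S\<close>. After
  normalisation both \<open>\<beta>\<close> and \<open>E * \<beta>\<close> are bounded where
  \<open>s * Im z >= 1\<close>, while \<open>\<beta>\<close> is not too small at one point
  \<open>w0\<close> of the axis. Harnack's inequality on large discs through that region then bounds
  \<open>E\<close>, and the height of \<open>w0\<close> cancels in the exponent.\<close>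

lemma sol_zero_type:
 assumes s: "s = 1 | s = - 1" and S: "S \<in> dual" and f: "f \<in> W" and E: "sol S f E"
  and edges: "!!e. 0 < e ==> EX d t. t \<in> I & d < s * t & supp s S (d + e)" and e: "0 < e"
 shows "EX C. ALL z. abs (Re z) <= s * Im z --> cmod (E z) <= C * exp (e * (s * Im z))"
proof -
 \<comment> \<open>Here \<open>608 = 19 * 8 * 4\<close>: the Harnack factors at \<open>w\<close> and
   at \<open>w0\<close> give 19 and \<open>8 * y / y0\<close>, the lower bound at \<open>w0\<close>
   gives \<open>4 * e1 * y0\<close>.\<close>
 define e1 where "e1 = e / 608"
 have e1: "0 < e1" using e by (simp add: e1_def)
 obtain d0 t where d0: "t \<in> I" "d0 < s * t" "supp s S (d0 + e1)" using edges[OF e1] by (elim exE conjE)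
 obtain T where T: "T \<in> W0" "~ supp s T d0" using W0_reaches[OF s d0(1,2)] by (elim bexE)
 note Td = W0_D(1)[OF T(1)]
 obtain d where d: "d0 <= d" "~ supp s T d" "supp s T (d + e1)"
 proof -
  obtain q b C where B: "inrad b" "bdd T q b C" by (rule dualE[OF Td]) blast
  \<comment> \<open>Moving on in steps of \<open>e1\<close> until the support is covered; the last
    failure locates the edge of the support of \<open>T\<close> up to \<open>e1\<close>.\<close>
  define Q where "Q n = supp s T (d0 + real n * e1)" for n
  obtain n where "(b - d0) / e1 <= real n" by (rule exE[OF real_arch_simple])
  hence "b <= d0 + real n * e1" using e1 by (simp add: pos_divide_le_eq)
  hence Qn: "Q n" unfolding Q_def by (rule supp_bdd[OF s B(2,1)])
  have "(LEAST n. Q n) ~= 0" using LeastI[of Q, OF Qn] T(2) by (metis Q_def add.right_neutral mult_zero_left of_nat_0)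
  then obtain m where m: "(LEAST n. Q n) = Suc m" using not0_implies_Suc by blast
  show ?thesis
  proof (rule that[of "d0 + real m * e1"])
   show "~ supp s T (d0 + real m * e1)" using not_less_Least[of m Q] m by (simp add: Q_def)
   show "supp s T (d0 + real m * e1 + e1)" using LeastI[of Q, OF Qn] m by (simp add: Q_def algebra_simps)
  qed (use e1 in simp)
 qed
 have dS: "supp s S (d + e1)" by (rule supp_mono[OF d0(3)]) (use d(1) in simp)
 define d' where "d' = d + 2 * e1"
 have dd: "d + e1 < d'" using e1 by (simp add: d'_def)
 have up: "EX C>=0. ALL z. 0 <= s * Im z --> cmod (FL R z) <= C * exp (om (cmod z) + d' * (s * Im z))" if "R \<in> dual" "supp s R (d + e1)" for R
 proof -
  from FL_supp_bound[OF s that dd] obtain C q where C: "0 <= C" "0 < q" "q < 1" "ALL z. 0 <= s * Im z --> cmod (FL R z) <= C * exp (q * om (cmod z) + d' * (s * Im z))"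
   by (elim exE conjE)
  have "cmod (FL R z) <= C * exp (om (cmod z) + d' * (s * Im z))" if "0 <= s * Im z" for z
  proof -
   have "q * om (cmod z) <= 1 * om (cmod z)" using C w_nonneg by (intro mult_right_mono) auto
   hence "C * exp (q * om (cmod z) + d' * (s * Im z)) <= C * exp (om (cmod z) + d' * (s * Im z))" using C by (intro mult_left_mono) auto
   thus ?thesis using C(4) that by (meson order_trans)
  qed
  thus ?thesis using C(1) by blast
 qed
 from up[OF Td d(3)] obtain C\<psi> where C\<psi>: "0 <= C\<psi>" "ALL z. 0 <= s * Im z --> cmod (FL T z) <= C\<psi> * exp (om (cmod z) + d' * (s * Im z))" by (elim exE conjE)
 from up[OF S dS] obtain C\<phi> where C\<phi>: "0 <= C\<phi>" "ALL z. 0 <= s * Im z --> cmod (FL S z) <= C\<phi> * exp (om (cmod z) + d' * (s * Im z))" by (elim exE conjE)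
 obtain A0 where A0: "0 <= A0" "!!z. cmod (E z * FL T z) * abs (Im z) <= A0 * (cmod (FL T z) + cmod (FL S z))"
 proof -
  obtain qT bT CT where T': "lin T" "0 < qT" "qT < 1" "inrad bT" "bdd T qT bT CT" "0 <= CT" by (rule dualE[OF Td])
  from dual_common_bdd[OF S T'(2-4)] obtain q b CS where q: "qT <= q" "q < 1" "bT <= b" "inrad b" "bdd S q b CS" "0 <= CS" by (elim exE conjE)
  have BT: "bdd T q b CT" by (rule bdd_mono[OF T'(5,2) q(1) _ q(3) order_refl]) (use T'(4) in \<open>simp add: inrad_def\<close>)
  have q0: "0 < q" using q(1) T'(2) by simp
  from sol_bound[OF f q0 q(2,4)] obtain K0 where K0: "ALL S T C C' E z. S \<in> dual --> bdd S q b C --> T \<in> W0 --> bdd T q b C' --> sol S f E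
   --> cmod (E z * FL T z) * abs (Im z) <= K0 * (C * cmod (FL T z) + C' * cmod (FL S z))" by (elim exE)
  show ?thesis
  proof (rule that[of "abs K0 * (CS + CT)"])
   fix z
   have "cmod (E z * FL T z) * abs (Im z) <= K0 * (CS * cmod (FL T z) + CT * cmod (FL S z))" using K0 S q(5) T(1) BT E by blast
   also have "... <= abs K0 * ((CS + CT) * cmod (FL T z) + (CS + CT) * cmod (FL S z))"
    using T'(6) q(6) by (intro mult_mono add_mono mult_right_mono) auto
   finally show "cmod (E z * FL T z) * abs (Im z) <= abs K0 * (CS + CT) * (cmod (FL T z) + cmod (FL S z))" by (simp add: algebra_simps)
  qed (use T'(6) q(6) in simp)
 qed
 from multiplier[OF e1] obtain v Cv where v: "v holomorphic_on UNIV" "0 < Cv" "!!z. cmod (v z) <= Cv * exp (- 2 * om (cmod z) + e1 * abs (Im z))"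
  "!!y. 1 <= cmod (v (\<i> * of_real y))" by metis
 \<comment> \<open>\<open>d'\<close> covers the growth of both transforms; one more
   \<open>e1\<close> covers the type of \<open>v\<close>, whose decay removes the weight. So the
   exponential factor makes \<open>\<beta>\<close> bounded.\<close>
 define d2 where "d2 = d + 3 * e1"
 define \<beta> where "\<beta> z = FL T z * v z * exp (\<i> * of_real (s * d2) * z)" for z
 have \<beta>h: "\<beta> holomorphic_on UNIV" unfolding \<beta>_def using FL_holomorphic[OF Td] v(1) by (intro holomorphic_intros)
 have en: "cmod (exp (\<i> * of_real (s * d2) * z)) = exp (- d2 * (s * Im z))" for z by (simp add: mult_ac)
 have vb: "exp (om (cmod z) + d' * (s * Im z)) * (cmod (v z) * exp (- d2 * (s * Im z))) <= Cv" if z: "0 <= s * Im z" for z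
 proof -
  have im: "abs (Im z) = s * Im z" using s z by auto
  have "exp (om (cmod z) + d' * (s * Im z)) * (cmod (v z) * exp (- d2 * (s * Im z)))
    <= exp (om (cmod z) + d' * (s * Im z)) * ((Cv * exp (- 2 * om (cmod z) + e1 * (s * Im z))) * exp (- d2 * (s * Im z)))"
   using v(3)[of z] unfolding im by (intro mult_left_mono mult_right_mono) auto
  also have "... = Cv * (exp (om (cmod z) + d' * (s * Im z)) * exp (- 2 * om (cmod z) + e1 * (s * Im z)) * exp (- d2 * (s * Im z)))" by (simp only: mult_ac)
  also have "exp (om (cmod z) + d' * (s * Im z)) * exp (- 2 * om (cmod z) + e1 * (s * Im z)) * exp (- d2 * (s * Im z)) = exp (- om (cmod z))"
   unfolding exp_add[symmetric] d'_def d2_def by (simp add: algebra_simps)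
  also have "Cv * exp (- om (cmod z)) <= Cv * 1" using v(2) w_nonneg[of "cmod z"] by (intro mult_left_mono) auto
  finally show ?thesis by simp
 qed
 define B where "B = Cv * (C\<psi> + C\<phi> + 1)"
 have B0: "0 < B" unfolding B_def using v(2) C\<psi> C\<phi> by simp
 have \<beta>B: "cmod (\<beta> z) <= B" if z: "0 <= s * Im z" for z
 proof -
  have "cmod (\<beta> z) <= (C\<psi> * exp (om (cmod z) + d' * (s * Im z))) * (cmod (v z) * exp (- d2 * (s * Im z)))"
   unfolding \<beta>_def norm_mult en mult.assoc[of "cmod (FL T z)"] using C\<psi>(2) z by (intro mult_right_mono) auto
  also have "... <= C\<psi> * Cv" using mult_left_mono[OF vb[OF z] C\<psi>(1)] by (simp add: mult_ac)
  also have "... <= B" using v(2) C\<psi> C\<phi> by (simp add: B_def algebra_simps)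
  finally show ?thesis .
 qed
 have E\<beta>B: "cmod (E z) * cmod (\<beta> z) <= (A0 + 1) * B" if z: "1 <= s * Im z" for z
 proof -
  have z0: "0 <= s * Im z" "1 <= abs (Im z)" using s z by auto
  have "cmod (E z * FL T z) * 1 <= cmod (E z * FL T z) * abs (Im z)" using z0 by (intro mult_left_mono) auto
  also have "... <= A0 * (cmod (FL T z) + cmod (FL S z))" by (rule A0(2))
  also have "... <= A0 * (C\<psi> * exp (om (cmod z) + d' * (s * Im z)) + C\<phi> * exp (om (cmod z) + d' * (s * Im z)))"
   using A0(1) C\<psi>(2) C\<phi>(2) z0 by (intro mult_left_mono add_mono) auto
  finally have 1: "cmod (E z * FL T z) <= A0 * (C\<psi> + C\<phi>) * exp (om (cmod z) + d' * (s * Im z))" by (simp add: algebra_simps)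
  have "cmod (E z) * cmod (\<beta> z) = cmod (E z * FL T z) * (cmod (v z) * exp (- d2 * (s * Im z)))" unfolding \<beta>_def norm_mult en by (simp only: mult_ac)
  also have "... <= (A0 * (C\<psi> + C\<phi>) * exp (om (cmod z) + d' * (s * Im z))) * (cmod (v z) * exp (- d2 * (s * Im z)))"
   by (rule mult_right_mono[OF 1]) simp
  also have "... = A0 * (C\<psi> + C\<phi>) * (exp (om (cmod z) + d' * (s * Im z)) * (cmod (v z) * exp (- d2 * (s * Im z))))" by (simp only: mult_ac)
  also have "... <= A0 * (C\<psi> + C\<phi>) * Cv" using vb[OF z0(1)] A0(1) C\<psi>(1) C\<phi>(1) by (intro mult_left_mono) auto
  also have "... <= (A0 + 1) * B" unfolding B_def using A0(1) C\<psi>(1) C\<phi>(1) v(2) by (simp add: algebra_simps add_increasing2)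
  finally show ?thesis .
 qed
 \<comment> \<open>If there were no such height, the transform would decay at rate
   \<open>d - e1\<close> and \<open>supp_of_decay\<close> would push the support below
   \<open>d\<close>. The part of \<open>D\<close> with \<open>K\<close> excludes heights up to
   2.\<close>
 obtain y0 where y0: "2 < y0" "B * exp ((d - e1) * y0) < cmod (FL T (\<i> * of_real (s * y0)))"
 proof -
  have "continuous_on (cball 0 2) (FL T)" using holomorphic_on_imp_continuous_on[OF FL_holomorphic[OF Td]] by (rule continuous_on_subset) simp
  from compact_imp_bounded[OF compact_continuous_image[OF this compact_cball]] obtain K where K: "\<forall>z\<in>cball 0 2. cmod (FL T z) <= K"
   unfolding bounded_iff by auto
  have K0: "0 <= K" using K[rule_format, of 0] norm_ge_zero[of "FL T 0"] by (simp del: norm_ge_zero)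
  define D where "D = B + K * exp (2 * abs (d - e1))"
  have "d - e1 < d" using e1 by simp
  hence "~ (ALL y. 0 <= y --> cmod (FL T (\<i> * of_real (s * y))) <= D * exp ((d - e1) * y))"
   using supp_of_decay[OF s Td, of "d - e1" d D] d(2) by blast
  then obtain y where y: "0 <= y" "D * exp ((d - e1) * y) < cmod (FL T (\<i> * of_real (s * y)))" by (auto simp: not_le)
  have "2 < y"
  proof (rule ccontr)
   assume "~ 2 < y"
   hence y2: "y <= 2" by simp
   have "cmod (\<i> * of_real (s * y)) <= 2" using s y(1) y2 by (auto simp: norm_mult)
   hence "cmod (FL T (\<i> * of_real (s * y))) <= K" using K by (simp add: dist_norm)
   moreover have "K * 1 <= K * (exp (2 * abs (d - e1)) * exp ((d - e1) * y))"
   proof (rule mult_left_mono[OF _ K0])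
    have "abs (d - e1) * y <= abs (d - e1) * 2" using y2 by (intro mult_left_mono) auto
    moreover have "- (abs (d - e1) * y) <= (d - e1) * y" using mult_right_mono[OF abs_ge_minus_self[of "d - e1"] y(1)] unfolding mult_minus_left by linarith
    ultimately have "0 <= 2 * abs (d - e1) + (d - e1) * y" by linarith
    thus "1 <= exp (2 * abs (d - e1)) * exp ((d - e1) * y)" by (simp flip: exp_add)
   qed
   moreover have "K * (exp (2 * abs (d - e1)) * exp ((d - e1) * y)) <= D * exp ((d - e1) * y)" using B0 by (simp add: D_def algebra_simps)
   ultimately show False using y(2) by linarith
  qed
  moreover have "B * exp ((d - e1) * y) <= D * exp ((d - e1) * y)" using K0 by (simp add: D_def)
  hence "B * exp ((d - e1) * y) < cmod (FL T (\<i> * of_real (s * y)))" using y(2) by linarith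
  ultimately show ?thesis by (rule that)
 qed
 define w0 where "w0 = \<i> * of_real (s * y0)"
 have w0: "s * Im w0 = y0" using s by (auto simp: w0_def)
 have \<beta>w0: "B * exp (- (4 * e1 * y0)) <= cmod (\<beta> w0)" "\<beta> w0 ~= 0"
 proof -
  have "B * exp ((d - e1) * y0) * (1 * exp (- d2 * y0)) <= cmod (FL T w0) * (cmod (v w0) * exp (- d2 * y0))"
   using y0(2) v(4)[of "s * y0"] unfolding w0_def by (intro mult_mono mult_right_mono) auto
  also have "... = cmod (\<beta> w0)" unfolding \<beta>_def norm_mult en w0 by simp
  also have "B * exp ((d - e1) * y0) * (1 * exp (- d2 * y0)) = B * exp (- (4 * e1 * y0))"
   unfolding d2_def by (simp add: algebra_simps flip: exp_add)
  finally show 1: "B * exp (- (4 * e1 * y0)) <= cmod (\<beta> w0)" .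
  thus "\<beta> w0 ~= 0" using B0 by (metis exp_gt_zero mult_pos_pos norm_zero not_le)
 qed
 have far: "cmod (E w) <= (A0 + 1) * exp (e * (s * Im w))" if w: "abs (Re w) <= s * Im w" "max 3 y0 <= s * Im w" for w
 proof -
  define y where "y = s * Im w"
  have y: "3 <= y" "y0 <= y" "abs (Re w) <= y" using w by (auto simp: y_def)
  \<comment> \<open>The disc about \<open>k\<close> of radius \<open>2 * y\<close> touches the line
    \<open>s * Im z = 1\<close>, so the bounds hold on its boundary. It contains \<open>w0\<close>,
    and \<open>w\<close> at distance at most \<open>(9/5) * y\<close>, since
    \<open>y >= 3\<close>.\<close>
  define k where "k = \<i> * of_real (s * (1 + 2 * y))"
  have wk: "Im (w - k) = - (s * (1 + y))" using s by (auto simp: k_def y_def)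
  have dk: "cmod (w0 - k) = 1 + 2 * y - y0"
  proof -
   have "w0 - k = \<i> * of_real (s * (y0 - (1 + 2 * y)))" by (simp add: w0_def k_def algebra_simps)
   hence "cmod (w0 - k) = abs (s * (y0 - (1 + 2 * y)))" by (simp only: norm_mult norm_of_real norm_ii mult_1)
   thus ?thesis using s y by auto
  qed
  have sq: "(cmod (w - k))^2 <= ((9/5) * y)^2"
  proof -
   have "(Re w)^2 <= y^2" using y(3) abs_le_square_iff[of "Re w" y] y(1) by simp
   moreover have "(cmod (w - k))^2 = (Re w)^2 + (1 + y)^2"
    unfolding cmod_power2 wk using s by (auto simp: k_def power2_eq_square algebra_simps)
   moreover have "3 * y <= y^2" unfolding power2_eq_square using y(1) by (intro mult_right_mono) auto
   moreover have "(1 + y)^2 = 1 + 2 * y + y^2" "((9/5) * y)^2 = 81/25 * y^2" by (simp_all add: power2_eq_square algebra_simps)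
   ultimately show ?thesis using y(1) by linarith
  qed
  hence wk2: "cmod (w - k) <= (9/5) * y" by (rule power2_le_imp_le) (use y in simp)
  have "cmod (E w) <= (A0 + 1) * exp (harnack_const (cmod (w - k) / (2 * y)) (cmod (w0 - k) / (2 * y)) * ln (B / cmod (\<beta> w0)))"
  proof (rule quotient_bound[OF _ \<beta>h])
   show "E holomorphic_on UNIV" using E by (simp add: sol_def)
   show "0 < 2 * y" using y by simp
   fix z assume z: "cmod (z - k) = 2 * y"
   have "abs (Im (z - k)) <= 2 * y" using abs_Im_le_cmod[of "z - k"] z by simp
   hence sz: "1 <= s * Im z" using s by (auto simp: k_def abs_le_iff)
   show "cmod (\<beta> z) <= B" using sz by (intro \<beta>B) simp
   show "cmod (E z) * cmod (\<beta> z) <= (A0 + 1) * B" by (rule E\<beta>B[OF sz])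
  qed (use dk wk2 y y0 \<beta>w0 in auto)
  moreover have "harnack_const (cmod (w - k) / (2 * y)) (cmod (w0 - k) / (2 * y)) * ln (B / cmod (\<beta> w0)) <= e * y"
  \<comment> \<open>The relative radius 9/10 of \<open>w\<close> gives 19. The point
    \<open>w0\<close> approaches the boundary as \<open>y\<close> grows, which costs a factor of
    order \<open>y / y0\<close>; its logarithmic deficit is proportional to \<open>y0\<close>, so
    the product is linear in \<open>y\<close>.\<close>
  proof -
   have "cmod (w - k) / (2 * y) <= 9/10" "0 <= cmod (w - k) / (2 * y)" using wk2 y by (auto simp: pos_divide_le_eq)
   hence h1: "(1 + cmod (w - k) / (2 * y)) / (1 - cmod (w - k) / (2 * y)) <= 19" by (simp add: pos_divide_le_eq)
   have "(1 + cmod (w0 - k) / (2 * y)) / (1 - cmod (w0 - k) / (2 * y)) = (2 * y + (1 + 2 * y - y0)) / (2 * y - (1 + 2 * y - y0))"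
    unfolding dk using y y0 by (simp add: divide_simps)
   also have "... <= (4 * y) / (y0 / 2)" using y y0 by (intro frac_le) auto
   finally have h2: "(1 + cmod (w0 - k) / (2 * y)) / (1 - cmod (w0 - k) / (2 * y)) <= 8 * y / y0" by simp
   have "0 <= (1 + cmod (w0 - k) / (2 * y)) / (1 - cmod (w0 - k) / (2 * y))" unfolding dk using y y0 by (intro divide_nonneg_nonneg) (auto simp: pos_divide_le_eq)
   hence hc: "harnack_const (cmod (w - k) / (2 * y)) (cmod (w0 - k) / (2 * y)) <= 19 * (8 * y / y0)"
    unfolding harnack_const_def by (intro mult_mono h1 h2) auto
   have b0: "0 < cmod (\<beta> w0)" using \<beta>w0(2) by simp
   have "B <= cmod (\<beta> w0) * exp (4 * e1 * y0)"
   proof -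
    have "B = (B * exp (- (4 * e1 * y0))) * exp (4 * e1 * y0)" by (simp flip: exp_add)
    also have "... <= cmod (\<beta> w0) * exp (4 * e1 * y0)" by (rule mult_right_mono[OF \<beta>w0(1)]) simp
    finally show ?thesis .
   qed
   hence "B / cmod (\<beta> w0) <= exp (4 * e1 * y0)" using b0 by (simp add: pos_divide_le_eq mult.commute)
   hence l: "ln (B / cmod (\<beta> w0)) <= 4 * e1 * y0" using b0 B0 by (subst ln_exp[symmetric], subst ln_le_cancel_iff) auto
   have l0: "0 <= ln (B / cmod (\<beta> w0))" using \<beta>B[of w0] w0 y0 b0 by simp
   have "harnack_const (cmod (w - k) / (2 * y)) (cmod (w0 - k) / (2 * y)) * ln (B / cmod (\<beta> w0)) <= (19 * (8 * y / y0)) * (4 * e1 * y0)"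
    using hc l l0 y y0 by (intro mult_mono) auto
   also have "... = e * y" using y0 by (simp add: e1_def)
   finally show ?thesis .
  qed
  hence "(A0 + 1) * exp (harnack_const (cmod (w - k) / (2 * y)) (cmod (w0 - k) / (2 * y)) * ln (B / cmod (\<beta> w0))) <= (A0 + 1) * exp (e * y)"
   using A0(1) by (intro mult_left_mono) auto
  ultimately show ?thesis unfolding y_def by linarith
 qed
 define Y where "Y = max 3 y0"
 have "continuous_on (cball 0 (2 * Y)) E" using E by (auto simp: sol_def intro: holomorphic_on_imp_continuous_on holomorphic_on_subset)
 from compact_imp_bounded[OF compact_continuous_image[OF this compact_cball]] obtain K where K: "\<forall>z\<in>cball 0 (2 * Y). cmod (E z) <= K"
  unfolding bounded_iff by auto
 have Y0: "0 <= Y" by (simp add: Y_def)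
 have K0: "0 <= K" using order_trans[OF norm_ge_zero bspec[OF K, of 0]] Y0 by simp
 have "cmod (E z) <= (A0 + 1 + K) * exp (e * (s * Im z))" if z: "abs (Re z) <= s * Im z" for z
 proof -
  have e0: "1 <= exp (e * (s * Im z))" using z e by auto
  have "cmod (E z) <= (A0 + 1) * exp (e * (s * Im z)) | cmod (E z) <= K"
  proof (cases "Y <= s * Im z")
   case True thus ?thesis using far[OF z] by (simp add: Y_def)
  next
   case False
   have "cmod z <= abs (Re z) + abs (Im z)" by (rule cmod_le)
   moreover have "abs (Im z) = s * Im z" using s z by auto
   ultimately have "cmod z <= 2 * Y" using z False by linarith
   thus ?thesis using K by simp
  qed
  moreover have "K * 1 <= K * exp (e * (s * Im z))" by (rule mult_left_mono[OF e0 K0])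
  moreover have "0 <= (A0 + 1) * exp (e * (s * Im z))" "0 <= K * exp (e * (s * Im z))" using A0(1) K0 by auto
  ultimately show ?thesis unfolding distrib_right by auto
 qed
 thus ?thesis by blast
qed

end

section \<open>Indicators, supports and weakly localisable submodules\<close>

lemma vanishes_0: "vanishes n \<mu> (%z. 0)"
 unfolding vanishes_def by (intro exI[of _ "%z. 0"]) simp

lemma ii_half_turn: "s = 1 | s = - 1 ==> of_real R * cis (s * (pi / 2)) = \<i> * of_real (s * R)"
 by (auto simp: cis_minus_pi_half)

lemma le_uminus_swap: "x <= - y \<longleftrightarrow> y <= - (x::ereal)"
 by (metis ereal_minus_le_minus ereal_uminus_uminus)

context Ua_Pa
begin

text \<open>\<open>D 1\<close> and \<open>D (- 1)\<close> limit the support on the two sides. The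
  condition runs over all real \<open>d\<close> above \<open>D s\<close> because \<open>D s\<close>
  may be infinite and the end itself need not be decided.\<close>

definition typed :: "(real => ereal) => ((real => complex) => complex) => bool" where
 "typed D T \<longleftrightarrow> (ALL s d. (s = 1 | s = - 1) --> D s < ereal d --> supp s T d)"

lemma supp_axis_bound:
 assumes s: "s = 1 | s = - 1" and T: "T \<in> dual" and d: "supp s T d" "d < d'"
 shows "EX C>0. ALL y>=0. cmod (FL T (\<i> * of_real (s * y))) <= C * exp (d' * y)"
proof -
 define m where "m = (d + d') / 2"
 have m: "d < m" "m < d'" using d(2) by (auto simp: m_def)
 from FL_supp_bound[OF s T d(1) m(1)] obtain C q where C: "0 <= C" "0 < q" "q < 1" "ALL z. 0 <= s * Im z --> cmod (FL T z) <= C * exp (q * om (cmod z) + m * (s * Im z))"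
  by (elim exE conjE)
 obtain K where K: "0 <= K" "!!x. 0 <= x ==> om x <= (d' - m) * x + K" by (rule w_small[of "d' - m"]) (use m in simp, rule that)
 have "cmod (FL T (\<i> * of_real (s * y))) <= (C * exp K + 1) * exp (d' * y)" if y: "0 <= y" for y
 proof -
  let ?z = "\<i> * of_real (s * y)"
  have z: "s * Im ?z = y" "cmod ?z = y" using s y by (auto simp: norm_mult)
  have "q * om y <= 1 * om y" using C(3) w_nonneg[OF y] by (intro mult_right_mono) auto
  hence e: "exp (q * om y + m * y) <= exp (K + d' * y)" using K(2)[OF y] by (simp add: algebra_simps)
  have "cmod (FL T ?z) <= C * exp (q * om y + m * y)" using C(4)[rule_format, of ?z] y unfolding z by simp
  also have "... <= C * exp (K + d' * y)" by (rule mult_left_mono[OF e C(1)])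
  also have "... <= (C * exp K + 1) * exp (d' * y)" by (simp add: exp_add algebra_simps)
  finally show ?thesis .
 qed
 thus ?thesis using C(1) by (intro exI[of _ "C * exp K + 1"]) (auto intro: add_nonneg_pos)
qed

lemma typed_indicator:
 assumes s: "s = 1 | s = - 1" and T: "T \<in> dual" and D: "!!d. D < ereal d ==> supp s T d"
 shows "indicator_fun (FL T) (s * (pi / 2)) <= D"
proof (rule ccontr)
 assume "~ ?thesis"
 then obtain d where d: "D < ereal d" "ereal d < indicator_fun (FL T) (s * (pi / 2))" using ereal_dense2[of D] by (auto simp: not_le)
 obtain d1 where d1: "D < ereal d1" "d1 < d" using ereal_dense2[OF d(1)] by auto
 define m where "m = (d1 + d) / 2"
 have m: "d1 < m" "m < d" using d1(2) by (auto simp: m_def)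
 from supp_axis_bound[OF s T D[OF d1(1)] m(1)] obtain C where C: "C > 0" "ALL y>=0. cmod (FL T (\<i> * of_real (s * y))) <= C * exp (m * y)" by (elim exE conjE)
 have "indicator_fun (FL T) (s * (pi / 2)) <= ereal d"
  unfolding indicator_fun_def
 proof (rule Limsup_bounded)
  have "eventually (%R. R >= max 1 (ln C / (d - m))) at_top" by (rule eventually_ge_at_top)
  thus "\<forall>\<^sub>F R in at_top. (if FL T (of_real R * cis (s * (pi / 2))) = 0 then - \<infinity>
    else ereal (ln (cmod (FL T (of_real R * cis (s * (pi / 2))))) / R)) <= ereal d"
  proof (rule eventually_mono)
   fix R assume "R >= max 1 (ln C / (d - m))"
   hence R: "1 <= R" "ln C <= R * (d - m)" using m by (auto simp: pos_divide_le_eq)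
   have "ln (cmod (FL T (\<i> * of_real (s * R)))) / R <= d" if nz: "FL T (\<i> * of_real (s * R)) ~= 0"
   proof -
    have "ln (cmod (FL T (\<i> * of_real (s * R)))) <= ln (C * exp (m * R))" using nz C R by (subst ln_le_cancel_iff) auto
    also have "... = ln C + m * R" using C by (simp add: ln_mult)
    finally show ?thesis using R by (simp add: pos_divide_le_eq algebra_simps)
   qed
   thus "(if FL T (of_real R * cis (s * (pi / 2))) = 0 then - \<infinity>
    else ereal (ln (cmod (FL T (of_real R * cis (s * (pi / 2))))) / R)) <= ereal d"
    unfolding ii_half_turn[OF s] by simp
  qed
 qed
 thus False using d(2) by simp
qed

text \<open>The limit superior gives an exponential bound for large heights and compactness gives
  the rest, so \<open>supp_of_decay\<close> applies. With \<open>typed_indicator\<close> this makes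
  support and indicator equivalent data.\<close>

lemma supp_of_indicator:
 assumes s: "s = 1 | s = - 1" and T: "T \<in> dual" and d: "indicator_fun (FL T) (s * (pi / 2)) < ereal d"
 shows "supp s T d"
proof -
 obtain d1 where d1: "indicator_fun (FL T) (s * (pi / 2)) < ereal d1" "d1 < d" using ereal_dense2[OF d] by auto
 from Limsup_lessD[OF d1(1)[unfolded indicator_fun_def]] obtain R0 where R0: "!!R. R0 <= R ==> (if FL T (of_real R * cis (s * (pi / 2))) = 0 then - \<infinity>
    else ereal (ln (cmod (FL T (of_real R * cis (s * (pi / 2))))) / R)) < ereal d1"
  unfolding eventually_at_top_linorder by blast
 define Y where "Y = max 1 R0"
 have "continuous_on (cball 0 Y) (FL T)" using holomorphic_on_imp_continuous_on[OF FL_holomorphic[OF T]] by (rule continuous_on_subset) simp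
 from compact_imp_bounded[OF compact_continuous_image[OF this compact_cball]] obtain K where K: "\<forall>z\<in>cball 0 Y. cmod (FL T z) <= K"
  unfolding bounded_iff by auto
 have Y0: "0 <= Y" by (simp add: Y_def)
 have K0: "0 <= K" using order_trans[OF norm_ge_zero bspec[OF K, of 0]] Y0 by simp
 have "cmod (FL T (\<i> * of_real (s * y))) <= (K * exp (abs d1 * Y) + 1) * exp (d1 * y)" if y: "0 <= y" for y
 proof (cases "y <= Y")
  case True
  have "cmod (\<i> * of_real (s * y)) = y" using s y by (auto simp: norm_mult)
  hence 1: "cmod (FL T (\<i> * of_real (s * y))) <= K" using K True by (simp add: dist_norm)
  have "abs d1 * y <= abs d1 * Y" using True by (intro mult_left_mono) auto
  moreover have "- abs d1 * y <= d1 * y" by (rule mult_right_mono[OF _ y]) simp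
  ultimately have "1 <= exp (abs d1 * Y) * exp (d1 * y)" by (simp flip: exp_add)
  hence "K * 1 <= K * (exp (abs d1 * Y) * exp (d1 * y))" by (rule mult_left_mono[OF _ K0])
  thus ?thesis using 1 by (simp add: algebra_simps add_increasing)
 next
  case False
  hence R: "R0 <= y" "1 <= y" by (auto simp: Y_def)
  have "cmod (FL T (\<i> * of_real (s * y))) <= exp (d1 * y)"
  proof (cases "FL T (\<i> * of_real (s * y)) = 0")
   case nz: False
   hence "ln (cmod (FL T (\<i> * of_real (s * y)))) < d1 * y" using R0[OF R(1)] R(2) unfolding ii_half_turn[OF s] by (simp add: pos_divide_less_eq)
   thus ?thesis using nz by (metis exp_le_cancel_iff exp_ln less_imp_le zero_less_norm_iff)
  qed simp
  also have "... <= (K * exp (abs d1 * Y) + 1) * exp (d1 * y)" using K0 by (simp add: distrib_right)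
  finally show ?thesis .
 qed
 thus ?thesis by (rule supp_of_decay[OF s T d1(2)])
qed

lemma vanishes_FL_iff: "S \<in> dual ==> vanishes n \<mu> (FL S) \<longleftrightarrow> (ALL j<n. S (em j \<mu>) = 0)"
 by (simp add: vanishes_iff_deriv[OF FL_holomorphic] higher_deriv_FL)

text \<open>Annihilating this set means having the zeros \<open>Z\<close> and the support limits
  \<open>D\<close>, see \<open>kills_tests_iff\<close>. Thus the functions with prescribed zeros and
  segment form an annihilator submodule, and closedness comes for free.\<close>

definition tests :: "(complex => nat) => (real => ereal) => (real => complex) set" where
 "tests Z D = exp_system a Z \<union> {f \<in> U. EX s d. (s = 1 | s = - 1) & D s < ereal d & (ALL j t. t \<in> Om --> s * t <= d --> Dn j f t = 0)}"

lemma kills_tests_iff: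
 assumes S: "S \<in> dual"
 shows "(\<forall>f\<in>tests Z D. S f = 0) \<longleftrightarrow> (\<forall>\<mu>. vanishes (Z \<mu>) \<mu> (FL S)) & typed D S"
 unfolding tests_def typed_def supp_def vanishes_FL_iff[OF S] exp_system_def by blast

lemma tests_submodule: "submodule om c r (annihilator_submodule om a c (tests Z D))"
proof (rule annihilator_submodule_is_submodule)
 show "tests Z D \<subseteq> U" unfolding tests_def exp_system_def using em_U by blast
 fix S assume S: "S \<in> dual" "!!f. f \<in> tests Z D ==> S f = 0"
 hence k: "\<forall>\<mu>. vanishes (Z \<mu>) \<mu> (FL S)" "typed D S" using kills_tests_iff[OF S(1), of Z D] by simp_all
 have "vanishes (Z \<mu>) \<mu> (FL (%f. S (Diff a f)))" for \<mu>
 proof -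
  have "FL (%f. S (Diff a f)) = (%z. - \<i> * z * FL S z)" using FL_Diff[OF S(1)] by (simp add: fun_eq_iff)
  thus ?thesis using vanishes_mult[OF k(1)[rule_format, of \<mu>], of "%z. - \<i> * z"] by (auto intro!: holomorphic_intros)
 qed
 moreover have "typed D (%f. S (Diff a f))"
  using k(2) Diff_U unfolding typed_def supp_def by (simp add: Dn_Diff del: funpow.simps)
 ultimately show "\<forall>f\<in>tests Z D. S (Diff a f) = 0" by (intro kills_tests_iff[OF dual_Diff[OF S(1)], THEN iffD2] conjI allI)
qed

text \<open>A weakly localisable submodule consists of all the functions allowed by its zeros and its indicator segment.\<close>

lemma weakly_localisable_eq:
 assumes wl: "weakly_localisable om c r K"
 shows "annihilator_submodule om a c (tests (min_mult K) (%s. if s = 1 then ind_right K else - ind_left K)) = K"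
proof -
 define D where "D s = (if s = 1 then ind_right K else - ind_left K)" for s :: real
 let ?Z = "min_mult K"
 define A where "A = annihilator_submodule om a c (tests ?Z D)"
 have K: "submodule om c r K" "K ~= {0}" and mx: "!!K'. submodule om c r K' ==> K' ~= {0} ==> min_mult K' = min_mult K ==> ind_left K' = ind_left K
  ==> ind_right K' = ind_right K ==> K \<subseteq> K' ==> K' = K"
  using wl unfolding weakly_localisable_def by auto
 have K0: "0 \<in> K" "K \<subseteq> P" using K(1) cfun.subspace_0 unfolding submodule_def by auto
 hence ne: "K - {0} ~= {}" using K(2) by auto
 have zord: "vanishes n \<mu> (FL T) \<longleftrightarrow> n <= nat (zorder (FL T) \<mu>)" if T: "T \<in> dual" "FL T ~= 0" for n \<mu> T
 proof -
  obtain v where "FL T v ~= 0" using T(2) by (auto simp: fun_eq_iff)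
  note vz = vanishes_zorder[OF FL_holomorphic[OF T(1)] this]
  have "vanishes 0 \<mu> (FL T)" unfolding vanishes_def using FL_holomorphic[OF T(1)] by auto
  thus ?thesis unfolding vz by simp linarith
 qed
 have sub: "K \<subseteq> A"
 proof
  fix \<psi> assume psi: "\<psi> \<in> K"
  hence "\<psi> \<in> P" using K0(2) by blast
  then obtain T where T: "T \<in> dual" "FL T = \<psi>" by (rule Pa_FL)
  have "(\<forall>\<mu>. vanishes (?Z \<mu>) \<mu> (FL T)) & typed D T"
  proof (cases "\<psi> = 0")
   case True
   have "T f = 0" if "f \<in> U" for f by (rule FL_injective[OF T(1) _ that]) (simp add: T(2) True)
   hence "typed D T" unfolding typed_def supp_def by blast
   moreover have "FL T = (%z. 0)" unfolding T(2) True by (simp add: fun_eq_iff)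
   ultimately show ?thesis using vanishes_0 by simp
  next
   case False
   hence m: "\<psi> \<in> K - {0}" using psi by simp
   have ind: "indicator_fun \<psi> (s * (pi / 2)) <= D s" if "s = 1 | s = - 1" for s
   proof -
    have "ind_left K <= - indicator_fun \<psi> (- pi / 2)" unfolding ind_left_def by (rule INF_lower[OF m])
    hence "indicator_fun \<psi> (- pi / 2) <= - ind_left K" by (rule le_uminus_swap[THEN iffD1])
    moreover have "indicator_fun \<psi> (pi / 2) <= ind_right K" unfolding ind_right_def by (rule SUP_upper[OF m])
    ultimately show ?thesis using that by (auto simp: D_def)
   qed
   have "?Z \<mu> <= nat (zorder \<psi> \<mu>)" for \<mu> unfolding min_mult_def by (rule cINF_lower[OF bdd_below_bot m])
   moreover have "typed D T" unfolding typed_def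
   proof (intro allI impI)
    fix s d assume s: "s = 1 | s = - 1" and d: "D s < ereal d"
    show "supp s T d" by (rule supp_of_indicator[OF s T(1)]) (use order.strict_trans1[OF ind[OF s] d] T(2) in simp)
   qed
   moreover have "FL T ~= 0" using False T(2) by simp
   ultimately show ?thesis using zord[OF T(1)] T(2) by simp
  qed
  hence "\<forall>f\<in>tests ?Z D. T f = 0" by (rule kills_tests_iff[OF T(1), THEN iffD2])
  thus "\<psi> \<in> A" unfolding A_def annihilator_submodule_iff by (intro bexI[OF _ T(1)] conjI T(2))
 qed
 \<comment> \<open>Functions in \<open>A\<close> vanish at least as prescribed and have indicators
   within the segment; as \<open>K\<close> is contained in \<open>A\<close>, zeros and segment of
   the two coincide and maximality applies.\<close>
 have A3: "?Z \<mu> <= nat (zorder \<psi> \<mu>)" "indicator_fun \<psi> (pi / 2) <= ind_right K" "ind_left K <= - indicator_fun \<psi> (- pi / 2)" if psi: "\<psi> \<in> A - {0}" for \<psi> \<mu>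
 proof -
  have "\<psi> \<in> A" using psi by simp
  then obtain T where T: "T \<in> dual" "\<forall>f\<in>tests ?Z D. T f = 0" "FL T = \<psi>" unfolding A_def annihilator_submodule_iff by (elim bexE conjE)
  have k: "vanishes (?Z \<mu>) \<mu> (FL T)" "typed D T" using T(2) kills_tests_iff[OF T(1), of ?Z D] by simp_all
  show "?Z \<mu> <= nat (zorder \<psi> \<mu>)" using k(1) zord[OF T(1)] T(3) psi by simp
  show "indicator_fun \<psi> (pi / 2) <= ind_right K"
   using typed_indicator[of 1 T "D 1"] T k(2) by (simp add: typed_def D_def)
  have "indicator_fun \<psi> (- 1 * (pi / 2)) <= D (- 1)"
   unfolding T(3)[symmetric] by (rule typed_indicator) (use T k(2) in \<open>auto simp: typed_def\<close>)
  hence "indicator_fun \<psi> (- pi / 2) <= - ind_left K" by (simp add: D_def)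
  thus "ind_left K <= - indicator_fun \<psi> (- pi / 2)" by (rule le_uminus_swap[THEN iffD2])
 qed
 have "A = K"
 proof (rule mx[OF _ _ _ _ _ sub])
  show "submodule om c r A" unfolding A_def by (rule tests_submodule)
  show "A ~= {0}" using sub ne by blast
  have ne': "A - {0} ~= {}" using sub ne by blast
  show "min_mult A = ?Z"
  proof
   fix \<mu>
   have "min_mult A \<mu> <= ?Z \<mu>" unfolding min_mult_def using sub by (intro cINF_superset_mono[OF ne bdd_below_bot]) auto
   moreover have "?Z \<mu> <= min_mult A \<mu>" unfolding min_mult_def[of A] by (rule cINF_greatest[OF ne' A3(1)])
   ultimately show "min_mult A \<mu> = ?Z \<mu>" by simp
  qed
  show "ind_left A = ind_left K"
  proof (rule antisym)
   show "ind_left A <= ind_left K" unfolding ind_left_def using sub by (intro INF_superset_mono) auto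
   show "ind_left K <= ind_left A" unfolding ind_left_def[of A] by (rule INF_greatest[OF A3(3)])
  qed
  show "ind_right A = ind_right K"
  proof (rule antisym)
   show "ind_right K <= ind_right A" unfolding ind_right_def using sub by (intro SUP_subset_mono) auto
   show "ind_right A <= ind_right K" unfolding ind_right_def[of A] by (rule SUP_least[OF A3(2)])
  qed
 qed
 moreover have "D = (%s. if s = 1 then ind_right K else - ind_left K)" by (simp add: D_def fun_eq_iff)
 ultimately show ?thesis by (simp add: A_def)
qed

end

section \<open>Synthesis from a class of annihilating functionals\<close>

context invariant
begin

text \<open>Annihilating functions flat on \<open>I\<close> confines the support to
  \<open>I\<close>. The end of \<open>I\<close> need not be attained and may be infinite, hence a
  point of \<open>I\<close> and a slack \<open>e\<close> instead of the end itself.\<close>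

lemma flat_edges:
 assumes S: "S \<in> dual" "!!g. g \<in> flat_on om a c I ==> S g = 0" and s: "s = 1 | s = - 1" and e: "0 < e"
 shows "EX d t. t \<in> I & d < s * t & supp s S (d + e)"
proof -
 obtain q b C where b: "inrad b" "bdd S q b C" by (rule dualE[OF S(1)]) blast
 show ?thesis
 proof (cases "\<exists>t\<in>I. b < s * t")
  case True
  thus ?thesis using supp_bdd[OF s b(2,1), of "b + e"] e by auto
 next
  case False
  hence bd: "bdd_above ((%t. s * t) ` I)" by (auto simp: not_less intro!: bdd_aboveI[of _ b])
  define \<sigma> where "\<sigma> = Sup ((%t. s * t) ` I)"
  have ne: "I ~= {}" using residual unfolding residual_interval_def rel_closed_interval_def by auto
  have "\<sigma> - e / 2 < \<sigma>" using e by simp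
  then obtain t where t: "t \<in> I" "\<sigma> - e / 2 < s * t" unfolding \<sigma>_def using less_cSup_iff[OF _ bd] ne by auto
  have le: "s * x <= \<sigma> - e / 2 + e" if "x \<in> I" for x
   using cSUP_upper[OF that bd] e unfolding \<sigma>_def by simp
  have "supp s S (\<sigma> - e / 2 + e)"
   unfolding supp_def
  proof (intro ballI impI S(2))
   fix f assume "f \<in> U" "ALL j t. t \<in> Om --> s * t <= \<sigma> - e / 2 + e --> Dn j f t = 0"
   thus "f \<in> flat_on om a c I" unfolding flat_on_def using le I_facts(1) by blast
  qed
  thus ?thesis using t by blast
 qed
qed

lemma sol_mult:
 assumes S: "S \<in> dual" and f: "f \<in> W" and E: "sol S f E"
  and edges: "!!s e. s = 1 | s = - 1 ==> 0 < e ==> EX d t. t \<in> I & d < s * t & supp s S (d + e)" and T: "T \<in> W0" "typed D T"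
 shows "\<exists>T'\<in>dual. FL T' = (%z. E z * FL T z) & typed D T'"
proof -
 from FL_common_majorant[OF S W0_D(1)[OF T(1)]] obtain p b A N where p: "0 < p" "p < 1" "inrad b"
  and A: "majorant p b (FL S) A" and N: "majorant p b (FL T) N" by (elim exE conjE)
 from sol_step[OF S f E p A] obtain K where K: "\<forall>T\<in>W0. ALL N. majorant p b (FL T) N --> majorant p b (%z. E z * FL T z) (K * N)" by (elim exE conjE)
 from majorant_FL[OF p] obtain q L C where "\<forall>\<psi> N. majorant p b \<psi> N --> (\<exists>S\<in>dual. FL S = \<psi> & bdd S q L (C * N))" by (elim exE conjE)
 then obtain T' where T': "T' \<in> dual" "FL T' = (%z. E z * FL T z)" using K T(1) N by meson
 have "supp s T' d" if s: "s = 1 | s = - 1" and d: "D s < ereal d" for s d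
 proof -
  obtain d1 where d1: "D s < ereal d1" "d1 < d" using ereal_dense2[OF d] by auto
  \<comment> \<open>One third for the axis bound of \<open>T\<close>, one for the growth of
    \<open>E\<close>, and one left to make the final inequality strict.\<close>
  define e where "e = (d - d1) / 3"
  have e: "0 < e" "d1 < d1 + e" "d1 + e + e < d" using d1(2) by (auto simp: e_def field_simps)
  have "supp s T d1" using T(2) s d1(1) unfolding typed_def by blast
  from supp_axis_bound[OF s W0_D(1)[OF T(1)] this e(2)] obtain C where C: "C > 0" "ALL y>=0. cmod (FL T (\<i> * of_real (s * y))) <= C * exp ((d1 + e) * y)" by (elim exE conjE)
  from sol_zero_type[OF s S f E _ e(1)] edges[OF s] obtain C' where C': "ALL z. abs (Re z) <= s * Im z --> cmod (E z) <= C' * exp (e * (s * Im z))" by blast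
  show ?thesis
  proof (rule supp_of_decay[OF s T'(1) e(3)])
   fix y :: real assume y: "0 <= y"
   have z: "Re (\<i> * of_real (s * y)) = 0" "s * Im (\<i> * of_real (s * y)) = y" using s by auto
   have 1: "cmod (E (\<i> * of_real (s * y))) <= C' * exp (e * y)" using C'[rule_format, of "\<i> * of_real (s * y)", unfolded z] y by simp
   have "cmod (FL T' (\<i> * of_real (s * y))) <= (C' * exp (e * y)) * (C * exp ((d1 + e) * y))"
    unfolding T'(2) norm_mult using C y by (intro mult_mono[OF 1]) (auto intro: order_trans[OF norm_ge_zero 1])
   also have "... = (C' * C) * exp ((d1 + e + e) * y)" by (simp add: algebra_simps flip: exp_add)
   finally show "cmod (FL T' (\<i> * of_real (s * y))) <= (C' * C) * exp ((d1 + e + e) * y)" .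
  qed
 qed
 thus ?thesis using T' unfolding typed_def by blast
qed

lemma em_in_W: assumes j: "j < mm \<mu>" shows "em j \<mu> \<in> W"
proof (rule W0_separates[OF em_U])
 fix T assume T: "T \<in> W0"
 show "T (em j \<mu>) = 0" using vanishes_FL_iff[OF W0_D(1)[OF T], THEN iffD1, OF W0_vanishes[OF T]] j by blast
qed

lemma Exp_vanishes: "S \<in> dual ==> (!!g. g \<in> Exp_set a W ==> S g = 0) ==> vanishes (mm \<mu>) \<mu> (FL S)"
 unfolding vanishes_FL_iff Exp_set_def using em_in_W by blast

lemma synthesis_of_annihilation:
 assumes key: "!!S f. S \<in> dual ==> (!!g. g \<in> Exp_set a W ==> S g = 0) ==> (!!g. g \<in> flat_on om a c I ==> S g = 0) ==> f \<in> W ==> S f = 0"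
 shows "admits_weak_spectral_synthesis om a c W"
proof -
 define Y where "Y = {f + g |f g. f \<in> cfun.span (Exp_set a W) & g \<in> flat_on om a c I}"
 have sf: "cfun.subspace (flat_on om a c I)"
  unfolding cfun.subspace_def flat_on_def
  using Ua_0 Ua_add Ua_scale Cinf_add[OF Ua_Cinf Ua_Cinf] Cinf_scale[OF Ua_Cinf] Cinf_scale[OF Ua_Cinf[OF Ua_0], of 0]
  by (auto simp: cscale_apply)
 have sY: "cfun.subspace Y" unfolding Y_def by (rule cfun.subspace_sums[OF cfun.subspace_span sf])
 have "cfun.span (Exp_set a W) \<subseteq> W" by (rule cfun.span_minimal[OF _ W_facts(2)]) (auto simp: Exp_set_def)
 hence YW: "Y \<subseteq> W" unfolding Y_def using I_facts(4) cfun.subspace_add[OF W_facts(2)] by blast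
 have "W = Ua_topology om a c closure_of Y"
 proof (rule antisym)
  show "Ua_topology om a c closure_of Y \<subseteq> W" by (rule closure_of_minimal[OF YW W_facts(3)])
  show "W \<subseteq> Ua_topology om a c closure_of Y"
  proof (rule subsetI, rule ccontr)
   fix f assume f: "f \<in> W" "f \<notin> Ua_topology om a c closure_of Y"
   have "Y \<subseteq> U" using YW W_facts(1) by blast
   from Ua_separation[OF sY this W_facts(1)[OF f(1)] f(2)] obtain S where S: "S \<in> dual" "\<forall>y\<in>Y. S y = 0" "S f ~= 0" by (elim bexE conjE)
   have "g \<in> Y" if "g \<in> Exp_set a W" for g
   proof -
    have "g = g + 0" by simp
    thus ?thesis unfolding Y_def using cfun.span_base[OF that] cfun.subspace_0[OF sf] by blast
   qed
   moreover have "g \<in> Y" if "g \<in> flat_on om a c I" for g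
   proof -
    have "g = 0 + g" by simp
    thus ?thesis unfolding Y_def using that cfun.span_zero by blast
   qed
   ultimately have "S f = 0" using S(2) by (intro key[OF S(1) _ _ f(1)]) auto
   thus False using S(3) by simp
  qed
 qed
 thus ?thesis unfolding admits_weak_spectral_synthesis_def Y_def using residual by blast
qed

text \<open>The common core of both cases. A class given by zeros and support limits is stable under
  multiplication by \<open>E\<close>; if it lies in the annihilator and is not trivial, all products
  \<open>E^n * FL T0\<close> are available and \<open>sol_constant\<close> applies.\<close>

lemma synthesis_of_class:
 assumes T0: "T0 \<in> W0" "FL T0 v ~= 0" "!!\<mu>. vanishes (Z \<mu>) \<mu> (FL T0)" "typed D T0"
  and cl: "!!T. T \<in> dual ==> (!!\<mu>. vanishes (Z \<mu>) \<mu> (FL T)) ==> typed D T ==> T \<in> W0"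
 shows "admits_weak_spectral_synthesis om a c W"
proof (rule synthesis_of_annihilation)
 fix S g assume S: "S \<in> dual" "!!g. g \<in> Exp_set a W ==> S g = 0" "!!g. g \<in> flat_on om a c I ==> S g = 0" and g: "g \<in> W"
 have "EX E k. sol S f E & (ALL z. E z = k)" if f: "f \<in> W" for f
 proof -
  have vS: "vanishes (mm \<mu>) \<mu> (FL S)" for \<mu> by (rule Exp_vanishes[OF S(1,2)])
  have ed: "EX d t. t \<in> I & d < s * t & supp s S (d + e)" if "s = 1 | s = - 1" "0 < e" for s e by (rule flat_edges[OF S(1,3) that])
  from sol_exists[OF S(1) vS f] obtain E where E: "sol S f E" by (elim exE)
  have "\<exists>T\<in>W0. (ALL z. FL T z = E z^n * FL T0 z) & (\<forall>\<mu>. vanishes (Z \<mu>) \<mu> (FL T)) & typed D T" for n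
  proof (induction n)
   case 0
   thus ?case using T0 by (intro bexI[of _ T0]) auto
  next
   case (Suc n)
   then obtain T where T: "T \<in> W0" "ALL z. FL T z = E z^n * FL T0 z" "\<forall>\<mu>. vanishes (Z \<mu>) \<mu> (FL T)" "typed D T" by (elim bexE conjE)
   have "\<exists>T'\<in>dual. FL T' = (%z. E z * FL T z) & typed D T'" by (rule sol_mult[OF S(1) f E _ T(1,4)]) (rule ed)
   then obtain T' where T': "T' \<in> dual" "FL T' = (%z. E z * FL T z)" "typed D T'"
    by (elim bexE conjE)
   have v: "vanishes (Z \<mu>) \<mu> (FL T')" for \<mu> unfolding T'(2) by (rule vanishes_mult[OF T(3)[rule_format]]) (use E in \<open>simp add: sol_def\<close>)
   have "T' \<in> W0" by (rule cl[OF T'(1) v T'(3)])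
   moreover have "ALL z. FL T' z = E z^Suc n * FL T0 z" unfolding T'(2) using T(2) by simp
   ultimately show ?case using v T'(3) by blast
  qed
  hence "EX k. ALL z. E z = k" by (intro sol_constant[OF S(1) f E T0(1,2)]) blast
  thus ?thesis using E by blast
 qed
 thus "S g = 0" by (rule constant_solutions_annihilate[OF S(1) _ g])
qed

lemma synthesis_of_weakly_localisable:
 assumes \<phi>: "\<phi> \<in> J" "\<phi> ~= 0" and wl: "weakly_localisable om c r (principal_submodule om c r \<phi>)"
 shows "admits_weak_spectral_synthesis om a c W"
proof -
 let ?K = "principal_submodule om c r \<phi>"
 let ?D = "%s::real. if s = 1 then ind_right ?K else - ind_left ?K"
 have sJ: "submodule om c r J"
  by (rule annihilator_submodule_is_submodule) (use W_facts in auto)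
 have KJ: "?K \<subseteq> J" by (rule principal_submodule_subset[OF sJ \<phi>(1)])
 have "\<phi> \<in> P" using sJ \<phi>(1) unfolding submodule_def by blast
 hence "\<phi> \<in> annihilator_submodule om a c (tests (min_mult ?K) ?D)" unfolding weakly_localisable_eq[OF wl] by (rule principal_submodule_mem)
 then obtain T where T: "T \<in> dual" "\<forall>f\<in>tests (min_mult ?K) ?D. T f = 0" "FL T = \<phi>" unfolding annihilator_submodule_iff by (elim bexE conjE)
 have cl: "R \<in> W0" if R: "R \<in> dual" "!!\<mu>. vanishes (min_mult ?K \<mu>) \<mu> (FL R)" "typed ?D R" for R
 proof -
  have "\<forall>f\<in>tests (min_mult ?K) ?D. R f = 0" by (rule kills_tests_iff[OF R(1), THEN iffD2]) (use R(2,3) in simp)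
  hence "FL R \<in> annihilator_submodule om a c (tests (min_mult ?K) ?D)" unfolding annihilator_submodule_iff by (intro bexI[OF _ R(1)] conjI refl)
  hence "FL R \<in> J" unfolding weakly_localisable_eq[OF wl] using KJ by blast
  then obtain R' where R': "R' \<in> W0" "FL R' = FL R" unfolding J_iff by (elim bexE)
  show ?thesis
  proof (rule W0_I[OF R(1)])
   fix f assume f: "f \<in> W"
   have "R f = R' f" by (rule FL_eqD[OF R(1) W0_D(1)[OF R'(1)] _ W_facts(1)[OF f]]) (simp add: R'(2))
   thus "R f = 0" using W0_D(2)[OF R'(1) f] by simp
  qed
 qed
 have k: "!!\<mu>. vanishes (min_mult ?K \<mu>) \<mu> (FL T)" "typed ?D T" using kills_tests_iff[OF T(1), THEN iffD1, OF T(2)] by simp_all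
 obtain v where v: "FL T v ~= 0" using \<phi>(2) T(3) by (auto simp: fun_eq_iff)
 show ?thesis by (rule synthesis_of_class[OF cl[OF T(1) k] v k cl])
qed

text \<open>Multiplying the transform by \<^term>\<open>exp (- \<i> * s * \<delta> * z)\<close> translates the functional by a small amount towards the end \<^term>\<open>s\<close>
 of the interval; comparing the solutions before and after shows that they are bounded in that direction.\<close>

lemma sol_bounded_cone:
 assumes s: "s = 1 | s = - 1" and S: "S \<in> dual" "!!\<mu>. vanishes (mm \<mu>) \<mu> (FL S)" and f: "f \<in> W" and E: "sol S f E"
  and t: "t \<in> I" "d < s * t" "supp s S d"
 shows "EX M. ALL z. max 1 (abs (Re z)) <= s * Im z --> cmod (E z) <= M"
proof -
 \<comment> \<open>The room between the support and \<open>t\<close> in quarters: one for the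
   translation, two for losses in the estimates, and one so that the translated support still ends
   before \<open>t\<close>.\<close>
 define g where "g = (s * t - d) / 4"
 have "4 * g = s * t - d" by (simp add: g_def)
 hence g: "0 < g" "d + 4 * g = s * t" using t(2) by linarith+
 define e where "e z = exp (- \<i> * of_real (s * g) * z)" for z :: complex
 have en: "cmod (e z) = exp (g * (s * Im z))" for z by (simp add: e_def mult_ac)
 have eh: "e holomorphic_on UNIV" unfolding e_def by (intro holomorphic_intros)
 define \<chi>' where "\<chi>' z = e z * FL S z" for z
 have "d < d + g" using g by simp
 from FL_supp_bound[OF s S(1) t(3) this] obtain C1 q1 where C1: "0 <= C1" "0 < q1" "q1 < 1"
  "ALL z. 0 <= s * Im z --> cmod (FL S z) <= C1 * exp (q1 * om (cmod z) + (d + g) * (s * Im z))" by (elim exE conjE)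
 obtain q2 b2 N2 where N2: "0 < q2" "q2 < 1" "inrad b2" "majorant q2 b2 (FL S) N2" by (rule FL_majorant[OF S(1)])
 have "t \<in> Om" using I_facts(1) t(1) by blast
 then obtain b3 where b3: "inrad b3" "abs t < b3" by (rule inrad_above)
 have N20: "0 <= N2" by (rule majorant_nonneg[OF N2(4)])
 define q where "q = max q1 q2"
 define b where "b = max b2 b3"
 have qb: "0 < q" "q < 1" "inrad b" using C1 N2 b3 by (auto simp: q_def b_def inrad_def max_def)
 have maj: "majorant q b \<chi>' (C1 + N2)"
  unfolding majorant_def
 proof (intro conjI allI)
  show "\<chi>' holomorphic_on UNIV" unfolding \<chi>'_def using eh FL_holomorphic[OF S(1)] by (intro holomorphic_intros)
  fix z
  have "q1 * om (cmod z) <= q * om (cmod z)" "q2 * om (cmod z) <= q * om (cmod z)"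
   by (rule mult_right_mono, simp add: q_def, simp add: w_nonneg)+
  note qw = this
  have bb: "b2 * abs (Im z) <= b * abs (Im z)" by (rule mult_right_mono) (simp_all add: b_def)
  let ?G = "exp (q * om (cmod z) + b * abs (Im z))"
  have "cmod (\<chi>' z) <= C1 * ?G | cmod (\<chi>' z) <= N2 * ?G"
  proof (cases "0 <= s * Im z")
   case True
   have "d + 2 * g <= b" using g b3 s unfolding b_def by auto
   hence "(d + 2 * g) * (s * Im z) <= b * (s * Im z)" using True by (intro mult_right_mono) auto
   moreover have "s * Im z = abs (Im z)" using True s by auto
   ultimately have "exp (g * (s * Im z)) * exp (q1 * om (cmod z) + (d + g) * (s * Im z)) <= ?G"
    using qw(1) by (simp add: algebra_simps flip: exp_add)
   hence 2: "C1 * (exp (g * (s * Im z)) * exp (q1 * om (cmod z) + (d + g) * (s * Im z))) <= C1 * ?G" by (rule mult_left_mono[OF _ C1(1)])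
   have "cmod (\<chi>' z) <= exp (g * (s * Im z)) * (C1 * exp (q1 * om (cmod z) + (d + g) * (s * Im z)))"
    unfolding \<chi>'_def norm_mult en using C1(4) True by (intro mult_left_mono) auto
   thus ?thesis using 2 by (simp add: mult.left_commute)
  next
   case False
   hence "exp (g * (s * Im z)) <= 1" using g by (simp add: mult_nonneg_nonpos)
   hence "cmod (\<chi>' z) <= 1 * (N2 * exp (q2 * om (cmod z) + b2 * abs (Im z)))"
    unfolding \<chi>'_def norm_mult en using N2(4) unfolding majorant_def by (intro mult_mono) auto
   also have "... <= N2 * ?G" using qw(2) bb N20 by (simp add: mult_left_mono add_mono)
   finally show ?thesis by simp
  qed
  moreover have "0 <= C1 * ?G" "0 <= N2 * ?G" using C1(1) N20 by auto
  ultimately show "cmod (\<chi>' z) <= (C1 + N2) * ?G" unfolding distrib_right by auto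
 qed
 from majorant_FL[OF qb] obtain qL L C where "\<forall>\<psi> N. majorant q b \<psi> N --> (\<exists>S\<in>dual. FL S = \<psi> & bdd S qL L (C * N))" by (elim exE conjE)
 from this[rule_format, OF maj] obtain S1 where S1: "S1 \<in> dual" "FL S1 = \<chi>'" by (elim bexE conjE)
 have v1: "vanishes (mm \<mu>) \<mu> (FL S1)" for \<mu> unfolding S1(2) \<chi>'_def by (rule vanishes_mult[OF S(2) eh])
 from sol_exists[OF S1(1) v1 f] obtain E1 where E1: "sol S1 f E1" by (elim exE)
 have "d < d + 3/2 * g" using g by simp
 from supp_axis_bound[OF s S(1) t(3) this] obtain C2 where C2: "C2 > 0" "ALL y>=0. cmod (FL S (\<i> * of_real (s * y))) <= C2 * exp ((d + 3/2 * g) * y)" by (elim exE conjE)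
 have "d + 5/2 * g < d + 3 * g" using g by simp
 hence supp1: "supp s S1 (d + 3 * g)"
 proof (rule supp_of_decay[OF s S1(1)])
  fix y :: real assume y: "0 <= y"
  have i: "s * Im (\<i> * of_real (s * y)) = y" using s by auto
  have "cmod (FL S1 (\<i> * of_real (s * y))) <= exp (g * y) * (C2 * exp ((d + 3/2 * g) * y))"
   unfolding S1(2) \<chi>'_def norm_mult en i using C2(2) y by (intro mult_left_mono) auto
  also have "... = C2 * exp ((d + 5/2 * g) * y)" by (simp add: algebra_simps flip: exp_add)
  finally show "cmod (FL S1 (\<i> * of_real (s * y))) <= C2 * exp ((d + 5/2 * g) * y)" .
 qed
 have "EX C. ALL z. abs (Re z) <= s * Im z --> cmod (E1 z) <= C * exp (g * (s * Im z))"
 proof (rule sol_zero_type[OF s S1(1) f E1 _ g(1)])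
  fix e' :: real assume "0 < e'"
  thus "EX d t. t \<in> I & d < s * t & supp s S1 (d + e')"
   using supp_mono[OF supp1, of "d + 3 * g + e'"] t(1) g by (intro exI[of _ "d + 3 * g"] exI[of _ t]) auto
 qed
 then obtain C3 where C3: "ALL z. abs (Re z) <= s * Im z --> cmod (E1 z) <= C3 * exp (g * (s * Im z))" by (elim exE)
 obtain p0 l0 D0 where D0: "lin S" "0 < p0" "p0 < 1" "inrad l0" "bdd S p0 l0 D0" "0 <= D0" by (rule dualE[OF S(1)])
 obtain p1 l1 D1 where lS1: "lin S1" by (rule dualE[OF S1(1)])
 from dual_common_bdd[OF S1(1) D0(2-4)] obtain p l D1 where p: "p0 <= p" "p < 1" "l0 <= l" "inrad l" "bdd S1 p l D1" "0 <= D1" by (elim exE conjE)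
 have B0: "bdd S p l D0" by (rule bdd_mono[OF D0(5,2) p(1) _ p(3) order_refl]) (use D0(4) in \<open>simp add: inrad_def\<close>)
 have p_pos: "0 < p" using p(1) D0(2) by simp
 from FL_res_bound[OF W_facts(1)[OF f] p_pos p(2,4)] obtain K where
  K: "ALL z. EX h. ALL S C. lin S --> bdd S p l C --> cmod (S (res z f) + h * FL S z) * abs (Im z) <= C * K" by (elim exE)
 obtain T v where T: "T \<in> W0" "FL T v ~= 0" using W0_nontrivial by blast
 note hol = S_res_holomorphic[OF S(1) W_facts(1)[OF f]] S_res_holomorphic[OF S1(1) W_facts(1)[OF f]]
 \<comment> \<open>The terms with \<open>T\<close> cancel, because the transform of
   \<open>S1\<close> is \<open>e\<close> times that of \<open>S\<close>.\<close>
 have id: "e z * E z - E1 z = e z * S (res z f) - S1 (res z f)" for z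
 proof (rule entire_eqI[where f = "%z. e z * E z - E1 z" and g = "%z. e z * S (res z f) - S1 (res z f)" and h = "FL T" and b = v])
  fix z
  have "E z * FL T z = FL T z * S (res z f) - FL S z * T (res z f)" "E1 z * FL T z = FL T z * S1 (res z f) - \<chi>' z * T (res z f)"
   using E E1 T(1) S1(2) unfolding sol_def by auto
  hence "e z * (E z * FL T z) - E1 z * FL T z = e z * (FL T z * S (res z f) - FL S z * T (res z f)) - (FL T z * S1 (res z f) - e z * FL S z * T (res z f))"
   by (simp add: \<chi>'_def)
  thus "(e z * E z - E1 z) * FL T z = (e z * S (res z f) - S1 (res z f)) * FL T z" by (simp add: algebra_simps)
 qed (use T E E1 eh hol FL_holomorphic[OF W0_D(1)[OF T(1)]] in \<open>auto simp: sol_def intro!: holomorphic_intros\<close>)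
 have "cmod (E z) <= abs (D0 * K) + abs C3 + abs (D1 * K)" if z: "max 1 (abs (Re z)) <= s * Im z" for z
 proof -
  from K[rule_format, of z] obtain h where h: "ALL S C. lin S --> bdd S p l C --> cmod (S (res z f) + h * FL S z) * abs (Im z) <= C * K" by (elim exE)
  define u where "u = S (res z f) + h * FL S z"
  define u1 where "u1 = S1 (res z f) + h * FL S1 z"
  have im: "1 <= abs (Im z)" using z s by auto
  have "cmod u * abs (Im z) <= D0 * K" "cmod u1 * abs (Im z) <= D1 * K" unfolding u_def u1_def using h D0(1) B0 lS1 p(5) by auto
  moreover have "cmod u * 1 <= cmod u * abs (Im z)" "cmod u1 * 1 <= cmod u1 * abs (Im z)" using im by (intro mult_left_mono; simp)+
  ultimately have u: "cmod u <= abs (D0 * K)" "cmod u1 <= abs (D1 * K)" by linarith+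
  define x where "x = exp (g * (s * Im z))"
  have x: "1 <= x" "cmod (e z) = x" using z g en by (auto simp: x_def)
  \<comment> \<open>For the same reason the corrections by \<open>h\<close> cancel. Here
    \<open>u\<close> and \<open>u1\<close> are bounded and \<open>E1\<close> grows at most like
    \<open>|e z|\<close>, so division by \<open>e z\<close> bounds \<open>E\<close>.\<close>
  have "e z * E z = e z * u + (E1 z - u1)" using id[of z] unfolding u_def u1_def S1(2) \<chi>'_def by (simp add: algebra_simps)
  hence "x * cmod (E z) <= x * cmod u + (cmod (E1 z) + cmod u1)"
   using norm_triangle_ineq[of "e z * u" "E1 z - u1"] norm_triangle_ineq4[of "E1 z" u1] x(2) by (metis add_left_mono norm_mult order_trans)
  also have "... <= x * abs (D0 * K) + (x * abs C3 + x * abs (D1 * K))"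
  proof (intro add_mono mult_left_mono u(1))
   have "cmod (E1 z) <= C3 * x" using C3[rule_format, of z] z by (simp add: x_def)
   also have "... <= x * abs C3" using x(1) by (simp add: mult.commute mult_left_mono)
   finally show "cmod (E1 z) <= x * abs C3" .
   have "1 * abs (D1 * K) <= x * abs (D1 * K)" by (rule mult_right_mono[OF x(1)]) simp
   thus "cmod u1 <= x * abs (D1 * K)" using u(2) by linarith
  qed (use x in simp)
  finally have "x * cmod (E z) <= x * (abs (D0 * K) + abs C3 + abs (D1 * K))" by (simp add: algebra_simps)
  thus ?thesis by (rule mult_left_le_imp_le) (use x in simp)
 qed
 thus ?thesis by blast
qed

text \<open>\<open>sol_bounded_cone\<close> on both sides bounds \<open>E\<close> on the double cone
  about the imaginary axis. The two remaining sectors have opening \<open>pi / 2\<close>, so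
  exponential growth is subcritical there and Phragmen-Lindelof finishes; then Liouville.\<close>

lemma strictly_inside:
 assumes S: "S \<in> dual" "!!\<mu>. vanishes (mm \<mu>) \<mu> (FL S)"
  and edges: "!!s. s = 1 | s = - 1 ==> EX d t. t \<in> I & d < s * t & supp s S d"
 shows "S \<in> W0"
proof (rule W0_I[OF S(1)], rule constant_solutions_annihilate[OF S(1)])
 fix f assume f: "f \<in> W"
 from sol_exists[OF S f] obtain E where E: "sol S f E" by (elim exE)
 have Eh: "E holomorphic_on UNIV" using E by (simp add: sol_def)
 have cone: "EX M. ALL z. max 1 (abs (Re z)) <= s * Im z --> cmod (E z) <= M" if s: "s = 1 | s = - 1" for s
 proof -
  from edges[OF s] obtain d t where "t \<in> I" "d < s * t" "supp s S d" by (elim exE conjE)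
  thus ?thesis by (rule sol_bounded_cone[OF s S f E])
 qed
 obtain M1 where M1: "ALL z. max 1 (abs (Re z)) <= 1 * Im z --> cmod (E z) <= M1" using cone[of 1] by auto
 obtain M2 where M2: "ALL z. max 1 (abs (Re z)) <= - 1 * Im z --> cmod (E z) <= M2" using cone[of "- 1"] by auto
 have "continuous_on (cball 0 2) E" using Eh by (auto intro: holomorphic_on_imp_continuous_on holomorphic_on_subset)
 from compact_imp_bounded[OF compact_continuous_image[OF this compact_cball]] obtain M3 where M3: "\<forall>z\<in>cball 0 2. cmod (E z) <= M3"
  unfolding bounded_iff by auto
 define Q where "Q = max 1 (max M1 (max M2 M3))"
 have vert: "cmod (E z) <= Q" if z: "abs (Re z) <= abs (Im z)" for z
 proof (cases "1 <= abs (Im z)")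
  case True
  then consider "max 1 (abs (Re z)) <= Im z" | "max 1 (abs (Re z)) <= - 1 * Im z" using z by linarith
  thus ?thesis using M1 M2 unfolding Q_def by cases fastforce+
 next
  case False
  have "cmod z <= 2" using cmod_le[of z] z False by linarith
  thus ?thesis using M3 by (simp add: Q_def le_max_iff_disj)
 qed
 obtain T v where T: "T \<in> W0" "FL T v ~= 0" using W0_nontrivial by blast
 from FL_common_majorant[OF S(1) W0_D(1)[OF T(1)]] obtain p b A N where p: "0 < p" "p < 1" "inrad b"
  and A: "majorant p b (FL S) A" and N: "majorant p b (FL T) N" by (elim exE conjE)
 from sol_step[OF S(1) f E p A] obtain K where "\<forall>T\<in>W0. ALL N. majorant p b (FL T) N --> majorant p b (%z. E z * FL T z) (K * N)" by (elim exE conjE)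
 hence "majorant p b (%z. E z * FL T z) (K * N)" using T(1) N by blast
 from quotient_growth[OF Eh N this _ _ T(2)] p obtain C L where G: "ALL z. cmod (E z) <= C * exp (L * cmod z)" by (auto simp: inrad_def)
 have "cmod (E z) <= Q" for z
 proof (cases "abs (Re z) <= abs (Im z)")
  case False
  then consider "abs (Im z) <= Re z" | "abs (Im z) <= Re (- z)" by (cases "0 <= Re z") auto
  thus ?thesis
  proof cases
   case 1
   show ?thesis by (rule Phragmen_Lindelof_sector[OF Eh G[rule_format] _ vert 1]) (auto simp: Q_def)
  next
   case 2
   have i: "abs (Im (- z)) <= Re (- z)" using 2 by simp
   have "cmod (E (- (- z))) <= Q"
   proof (rule Phragmen_Lindelof_sector[where G = "%z. E (- z)" and C = C and K = L, OF _ _ _ _ i])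
    show "(%z. E (- z)) holomorphic_on UNIV" by (intro entire_compose[OF Eh] holomorphic_intros)
    show "cmod (E (- w)) <= C * exp (L * cmod w)" for w using G[rule_format, of "- w"] by simp
    show "cmod (E (- w)) <= Q" if "abs (Im w) = Re w" for w using that by (intro vert) auto
   qed (simp add: Q_def)
   thus ?thesis by simp
  qed
 qed (rule vert)
 hence "bounded (range E)" unfolding bounded_iff by blast
 from Liouville_theorem[OF Eh this] have "EX k. ALL z. E z = k" by (auto simp: constant_on_def)
 thus "EX E k. sol S f E & (ALL z. E z = k)" using E by blast
qed

end

section \<open>Functionals from incomplete exponential systems\<close>

context Ua_space
begin

definition cb :: "nat => real => (real => complex) => real => bool" where
 "cb n s f B \<longleftrightarrow> (ALL j<=n. ALL t. abs t <= s --> cmod (Dn j f t) <= B)"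

lemma Cinf_seminorm_le: "Cinf_seminorm a n s f <= ereal B \<longleftrightarrow> cb n s f B"
 unfolding Cinf_seminorm_def cb_def SUP_le_iff by (auto simp: abs_le_iff)

lemma cb_exists: assumes f: "f \<in> Cinf a" and s: "inrad s" shows "EX B. cb n s f B"
proof -
 have "{-s..s} \<subseteq> Om" using Om_inner[OF s] by (auto simp: abs_le_iff)
 have "EX B. ALL t. abs t <= s --> cmod (Dn j f t) <= B" for j
 proof -
  obtain B where "\<forall>t\<in>{-s..s}. cmod (Dn j f t) <= B"
   using compact_imp_bounded[OF compact_continuous_image[OF Cinf_continuous[OF f \<open>{-s..s} \<subseteq> Om\<close>] compact_Icc]]
   unfolding bounded_iff by auto
  thus ?thesis by (intro exI[of _ B]) (auto simp: abs_le_iff)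
 qed
 hence "ALL j. EX B. ALL t. abs t <= s --> cmod (Dn j f t) <= B" by blast
 from choice[OF this] obtain B where B: "ALL j t. abs t <= s --> cmod (Dn j f t) <= B j" by (elim exE)
 have "cmod (Dn j f t) <= (\<Sum>i\<le>n. abs (B i))" if "j <= n" "abs t <= s" for j t
 proof -
  have "cmod (Dn j f t) <= abs (B j)" using B that(2) by (meson abs_ge_self order_trans)
  also have "... <= (\<Sum>i\<le>n. abs (B i))" using that(1) by (intro member_le_sum[of j "{..n}" "%i. abs (B i)"]) auto
  finally show ?thesis .
 qed
 thus ?thesis unfolding cb_def by blast
qed

lemma subspace_Cinf: "cfun.subspace (Cinf a)"
 using Ua_Cinf[OF Ua_0] Cinf_add Cinf_scale by (simp add: cfun.subspace_def)

lemma Cinf_seminormed: "seminormed_space (Cinf a) {Cinf_seminorm a n s |n s. 0 < s & ereal s < a}" (is "seminormed_space _ ?P")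
proof (rule seminormed_spaceI[OF subspace_Cinf])
 show "?P ~= {}" using inrad_c[of 0] by (auto simp: inrad_def)
 fix p f assume p: "p \<in> ?P"
 then obtain n s where ns: "p = Cinf_seminorm a n s" "inrad s" unfolding inrad_def by blast
 have "0 <= ereal (cmod (Dn 0 f 0))" by simp
 also have "... <= p f" unfolding ns(1) Cinf_seminorm_def using ns(2) by (intro SUP_upper2[of 0] SUP_upper) (auto simp: inrad_def)
 finally show "0 <= p f" .
 assume f: "f \<in> Cinf a"
 show "EX B. p f <= ereal B" unfolding ns(1) Cinf_seminorm_le by (rule cb_exists[OF f ns(2)])
 show "p (cscale k f) <= ereal (cmod k * A)" if "p f <= ereal A" for k A
  using that unfolding ns(1) Cinf_seminorm_le cb_def by (simp add: Cinf_scale[OF f] cscale_apply norm_mult mult_left_mono)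
 show "p (f + g) <= ereal (A + B)" if "g \<in> Cinf a" "p f <= ereal A" "p g <= ereal B" for g A B
  using that(2,3) unfolding ns(1) Cinf_seminorm_le cb_def by (simp add: Cinf_add[OF f that(1)]) (meson add_mono norm_triangle_le)
next
 fix p1 p2 assume "p1 \<in> ?P" "p2 \<in> ?P"
 then obtain n1 s1 n2 s2 where 1: "p1 = Cinf_seminorm a n1 s1" "0 < s1" "ereal s1 < a" and 2: "p2 = Cinf_seminorm a n2 s2" "0 < s2" "ereal s2 < a" by blast
 have le: "Cinf_seminorm a n s f <= Cinf_seminorm a n' s' f" if "n <= n'" "s <= s'" for n n' s s' f
  unfolding Cinf_seminorm_def using that by (intro SUP_subset_mono SUP_mono) (auto intro!: SUP_subset_mono)
 show "\<exists>p\<in>?P. \<forall>f\<in>Cinf a. p1 f <= p f & p2 f <= p f"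
 proof (rule bexI[of _ "Cinf_seminorm a (max n1 n2) (max s1 s2)"])
  show "\<forall>f\<in>Cinf a. p1 f <= Cinf_seminorm a (max n1 n2) (max s1 s2) f & p2 f <= Cinf_seminorm a (max n1 n2) (max s1 s2) f"
   unfolding 1 2 by (intro ballI conjI le) auto
 qed (use 1 2 in \<open>auto simp: max_def\<close>)
qed

abbreviation Poly :: "(real => complex) set" where "Poly \<equiv> cfun.span (range (%j. em j 0))"

lemma Poly_Cinf: "p \<in> Poly ==> p \<in> Cinf a"
 using cfun.span_minimal[OF _ subspace_Cinf, of "range (%j. em j 0)"] Ua_Cinf[OF em_U] by blast

lemma res_em: "res 0 (em j 0) = cscale (1 / of_nat (Suc j)) (em (Suc j) 0)"
proof (rule res_unique[symmetric])
 define k :: complex where "k = of_nat (Suc j)"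
 have k: "k ~= 0" unfolding k_def by (rule of_nat_neq_0)
 have c: "em j 0 \<in> Cinf a" for j by (rule Ua_Cinf[OF em_U])
 show "em j 0 \<in> Cinf a" "cscale (1 / of_nat (Suc j)) (em (Suc j) 0) \<in> Cinf a" using c Cinf_scale by blast+
 show "cscale (1 / of_nat (Suc j)) (em (Suc j) 0) 0 = 0" by (simp add: cscale_apply exp_monomial_def)
 fix t assume t: "t \<in> Om"
 have "((%w. w^Suc j) has_field_derivative k * of_real t^j) (at (of_real t :: complex))"
  by (rule DERIV_power[OF DERIV_ident, where n = "Suc j", THEN DERIV_cong]) (simp add: k_def)
 from has_vector_derivative_real_field[OF this]
 have "((%t. of_real t^Suc j) has_vector_derivative k * of_real t^j) (at t)" .
 moreover have "em (Suc j) 0 = cut (%t. of_real t^Suc j)" by (simp add: cut_def exp_monomial_def fun_eq_iff)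
 ultimately have "((em (Suc j) 0) has_vector_derivative k * of_real t^j) (at t)" using cut_derivative[OF t] by (simp only:)
 hence D: "Diff a (em (Suc j) 0) t = k * of_real t^j" using t by (simp add: Diff_def vector_derivative_at)
 have e: "em j 0 t = of_real t^j" using t by (simp add: exp_monomial_def)
 show "Diff a (cscale (1 / of_nat (Suc j)) (em (Suc j) 0)) t = - \<i> * 0 * cscale (1 / of_nat (Suc j)) (em (Suc j) 0) t + em j 0 t"
  unfolding Diff_scale[OF c] D e k_def[symmetric] using k by simp
qed

lemma res_Poly: assumes "p \<in> Poly" shows "res 0 p \<in> Poly"
proof -
 have "Poly \<subseteq> {p \<in> Cinf a. res 0 p \<in> Poly}"
 proof (rule cfun.span_minimal)
  have "res 0 (em j 0) \<in> Poly" for j unfolding res_em by (intro cfun.span_scale cfun.span_base) blast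
  thus "range (%j. em j 0) \<subseteq> {p \<in> Cinf a. res 0 p \<in> Poly}" using Ua_Cinf[OF em_U] by blast
  have "res 0 0 = 0" using res_scale[OF Ua_Cinf[OF Ua_0], of 0 0] by simp
  thus "cfun.subspace {p \<in> Cinf a. res 0 p \<in> Poly}"
   using subspace_Cinf unfolding cfun.subspace_def by (simp add: res_add res_scale cfun.span_zero cfun.span_add cfun.span_scale)
 qed
 thus ?thesis using assms by blast
qed

lemma real_polynomial_Poly: assumes "real_polynomial_function h" shows "cut (%t. of_real (h t)) \<in> Poly"
proof -
 obtain b n where h: "h = (%x. \<Sum>i\<le>n. b i * x^i)" using assms real_polynomial_function_iff_sum by blast
 have "cut (%t. of_real (\<Sum>i\<le>n. b i * t^i)) \<in> Poly" for n
 proof (induction n)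
  case 0
  have "cut (%t. of_real (\<Sum>i\<le>0. b i * t^i)) = cscale (of_real (b 0)) (em 0 0)" by (simp add: fun_eq_iff cut_def exp_monomial_def cscale_apply)
  thus ?case using cfun.span_scale[OF cfun.span_base[of "em 0 0"]] by simp
 next
  case (Suc n)
  have e: "cut (%t. of_real (\<Sum>i\<le>Suc n. b i * t^i)) = cut (%t. of_real (\<Sum>i\<le>n. b i * t^i)) + cscale (of_real (b (Suc n))) (em (Suc n) 0)"
   by (simp add: fun_eq_iff cut_def exp_monomial_def cscale_apply)
  show ?case unfolding e by (intro cfun.span_add Suc cfun.span_scale cfun.span_base) blast
 qed
 thus ?thesis unfolding h .
qed

text \<open>Induction on the order: approximate the derivative and integrate the polynomial from 0
  with \<open>res 0\<close>. The case of order 0 is the Weierstrass theorem for real and imaginary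
  part.\<close>

lemma Poly_dense:
 assumes "f \<in> Cinf a" "inrad s" "0 < e"
 shows "\<exists>p\<in>Poly. cb n s (f - p) e"
 using assms(1,3)
proof (induction n arbitrary: f e)
 case 0
 have sub: "{-s..s} \<subseteq> Om" using Om_inner[OF assms(2)] by (auto simp: abs_le_iff)
 have co: "continuous_on {-s..s} f" using Cinf_continuous[OF 0(1) sub, of 0] by simp
 from Stone_Weierstrass_polynomial_function[OF compact_Icc co 0(2)]
 obtain g where g: "polynomial_function g" "\<forall>t\<in>{-s..s}. cmod (f t - g t) < e" by (elim exE conjE)
 have r: "real_polynomial_function (%t. Re (g t))" "real_polynomial_function (%t. Im (g t))"
  using g(1) bounded_linear_Re bounded_linear_Im unfolding polynomial_function_def by (auto simp: o_def)
 define p where "p = cut (%t. of_real (Re (g t))) + cscale \<i> (cut (%t. of_real (Im (g t))))"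
 have pP: "p \<in> Poly" unfolding p_def by (intro cfun.span_add cfun.span_scale real_polynomial_Poly r)
 have "p t = g t" if "t \<in> Om" for t using that by (simp add: p_def cut_def cscale_apply complex_eq_iff)
 hence "cb 0 s (f - p) e" unfolding cb_def using g(2) sub by (auto simp: abs_le_iff subset_iff intro!: less_imp_le)
 thus ?case by (rule bexI[OF _ pP])
next
 case (Suc n)
 have s0: "0 < s" using assms(2) by (simp add: inrad_def)
 define e' where "e' = min e (e / s)"
 have e': "0 < e'" "e' <= e" "e' * s <= e" using Suc(3) s0 by (auto simp: e'_def min_def field_simps)
 from Suc(1)[OF Diff_Cinf[OF Suc(2)] e'(1)] obtain p where p: "p \<in> Poly" "cb n s (Diff a f - p) e'" by (elim bexE)
 define P where "P = res 0 p + cscale (f 0) (em 0 0)"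
 have PP: "P \<in> Poly" unfolding P_def by (intro cfun.span_add res_Poly[OF p(1)] cfun.span_scale cfun.span_base) blast
 note cc = Poly_Cinf[OF PP] Poly_Cinf[OF p(1)] Suc(2) res_Cinf[OF Poly_Cinf[OF p(1)], of 0] Ua_Cinf[OF em_U, of 0 0]
 have "Diff a (f - P) = Diff a f - p"
 proof
  fix t
  show "Diff a (f - P) t = (Diff a f - p) t"
  proof (cases "t \<in> Om")
   case True
   have "Diff a P t = p t"
    unfolding P_def using Diff_res[OF cc(2) True, of 0] Diff_ez[OF True, of 0] cc by (simp add: Diff_add Diff_scale Cinf_scale)
   thus ?thesis using Diff_minus[OF cc(3,1), of t] by simp
  next
   case False
   thus ?thesis using Cinf_outside[OF cc(2)] by (simp add: Diff_def)
  qed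
 qed
 hence D: "Dn (Suc j) (f - P) t = Dn j (Diff a f - p) t" for j t using Dn_Diff[of j "f - P"] by simp
 have d: "cmod (Dn (Suc j) (f - P) t) <= e'" if "j <= n" "abs t <= s" for j t unfolding D using p(2) that unfolding cb_def by blast
 have fP: "f - P \<in> Cinf a" by (rule Cinf_minus[OF cc(3,1)])
 have z: "(f - P) 0 = 0" using zero_in_Om by (simp add: P_def res_0 cscale_apply exp_monomial_def)
 have v: "cmod ((f - P) t) <= e" if t: "abs t <= s" for t
 proof -
  have "cmod ((f - P) t - (f - P) 0) <= e' * abs t"
  proof (rule vector_derivative_increment_bound[OF _ _ t])
   fix x assume x: "abs x <= s"
   show "((f - P) has_vector_derivative Dn (Suc 0) (f - P) x) (at x)" using Cinf_derivative[OF fP Om_inner[OF assms(2) x], of 0] by simp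
   show "cmod (Dn (Suc 0) (f - P) x) <= e'" by (rule d[OF _ x]) simp
  qed
  also have "... <= e' * s" using t e'(1) by (intro mult_left_mono) auto
  finally show ?thesis unfolding z using e'(3) by simp
 qed
 have "cb (Suc n) s (f - P) e"
  unfolding cb_def
 proof (intro allI impI)
  fix j t assume j: "j <= Suc n" and t: "abs t <= s"
  show "cmod (Dn j (f - P) t) <= e"
  proof (cases j)
   case 0 thus ?thesis using v[OF t] by simp
  next
   case (Suc i) thus ?thesis using d[of i t] j t e'(2) by simp
  qed
 qed
 thus ?case by (rule bexI[OF _ PP])
qed

text \<open>Separation takes place in the space of smooth functions; the functional restricts to the
  dual of the smaller space. It remains to see that its transform is not 0, for which density of
  polynomials is used.\<close>

lemma incomplete_functional:
 assumes "Cinf_topology a closure_of cfun.span (exp_system a \<Lambda>) ~= Cinf a"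
 shows "EX R n s C v. inrad s & R \<in> dual & (\<forall>f\<in>Cinf a. \<forall>g\<in>Cinf a. R (f + g) = R f + R g) & (ALL k. \<forall>f\<in>Cinf a. R (cscale k f) = k * R f)
  & (\<forall>f\<in>Cinf a. ALL B. cb n s f B --> cmod (R f) <= C * B) & (\<forall>g\<in>exp_system a \<Lambda>. R g = 0) & FL R v ~= 0"
proof -
 interpret N: seminormed_space "Cinf a" "{Cinf_seminorm a n s |n s. 0 < s & ereal s < a}" by (rule Cinf_seminormed)
 let ?E = "cfun.span (exp_system a \<Lambda>)"
 have EC: "?E \<subseteq> Cinf a" by (rule cfun.span_minimal[OF _ subspace_Cinf]) (use Ua_Cinf[OF em_U] in \<open>auto simp: exp_system_def\<close>)
 have "Cinf_topology a closure_of ?E \<subseteq> Cinf a" using closure_of_subset_topspace[of "Cinf_topology a" ?E] N.topspace_eq unfolding Cinf_topology_def by simp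
 then obtain f where f: "f \<in> Cinf a" "f \<notin> Cinf_topology a closure_of ?E" using assms by blast
 from N.separation[OF cfun.subspace_span EC f[unfolded Cinf_topology_def]] obtain R where
  R: "\<forall>f\<in>Cinf a. \<forall>g\<in>Cinf a. R (f + g) = R f + R g" "ALL k. \<forall>f\<in>Cinf a. R (cscale k f) = k * R f"
  "continuous_map (seminorm_topology (Cinf a) {Cinf_seminorm a n s |n s. 0 < s & ereal s < a}) (euclidean :: complex topology) R"
  "\<forall>y\<in>?E. R y = 0" "R f ~= 0" by (elim exE conjE)
 from N.continuous_iff[of R] R(1-3) obtain p C where p: "p \<in> {Cinf_seminorm a n s |n s. 0 < s & ereal s < a}" "\<forall>f\<in>Cinf a. cmod (R f) <= C * N.val p f" by auto
 then obtain n s where ns: "p = Cinf_seminorm a n s" "inrad s" unfolding inrad_def by blast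
 have bd: "cmod (R g) <= abs C * B" if g: "g \<in> Cinf a" "cb n s g B" for g B
 proof -
  have le: "p g <= ereal B" unfolding ns(1) Cinf_seminorm_le by (rule g(2))
  have "0 <= p g" using N.finite_nonneg[OF p(1) g(1)] by simp
  hence v: "0 <= N.val p g" "N.val p g <= B" using le unfolding N.val_def by (cases "p g"; simp)+
  have "cmod (R g) <= C * N.val p g" using p(2) g(1) by blast
  also have "... <= abs C * B" using v by (intro mult_mono) auto
  finally show ?thesis .
 qed
 have "R \<in> dual"
 proof (rule dualI[where q = "1/2" and b = s and C = "abs C * M (1/2) n"])
  show "lin R" unfolding lin_def using R(1,2) Ua_Cinf by blast
  show "bdd R (1/2) s (abs C * M (1/2) n)"
   unfolding bdd_def
  proof (intro ballI allI impI)
   fix g B assume g: "g \<in> U" "nb (1/2) s g B"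
   have B: "0 <= B" using nb_nonneg[OF g(2)] ns(2) by (simp add: inrad_def)
   have "cb n s g (B * M (1/2) n)"
    unfolding cb_def
   proof (intro allI impI)
    fix j t assume "j <= n" "abs t <= s"
    thus "cmod (Dn j g t) <= B * M (1/2) n"
     using nbD[OF g(2), of t j] mult_left_mono[OF M_mono[of "1/2" j n] B] by simp
   qed
   from bd[OF Ua_Cinf[OF g(1)] this] show "cmod (R g) <= abs C * M (1/2) n * B" by (simp add: mult_ac)
  qed
 qed (use ns(2) in auto)
 note Rd = this
 have "EX v. FL R v ~= 0"
 proof (rule ccontr)
  assume "~ ?thesis"
  hence z: "FL R = (%z. 0)" by (simp add: fun_eq_iff)
  have "(deriv ^^ j) (%z. 0 :: complex) = (%z. 0)" for j by (induction j) auto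
  \<comment> \<open>The derivatives of the transform at 0 are the moments of \<open>R\<close> up to
    powers of \<open>- \<i>\<close>, so a zero transform would annihilate all polynomials.\<close>
  hence em: "R (em j 0) = 0" for j using higher_deriv_FL[OF Rd, of j 0] unfolding z by simp
  have P: "R q = 0" if "q \<in> Poly" for q
  proof -
   have "Poly \<subseteq> {q \<in> Cinf a. R q = 0}"
   proof (rule cfun.span_minimal)
    show "range (%j. em j 0) \<subseteq> {q \<in> Cinf a. R q = 0}" using em Ua_Cinf[OF em_U] by blast
    have "R 0 = 0" using R(2)[rule_format, OF f(1), of 0] by simp
    thus "cfun.subspace {q \<in> Cinf a. R q = 0}" using subspace_Cinf R(1,2) unfolding cfun.subspace_def by simp
   qed
   thus ?thesis using that by blast
  qed
  define e where "e = cmod (R f) / (2 * (abs C + 1))"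
  have e: "0 < e" "abs C * e < cmod (R f)"
  proof -
   show e0: "0 < e" using R(5) by (simp add: e_def add_nonneg_pos)
   have "abs C * e < 2 * (abs C + 1) * e" using e0 by (intro mult_strict_right_mono) auto
   thus "abs C * e < cmod (R f)" by (simp add: e_def add_nonneg_eq_0_iff)
  qed
  from Poly_dense[OF f(1) ns(2) e(1), where n = n] obtain q where q: "q \<in> Poly" "cb n s (f - q) e" by (elim bexE)
  have fq: "f - q \<in> Cinf a" by (rule Cinf_minus[OF f(1) Poly_Cinf[OF q(1)]])
  have "R f = R (f - q) + R q" using R(1)[rule_format, OF fq Poly_Cinf[OF q(1)]] by simp
  thus False using bd[OF fq q(2)] P[OF q(1)] e(2) by simp
 qed
 then obtain v where "FL R v ~= 0" by (elim exE)
 moreover have "\<forall>g\<in>exp_system a \<Lambda>. R g = 0" using R(4) cfun.span_base by blast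
 ultimately show ?thesis using ns(2) Rd R(1,2) bd
  by (intro exI[of _ R] exI[of _ n] exI[of _ s] exI[of _ "abs C"] exI[of _ v] conjI) auto
qed

end

text \<open>Two actual points of \<open>I\<close> more than \<open>2 * \<rho>\<close> apart replace
  the length, which may be infinite and whose ends may not belong to \<open>I\<close>.\<close>

lemma completeness_radius_witness:
 assumes "2 * ereal pi * BM_density \<Lambda> < interval_length I" "I ~= {}"
 obtains \<rho> t1 t2 where "0 < \<rho>" "Cinf_topology (ereal \<rho>) closure_of cfun.span (exp_system (ereal \<rho>) \<Lambda>) ~= Cinf (ereal \<rho>)"
  "t1 \<in> I" "t2 \<in> I" "2 * \<rho> < t2 - t1"
proof -
 let ?S = "{\<rho>. 0 < \<rho> & Cinf_topology (ereal \<rho>) closure_of cfun.span (exp_system (ereal \<rho>) \<Lambda>) ~= Cinf (ereal \<rho>)}"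
 have c0: "0 <= completeness_radius \<Lambda>" unfolding completeness_radius_def by (rule INF_greatest) simp
 obtain x where x: "completeness_radius \<Lambda> = ereal x"
  using assms(1) c0 unfolding BM_density_def by (cases "completeness_radius \<Lambda>") auto
 have "ereal (2 * x) < interval_length I" using assms(1) unfolding BM_density_def x by simp
 then obtain y where y: "2 * x < y" "ereal y < interval_length I" using ereal_dense2 by fastforce
 have "completeness_radius \<Lambda> < ereal (y / 2)" unfolding x using y(1) by simp
 then obtain \<rho> where \<rho>: "\<rho> \<in> ?S" "\<rho> < y / 2" unfolding completeness_radius_def INF_less_iff by auto
 have "\<exists>t1\<in>I. \<exists>t2\<in>I. 2 * \<rho> < t2 - t1"
 proof (rule ccontr)
  assume n: "~ ?thesis"
  obtain t0 where t0: "t0 \<in> I" using assms(2) by auto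
  let ?s = "SUP x\<in>I. ereal x" and ?i = "INF x\<in>I. ereal x"
  have s1: "?s <= ereal (t + 2 * \<rho>)" if "t \<in> I" for t by (rule SUP_least) (use n that in force)
  have "ereal t0 <= ?s" by (rule SUP_upper[OF t0])
  then obtain s where s: "?s = ereal s" using s1[OF t0] by (cases ?s) auto
  have i1: "ereal (s - 2 * \<rho>) <= ?i" by (rule INF_greatest) (use s1 s in force)
  have "?i <= ereal t0" by (rule INF_lower[OF t0])
  then obtain i where i: "?i = ereal i" using i1 by (cases ?i) auto
  show False using y(2) i1 \<rho>(2) unfolding interval_length_def s i by simp
 qed
 thus ?thesis using that \<rho>(1) by blast
qed

section \<open>The case of small density\<close>

context invariant
begin

text \<open>An incomplete system on an interval shorter than \<^term>\<open>I\<close> gives a functional that annihilates \<^term>\<open>Exp_set a W\<close> and whose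
 support lies strictly inside \<^term>\<open>I\<close> after a translation.\<close>

lemma synthesis_of_small_density:
 assumes \<Lambda>: "exponents a W \<Lambda>" and dens: "2 * ereal pi * BM_density \<Lambda> < interval_length I"
 shows "admits_weak_spectral_synthesis om a c W"
proof -
 have "I ~= {}" using residual unfolding residual_interval_def rel_closed_interval_def by auto
 from completeness_radius_witness[OF dens this] obtain \<rho> t1 t2 where \<rho>: "0 < \<rho>"
  "Cinf_topology (ereal \<rho>) closure_of cfun.span (exp_system (ereal \<rho>) \<Lambda>) ~= Cinf (ereal \<rho>)"
  and t: "t1 \<in> I" "t2 \<in> I" "2 * \<rho> < t2 - t1" by metis
 \<comment> \<open>An increasing sequence with limit \<open>\<rho>\<close>, positive from the start
   because of the 2.\<close>
 define c' where "c' k = \<rho> * (1 - 1 / (real k + 2))" for k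
 interpret R: Ua_space om "ereal \<rho>" c'
 proof
  show "weight om" by (rule weight)
  show "0 < ereal \<rho>" using \<rho>(1) by simp
  show "incseq c'" unfolding c'_def incseq_def using \<rho>(1) by (auto intro!: mult_left_mono divide_left_mono)
  show "0 < c' k" "ereal (c' k) < ereal \<rho>" for k using \<rho>(1) by (auto simp: c'_def field_simps add_pos_nonneg)
  have "c' \<longlonglongrightarrow> \<rho>" unfolding c'_def by real_asymp
  thus "(%k. ereal (c' k)) \<longlonglongrightarrow> ereal \<rho>" by simp
 qed
 from R.incomplete_functional[OF \<rho>(2)] obtain F n \<sigma> C v where \<sigma>: "R.inrad \<sigma>" and F: "F \<in> Ua_dual om (ereal \<rho>) c'"
  "\<forall>f\<in>Cinf (ereal \<rho>). \<forall>g\<in>Cinf (ereal \<rho>). F (f + g) = F f + F g" "ALL k. \<forall>f\<in>Cinf (ereal \<rho>). F (cscale k f) = k * F f"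
  "\<forall>f\<in>Cinf (ereal \<rho>). ALL B. R.cb n \<sigma> f B --> cmod (F f) <= C * B" "\<forall>g\<in>exp_system (ereal \<rho>) \<Lambda>. F g = 0" "R.FL F v ~= 0" by (elim exE conjE)
 have s0: "0 < \<sigma>" "\<sigma> < \<rho>" using \<sigma> by (auto simp: R.inrad_def)
 define m where "m = (t1 + t2) / 2"
 have m: "t1 < m - \<rho>" "m + \<rho> < t2" using t(3) by (auto simp: m_def field_simps)
 have tO: "t1 \<in> Om" "t2 \<in> Om" using t I_facts(1) by auto
 have inO: "x + m \<in> Om" if "abs x <= \<rho>" for x
 proof -
  have "x + m \<in> {t1..t2}" using m that by auto
  thus ?thesis using interval_Om[OF tO] by blast
 qed
 define b where "b = max (abs t1) (abs t2)"
 have b: "inrad b" using tO m \<rho>(1) by (auto simp: b_def Om_iff inrad_def max_def)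
 have sub: "sym_ival (ereal \<rho>) \<subseteq> Om"
 proof
  fix x assume "x \<in> sym_ival (ereal \<rho>)"
  hence "abs x <= b" using m by (auto simp: sym_ival_def b_def)
  thus "x \<in> Om" by (rule Om_inner[OF b])
 qed
 \<comment> \<open>Translates the middle of \<open>t1\<close> and \<open>t2\<close> to the origin
   and restricts to the short interval; composing \<open>F\<close> with it puts a copy of
   \<open>F\<close> between \<open>t1\<close> and \<open>t2\<close>.\<close>
 define \<tau> where "\<tau> f = R.cut (%x. f (x + m))" for f :: "real => complex"
 have jet: "R.jet (%j x. Dn j f (x + m))" if f: "f \<in> Cinf a" for f
  unfolding R.jet_def
 proof (intro allI ballI)
  fix j x assume "x \<in> sym_ival (ereal \<rho>)"
  hence "x + m \<in> Om" by (intro inO) (simp add: sym_ival_def)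
  from Cinf_derivative[OF f this, of j] have "(Dn j f has_vector_derivative Dn (Suc j) f (x + m)) (at (x + m))" .
  moreover have "((%x. x + m) has_vector_derivative 1 + 0) (at x)" by (intro has_vector_derivative_add has_vector_derivative_id has_vector_derivative_const)
  ultimately show "((%x. Dn j f (x + m)) has_vector_derivative Dn (Suc j) f (x + m)) (at x)"
   using vector_diff_chain_at[of "%x. x + m" 1 x "Dn j f"] by (simp add: o_def del: funpow.simps)
 qed
 have \<tau>C: "\<tau> f \<in> Cinf (ereal \<rho>)" and \<tau>D: "abs x < \<rho> ==> (Diff (ereal \<rho>) ^^ j) (\<tau> f) x = Dn j f (x + m)" if "f \<in> Cinf a" for f j x
  using R.cut_Cinf[OF jet[OF that]] R.Dn_cut[OF jet[OF that], of j] by (auto simp: \<tau>_def R.cut_def sym_ival_def)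
 define S where "S f = F (\<tau> f)" for f
 have bound: "cmod (S f) <= C * B" if f: "f \<in> Cinf a" and B: "!!j x. j <= n ==> abs x <= \<sigma> ==> cmod (Dn j f (x + m)) <= B" for f B
 proof -
  have "R.cb n \<sigma> (\<tau> f) B" unfolding R.cb_def using B \<tau>D[OF f] s0 by auto
  thus ?thesis unfolding S_def using F(4) \<tau>C[OF f] by blast
 qed
 have lS: "lin S"
  unfolding lin_def
 proof (intro conjI ballI allI)
  fix f g assume f: "f \<in> U" and g: "g \<in> U"
  have "\<tau> (f + g) = \<tau> f + \<tau> g" by (simp add: \<tau>_def R.cut_def fun_eq_iff)
  thus "S (f + g) = S f + S g" unfolding S_def using F(2) \<tau>C Ua_Cinf f g by simp
 next
  fix k f assume f: "f \<in> U"
  have "\<tau> (cscale k f) = cscale k (\<tau> f)" by (simp add: \<tau>_def R.cut_def fun_eq_iff cscale_apply)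
  thus "S (cscale k f) = k * S f" unfolding S_def using F(3) \<tau>C Ua_Cinf f by simp
 qed
 have C0: "C * B <= abs C * B" if "0 <= B" for B using that by (intro mult_right_mono) auto
 have Sd: "S \<in> dual"
 proof (rule dualI[OF lS, where q = "1/2" and b = b and C = "abs C * M (1/2) n"])
  show "bdd S (1/2) b (abs C * M (1/2) n)"
   unfolding bdd_def
  proof (intro ballI allI impI)
   fix f B assume f: "f \<in> U" "nb (1/2) b f B"
   have B: "0 <= B" using nb_nonneg[OF f(2)] b by (simp add: inrad_def)
   have "cmod (S f) <= C * (B * M (1/2) n)"
   proof (rule bound[OF Ua_Cinf[OF f(1)]])
    fix j x assume j: "j <= n" and x: "abs x <= \<sigma>"
    have "abs (x + m) <= b" using x m s0 unfolding b_def by linarith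
    from nbD[OF f(2) this, of j] show "cmod (Dn j f (x + m)) <= B * M (1/2) n"
     using mult_left_mono[OF M_mono[of "1/2" j n] B] j by simp
   qed
   thus "cmod (S f) <= abs C * M (1/2) n * B" using C0[of "B * M (1/2) n"] B by (simp add: mult_ac)
  qed
 qed (use b in auto)
 have FLS: "FL S z = exp (- \<i> * z * of_real m) * R.FL F z" for z
 proof -
  have "\<tau> (ez z) = cscale (exp (- \<i> * z * of_real m)) (R.ez z)"
  proof
   fix x show "\<tau> (ez z) x = cscale (exp (- \<i> * z * of_real m)) (R.ez z) x"
    using inO[of x] by (auto simp: \<tau>_def R.cut_def cscale_apply exp_monomial_def sym_ival_def[of "ereal \<rho>"] algebra_simps simp flip: exp_add)
  qed
  thus ?thesis unfolding FL_def R.FL_def S_def using F(3) R.ez_Cinf by simp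
 qed
 have van: "vanishes (mm \<mu>) \<mu> (FL S)" for \<mu>
 proof -
  have "F (R.em j \<mu>) = 0" if "j < mm \<mu>" for j
  proof -
   have "em j \<mu> \<in> exp_system a \<Lambda>" using em_in_W[OF that] \<Lambda> unfolding exponents_def Exp_set_def by blast
   \<comment> \<open>Two monomials equal on the large interval are equal on the small one, so their
     parameters need not be compared.\<close>
   then obtain j' \<mu>' where e: "em j \<mu> = em j' \<mu>'" "j' < \<Lambda> \<mu>'" unfolding exp_system_def by blast
   have "R.em j \<mu> x = R.em j' \<mu>' x" for x
    using fun_cong[OF e(1), of x] sub by (auto simp: exp_monomial_def split: if_splits)
   hence "R.em j \<mu> \<in> exp_system (ereal \<rho>) \<Lambda>" unfolding exp_system_def using e(2) by auto
   thus ?thesis using F(5) by blast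
  qed
  hence "vanishes (mm \<mu>) \<mu> (R.FL F)" unfolding vanishes_iff_deriv[OF R.FL_holomorphic[OF F(1)]] by (simp add: R.higher_deriv_FL[OF F(1)])
  moreover have "(%z. exp (- \<i> * z * of_real m)) holomorphic_on UNIV" by (intro holomorphic_intros)
  ultimately show ?thesis unfolding FLS[abs_def] by (rule vanishes_mult)
 qed
 have sp: "supp s S (s * m + \<sigma>)" if s: "s = 1 | s = - 1" for s
  unfolding supp_def
 proof (intro ballI impI)
  fix f assume f: "f \<in> U" and z: "ALL j t. t \<in> Om --> s * t <= s * m + \<sigma> --> Dn j f t = 0"
  have "cmod (S f) <= C * 0"
  proof (rule bound[OF Ua_Cinf[OF f]])
   fix j x assume x: "abs x <= \<sigma>"
   have "s * (x + m) <= s * m + \<sigma>" using s x by auto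
   thus "cmod (Dn j f (x + m)) <= 0" using z inO[of x] x s0 by simp
  qed
  thus "S f = 0" by simp
 qed
 \<comment> \<open>The support limits of the translated functional. Because of
   \<open>\<sigma> < \<rho>\<close>, the whole class with these limits has support strictly inside
   \<open>I\<close>, and \<open>strictly_inside\<close> puts it into the annihilator.\<close>
 define D where "D s = ereal (s * m + \<sigma>)" for s
 have reach: "\<exists>t\<in>I. s * m + \<rho> < s * t" if "s = 1 | s = - 1" for s using that t m by (auto intro: bexI[of _ t1] bexI[of _ t2])
 have inside: "T \<in> W0" if T: "T \<in> dual" "!!\<mu>. vanishes (mm \<mu>) \<mu> (FL T)" "typed D T" for T
 proof (rule strictly_inside[OF T(1,2)])
  fix s :: real assume s: "s = 1 | s = - 1"
  have "ereal (s * m + \<sigma>) < ereal (s * m + \<rho>)" using s0 by simp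
  hence "supp s T (s * m + \<rho>)" using T(3) s unfolding typed_def D_def by blast
  moreover obtain t where "t \<in> I" "s * m + \<rho> < s * t" using reach[OF s] by blast
  ultimately show "EX d t. t \<in> I & d < s * t & supp s T d" by (intro exI[of _ "s * m + \<rho>"] exI[of _ t]) simp
 qed
 have ty: "typed D S" unfolding typed_def D_def
 proof (intro allI impI)
  fix s d assume s: "s = 1 | s = - 1" "ereal (s * m + \<sigma>) < ereal d"
  thus "supp s S d" by (intro supp_mono[OF sp]) auto
 qed
 have "FL S v ~= 0" unfolding FLS using F(6) by simp
 from synthesis_of_class[OF inside[OF Sd van ty] this van ty inside] show ?thesis .
qed

end

theorem theorem3p4:
  fixes \<omega> :: "real \<Rightarrow> real" and a :: ereal and c r :: "nat \<Rightarrow> real"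
    and W :: "(real \<Rightarrow> complex) set" and I :: "real set" and \<Lambda> :: "complex \<Rightarrow> nat"
  assumes "weight \<omega>"
    and "0 < a"
    and "incseq c" and "\<And>k. 0 < c k" and "\<And>k. ereal (c k) < a"
    and "(\<lambda>k. ereal (c k)) \<longlonglongrightarrow> a"
    and "incseq r" and "\<And>k. 0 < r k" and "\<And>k. r k < 1" and "r \<longlonglongrightarrow> 1"
    and "D_invariant_subspace \<omega> a c W" and "W \<noteq> Ua \<omega> a c"
    and "residual_interval \<omega> a c W I"
    and "exponents a W \<Lambda>"
    and "stable_submodule (annihilator_submodule \<omega> a c W)"
    and "2 * ereal pi * BM_density \<Lambda> < interval_length I \<or>
         (\<exists>\<phi>\<^sub>0 \<in> annihilator_submodule \<omega> a c W. \<phi>\<^sub>0 \<noteq> 0 \<and>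
            weakly_localisable \<omega> c r (principal_submodule \<omega> c r \<phi>\<^sub>0))"
  shows "admits_weak_spectral_synthesis \<omega> a c W"
proof -
  interpret invariant \<omega> a c r W I
    by unfold_locales (use assms in auto)
  show ?thesis
    using assms(16) synthesis_of_small_density[OF assms(14)] synthesis_of_weakly_localisable by blast
qed

end
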